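(* (a) For every fixed regular expression $\alpha$, the regular path query given by $\alpha$ on directed labeled graphs can be maintained in $\mathsf{DynFO}$. (b) Every fixed conjunction of regular path queries on directed labeled graphs can be maintained in $\mathsf{DynFO}$. (c) $2$-SAT is in $\mathsf{DynFO}$.
   Context: Dynamic complexity setting: an input is a relational structure over a finite domain fixed for the whole computation, with input relations initially empty; each change inserts or deletes a single tuple of an input relation. A dynamic program maintains auxiliary relations, each updated after every change by a first-order formula $\varphi^R_\delta(\vec x;\vec y)$ (the new $R$ is the set of $\vec b$ with $\text{current state}\models\varphi^R_\delta(\vec a;\vec b)$ for change $\delta(\vec a)$); it maintains a query if a designated auxiliary relation always equals the query's answer on the current input. $\mathsf{DynFO}$: the auxiliary relations are initially empty. Regular path queries: a labeled directed graph has node set $V$, a fixed finite alphabet $\Sigma$ of labels, and a ternary relation $E$ of triples $(v,a,v')$ meaning there is an $a$-labeled edge from $v$ to $v'$; edges may be added, deleted (or relabeled). For a fixed regular expression $\alpha$ over $\Sigma$ and distinguished nodes $s,t$, the query asks whether there is a (not necessarily simple) directed path from $s$ to $t$ whose sequence of labels is a word in $L(\alpha)$. A conjunction of regular path queries is the Boolean conjunction of finitely many such queries. $2$-SAT: the domain is the set of variables of a 2-CNF formula $\varphi$; clauses are given by binary relations $C_{TT},C_{TF},C_{FF}$, where $(x,y)\in C_{TT}$ represents clause $x\vee y$, $(x,y)\in C_{TF}$ represents $x\vee\neg y$, and $(x,y)\in C_{FF}$ represents $\neg x\vee\neg y$. The query asks whether $\varphi$ is satisfiable.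
   Formalization: The answer relation is required to be correct after every nonempty sequence of changes; before the first change all auxiliary relations are empty, so a query true on the empty input (such as 2-SAT on the empty formula) cannot be answered correctly then. *)

theory Defs
  imports Main
begin

section \<open>First-order formulas over relational structures\<close>

text \<open>
  Structures have a finite domain \<open>D\<close>, a set of natural numbers. Formulas can only compare elements
  for equality, so nothing beyond the names of the elements depends on this choice, and every finite
  structure has an isomorphic copy of this form. Relations are sets of tuples, represented as lists.
  The type \<open>'s\<close> consists of relation symbols; variables and constant symbols are natural numbers.
\<close>

datatype fo_term = Var nat | Const nat

datatype 's fo =
    Rel 's "fo_term list"
  | Eq fo_term fo_term
  | Neg "'s fo"
  | Conj "'s fo" "'s fo"
  | Exists nat "'s fo"

fun term_val :: "(nat \<Rightarrow> nat) \<Rightarrow> (nat \<Rightarrow> nat) \<Rightarrow> fo_term \<Rightarrow> nat" where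
  "term_val \<kappa> \<sigma> (Var x) = \<sigma> x"
| "term_val \<kappa> \<sigma> (Const c) = \<kappa> c"

fun holds ::
  "nat set \<Rightarrow> (nat \<Rightarrow> nat) \<Rightarrow> ('s \<Rightarrow> nat list set) \<Rightarrow> (nat \<Rightarrow> nat) \<Rightarrow> 's fo \<Rightarrow> bool" where
  "holds D \<kappa> S \<sigma> (Rel s ts) \<longleftrightarrow> map (term_val \<kappa> \<sigma>) ts \<in> S s"
| "holds D \<kappa> S \<sigma> (Eq t u) \<longleftrightarrow> term_val \<kappa> \<sigma> t = term_val \<kappa> \<sigma> u"
| "holds D \<kappa> S \<sigma> (Neg \<phi>) \<longleftrightarrow> \<not> holds D \<kappa> S \<sigma> \<phi>"
| "holds D \<kappa> S \<sigma> (Conj \<phi> \<psi>) \<longleftrightarrow> holds D \<kappa> S \<sigma> \<phi> \<and> holds D \<kappa> S \<sigma> \<psi>"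
| "holds D \<kappa> S \<sigma> (Exists x \<phi>) \<longleftrightarrow> (\<exists>d\<in>D. holds D \<kappa> S (\<sigma>(x := d)) \<phi>)"

text \<open>
  \<open>wf_term C X\<close> and \<open>wf_fo sig C X\<close>: all constant symbols belong to \<open>C\<close>, all free variables belong
  to \<open>X\<close>, and relation symbols are used with the arity given by \<open>sig\<close> (\<open>None\<close>: not in the
  vocabulary).
\<close>

fun wf_term :: "nat set \<Rightarrow> nat set \<Rightarrow> fo_term \<Rightarrow> bool" where
  "wf_term C X (Var x) \<longleftrightarrow> x \<in> X"
| "wf_term C X (Const c) \<longleftrightarrow> c \<in> C"

fun wf_fo :: "('s \<Rightarrow> nat option) \<Rightarrow> nat set \<Rightarrow> nat set \<Rightarrow> 's fo \<Rightarrow> bool" where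
  "wf_fo sig C X (Rel s ts) \<longleftrightarrow> sig s = Some (length ts) \<and> (\<forall>t\<in>set ts. wf_term C X t)"
| "wf_fo sig C X (Eq t u) \<longleftrightarrow> wf_term C X t \<and> wf_term C X u"
| "wf_fo sig C X (Neg \<phi>) \<longleftrightarrow> wf_fo sig C X \<phi>"
| "wf_fo sig C X (Conj \<phi> \<psi>) \<longleftrightarrow> wf_fo sig C X \<phi> \<and> wf_fo sig C X \<psi>"
| "wf_fo sig C X (Exists x \<phi>) \<longleftrightarrow> wf_fo sig C (insert x X) \<phi>"

section \<open>Dynamic programs\<close>

text \<open>
  \<open>'r\<close> is the type of input relation symbols. \<open>Relabel r r'\<close> moves a tuple from \<open>r\<close> to \<open>r'\<close>, and does
  nothing if the tuple is not in \<open>r\<close>; it serves to express the relabeling of edges.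
\<close>

datatype 'r change_op = Ins 'r | Del 'r | Relabel 'r 'r

definition single_tuple_changes :: "'r change_op set" where
  "single_tuple_changes = range Ins \<union> range Del"

fun op_arity :: "('r \<Rightarrow> nat) \<Rightarrow> 'r change_op \<Rightarrow> nat" where
  "op_arity ar (Ins r) = ar r"
| "op_arity ar (Del r) = ar r"
| "op_arity ar (Relabel r r') = ar r"

type_synonym 'r input = "'r \<Rightarrow> nat list set"

type_synonym 'r change = "'r change_op \<times> nat list"

fun apply_change :: "'r change \<Rightarrow> 'r input \<Rightarrow> 'r input" where
  "apply_change (Ins r, a) I = I(r := insert a (I r))"
| "apply_change (Del r, a) I = I(r := I r - {a})"
| "apply_change (Relabel r r', a) I =
     (if a \<in> I r then let I' = I(r := I r - {a}) in I'(r' := insert a (I' r')) else I)"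

text \<open>
  Auxiliary relation symbols are the numbers below the length of the arity list. In update formulas,
  \<open>Inl r\<close> is an input and \<open>Inr i\<close> an auxiliary relation symbol. In \<open>update P \<delta> i\<close>, the variables
  \<open>0, \<dots>, k - 1\<close> stand for the changed tuple (\<open>k\<close> the arity of \<open>\<delta>\<close>) and the following
  \<open>aux_arities P ! i\<close> variables for the candidate tuple of the auxiliary relation.
\<close>

record 'r dyn_program =
  aux_arities :: "nat list"
  update :: "'r change_op \<Rightarrow> nat \<Rightarrow> ('r + nat) fo"
  answer :: nat

definition signature :: "('r \<Rightarrow> nat) \<Rightarrow> nat list \<Rightarrow> 'r + nat \<Rightarrow> nat option" where
  "signature ar as = case_sum (\<lambda>r. Some (ar r)) (\<lambda>i. if i < length as then Some (as ! i) else None)"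

definition wf_program ::
  "('r \<Rightarrow> nat) \<Rightarrow> nat set \<Rightarrow> 'r change_op set \<Rightarrow> nat \<Rightarrow> 'r dyn_program \<Rightarrow> bool" where
  "wf_program ar C \<Delta> m P \<longleftrightarrow>
     (\<forall>\<delta>\<in>\<Delta>. \<forall>i<length (aux_arities P).
        wf_fo (signature ar (aux_arities P)) C {..<op_arity ar \<delta> + aux_arities P ! i} (update P \<delta> i)) \<and>
     answer P < length (aux_arities P) \<and> aux_arities P ! answer P = m"

type_synonym 'r state = "'r input \<times> (nat \<Rightarrow> nat list set)"

text \<open>Update formulas are evaluated in the state before the change.\<close>

fun step ::
  "'r dyn_program \<Rightarrow> nat set \<Rightarrow> (nat \<Rightarrow> nat) \<Rightarrow> 'r change \<Rightarrow> 'r state \<Rightarrow> 'r state" where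
  "step P D \<kappa> (\<delta>, a) (I, A) =
     (apply_change (\<delta>, a) I,
      \<lambda>i. if i < length (aux_arities P)
          then {b. length b = aux_arities P ! i \<and> set b \<subseteq> D \<and>
                   holds D \<kappa> (case_sum I A) (\<lambda>x. (a @ b) ! x) (update P \<delta> i)}
          else {})"

definition initial_state :: "'r state" where
  "initial_state = (\<lambda>r. {}, \<lambda>i. {})"

definition run ::
  "'r dyn_program \<Rightarrow> nat set \<Rightarrow> (nat \<Rightarrow> nat) \<Rightarrow> 'r change list \<Rightarrow> 'r state" where
  "run P D \<kappa> cs = fold (step P D \<kappa>) cs initial_state"

definition valid_change ::
  "('r \<Rightarrow> nat) \<Rightarrow> 'r change_op set \<Rightarrow> nat set \<Rightarrow> 'r change \<Rightarrow> bool" where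
  "valid_change ar \<Delta> D c \<longleftrightarrow>
     fst c \<in> \<Delta> \<and> length (snd c) = op_arity ar (fst c) \<and> set (snd c) \<subseteq> D"

text \<open>A query maps domain, interpretation of the constants and input relations to a set of tuples.\<close>

type_synonym 'r query = "nat set \<Rightarrow> (nat \<Rightarrow> nat) \<Rightarrow> 'r input \<Rightarrow> nat list set"

text \<open>
  The answer is required after every nonempty sequence of changes. Before the first change all
  auxiliary relations are empty, so there the requirement would hold automatically if the query has
  an empty answer on the empty input, and be unsatisfiable otherwise (e.g. for 2-SAT, as the
  empty formula is satisfiable).
\<close>

definition maintains ::
  "('r \<Rightarrow> nat) \<Rightarrow> nat set \<Rightarrow> 'r change_op set \<Rightarrow> 'r dyn_program \<Rightarrow> 'r query \<Rightarrow> bool" where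
  "maintains ar C \<Delta> P Q \<longleftrightarrow>
     (\<forall>D \<kappa> cs. finite D \<longrightarrow> \<kappa> ` C \<subseteq> D \<longrightarrow> cs \<noteq> [] \<longrightarrow> (\<forall>c\<in>set cs. valid_change ar \<Delta> D c) \<longrightarrow>
        snd (run P D \<kappa> cs) (answer P) = Q D \<kappa> (fst (run P D \<kappa> cs)))"

text \<open>
  The \<open>m\<close>-ary query \<open>Q\<close> on inputs with relation symbols of arities \<open>ar\<close> and constant symbols \<open>C\<close> can
  be maintained in DynFO under the change operations \<open>\<Delta>\<close>.
\<close>

definition in_DynFO ::
  "('r::finite \<Rightarrow> nat) \<Rightarrow> nat set \<Rightarrow> 'r change_op set \<Rightarrow> nat \<Rightarrow> 'r query \<Rightarrow> bool" where
  "in_DynFO ar C \<Delta> m Q \<longleftrightarrow> (\<exists>P. wf_program ar C \<Delta> m P \<and> maintains ar C \<Delta> P Q)"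

definition boolean_query ::
  "(nat set \<Rightarrow> (nat \<Rightarrow> nat) \<Rightarrow> 'r input \<Rightarrow> bool) \<Rightarrow> 'r query" where
  "boolean_query q = (\<lambda>D \<kappa> I. if q D \<kappa> I then {[]} else {})"

section \<open>Regular path queries\<close>

datatype 'l rexp =
    Empty
  | Epsilon
  | Letter 'l
  | Union "'l rexp" "'l rexp"
  | Concat "'l rexp" "'l rexp"
  | Star "'l rexp"

inductive_set kleene_star :: "'l list set \<Rightarrow> 'l list set" for L where
  Nil: "[] \<in> kleene_star L"
| append: "u \<in> L \<Longrightarrow> v \<in> kleene_star L \<Longrightarrow> u @ v \<in> kleene_star L"

fun lang :: "'l rexp \<Rightarrow> 'l list set" where
  "lang Empty = {}"
| "lang Epsilon = {[]}"
| "lang (Letter a) = {[a]}"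
| "lang (Union \<alpha> \<beta>) = lang \<alpha> \<union> lang \<beta>"
| "lang (Concat \<alpha> \<beta>) = {u @ v | u v. u \<in> lang \<alpha> \<and> v \<in> lang \<beta>}"
| "lang (Star \<alpha>) = kleene_star (lang \<alpha>)"

inductive labeled_path :: "('v \<times> 'l \<times> 'v) set \<Rightarrow> 'v \<Rightarrow> 'l list \<Rightarrow> 'v \<Rightarrow> bool" for E where
  Nil: "labeled_path E v [] v"
| Cons: "(u, a, v) \<in> E \<Longrightarrow> labeled_path E v w x \<Longrightarrow> labeled_path E u (a # w) x"

text \<open>
  Labels are not elements of the domain: a labeled graph with edge set \<open>E \<subseteq> V \<times> \<Sigma> \<times> V\<close> is given by
  one binary relation per label, so that changes of single triples of \<open>E\<close> are exactly changes of
  single tuples of these relations.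
\<close>

definition edges :: "'l input \<Rightarrow> (nat \<times> 'l \<times> nat) set" where
  "edges I = {(u, a, v). [u, v] \<in> I a}"

definition labeled_graph_changes :: "'l change_op set" where
  "labeled_graph_changes = single_tuple_changes \<union> {Relabel a b | a b. True}"

definition rpq_holds :: "'l rexp \<Rightarrow> ('v \<times> 'l \<times> 'v) set \<Rightarrow> 'v \<Rightarrow> 'v \<Rightarrow> bool" where
  "rpq_holds \<alpha> E u v \<longleftrightarrow> (\<exists>w\<in>lang \<alpha>. labeled_path E u w v)"

text \<open>The distinguished nodes of a query are given by constant symbols \<open>s\<close> and \<open>t\<close>.\<close>

definition rpq :: "'l rexp \<Rightarrow> nat \<Rightarrow> nat \<Rightarrow> 'l query" where
  "rpq \<alpha> s t = boolean_query (\<lambda>D \<kappa> I. rpq_holds \<alpha> (edges I) (\<kappa> s) (\<kappa> t))"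

definition rpq_conjunction :: "('l rexp \<times> nat \<times> nat) list \<Rightarrow> 'l query" where
  "rpq_conjunction qs =
     boolean_query (\<lambda>D \<kappa> I. \<forall>(\<alpha>, s, t)\<in>set qs. rpq_holds \<alpha> (edges I) (\<kappa> s) (\<kappa> t))"

section \<open>2-SAT\<close>

datatype clause_rel = C_TT | C_TF | C_FF

instance clause_rel :: finite
proof
  have "(UNIV :: clause_rel set) \<subseteq> {C_TT, C_TF, C_FF}"
    by (auto intro: clause_rel.exhaust)
  then show "finite (UNIV :: clause_rel set)"
    by (rule finite_subset) simp
qed

definition satisfies :: "(nat \<Rightarrow> bool) \<Rightarrow> clause_rel input \<Rightarrow> bool" where
  "satisfies \<beta> I \<longleftrightarrow>
     (\<forall>x y. [x, y] \<in> I C_TT \<longrightarrow> \<beta> x \<or> \<beta> y) \<and>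
     (\<forall>x y. [x, y] \<in> I C_TF \<longrightarrow> \<beta> x \<or> \<not> \<beta> y) \<and>
     (\<forall>x y. [x, y] \<in> I C_FF \<longrightarrow> \<not> \<beta> x \<or> \<not> \<beta> y)"

definition two_sat :: "clause_rel query" where
  "two_sat = boolean_query (\<lambda>D \<kappa> I. \<exists>\<beta>. satisfies \<beta> I)"

end

theory Submission
  imports Defs "HOL-Computational_Algebra.Primes" "Jordan_Normal_Form.Determinant"
begin

text \<open>
  Regular path queries and 2-SAT reduce to reachability in graphs whose nodes are pairs of an element
  and one of finitely many colours (the quotients of the regular languages, the signs of literals).
  For reachability, let \<open>A\<close> be the adjacency matrix. An integer \<open>\<theta>\<close> larger than all degrees makes
  \<open>\<theta> I - A\<close> invertible over the rationals, and the entry of the inverse at \<open>(x, y)\<close> is nonzero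
  exactly if \<open>y\<close> is reachable from \<open>x\<close>. The program stores columns of inverses modulo all numbers
  \<open>m\<close> of logarithmic size that can be denoted by tuples of a fixed length; a change of boundedly many
  edges is a sequence of rank-one updates, for which the Sherman-Morrison formula is first-order.

  Arithmetic on tuples is not given but built up while elements become active, by doubling the range
  of the tables in each step. A modulus is lost when an intermediate matrix becomes singular, so a
  fresh family of inverses is always being computed in the background: it starts from the empty
  graph, catches up with the current graph by several edges per step, and then replaces the family
  in use. During the life time of a family only polynomially many graphs occur, each with a determinant
  with polynomially many bits, so some prime modulus survives and also witnesses that the entry in
  question is nonzero. Small active domains are treated by explicit formulas.
\<close>

text \<open>A thread is a pair of a modulus and a diagonal entry \<open>\<theta>\<close>, and all
  pairs run in parallel: which moduli are good and how large \<open>\<theta>\<close> must be is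
  known only when the answer is read. Soundness is unconditional, since a surviving thread holds an
  exact inverse modulo its modulus, prime or composite, and the entries of such an inverse vanish at
  unreachable pairs. Only completeness calls for a prime. If a family starts with \<open>a\<close>
  active elements, the numbers to be avoided by the prime have, up to the end of its life, at most a
  fixed power of \<open>a\<close> prime divisors in total, whereas its moduli extend to a constant
  fraction of \<open>a\<close>, raised to the power \<open>num_len\<close>. A Chebyshev bound then
  yields a good prime once the tuple length \<open>num_len\<close> beats that fixed power. What
  keeps the power fixed is the race between changes and repair: a change alters at most
  \<open>L\<close> pairs of the node graph, \<open>L\<close> depending only on the number of
  colours, and \<open>L + 1\<close> pairs are repaired per step. So a new family catches up within
  about \<open>a ^ 4\<close> steps, before the old one has seen more than polynomially many
  graphs.\<close>

section \<open>A lower bound for the number of primes up to \<open>N\<close>\<close>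

text \<open>The numbers \<open>1 / (m * (n choose m))\<close> form Leibniz's harmonic triangle: the
  entry for \<open>Suc m\<close> in row \<open>n\<close> is the entry for \<open>m\<close> in row
  \<open>n - 1\<close> minus that in row \<open>n\<close>. Starting from the column
  \<open>1 / n\<close>, every entry multiplied by the lcm therefore stays an integer.\<close>

lemma Leibniz_triangle_dvd_Lcm:
  assumes "1 \<le> m" "m \<le> n" "n \<le> N"
  shows "m * (n choose m) dvd Lcm {1..N}"
proof -
  define L where "L = Lcm {1..N}"
  have "(of_nat L :: rat) / (of_nat m * of_nat (n choose m)) \<in> \<int>"
    using assms
  proof (induction m arbitrary: n)
    case 0
    then show ?case by simp
  next
    case (Suc m)
    show ?case
    proof (cases "m = 0")
    case True
    then have "n dvd L" using Suc.prems by (auto simp: L_def intro!: dvd_Lcm)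
    then obtain k where k: "L = n * k" by blast
    have "(of_nat L :: rat) / (of_nat (Suc m) * of_nat (n choose Suc m)) = of_nat k"
      using Suc.prems True by (simp add: k)
    then show ?thesis by (metis Ints_of_nat)
  next
    case False
    then obtain n' where n: "n = Suc n'" using Suc.prems by (cases n) auto
    have mn: "m < n" "1 \<le> m" "m \<le> n'" using Suc.prems n False by auto
    let ?C = "of_nat (n choose m) :: rat"
    have C0: "?C \<noteq> 0" using mn by simp
    have a: "of_nat (Suc m) * (of_nat (n choose Suc m) :: rat) = of_nat (n - m) * ?C"
      using binomial_absorb_comp[of n m] binomial_absorption[of m n]
      by (simp only: of_nat_mult[symmetric])
    have b: "of_nat n * (of_nat (n' choose m) :: rat) = of_nat (n - m) * ?C"
      using binomial_absorb_comp[of n m] n by (metis diff_Suc_1 of_nat_mult)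
    have nm: "(of_nat (n - m) :: rat) = of_nat n - of_nat m" using mn by (simp add: of_nat_diff)
    have nz: "(of_nat n :: rat) - of_nat m \<noteq> 0" "(of_nat m :: rat) \<noteq> 0" "(of_nat n :: rat) \<noteq> 0"
      using mn by auto
    have c: "(of_nat (n' choose m) :: rat) = (of_nat n - of_nat m) * ?C / of_nat n"
      using b nz nm by (simp add: field_simps)
    have "(of_nat L :: rat) / (of_nat (Suc m) * of_nat (n choose Suc m))
      = of_nat L / (of_nat m * of_nat (n' choose m)) - of_nat L / (of_nat m * ?C)"
      unfolding a c nm using nz C0 by (simp add: divide_simps) (simp add: algebra_simps)
    moreover have "of_nat L / (of_nat m * of_nat (n' choose m)) \<in> (\<int> :: rat set)"
      using Suc.IH[of n'] mn Suc.prems n by auto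
    moreover have "of_nat L / (of_nat m * ?C) \<in> (\<int> :: rat set)"
      using Suc.IH[of n] mn Suc.prems by auto
    ultimately show ?thesis by simp
  qed
  qed
  then obtain k :: int where "(of_nat L :: rat) / (of_nat m * of_nat (n choose m)) = of_int k"
    by (auto elim: Ints_cases)
  moreover have "(of_nat m * of_nat (n choose m) :: rat) \<noteq> 0" using assms by simp
  ultimately have "(of_nat L :: rat) = of_int k * (of_nat m * of_nat (n choose m))"
    by (simp add: field_simps)
  then have "(of_int (int L) :: rat) = of_int (k * int (m * (n choose m)))" by simp
  then have "int L = k * int (m * (n choose m))" by (simp only: of_int_eq_iff)
  then have "int (m * (n choose m)) dvd int L" by simp
  then show ?thesis unfolding L_def by (simp only: int_dvd_int_iff)
qed

lemma Lcm_atLeastAtMost_pos: "0 < Lcm {1..N::nat}"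
  by (rule Nat.gr0I) (auto simp: Lcm_0_iff)

text \<open>Nair's argument: the \<open>N\<close> summands \<open>i * (N choose i)\<close> of
  \<open>N * 2 ^ (N - 1)\<close> all divide the lcm, so none exceeds it.\<close>

lemma Lcm_ge_power2:
  assumes "1 \<le> N"
  shows "2 ^ (N - 1) \<le> Lcm {1..N}"
proof -
  have "N * 2 ^ (N - 1) = (\<Sum>i\<le>N. i * (N choose i))" by (simp add: choose_linear_sum)
  also have "\<dots> = (\<Sum>i\<in>{1..N}. i * (N choose i))"
    by (rule sum.mono_neutral_right) auto
  also have "\<dots> \<le> (\<Sum>i\<in>{1..N}. Lcm {1..N})"
  proof (rule sum_mono)
    fix i assume "i \<in> {1..N}"
    then have "i * (N choose i) dvd Lcm {1..N}" by (intro Leibniz_triangle_dvd_Lcm) auto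
    then show "i * (N choose i) \<le> Lcm {1..N}" by (rule dvd_imp_le[OF _ Lcm_atLeastAtMost_pos])
  qed
  finally show ?thesis using assms by simp
qed

text \<open>The multiplicity of a prime in an lcm is the maximum of its multiplicities in the
  arguments, so one argument already carries the whole power.\<close>

lemma prime_power_dvd_Lcm:
  assumes "prime (p :: nat)" "p ^ k dvd Lcm {1..N}" "k > 0"
  shows "\<exists>i\<in>{1..N}. p ^ k dvd i"
  using assms(2)
proof (induction N)
  case 0
  then show ?case using assms by (auto simp: prime_gt_Suc_0_nat)
next
  case (Suc N)
  have eq: "{1..Suc N} = insert (Suc N) {1..N}" by auto
  have "k \<le> multiplicity p (lcm (Suc N) (Lcm {1..N}))"
    using Suc.prems assms unfolding eq Lcm_insert
    by (intro multiplicity_geI) (auto simp: lcm_eq_0_iff Lcm_0_iff)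
  also have "\<dots> = max (multiplicity p (Suc N)) (multiplicity p (Lcm {1..N}))"
    using assms(1) by (intro multiplicity_lcm) (auto simp: Lcm_0_iff)
  finally have "p ^ k dvd Suc N \<or> p ^ k dvd Lcm {1..N}"
    by (auto intro: multiplicity_dvd' simp: le_max_iff_disj)
  then show ?case using Suc.IH unfolding eq by auto
qed

text \<open>\<open>n\<close> is the product of its prime power parts; each part is at most
  \<open>N\<close>, hence so is each prime, and there are at most as many parts as primes up to
  \<open>N\<close>.\<close>

lemma le_power_card_primes:
  assumes n: "0 < (n::nat)"
    and le: "\<And>p. prime p \<Longrightarrow> p dvd n \<Longrightarrow> p ^ multiplicity p n \<le> N"
  shows "n \<le> N ^ card {p. prime p \<and> p \<le> N}"
proof -
  have le': "p \<le> N" if p: "prime p" "p dvd n" for p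
  proof -
    have "0 < multiplicity p n" using p n by (simp add: prime_multiplicity_gt_zero_iff)
    then have "p \<le> p ^ multiplicity p n" using p by (intro self_le_power prime_ge_1_nat)
    also have "\<dots> \<le> N" by (rule le[OF p])
    finally show ?thesis .
  qed
  have "(\<Prod>p\<in>prime_factors n. p ^ multiplicity p n) = n"
    using prod_prime_factors[of n] n by (simp only: normalize_nat_def id_apply)
  moreover have "(\<Prod>p\<in>prime_factors n. p ^ multiplicity p n) \<le> (\<Prod>p\<in>prime_factors n. N)"
  proof (rule prod_mono, intro conjI)
    fix p assume "p \<in> prime_factors n"
    then show "p ^ multiplicity p n \<le> N" using n by (auto simp: prime_factors_dvd intro: le)
  qed simp
  moreover have "N ^ card (prime_factors n) \<le> N ^ card {p. prime p \<and> p \<le> N}"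
  proof (cases "N = 0")
    case False
    have "finite {p. prime p \<and> p \<le> N}" by (rule finite_subset[of _ "{..N}"]) auto
    moreover have "prime_factors n \<subseteq> {p. prime p \<and> p \<le> N}"
      using n le' by (auto simp: prime_factors_dvd)
    ultimately have "card (prime_factors n) \<le> card {p. prime p \<and> p \<le> N}"
      by (rule card_mono)
    then show ?thesis using False by (intro power_increasing) auto
  next
    case True
    then have "prime_factors n = {}" using n le' prime_gt_0_nat by (force simp: prime_factors_dvd)
    moreover have "{p. prime p \<and> p \<le> N} = {}" using True by (auto dest: prime_gt_0_nat)
    ultimately show ?thesis by (simp only: card.empty)
  qed
  ultimately show ?thesis by simp
qed

lemma Lcm_le_power_card_primes: "Lcm {1..N} \<le> N ^ card {p. prime p \<and> p \<le> (N::nat)}"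
proof (rule le_power_card_primes[OF Lcm_atLeastAtMost_pos])
  fix p :: nat assume p: "prime p" "p dvd Lcm {1..N}"
  have "0 < multiplicity p (Lcm {1..N})"
    using p Lcm_atLeastAtMost_pos[of N] prime_multiplicity_gt_zero_iff[of p "Lcm {1..N}"] by auto
  from prime_power_dvd_Lcm[OF p(1) multiplicity_dvd this]
  obtain i where "i \<in> {1..N}" "p ^ multiplicity p (Lcm {1..N}) dvd i" by blast
  then show "p ^ multiplicity p (Lcm {1..N}) \<le> N" by (auto dest!: dvd_imp_le)
qed

text \<open>Comparison of the lower estimate \<open>2 ^ (N - 1)\<close> of the lcm with the upper
  one, a power of \<open>N\<close> whose exponent is the number of primes. Replacing
  \<open>N\<close> by \<open>2 ^ k\<close> in the latter gives a Chebyshev bound free of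
  logarithms.\<close>

lemma card_primes_ge:
  assumes "N \<le> 2 ^ k" "1 \<le> N"
  shows "N - 1 \<le> k * card {p. prime p \<and> p \<le> (N::nat)}"
proof -
  let ?c = "card {p. prime p \<and> p \<le> N}"
  have "2 ^ (N - 1) \<le> N ^ ?c"
    using Lcm_ge_power2[OF assms(2)] Lcm_le_power_card_primes[of N] by linarith
  also have "\<dots> \<le> (2 ^ k) ^ ?c" using assms by (intro power_mono) auto
  finally have "(2::nat) ^ (N - 1) \<le> 2 ^ (k * ?c)" by (simp add: power_mult)
  then show ?thesis by simp
qed

lemma power2_card_prime_factors_le:
  assumes n: "0 < (n::nat)"
  shows "2 ^ card (prime_factors n) \<le> n"
proof -
  have "(\<Prod>p\<in>prime_factors n. p ^ multiplicity p n) = n"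
    using prod_prime_factors[of n] n by (simp only: normalize_nat_def id_apply)
  moreover have "(\<Prod>p\<in>prime_factors n. 2) \<le> (\<Prod>p\<in>prime_factors n. p ^ multiplicity p n)"
  proof (rule prod_mono, intro conjI)
    fix p assume "p \<in> prime_factors n"
    then have p: "prime p" "p dvd n" by (auto simp: prime_factors_dvd)
    have "0 < multiplicity p n" using p n by (simp add: prime_multiplicity_gt_zero_iff)
    then have "p \<le> p ^ multiplicity p n" using p by (intro self_le_power prime_ge_1_nat)
    then show "2 \<le> p ^ multiplicity p n" using prime_ge_2_nat[OF p(1)] by linarith
  qed simp
  ultimately show ?thesis by simp
qed

text \<open>Distinct prime divisors contribute a factor of at least 2 each. This bounds the moduli
  that a single determinant can spoil.\<close>

lemma card_prime_divisors_le:
  assumes "d \<noteq> 0" "\<bar>d :: int\<bar> \<le> 2 ^ k"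
  shows "finite {p::nat. prime p \<and> int p dvd d}" "card {p::nat. prime p \<and> int p dvd d} \<le> k"
proof -
  let ?n = "nat \<bar>d\<bar>"
  have n: "0 < ?n" using assms by simp
  have eq: "{p::nat. prime p \<and> int p dvd d} = prime_factors ?n"
    using n by (auto simp: prime_factors_dvd dvd_nat_abs_iff)
  show "finite {p::nat. prime p \<and> int p dvd d}" unfolding eq by simp
  have "2 ^ card (prime_factors ?n) \<le> ?n" by (rule power2_card_prime_factors_le[OF n])
  also have "\<dots> \<le> 2 ^ k" using assms(2) by (simp add: nat_le_iff)
  finally show "card {p::nat. prime p \<and> int p dvd d} \<le> k" unfolding eq by simp
qed

section \<open>Determinants and adjugates over an arbitrary finite index set\<close>

text \<open>Transfer of determinants from matrices indexed by an initial segment of the naturals,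
  along an enumeration \<open>e\<close> of \<open>W\<close>. The bound on \<open>d\<close> is the
  Leibniz formula: \<open>card W\<close> factorial many products of \<open>card W\<close> entries.
  The kernel vector in the last clause is what diagonal dominance later refutes to obtain
  \<open>d \<noteq> 0\<close>.\<close>

lemma integer_adjugate:
  fixes X :: "'a \<Rightarrow> 'a \<Rightarrow> int"
  assumes W: "finite W" and bnd: "\<And>i j. i \<in> W \<Longrightarrow> j \<in> W \<Longrightarrow> \<bar>X i j\<bar> \<le> B"
  shows "\<exists>(d :: int) Y. \<bar>d\<bar> \<le> fact (card W) * B ^ card W \<and>
    (\<forall>i\<in>W. \<forall>k\<in>W. (\<Sum>j\<in>W. Y i j * X j k) = (if i = k then d else 0)) \<and>
    (\<forall>i\<in>W. \<forall>k\<in>W. (\<Sum>j\<in>W. X i j * Y j k) = (if i = k then d else 0)) \<and>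
    (d = 0 \<longrightarrow> (\<exists>w. (\<exists>i\<in>W. w i \<noteq> 0) \<and> (\<forall>i\<in>W. (\<Sum>j\<in>W. X i j * w j) = 0)))"
proof -
  let ?n = "card W"
  obtain e where e: "bij_betw e {0..<?n} W" using ex_bij_betw_nat_finite[OF W] by blast
  define f where "f = the_inv_into {0..<?n} e"
  have f: "bij_betw f W {0..<?n}" unfolding f_def by (rule bij_betw_the_inv_into[OF e])
  have fe: "f (e i) = i" if "i < ?n" for i
    unfolding f_def using that e by (intro the_inv_into_f_f) (auto simp: bij_betw_def)
  have eW: "e i \<in> W" if "i < ?n" for i using e that by (auto simp: bij_betw_def)
  have fW: "f i < ?n" if "i \<in> W" for i using f that by (auto simp: bij_betw_def)
  have finj: "f i = f j \<longleftrightarrow> i = j" if "i \<in> W" "j \<in> W" for i j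
    using f that by (auto simp: bij_betw_def inj_on_def)
  have ef: "e (f i) = i" if "i \<in> W" for i
    unfolding f_def using that e by (intro f_the_inv_into_f) (auto simp: bij_betw_def)
  define A where "A = mat ?n ?n (\<lambda>(i, j). X (e i) (e j))"
  have A: "A \<in> carrier_mat ?n ?n" by (simp add: A_def)
  define Y where "Y = (\<lambda>i j. adj_mat A $$ (f i, f j))"
  have adj: "adj_mat A \<in> carrier_mat ?n ?n" by (rule adj_mat(1)[OF A])
  have reidx: "(\<Sum>j\<in>W. g j) = (\<Sum>j<?n. g (e j))" for g :: "'a \<Rightarrow> int"
    using sum.reindex_bij_betw[OF e, of g] by (simp add: atLeast0LessThan)
  have Aij: "A $$ (i, j) = X (e i) (e j)" if "i < ?n" "j < ?n" for i j
    using that by (simp add: A_def)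
  have mm: "(P * Q) $$ (i, k) = (\<Sum>j<?n. P $$ (i, j) * Q $$ (j, k))"
    if "P \<in> carrier_mat ?n ?n" "Q \<in> carrier_mat ?n ?n" "i < ?n" "k < ?n" for P Q :: "int mat" and i k
    using that by (auto simp: scalar_prod_def atLeast0LessThan intro!: sum.cong)
  show ?thesis
  proof (intro exI[of _ "det A"] exI[of _ Y] conjI ballI impI)
    have "\<bar>det A\<bar> \<le> (\<Sum>p\<in>{p. p permutes {0..<?n}}. \<bar>signof p * (\<Prod>i = 0..<?n. A $$ (i, p i))\<bar>)"
      unfolding det_def'[OF A] by (rule sum_abs)
    also have "\<dots> \<le> (\<Sum>p\<in>{p. p permutes {0..<?n}}. B ^ ?n)"
    proof (rule sum_mono)
      fix p assume "p \<in> {p. p permutes {0..<?n}}"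
      then have p: "p i < ?n" if "i < ?n" for i
        using that by (metis atLeast0LessThan lessThan_iff mem_Collect_eq permutes_in_image)
      have "\<bar>signof p * (\<Prod>i = 0..<?n. A $$ (i, p i))\<bar> = (\<Prod>i = 0..<?n. \<bar>A $$ (i, p i)\<bar>)"
        by (simp add: abs_mult abs_prod sign_def)
      also have "\<dots> \<le> (\<Prod>i = 0..<?n. B)"
        by (rule prod_mono) (auto simp: Aij p eW intro!: bnd)
      finally show "\<bar>signof p * (\<Prod>i = 0..<?n. A $$ (i, p i))\<bar> \<le> B ^ ?n" by simp
    qed
    also have "\<dots> = fact ?n * B ^ ?n" by (simp add: card_permutations)
    finally show "\<bar>det A\<bar> \<le> fact ?n * B ^ ?n" .
  next
    fix i k assume ik: "i \<in> W" "k \<in> W"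
    have "(\<Sum>j\<in>W. Y i j * X j k) = (adj_mat A * A) $$ (f i, f k)"
      unfolding reidx mm[OF adj A fW[OF ik(1)] fW[OF ik(2)]]
      by (rule sum.cong) (auto simp: Y_def Aij fe fW ik ef)
    also have "\<dots> = (if i = k then det A else 0)"
      unfolding adj_mat(3)[OF A] using ik fW by (auto simp: finj)
    finally show "(\<Sum>j\<in>W. Y i j * X j k) = (if i = k then det A else 0)" .
  next
    fix i k assume ik: "i \<in> W" "k \<in> W"
    have "(\<Sum>j\<in>W. X i j * Y j k) = (A * adj_mat A) $$ (f i, f k)"
      unfolding reidx mm[OF A adj fW[OF ik(1)] fW[OF ik(2)]]
      by (rule sum.cong) (auto simp: Y_def Aij fe fW ik ef)
    also have "\<dots> = (if i = k then det A else 0)"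
      unfolding adj_mat(2)[OF A] using ik fW by (auto simp: finj)
    finally show "(\<Sum>j\<in>W. X i j * Y j k) = (if i = k then det A else 0)" .
  next
    assume "det A = 0"
    then obtain v where v: "v \<in> carrier_vec ?n" "v \<noteq> 0\<^sub>v ?n" "A *\<^sub>v v = 0\<^sub>v ?n"
      using det_0_iff_vec_prod_zero[OF A] by blast
    obtain i0 where i0: "i0 < ?n" "v $ i0 \<noteq> 0" using v(1,2) by (metis carrier_vecD eq_vecI index_zero_vec)
    show "\<exists>w. (\<exists>i\<in>W. w i \<noteq> 0) \<and> (\<forall>i\<in>W. (\<Sum>j\<in>W. X i j * w j) = 0)"
    proof (intro exI conjI ballI)
      show "\<exists>i\<in>W. v $ f i \<noteq> 0" using i0 eW fe by (intro bexI[of _ "e i0"]) auto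
    next
      fix i assume i: "i \<in> W"
      have "(\<Sum>j\<in>W. X i j * v $ f j) = (\<Sum>j<?n. A $$ (f i, j) * v $ j)"
        unfolding reidx by (rule sum.cong) (auto simp: Aij fe fW i ef)
      also have "\<dots> = (A *\<^sub>v v) $ f i"
        using v(1) A fW[OF i] by (auto simp: scalar_prod_def atLeast0LessThan intro!: sum.cong)
      finally show "(\<Sum>j\<in>W. X i j * v $ f j) = 0" using v(3) fW[OF i] by simp
    qed
  qed
qed

section \<open>First-order definability of predicates on structures\<close>

type_synonym 's model = "nat set \<times> (nat \<Rightarrow> nat) \<times> ('s \<Rightarrow> nat list set)"

definition Vec :: "nat \<Rightarrow> nat set \<Rightarrow> nat list set" where
  "Vec n D = {w. length w = n \<and> set w \<subseteq> D}"

text \<open>Update formulas are written as HOL predicates on a model and a list of values for the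
  variables \<open>0, ..., k - 1\<close>, and shown definable by closure properties. The formula is
  chosen before the structure, so it is the same for all domains.\<close>

definition definable ::
  "('s \<Rightarrow> nat option) \<Rightarrow> nat set \<Rightarrow> nat \<Rightarrow> ('s model \<Rightarrow> nat list \<Rightarrow> bool) \<Rightarrow> bool" where
  "definable sig C k P \<longleftrightarrow> (\<exists>\<phi>. wf_fo sig C {..<k} \<phi> \<and>
     (\<forall>D \<kappa> S \<sigma>. holds D \<kappa> S \<sigma> \<phi> \<longleftrightarrow> P (D, \<kappa>, S) (map \<sigma> [0..<k])))"

text \<open>The list \<open>ts\<close> is chosen before the model, so the tuple is given by the same
  terms in every structure. Only environments of length \<open>k\<close> are constrained, which
  admits HOL expressions such as \<open>take k e\<close>.\<close>

definition vec_term ::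
  "nat set \<Rightarrow> nat \<Rightarrow> nat \<Rightarrow> ('s model \<Rightarrow> nat list \<Rightarrow> nat list) \<Rightarrow> bool" where
  "vec_term C k n t \<longleftrightarrow> (\<exists>ts. length ts = n \<and> (\<forall>u\<in>set ts. wf_term C {..<k} u) \<and>
     (\<forall>M e. length e = k \<longrightarrow> t M e = map (term_val (fst (snd M)) (\<lambda>i. e ! i)) ts))"

abbreviation elem_term ::
  "nat set \<Rightarrow> nat \<Rightarrow> ('s model \<Rightarrow> nat list \<Rightarrow> nat) \<Rightarrow> bool" where
  "elem_term C k t \<equiv> vec_term C k 1 (\<lambda>M e. [t M e])"

lemma term_val_nth_map:
  "wf_term C {..<k} u \<Longrightarrow> term_val \<kappa> ((!) (map \<sigma> [0..<k])) u = term_val \<kappa> \<sigma> u"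
  by (cases u) auto

lemma vec_term_obtain:
  assumes "vec_term C k n t"
  obtains ts where "length ts = n" "\<forall>u\<in>set ts. wf_term C {..<k} u"
    "\<And>D \<kappa> S \<sigma>. t (D, \<kappa>, S) (map \<sigma> [0..<k]) = map (term_val \<kappa> \<sigma>) ts"
proof -
  obtain ts where ts: "length ts = n" "\<forall>u\<in>set ts. wf_term C {..<k} u"
     "\<And>M e. length e = k \<Longrightarrow> t M e = map (term_val (fst (snd M)) (\<lambda>i. e ! i)) ts"
    using assms unfolding vec_term_def by blast
  show thesis
  proof (rule that[OF ts(1,2)])
    fix D \<kappa> S \<sigma>
    show "t (D, \<kappa>, S) (map \<sigma> [0..<k]) = map (term_val \<kappa> \<sigma>) ts"
      using ts(2) by (subst ts(3)) (auto intro!: term_val_nth_map)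
  qed
qed

subsection \<open>Terms\<close>

lemma length_vec_term: "vec_term C k n t \<Longrightarrow> length e = k \<Longrightarrow> length (t M e) = n"
  unfolding vec_term_def by (metis length_map)

lemma vec_term_take:
  assumes "vec_term C k n t"
  shows "vec_term C (k + m) n (\<lambda>M e. t M (take k e))"
proof -
  obtain ts where ts: "length ts = n" "\<forall>u\<in>set ts. wf_term C {..<k} u"
     "\<And>M e. length e = k \<Longrightarrow> t M e = map (term_val (fst (snd M)) (\<lambda>i. e ! i)) ts"
    using assms unfolding vec_term_def by blast
  have wf: "wf_term C {..<k + m} u" if "u \<in> set ts" for u
    using ts(2) that by (cases u) force+
  have val: "term_val \<kappa> (\<lambda>i. take k e ! i) u = term_val \<kappa> (\<lambda>i. e ! i) u" if "u \<in> set ts" for u \<kappa> e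
    using ts(2) that by (cases u) force+
  show ?thesis unfolding vec_term_def
    using ts(1,2) wf val by (intro exI[of _ ts]) (auto simp: ts(3))
qed

lemma vec_term_drop: "vec_term C (k + m) m (\<lambda>M e. drop k e)"
  unfolding vec_term_def
proof (intro exI[of _ "map Var [k..<k+m]"] conjI allI impI)
  fix M :: "'a model" and e :: "nat list" assume "length e = k + m"
  then show "drop k e = map (term_val (fst (snd M)) ((!) e)) (map Var [k..<k + m])"
    by (intro nth_equalityI) auto
qed auto

lemma vec_term_env: "vec_term C k k (\<lambda>M e. e)"
  using vec_term_drop[of C 0 k] by simp

lemma vec_term_Nil: "vec_term C k 0 (\<lambda>M e. [])"
  unfolding vec_term_def by auto

lemma vec_term_append:
  assumes "vec_term C k n t" "vec_term C k m u"
  shows "vec_term C k (n + m) (\<lambda>M e. t M e @ u M e)"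
proof -
  obtain ts us where "length ts = n" "\<forall>u\<in>set ts. wf_term C {..<k} u"
     "\<And>M e. length e = k \<Longrightarrow> t M e = map (term_val (fst (snd M)) (\<lambda>i. e ! i)) ts"
    "length us = m" "\<forall>u\<in>set us. wf_term C {..<k} u"
     "\<And>M e. length e = k \<Longrightarrow> u M e = map (term_val (fst (snd M)) (\<lambda>i. e ! i)) us"
    using assms unfolding vec_term_def by blast
  then show ?thesis unfolding vec_term_def by (intro exI[of _ "ts @ us"]) auto
qed

lemma vec_term_Cons:
  assumes "elem_term C k t" "vec_term C k n u"
  shows "vec_term C k (Suc n) (\<lambda>M e. t M e # u M e)"
  using vec_term_append[OF assms] by simp

lemma elem_term_nth:
  assumes "vec_term C k n t" "i < n"
  shows "elem_term C k (\<lambda>M e. t M e ! i)"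
proof -
  obtain ts where "length ts = n" "\<forall>u\<in>set ts. wf_term C {..<k} u"
     "\<And>M e. length e = k \<Longrightarrow> t M e = map (term_val (fst (snd M)) (\<lambda>i. e ! i)) ts"
    using assms unfolding vec_term_def by blast
  then show ?thesis unfolding vec_term_def using assms(2) by (intro exI[of _ "[ts ! i]"]) auto
qed

lemma vec_term_take':
  assumes "vec_term C k n t" "m \<le> n"
  shows "vec_term C k m (\<lambda>M e. take m (t M e))"
proof -
  obtain ts where "length ts = n" "\<forall>u\<in>set ts. wf_term C {..<k} u"
     "\<And>M e. length e = k \<Longrightarrow> t M e = map (term_val (fst (snd M)) (\<lambda>i. e ! i)) ts"
    using assms unfolding vec_term_def by blast
  then show ?thesis unfolding vec_term_def using assms(2)
    by (intro exI[of _ "take m ts"]) (auto simp: take_map dest: in_set_takeD)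
qed

lemma vec_term_drop':
  assumes "vec_term C k n t" "m + l = n"
  shows "vec_term C k l (\<lambda>M e. drop m (t M e))"
proof -
  obtain ts where "length ts = n" "\<forall>u\<in>set ts. wf_term C {..<k} u"
     "\<And>M e. length e = k \<Longrightarrow> t M e = map (term_val (fst (snd M)) (\<lambda>i. e ! i)) ts"
    using assms unfolding vec_term_def by blast
  then show ?thesis unfolding vec_term_def using assms(2)
    by (intro exI[of _ "drop m ts"]) (auto simp: drop_map dest: in_set_dropD)
qed

lemma elem_term_const: "c \<in> C \<Longrightarrow> elem_term C k (\<lambda>M e. fst (snd M) c)"
  unfolding vec_term_def by (intro exI[of _ "[Const c]"]) auto

lemma elem_term_last: "elem_term C (k + 1) (\<lambda>M e. e ! k)"
  by (rule elem_term_nth[OF vec_term_env]) simp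

subsection \<open>Formulas\<close>

lemma definable_cong:
  assumes "definable sig C k P" "\<And>M e. length e = k \<Longrightarrow> P M e = Q M e"
  shows "definable sig C k Q"
  using assms unfolding definable_def by (metis (no_types, lifting) diff_zero length_map length_upt)

lemma definable_Neg: "definable sig C k P \<Longrightarrow> definable sig C k (\<lambda>M e. \<not> P M e)"
  unfolding definable_def by (metis holds.simps(3) wf_fo.simps(3))

lemma definable_Conj:
  assumes "definable sig C k P" "definable sig C k Q"
  shows "definable sig C k (\<lambda>M e. P M e \<and> Q M e)"
proof -
  obtain \<phi> \<psi> where "wf_fo sig C {..<k} \<phi>" "wf_fo sig C {..<k} \<psi>"
    "\<And>D \<kappa> S \<sigma>. holds D \<kappa> S \<sigma> \<phi> \<longleftrightarrow> P (D, \<kappa>, S) (map \<sigma> [0..<k])"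
    "\<And>D \<kappa> S \<sigma>. holds D \<kappa> S \<sigma> \<psi> \<longleftrightarrow> Q (D, \<kappa>, S) (map \<sigma> [0..<k])"
    using assms unfolding definable_def by blast
  then show ?thesis unfolding definable_def by (intro exI[of _ "Conj \<phi> \<psi>"]) auto
qed

lemma definable_Disj:
  assumes "definable sig C k P" "definable sig C k Q"
  shows "definable sig C k (\<lambda>M e. P M e \<or> Q M e)"
  using definable_Neg[OF definable_Conj[OF definable_Neg[OF assms(1)] definable_Neg[OF assms(2)]]]
  by simp

lemma definable_Imp:
  assumes "definable sig C k P" "definable sig C k Q"
  shows "definable sig C k (\<lambda>M e. P M e \<longrightarrow> Q M e)"
  using definable_Disj[OF definable_Neg[OF assms(1)] assms(2)] by (rule definable_cong) blast

lemma definable_Iff: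
  assumes "definable sig C k P" "definable sig C k Q"
  shows "definable sig C k (\<lambda>M e. P M e = Q M e)"
  using definable_Conj[OF definable_Imp[OF assms] definable_Imp[OF assms(2,1)]]
  by (rule definable_cong) auto

text \<open>Formulas have no truth constants. The quantifier makes the contradiction closed, and the
  result is false over the empty domain too.\<close>

lemma definable_False: "definable sig C k (\<lambda>M e. False)"
  unfolding definable_def by (intro exI[of _ "Exists 0 (Neg (Eq (Var 0) (Var 0)))"]) auto

lemma definable_True: "definable sig C k (\<lambda>M e. True)"
  using definable_Neg[OF definable_False] by simp

lemma definable_bool: "definable sig C k (\<lambda>M e. b)"
  by (cases b) (auto intro: definable_True definable_False)

lemma definable_Rel:
  assumes "vec_term C k n t" "sig s = Some n"
  shows "definable sig C k (\<lambda>M e. t M e \<in> snd (snd M) s)"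
proof -
  obtain ts where "length ts = n" "\<forall>u\<in>set ts. wf_term C {..<k} u"
     "\<And>D \<kappa> S \<sigma>. t (D, \<kappa>, S) (map \<sigma> [0..<k]) = map (term_val \<kappa> \<sigma>) ts"
    using vec_term_obtain[OF assms(1)] by metis
  then show ?thesis unfolding definable_def using assms(2) by (intro exI[of _ "Rel s ts"]) auto
qed

lemma definable_elem_eq:
  assumes "elem_term C k t" "elem_term C k u"
  shows "definable sig C k (\<lambda>M e. t M e = u M e)"
proof -
  obtain ts us where ts: "length ts = 1" "\<forall>u\<in>set ts. wf_term C {..<k} u"
     "\<And>D \<kappa> S \<sigma>. [t (D, \<kappa>, S) (map \<sigma> [0..<k])] = map (term_val \<kappa> \<sigma>) ts"
     "length us = 1" "\<forall>u\<in>set us. wf_term C {..<k} u"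
     "\<And>D \<kappa> S \<sigma>. [u (D, \<kappa>, S) (map \<sigma> [0..<k])] = map (term_val \<kappa> \<sigma>) us"
    by (rule vec_term_obtain[OF assms(1)], rule vec_term_obtain[OF assms(2)]) blast
  obtain a b where ab: "ts = [a]" "us = [b]" using ts(1,4) by (auto simp: length_Suc_conv)
  show ?thesis unfolding definable_def
    using ts ab by (intro exI[of _ "Eq a b"]) auto
qed

lemma definable_All_less:
  assumes "\<And>i. i < (n::nat) \<Longrightarrow> definable sig C k (P i)"
  shows "definable sig C k (\<lambda>M e. \<forall>i<n. P i M e)"
  using assms
proof (induction n)
  case (Suc n)
  have "definable sig C k (\<lambda>M e. (\<forall>i<n. P i M e) \<and> P n M e)"
    using Suc by (intro definable_Conj) auto
  then show ?case by (rule definable_cong) (auto simp: less_Suc_eq)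
qed (simp add: definable_True)

lemma definable_Ex_less:
  assumes "\<And>i. i < (n::nat) \<Longrightarrow> definable sig C k (P i)"
  shows "definable sig C k (\<lambda>M e. \<exists>i<n. P i M e)"
  using definable_Neg[OF definable_All_less[of n sig C k "\<lambda>i M e. \<not> P i M e"]] assms
  by (auto intro: definable_Neg)

lemma definable_Ex_finite:
  assumes "finite A" "\<And>i. i \<in> A \<Longrightarrow> definable sig C k (P i)"
  shows "definable sig C k (\<lambda>M e. \<exists>i\<in>A. P i M e)"
  using assms
proof (induction A rule: finite_induct)
  case (insert x A)
  have "definable sig C k (\<lambda>M e. P x M e \<or> (\<exists>i\<in>A. P i M e))"
    using insert by (intro definable_Disj) auto
  then show ?case by (rule definable_cong) auto
qed (simp add: definable_False)

lemma definable_All_finite: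
  assumes "finite A" "\<And>i. i \<in> A \<Longrightarrow> definable sig C k (P i)"
  shows "definable sig C k (\<lambda>M e. \<forall>i\<in>A. P i M e)"
  using definable_Neg[OF definable_Ex_finite[of A sig C k "\<lambda>i M e. \<not> P i M e"]] assms
  by (auto intro: definable_Neg)

lemma definable_vec_eq:
  assumes "vec_term C k n t" "vec_term C k n u"
  shows "definable sig C k (\<lambda>M e. t M e = u M e)"
proof -
  have "definable sig C k (\<lambda>M e. \<forall>i<n. t M e ! i = u M e ! i)"
    using assms by (intro definable_All_less definable_elem_eq elem_term_nth)
  then show ?thesis
    by (rule definable_cong)
      (simp add: list_eq_iff_nth_eq length_vec_term[OF assms(1)] length_vec_term[OF assms(2)])
qed

text \<open>The quantified element becomes variable \<open>k\<close>, the entry appended to an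
  environment of length \<open>k\<close>; \<open>take k e\<close> and \<open>e ! k\<close> separate
  the old environment from it.\<close>

lemma definable_Ex_elem:
  assumes "definable sig C (k + 1) (\<lambda>M e. P M (take k e) (e ! k))"
  shows "definable sig C k (\<lambda>M e. \<exists>d\<in>fst M. P M e d)"
proof -
  obtain \<phi> where \<phi>: "wf_fo sig C {..<k + 1} \<phi>"
    "\<And>D \<kappa> S \<sigma>. holds D \<kappa> S \<sigma> \<phi> \<longleftrightarrow>
       P (D, \<kappa>, S) (take k (map \<sigma> [0..<k + 1])) (map \<sigma> [0..<k + 1] ! k)"
    using assms unfolding definable_def by blast
  have eq: "take k (map (\<sigma>(k := d)) [0..<Suc k]) = map \<sigma> [0..<k]"
    "map (\<sigma>(k := d)) [0..<Suc k] ! k = d" for \<sigma> and d :: nat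
    by (auto simp: take_map nth_append intro!: nth_equalityI)
  have set: "insert k {..<k} = {..<Suc k}" by auto
  show ?thesis unfolding definable_def
    by (intro exI[of _ "Exists k \<phi>"]) (use \<phi>(1) in \<open>simp add: set \<phi>(2) eq del: upt_Suc\<close>)
qed

lemma definable_Ex_vec:
  assumes "definable sig C (k + n) (\<lambda>M e. P M (take k e) (drop k e))"
  shows "definable sig C k (\<lambda>M e. \<exists>w\<in>Vec n (fst M). P M e w)"
  using assms
proof (induction n arbitrary: P)
  case 0
  have "Vec 0 D = {[]}" for D by (auto simp: Vec_def)
  then show ?case using 0 by (auto elim!: definable_cong)
next
  case (Suc n)
  have "definable sig C (k + n) (\<lambda>M e. \<exists>d\<in>fst M. P M (take k e) (drop k e @ [d]))"
  proof (rule definable_Ex_elem)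
    have *: "definable sig C (k + n + 1) (\<lambda>M e. P M (take k e) (drop k e))"
      using Suc.prems by simp
    show "definable sig C (k + n + 1) (\<lambda>M e. P M (take k (take (k + n) e)) (drop k (take (k + n) e) @ [e ! (k + n)]))"
    proof (rule definable_cong[OF *])
      fix M :: "'a model" and e :: "nat list" assume e: "length e = k + n + 1"
      have "drop k (take (k + n) e) @ [e ! (k + n)] = drop k e"
        using e by (intro nth_equalityI) (auto simp: nth_append min_def less_Suc_eq)
      then show "P M (take k e) (drop k e) = P M (take k (take (k + n) e)) (drop k (take (k + n) e) @ [e ! (k + n)])"
        by (simp add: min_def)
    qed
  qed
  then have "definable sig C k (\<lambda>M e. \<exists>w\<in>Vec n (fst M). \<exists>d\<in>fst M. P M e (w @ [d]))"
    by (rule Suc.IH)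
  moreover have "(\<exists>w\<in>Vec n D. \<exists>d\<in>D. Q (w @ [d])) \<longleftrightarrow> (\<exists>w\<in>Vec (Suc n) D. Q w)" for D Q
  proof
    assume "\<exists>w\<in>Vec (Suc n) D. Q w"
    then obtain w where w: "w \<in> Vec (Suc n) D" "Q w" by blast
    then obtain v d where "w = v @ [d]" by (cases w rule: rev_cases) (auto simp: Vec_def)
    then show "\<exists>w\<in>Vec n D. \<exists>d\<in>D. Q (w @ [d])"
      using w by (intro bexI[of _ v] bexI[of _ d]) (auto simp: Vec_def)
  next
    assume "\<exists>w\<in>Vec n D. \<exists>d\<in>D. Q (w @ [d])"
    then obtain w d where "w \<in> Vec n D" "d \<in> D" "Q (w @ [d])" by blast
    then show "\<exists>w\<in>Vec (Suc n) D. Q w" by (intro bexI[of _ "w @ [d]"]) (auto simp: Vec_def)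
  qed
  ultimately show ?case by simp
qed

lemma definable_All_elem:
  assumes "definable sig C (k + 1) (\<lambda>M e. P M (take k e) (e ! k))"
  shows "definable sig C k (\<lambda>M e. \<forall>d\<in>fst M. P M e d)"
  using definable_Neg[OF definable_Ex_elem[OF definable_Neg[OF assms]]] by simp

lemma definable_All_vec:
  assumes "definable sig C (k + n) (\<lambda>M e. P M (take k e) (drop k e))"
  shows "definable sig C k (\<lambda>M e. \<forall>w\<in>Vec n (fst M). P M e w)"
  using definable_Neg[OF definable_Ex_vec[OF definable_Neg[OF assms]]] by simp

lemma definable_If:
  assumes "definable sig C k B" "definable sig C k P" "definable sig C k Q"
  shows "definable sig C k (\<lambda>M e. if B M e then P M e else Q M e)"
  using definable_Disj[OF definable_Conj[OF assms(1,2)] definable_Conj[OF definable_Neg[OF assms(1)] assms(3)]]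
  by (rule definable_cong) auto

lemmas definable_intros = definable_Neg definable_Conj definable_Disj definable_Imp definable_Iff
  definable_True definable_False definable_Ex_elem definable_Ex_vec definable_All_elem definable_All_vec

lemmas vec_term_intros = vec_term_take vec_term_drop vec_term_append vec_term_Cons vec_term_Nil
  elem_term_last

hide_const (open) le add zero one mult

subsection \<open>Ordering tuples\<close>

text \<open>The order is reflexive exactly on \<open>A\<close> and relates nothing else, so one
  binary relation stores both the set of active elements and the order in which they became
  active.\<close>

definition linorder_on :: "nat set \<Rightarrow> (nat \<Rightarrow> nat \<Rightarrow> bool) \<Rightarrow> bool" where
  "linorder_on A le \<longleftrightarrow> (\<forall>x y. le x y \<longrightarrow> x \<in> A \<and> y \<in> A) \<and> (\<forall>x\<in>A. le x x) \<and>
     (\<forall>x y z. le x y \<longrightarrow> le y z \<longrightarrow> le x z) \<and> (\<forall>x y. le x y \<longrightarrow> le y x \<longrightarrow> x = y) \<and>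
     (\<forall>x\<in>A. \<forall>y\<in>A. le x y \<or> le y x)"

text \<open>Comparison of the largest entries, expressed without naming them.\<close>

definition max_le :: "nat \<Rightarrow> (nat \<Rightarrow> nat \<Rightarrow> bool) \<Rightarrow> nat list \<Rightarrow> nat list \<Rightarrow> bool" where
  "max_le n le x y \<longleftrightarrow> (\<forall>i<n. \<exists>j<n. le (x ! i) (y ! j))"

definition lex_less :: "nat \<Rightarrow> (nat \<Rightarrow> nat \<Rightarrow> bool) \<Rightarrow> nat list \<Rightarrow> nat list \<Rightarrow> bool" where
  "lex_less n le x y \<longleftrightarrow> (\<exists>i<n. (\<forall>j<i. x ! j = y ! j) \<and> le (x ! i) (y ! i) \<and> x ! i \<noteq> y ! i)"

text \<open>Largest entry first, lexicographic order among ties. Plain lexicographic order would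
  renumber old tuples whenever an element is activated; here a tuple with a new, larger entry comes
  after all old tuples, so a tuple never changes the number it denotes.\<close>

definition tuple_less :: "nat \<Rightarrow> (nat \<Rightarrow> nat \<Rightarrow> bool) \<Rightarrow> nat list \<Rightarrow> nat list \<Rightarrow> bool" where
  "tuple_less n le x y \<longleftrightarrow> max_le n le x y \<and> (max_le n le y x \<longrightarrow> lex_less n le x y)"

definition active :: "nat \<Rightarrow> (nat \<Rightarrow> nat \<Rightarrow> bool) \<Rightarrow> nat list \<Rightarrow> bool" where
  "active n le x \<longleftrightarrow> (\<forall>i<n. le (x ! i) (x ! i))"

definition num :: "nat set \<Rightarrow> (nat \<Rightarrow> nat \<Rightarrow> bool) \<Rightarrow> nat \<Rightarrow> nat list \<Rightarrow> nat" where
  "num A le n x = card {y \<in> Vec n A. tuple_less n le y x}"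

lemma finite_Vec: "finite A \<Longrightarrow> finite (Vec n A)"
  unfolding Vec_def using finite_lists_length_eq[of A n] by (simp add: conj_commute)

lemma card_Vec: "finite A \<Longrightarrow> card (Vec n A) = card A ^ n"
  unfolding Vec_def using card_lists_length_eq[of A n] by (simp add: conj_commute)

lemma Vec_mono: "A \<subseteq> B \<Longrightarrow> Vec n A \<subseteq> Vec n B"
  by (auto simp: Vec_def)

lemma Vec_nth: "x \<in> Vec n A \<Longrightarrow> i < n \<Longrightarrow> x ! i \<in> A"
  by (auto simp: Vec_def)

lemma VecI: "length x = n \<Longrightarrow> (\<And>i. i < n \<Longrightarrow> x ! i \<in> A) \<Longrightarrow> x \<in> Vec n A"
  by (auto simp: Vec_def in_set_conv_nth)

lemma length_Vec: "x \<in> Vec n A \<Longrightarrow> length x = n"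
  by (simp add: Vec_def)

locale activation =
  fixes A :: "nat set" and le :: "nat \<Rightarrow> nat \<Rightarrow> bool"
  assumes fin: "finite A" and lin: "linorder_on A le"
begin

lemma le_in: "le x y \<Longrightarrow> x \<in> A" "le x y \<Longrightarrow> y \<in> A" and le_refl: "x \<in> A \<Longrightarrow> le x x"
  and le_trans: "le x y \<Longrightarrow> le y z \<Longrightarrow> le x z" and le_antisym: "le x y \<Longrightarrow> le y x \<Longrightarrow> x = y"
  and le_total: "x \<in> A \<Longrightarrow> y \<in> A \<Longrightarrow> le x y \<or> le y x"
  using lin unfolding linorder_on_def by blast+

lemma active_iff: "length x = n \<Longrightarrow> active n le x \<longleftrightarrow> x \<in> Vec n A"
proof
  assume "length x = n" "active n le x"
  then show "x \<in> Vec n A" by (intro VecI) (auto simp: active_def dest: le_in(1))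
qed (simp add: active_def Vec_nth le_refl)

lemma max_le_trans: "max_le n le x y \<Longrightarrow> max_le n le y z \<Longrightarrow> max_le n le x z"
  unfolding max_le_def by (meson le_trans)

lemma max_le_total:
  assumes "x \<in> Vec n A" "y \<in> Vec n A" "\<not> max_le n le x y"
  shows "max_le n le y x"
proof -
  obtain i where i: "i < n" "\<forall>j<n. \<not> le (x ! i) (y ! j)" using assms(3) by (auto simp: max_le_def)
  then have "le (y ! j) (x ! i)" if "j < n" for j
    using le_total[of "x ! i" "y ! j"] that assms(1,2) by (auto simp: Vec_nth)
  then show ?thesis using i by (auto simp: max_le_def)
qed

lemma lex_less_trans:
  assumes "lex_less n le x y" "lex_less n le y z"
  shows "lex_less n le x z"
proof -
  obtain i where i: "i < n" "\<forall>j<i. x ! j = y ! j" "le (x ! i) (y ! i)" "x ! i \<noteq> y ! i"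
    using assms(1) unfolding lex_less_def by blast
  obtain k where k: "k < n" "\<forall>j<k. y ! j = z ! j" "le (y ! k) (z ! k)" "y ! k \<noteq> z ! k"
    using assms(2) unfolding lex_less_def by blast
  consider "i < k" | "i = k" | "k < i" by linarith
  then show ?thesis
  proof cases
    case 1
    then show ?thesis using i k unfolding lex_less_def by (intro exI[of _ i]) auto
  next
    case 2
    then have "le (x ! i) (z ! i)" "x ! i \<noteq> z ! i" using i k le_trans le_antisym by metis+
    then show ?thesis using i k 2 unfolding lex_less_def by (intro exI[of _ i]) auto
  next
    case 3
    then show ?thesis using i k unfolding lex_less_def by (intro exI[of _ k]) auto
  qed
qed

lemma lex_less_irrefl: "\<not> lex_less n le x x"
  by (auto simp: lex_less_def)

lemma lex_less_total:
  assumes "x \<in> Vec n A" "y \<in> Vec n A" "x \<noteq> y"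
  shows "lex_less n le x y \<or> lex_less n le y x"
proof -
  have "\<exists>i. i < n \<and> x ! i \<noteq> y ! i" using assms by (auto simp: list_eq_iff_nth_eq length_Vec)
  then obtain i where i: "i < n \<and> x ! i \<noteq> y ! i" "\<forall>j<i. \<not> (j < n \<and> x ! j \<noteq> y ! j)"
    using exists_least_iff[of "\<lambda>i. i < n \<and> x ! i \<noteq> y ! i"] by blast
  then have "le (x ! i) (y ! i) \<or> le (y ! i) (x ! i)"
    using le_total assms by (simp add: Vec_nth)
  then show ?thesis using i unfolding lex_less_def by (metis dual_order.strict_trans)
qed

lemma tuple_less_trans: "tuple_less n le x y \<Longrightarrow> tuple_less n le y z \<Longrightarrow> tuple_less n le x z"
  unfolding tuple_less_def using max_le_trans lex_less_trans by blast

lemma tuple_less_irrefl: "\<not> tuple_less n le x x"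
  unfolding tuple_less_def using lex_less_irrefl by blast

lemma tuple_less_total:
  "x \<in> Vec n A \<Longrightarrow> y \<in> Vec n A \<Longrightarrow> x \<noteq> y \<Longrightarrow> tuple_less n le x y \<or> tuple_less n le y x"
  unfolding tuple_less_def using max_le_total lex_less_total by blast

lemma tuple_less_downward:
  assumes "\<And>x y. le x y \<Longrightarrow> y \<in> B \<Longrightarrow> x \<in> B" "tuple_less n le x y" "y \<in> Vec n B" "length x = n"
  shows "x \<in> Vec n B"
  using assms by (intro VecI) (auto simp: tuple_less_def max_le_def Vec_nth)

lemma num_less_iff:
  assumes "x \<in> Vec n A" "y \<in> Vec n A"
  shows "num A le n x < num A le n y \<longleftrightarrow> tuple_less n le x y"
proof -
  have fin': "finite {z \<in> Vec n A. tuple_less n le z w}" for w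
    using finite_Vec[OF fin] by simp
  have mono: "num A le n x < num A le n y" if "x \<in> Vec n A" "y \<in> Vec n A" "tuple_less n le x y" for x y
    unfolding num_def
  proof (rule psubset_card_mono[OF fin'])
    show "{z \<in> Vec n A. tuple_less n le z x} \<subset> {z \<in> Vec n A. tuple_less n le z y}"
      using that tuple_less_trans tuple_less_irrefl by blast
  qed
  show ?thesis using mono[of x y] mono[of y x] tuple_less_total[of x n y] assms by fastforce
qed

lemma num_eq_iff:
  assumes "x \<in> Vec n A" "y \<in> Vec n A"
  shows "num A le n x = num A le n y \<longleftrightarrow> x = y"
  using num_less_iff[OF assms] num_less_iff[OF assms(2,1)] tuple_less_total[OF assms] by auto

text \<open>A downward closed \<open>B\<close> makes \<open>Vec n B\<close> an initial segment of
  the tuples, and ranks are injective; counting then forces all ranks below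
  \<open>card B ^ n\<close> to occur.\<close>

lemma num_image:
  assumes B: "B \<subseteq> A" and down: "\<And>x y. le x y \<Longrightarrow> y \<in> B \<Longrightarrow> x \<in> B"
  shows "num A le n ` Vec n B = {..<card B ^ n}"
proof -
  have finB: "finite B" using B fin finite_subset by blast
  have BA: "Vec n B \<subseteq> Vec n A" by (rule Vec_mono[OF B])
  have "num A le n x < card B ^ n" if x: "x \<in> Vec n B" for x
  proof -
    have "y \<in> Vec n B" if "y \<in> Vec n A" "tuple_less n le y x" for y
      by (rule tuple_less_downward[OF down that(2) x]) (use that in \<open>auto simp: length_Vec\<close>)
    then have "{y \<in> Vec n A. tuple_less n le y x} \<subset> Vec n B"
      using x tuple_less_irrefl[of n x] by blast
    then have "num A le n x < card (Vec n B)"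
      unfolding num_def by (rule psubset_card_mono[OF finite_Vec[OF finB]])
    then show ?thesis by (simp add: card_Vec finB)
  qed
  moreover have "inj_on (num A le n) (Vec n B)"
    using BA num_eq_iff[of _ n] unfolding inj_on_def by blast
  then have "card (num A le n ` Vec n B) = card B ^ n"
    by (simp add: card_image card_Vec finB)
  ultimately show ?thesis by (intro card_subset_eq) auto
qed

lemma num_exists:
  assumes "k \<le> num A le n t" "t \<in> Vec n A"
  shows "\<exists>x\<in>Vec n A. num A le n x = k"
proof -
  have "num A le n ` Vec n A = {..<card A ^ n}" by (rule num_image) (auto dest: le_in)
  moreover from this have "num A le n t < card A ^ n" using assms(2) by auto
  ultimately have "k \<in> num A le n ` Vec n A" using assms(1) by auto
  then show ?thesis by auto
qed

lemma num_less_imp_Vec: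
  assumes "num A le n x < card B ^ n" "x \<in> Vec n A" "B \<subseteq> A" "\<And>x y. le x y \<Longrightarrow> y \<in> B \<Longrightarrow> x \<in> B"
  shows "x \<in> Vec n B"
proof -
  have "num A le n x \<in> num A le n ` Vec n B"
    using num_image[where n = n, OF assms(3,4)] assms(1) by simp
  then obtain y where y: "y \<in> Vec n B" "num A le n x = num A le n y" by blast
  then have "y \<in> Vec n A" using Vec_mono[OF assms(3)] by blast
  then have "x = y" using num_eq_iff[OF assms(2)] y by blast
  then show ?thesis using y by simp
qed

end

text \<open>For \<open>y\<close> in \<open>A\<close> the equivalence \<open>ext\<close> also covers
  \<open>x\<close> outside \<open>A\<close>, where \<open>le x y\<close> is false: newly activated
  elements are placed above all old ones.\<close>

locale activation_ext = old: activation A le + new: activation A' le'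
  for A le A' le' +
  assumes ext: "\<And>x y. y \<in> A \<Longrightarrow> le' x y \<longleftrightarrow> le x y" and sub: "A \<subseteq> A'"
begin

lemma max_le_ext: "y \<in> Vec n A \<Longrightarrow> max_le n le' x y \<longleftrightarrow> max_le n le x y"
  by (simp add: max_le_def ext Vec_nth cong: conj_cong)

lemma lex_less_ext: "y \<in> Vec n A \<Longrightarrow> lex_less n le' x y \<longleftrightarrow> lex_less n le x y"
  by (auto simp: lex_less_def ext Vec_nth)

lemma tuple_less_ext:
  "x \<in> Vec n A \<Longrightarrow> y \<in> Vec n A \<Longrightarrow> tuple_less n le' x y \<longleftrightarrow> tuple_less n le x y"
  by (simp add: tuple_less_def max_le_ext lex_less_ext)

lemma num_ext:
  assumes "x \<in> Vec n A"
  shows "num A' le' n x = num A le n x"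
proof -
  have "y \<in> Vec n A" if "y \<in> Vec n A'" "tuple_less n le' y x" for y
  proof (rule new.tuple_less_downward[OF _ that(2) assms])
    show "x \<in> A" if "le' x y" "y \<in> A" for x y
      using that ext old.le_in by blast
  qed (use that in \<open>simp add: length_Vec\<close>)
  then have "{y \<in> Vec n A'. tuple_less n le' y x} = {y \<in> Vec n A. tuple_less n le y x}"
    using assms Vec_mono[OF sub] tuple_less_ext by blast
  then show ?thesis by (simp add: num_def)
qed

end

subsection \<open>Arithmetic on tuples\<close>

text \<open>Quantifiers range over \<open>D\<close>, hence the relativization to active tuples.
  Together with \<open>next_num\<close> this defines the numbering from the order alone.\<close>

definition zero :: "nat set \<Rightarrow> (nat \<Rightarrow> nat \<Rightarrow> bool) \<Rightarrow> nat \<Rightarrow> nat list \<Rightarrow> bool" where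
  "zero D le n x \<longleftrightarrow> active n le x \<and> \<not> (\<exists>w\<in>Vec n D. active n le w \<and> tuple_less n le w x)"

definition next_num :: "nat set \<Rightarrow> (nat \<Rightarrow> nat \<Rightarrow> bool) \<Rightarrow> nat \<Rightarrow> nat list \<Rightarrow> nat list \<Rightarrow> bool" where
  "next_num D le n x y \<longleftrightarrow> active n le x \<and> active n le y \<and> tuple_less n le x y \<and>
     \<not> (\<exists>w\<in>Vec n D. active n le w \<and> tuple_less n le x w \<and> tuple_less n le w y)"

definition one :: "nat set \<Rightarrow> (nat \<Rightarrow> nat \<Rightarrow> bool) \<Rightarrow> nat \<Rightarrow> nat list \<Rightarrow> bool" where
  "one D le n x \<longleftrightarrow> (\<exists>w\<in>Vec n D. zero D le n w \<and> next_num D le n w x)"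

definition below :: "(nat \<Rightarrow> nat \<Rightarrow> bool) \<Rightarrow> nat \<Rightarrow> nat list \<Rightarrow> nat list \<Rightarrow> bool" where
  "below le n t x \<longleftrightarrow> active n le t \<and> active n le x \<and> \<not> tuple_less n le t x"

type_synonym table = "nat list \<Rightarrow> nat list \<Rightarrow> nat list \<Rightarrow> nat list \<Rightarrow> bool"

text \<open>A modulus \<open>m\<close> is represented by the tuple \<open>t\<close> denoting \<open>m - 1\<close>. Each step doubles the range
  of the second operand covered by the tables.\<close>

definition add_step :: "nat set \<Rightarrow> (nat \<Rightarrow> nat \<Rightarrow> bool) \<Rightarrow> nat \<Rightarrow> table \<Rightarrow> table" where
  "add_step D le n add t x y z \<longleftrightarrow> below le n t x \<and> below le n t y \<and> below le n t z \<and>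
     (add t x y z \<or> (zero D le n y \<and> z = x) \<or>
      (one D le n y \<and> (x = t \<and> zero D le n z \<or> x \<noteq> t \<and> next_num D le n x z)) \<or>
      (\<exists>y1\<in>Vec n D. \<exists>y2\<in>Vec n D. \<exists>w\<in>Vec n D. add t y1 y2 y \<and> add t x y1 w \<and> add t w y2 z))"

definition mul_step :: "nat set \<Rightarrow> (nat \<Rightarrow> nat \<Rightarrow> bool) \<Rightarrow> nat \<Rightarrow> table \<Rightarrow> table \<Rightarrow> table" where
  "mul_step D le n add mul t x y z \<longleftrightarrow> below le n t x \<and> below le n t y \<and> below le n t z \<and>
     (mul t x y z \<or> (zero D le n y \<and> zero D le n z) \<or> (one D le n y \<and> z = x) \<or>
      (\<exists>y1\<in>Vec n D. \<exists>y2\<in>Vec n D. \<exists>z1\<in>Vec n D. \<exists>z2\<in>Vec n D.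
        add t y1 y2 y \<and> mul t x y1 z1 \<and> mul t x y2 z2 \<and> add t z1 z2 z))"

text \<open>A first-order test by which the program recognizes that its tables for the tuple
  \<open>t\<close> are finished: the modulus is at least 2 and both operations are total on
  residues. Soundness of the tables then makes them exact.\<close>

definition complete ::
  "nat set \<Rightarrow> (nat \<Rightarrow> nat \<Rightarrow> bool) \<Rightarrow> nat \<Rightarrow> table \<Rightarrow> table \<Rightarrow> nat list \<Rightarrow> bool" where
  "complete D le n add mul t \<longleftrightarrow> (\<exists>w\<in>Vec n D. one D le n w \<and> below le n t w) \<and>
     (\<forall>x\<in>Vec n D. \<forall>y\<in>Vec n D. below le n t x \<and> below le n t y \<longrightarrow>
        (\<exists>z\<in>Vec n D. add t x y z) \<and> (\<exists>z\<in>Vec n D. mul t x y z))"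

definition table_sound :: "nat set \<Rightarrow> (nat \<Rightarrow> nat \<Rightarrow> bool) \<Rightarrow> nat \<Rightarrow> (nat \<Rightarrow> nat \<Rightarrow> nat) \<Rightarrow> table \<Rightarrow> bool" where
  "table_sound A le n f tab \<longleftrightarrow> (\<forall>t x y z. tab t x y z \<longrightarrow>
     t \<in> Vec n A \<and> x \<in> Vec n A \<and> y \<in> Vec n A \<and> z \<in> Vec n A \<and>
     num A le n x \<le> num A le n t \<and> num A le n y \<le> num A le n t \<and> num A le n z \<le> num A le n t \<and>
     num A le n z = f (num A le n x) (num A le n y) mod Suc (num A le n t))"

text \<open>Level 0 claims nothing, so moduli that have just become denotable satisfy it vacuously.
  Each further level doubles the range of the second operand, beginning with 0 and 1.\<close>

definition table_level ::
  "nat set \<Rightarrow> (nat \<Rightarrow> nat \<Rightarrow> bool) \<Rightarrow> nat \<Rightarrow> (nat \<Rightarrow> nat \<Rightarrow> nat) \<Rightarrow> table \<Rightarrow> nat list \<Rightarrow> nat \<Rightarrow> bool" where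
  "table_level A le n f tab t j \<longleftrightarrow> j > 0 \<longrightarrow> (\<forall>x\<in>Vec n A. \<forall>y\<in>Vec n A. \<forall>z\<in>Vec n A.
     num A le n x \<le> num A le n t \<and> num A le n y \<le> num A le n t \<and> num A le n y \<le> 2 ^ (j - 1) \<and>
     num A le n z = f (num A le n x) (num A le n y) mod Suc (num A le n t) \<longrightarrow> tab t x y z)"

text \<open>Products are formed by adding products with halves of an operand, which requires
  addition to be complete for the modulus. If the number of \<open>t\<close> is at most
  \<open>2 ^ k\<close>, this takes \<open>k + 1\<close> steps, by which multiplication lags
  behind.\<close>

definition tables_level ::
  "nat set \<Rightarrow> (nat \<Rightarrow> nat \<Rightarrow> bool) \<Rightarrow> nat \<Rightarrow> table \<Rightarrow> table \<Rightarrow> nat list \<Rightarrow> nat \<Rightarrow> bool" where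
  "tables_level A le n add mul t j \<longleftrightarrow> table_level A le n (+) add t j \<and>
     (\<forall>k. num A le n t \<le> 2 ^ k \<longrightarrow> table_level A le n (*) mul t (j - (k + 1)))"

lemma table_level_mono:
  assumes "table_level A le n f tab t j" "i \<le> j"
  shows "table_level A le n f tab t i"
proof -
  have "(2::nat) ^ (i - 1) \<le> 2 ^ (j - 1)" using assms(2) by (intro power_increasing) auto
  then show ?thesis using assms unfolding table_level_def by (meson le_trans less_le_trans)
qed

lemma table_levelD:
  assumes "table_level A le n f tab t j" "0 < j" "x \<in> Vec n A" "y \<in> Vec n A" "z \<in> Vec n A"
    "num A le n x \<le> num A le n t" "num A le n y \<le> num A le n t" "num A le n y \<le> 2 ^ (j - 1)"
    "num A le n z = f (num A le n x) (num A le n y) mod Suc (num A le n t)"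
  shows "tab t x y z"
  using assms unfolding table_level_def by blast

locale number_line = activation +
  fixes D :: "nat set" and n :: nat
  assumes AD: "A \<subseteq> D"
begin

abbreviation "\<nu> \<equiv> num A le n"

lemma VA_VD: "x \<in> Vec n A \<Longrightarrow> x \<in> Vec n D"
  using Vec_mono[OF AD] by blast

lemma zero_iff: "length x = n \<Longrightarrow> zero D le n x \<longleftrightarrow> x \<in> Vec n A \<and> \<nu> x = 0"
proof -
  assume l: "length x = n"
  have "\<not> (\<exists>w\<in>Vec n D. active n le w \<and> tuple_less n le w x) \<longleftrightarrow> \<nu> x = 0" if "x \<in> Vec n A"
  proof -
    have "finite {y \<in> Vec n A. tuple_less n le y x}" using finite_Vec[OF fin] by simp
    then show ?thesis unfolding num_def using VA_VD
      by (auto simp: active_iff length_Vec)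
  qed
  then show ?thesis unfolding zero_def using active_iff[OF l] by blast
qed

lemma next_num_iff:
  assumes l: "length x = n" "length y = n"
  shows "next_num D le n x y \<longleftrightarrow> x \<in> Vec n A \<and> y \<in> Vec n A \<and> \<nu> y = Suc (\<nu> x)"
proof (cases "x \<in> Vec n A \<and> y \<in> Vec n A")
  case True
  have "next_num D le n x y \<longleftrightarrow> \<nu> x < \<nu> y \<and> \<not> (\<exists>w\<in>Vec n A. \<nu> x < \<nu> w \<and> \<nu> w < \<nu> y)"
    unfolding next_num_def using True VA_VD active_iff num_less_iff length_Vec l by metis
  also have "\<dots> \<longleftrightarrow> \<nu> y = Suc (\<nu> x)"
  proof -
    have "\<exists>w\<in>Vec n A. \<nu> w = Suc (\<nu> x)" if "\<nu> x < \<nu> y"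
      by (rule num_exists[of _ _ y]) (use that True in auto)
    then show ?thesis by (auto simp: less_Suc_eq) (metis Suc_lessI lessI)
  qed
  finally show ?thesis using True by simp
next
  case False
  then show ?thesis unfolding next_num_def using active_iff l by blast
qed

lemma one_iff: "length x = n \<Longrightarrow> one D le n x \<longleftrightarrow> x \<in> Vec n A \<and> \<nu> x = 1"
proof -
  assume l: "length x = n"
  have "\<exists>w\<in>Vec n A. \<nu> w = 0" if "x \<in> Vec n A" by (rule num_exists[OF _ that]) simp
  then show ?thesis
    unfolding one_def using VA_VD by (auto simp: zero_iff next_num_iff length_Vec l) blast
qed

lemma below_iff:
  "length t = n \<Longrightarrow> length x = n \<Longrightarrow> below le n t x \<longleftrightarrow> t \<in> Vec n A \<and> x \<in> Vec n A \<and> \<nu> x \<le> \<nu> t"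
  unfolding below_def using active_iff num_less_iff by (metis not_less)

lemma add_step_sound:
  assumes "table_sound A le n (+) add"
  shows "table_sound A le n (+) (\<lambda>t x y z. t \<in> Vec n D \<and> x \<in> Vec n D \<and> y \<in> Vec n D \<and> z \<in> Vec n D \<and> add_step D le n add t x y z)"
  unfolding table_sound_def
proof (intro allI impI)
  fix t x y z
  assume *: "t \<in> Vec n D \<and> x \<in> Vec n D \<and> y \<in> Vec n D \<and> z \<in> Vec n D \<and> add_step D le n add t x y z"
  then have l: "length t = n" "length x = n" "length y = n" "length z = n" by (auto simp: length_Vec)
  from * have b: "t \<in> Vec n A" "x \<in> Vec n A" "y \<in> Vec n A" "z \<in> Vec n A"
    "\<nu> x \<le> \<nu> t" "\<nu> y \<le> \<nu> t" "\<nu> z \<le> \<nu> t"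
    unfolding add_step_def by (auto simp: below_iff l)
  from * consider "add t x y z" | "\<nu> y = 0" "z = x" | "\<nu> y = 1" "x = t" "\<nu> z = 0"
    | "\<nu> y = 1" "x \<noteq> t" "\<nu> z = Suc (\<nu> x)"
    | y1 y2 w where "add t y1 y2 y" "add t x y1 w" "add t w y2 z"
    unfolding add_step_def by (auto simp: zero_iff one_iff next_num_iff l)
  then have "\<nu> z = (\<nu> x + \<nu> y) mod Suc (\<nu> t)"
  proof cases
    case 1
    then show ?thesis using assms unfolding table_sound_def by blast
  next
    case 4
    then show ?thesis using b by simp
  next
    case 5
    have "\<nu> z = (\<nu> w + \<nu> y2) mod Suc (\<nu> t)" "\<nu> w = (\<nu> x + \<nu> y1) mod Suc (\<nu> t)"
      "\<nu> y = (\<nu> y1 + \<nu> y2) mod Suc (\<nu> t)"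
      using 5 assms unfolding table_sound_def by blast+
    then show ?thesis by (simp add: mod_simps ac_simps)
  qed (use b in auto)
  then show "t \<in> Vec n A \<and> x \<in> Vec n A \<and> y \<in> Vec n A \<and> z \<in> Vec n A \<and> \<nu> x \<le> \<nu> t \<and> \<nu> y \<le> \<nu> t \<and> \<nu> z \<le> \<nu> t
    \<and> \<nu> z = (\<nu> x + \<nu> y) mod Suc (\<nu> t)" using b by simp
qed

lemma mul_step_sound:
  assumes "table_sound A le n (+) add" "table_sound A le n (*) mul"
  shows "table_sound A le n (*) (\<lambda>t x y z. t \<in> Vec n D \<and> x \<in> Vec n D \<and> y \<in> Vec n D \<and> z \<in> Vec n D \<and> mul_step D le n add mul t x y z)"
  unfolding table_sound_def
proof (intro allI impI)
  fix t x y z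
  assume *: "t \<in> Vec n D \<and> x \<in> Vec n D \<and> y \<in> Vec n D \<and> z \<in> Vec n D \<and> mul_step D le n add mul t x y z"
  then have l: "length t = n" "length x = n" "length y = n" "length z = n" by (auto simp: length_Vec)
  from * have b: "t \<in> Vec n A" "x \<in> Vec n A" "y \<in> Vec n A" "z \<in> Vec n A"
    "\<nu> x \<le> \<nu> t" "\<nu> y \<le> \<nu> t" "\<nu> z \<le> \<nu> t"
    unfolding mul_step_def by (auto simp: below_iff l)
  from * consider "mul t x y z" | "\<nu> y = 0" "\<nu> z = 0" | "\<nu> y = 1" "z = x"
    | y1 y2 z1 z2 where "add t y1 y2 y" "mul t x y1 z1" "mul t x y2 z2" "add t z1 z2 z"
    unfolding mul_step_def by (auto simp: zero_iff one_iff l)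
  then have "\<nu> z = (\<nu> x * \<nu> y) mod Suc (\<nu> t)"
  proof cases
    case 1
    then show ?thesis using assms unfolding table_sound_def by blast
  next
    case 4
    have "\<nu> y = (\<nu> y1 + \<nu> y2) mod Suc (\<nu> t)" "\<nu> z = (\<nu> z1 + \<nu> z2) mod Suc (\<nu> t)"
      "\<nu> z1 = (\<nu> x * \<nu> y1) mod Suc (\<nu> t)" "\<nu> z2 = (\<nu> x * \<nu> y2) mod Suc (\<nu> t)"
      using 4 assms unfolding table_sound_def by blast+
    then show ?thesis by (simp add: mod_simps algebra_simps)
  qed (use b in auto)
  then show "t \<in> Vec n A \<and> x \<in> Vec n A \<and> y \<in> Vec n A \<and> z \<in> Vec n A \<and> \<nu> x \<le> \<nu> t \<and> \<nu> y \<le> \<nu> t \<and> \<nu> z \<le> \<nu> t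
    \<and> \<nu> z = (\<nu> x * \<nu> y) mod Suc (\<nu> t)" using b by simp
qed

text \<open>An operand of at least 2 is the sum of its halves, rounded down and up, both within the
  old range; adding them one after the other reaches \<open>x + y\<close>. The same old level also
  certifies that the halves sum to \<open>y\<close>.\<close>

lemma add_step_level:
  assumes "t \<in> Vec n A" "table_level A le n (+) add t j"
  shows "table_level A le n (+) (add_step D le n add) t (Suc j)"
  unfolding table_level_def
proof (intro impI ballI)
  fix x y z assume x: "x \<in> Vec n A" and y: "y \<in> Vec n A" and z: "z \<in> Vec n A"
    and *: "\<nu> x \<le> \<nu> t \<and> \<nu> y \<le> \<nu> t \<and> \<nu> y \<le> 2 ^ (Suc j - 1) \<and> \<nu> z = (\<nu> x + \<nu> y) mod Suc (\<nu> t)"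
  have l: "length t = n" "length x = n" "length y = n" "length z = n"
    using assms x y z by (auto simp: length_Vec)
  have zt: "\<nu> z \<le> \<nu> t" using * by (simp add: less_Suc_eq_le[symmetric] del: less_Suc_eq_le)
  have bel: "below le n t x" "below le n t y" "below le n t z"
    using * zt assms x y z by (auto simp: below_iff l)
  consider "\<nu> y = 0" | "\<nu> y = 1" | "2 \<le> \<nu> y" by linarith
  then show "add_step D le n add t x y z"
  proof cases
    case 1
    then have "z = x" using * num_eq_iff[OF z x] by auto
    then show ?thesis unfolding add_step_def using 1 bel y by (simp add: zero_iff l)
  next
    case 2
    then have "x = t \<and> zero D le n z \<or> x \<noteq> t \<and> next_num D le n x z"
      using * x z assms num_eq_iff[of x n t] by (auto simp: zero_iff next_num_iff l)
    then show ?thesis unfolding add_step_def using 2 bel y by (simp add: one_iff l)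
  next
    case 3
    \<comment> \<open>For \<open>j = 0\<close> the bound on the second operand is
      \<open>2 ^ 0 = 1\<close>.\<close>
    then have j: "j > 0" using * by (cases j) auto
    have half: "(\<nu> y + 1) div 2 \<le> 2 ^ (j - 1)" "\<nu> y div 2 \<le> 2 ^ (j - 1)"
      using * j by (cases j; simp)+
    have "\<nu> y div 2 \<le> \<nu> t" using * div_le_dividend[of "\<nu> y" 2] by linarith
    then obtain y1 where y1: "y1 \<in> Vec n A" "\<nu> y1 = \<nu> y div 2"
      using num_exists[OF _ assms(1)] by blast
    have "(\<nu> y + 1) div 2 \<le> \<nu> t" using * 3 by linarith
    then obtain y2 where y2: "y2 \<in> Vec n A" "\<nu> y2 = (\<nu> y + 1) div 2"
      using num_exists[OF _ assms(1)] by blast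
    have y12: "\<nu> y1 + \<nu> y2 = \<nu> y" using y1 y2 by simp
    have wt: "(\<nu> x + \<nu> y1) mod Suc (\<nu> t) \<le> \<nu> t"
      by (simp add: less_Suc_eq_le[symmetric] del: less_Suc_eq_le)
    obtain w where w: "w \<in> Vec n A" "\<nu> w = (\<nu> x + \<nu> y1) mod Suc (\<nu> t)"
      using num_exists[OF wt assms(1)] by auto
    have lev: "add t x' y' z'" if "x' \<in> Vec n A" "y' \<in> Vec n A" "z' \<in> Vec n A" "\<nu> x' \<le> \<nu> t" "\<nu> y' \<le> \<nu> t"
      "\<nu> y' \<le> 2 ^ (j - 1)" "\<nu> z' = (\<nu> x' + \<nu> y') mod Suc (\<nu> t)" for x' y' z'
      using table_levelD[OF assms(2) j] that by blast
    have "add t y1 y2 y" using y1 y2 y12 half * y by (intro lev) auto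
    moreover have "add t x y1 w" using y1 w half * x y12 by (intro lev) auto
    moreover have "add t w y2 z" using y2 w half * z wt y12
      by (intro lev) (auto simp: mod_simps ac_simps)
    ultimately show ?thesis unfolding add_step_def using bel y1 y2 w VA_VD by blast
  qed
qed

text \<open>Distributivity over the two halves of \<open>y\<close>. The partial products are
  arbitrary residues, hence the demand that addition already covers the whole range.\<close>

lemma mul_step_level:
  assumes "t \<in> Vec n A" "table_level A le n (*) mul t j"
    and add: "j > 0 \<Longrightarrow> \<exists>k. \<nu> t \<le> 2 ^ k \<and> table_level A le n (+) add t (Suc k)"
  shows "table_level A le n (*) (mul_step D le n add mul) t (Suc j)"
  unfolding table_level_def
proof (intro impI ballI)
  fix x y z assume x: "x \<in> Vec n A" and y: "y \<in> Vec n A" and z: "z \<in> Vec n A"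
    and *: "\<nu> x \<le> \<nu> t \<and> \<nu> y \<le> \<nu> t \<and> \<nu> y \<le> 2 ^ (Suc j - 1) \<and> \<nu> z = (\<nu> x * \<nu> y) mod Suc (\<nu> t)"
  have l: "length t = n" "length x = n" "length y = n" "length z = n"
    using assms x y z by (auto simp: length_Vec)
  have mod_le: "a mod Suc (\<nu> t) \<le> \<nu> t" for a
    by (simp add: less_Suc_eq_le[symmetric] del: less_Suc_eq_le)
  have bel: "below le n t x" "below le n t y" "below le n t z"
    using * mod_le assms x y z by (auto simp: below_iff l)
  consider "\<nu> y = 0" | "\<nu> y = 1" | "2 \<le> \<nu> y" by linarith
  then show "mul_step D le n add mul t x y z"
  proof cases
    case 1
    then show ?thesis unfolding mul_step_def using * bel y z by (simp add: zero_iff l)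
  next
    case 2
    then have "z = x" using * num_eq_iff[OF z x] by auto
    then show ?thesis unfolding mul_step_def using 2 bel y by (simp add: one_iff l)
  next
    case 3
    then have j: "j > 0" using * by (cases j) auto
    have half: "(\<nu> y + 1) div 2 \<le> 2 ^ (j - 1)" "\<nu> y div 2 \<le> 2 ^ (j - 1)"
      using * j by (cases j; simp)+
    have "\<nu> y div 2 \<le> \<nu> t" using * div_le_dividend[of "\<nu> y" 2] by linarith
    then obtain y1 where y1: "y1 \<in> Vec n A" "\<nu> y1 = \<nu> y div 2"
      using num_exists[OF _ assms(1)] by blast
    have "(\<nu> y + 1) div 2 \<le> \<nu> t" using * 3 by linarith
    then obtain y2 where y2: "y2 \<in> Vec n A" "\<nu> y2 = (\<nu> y + 1) div 2"
      using num_exists[OF _ assms(1)] by blast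
    have y12: "\<nu> y1 + \<nu> y2 = \<nu> y" using y1 y2 by simp
    obtain z1 where z1: "z1 \<in> Vec n A" "\<nu> z1 = (\<nu> x * \<nu> y1) mod Suc (\<nu> t)"
      using num_exists[OF mod_le assms(1)] by auto
    obtain z2 where z2: "z2 \<in> Vec n A" "\<nu> z2 = (\<nu> x * \<nu> y2) mod Suc (\<nu> t)"
      using num_exists[OF mod_le assms(1)] by auto
    have lev: "mul t x' y' z'" if "x' \<in> Vec n A" "y' \<in> Vec n A" "z' \<in> Vec n A" "\<nu> x' \<le> \<nu> t" "\<nu> y' \<le> \<nu> t"
      "\<nu> y' \<le> 2 ^ (j - 1)" "\<nu> z' = (\<nu> x' * \<nu> y') mod Suc (\<nu> t)" for x' y' z'
      using table_levelD[OF assms(2) j] that by blast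
    obtain k where k: "\<nu> t \<le> 2 ^ k" "table_level A le n (+) add t (Suc k)" using add[OF j] by blast
    have addc: "add t x' y' z'" if "x' \<in> Vec n A" "y' \<in> Vec n A" "z' \<in> Vec n A" "\<nu> x' \<le> \<nu> t" "\<nu> y' \<le> \<nu> t"
      "\<nu> z' = (\<nu> x' + \<nu> y') mod Suc (\<nu> t)" for x' y' z'
      using table_levelD[OF k(2)] that k(1) by simp
    have "add t y1 y2 y" using y1 y2 y12 * y by (intro addc) auto
    moreover have "mul t x y1 z1" "mul t x y2 z2" using y1 y2 z1 z2 half * x y12 by (auto intro!: lev)
    moreover have "\<nu> z = (\<nu> z1 + \<nu> z2) mod Suc (\<nu> t)"
      using * z1 z2 y12 by (simp add: mod_simps flip: distrib_left)
    then have "add t z1 z2 z" using z1 z2 z mod_le by (intro addc) auto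
    ultimately show ?thesis unfolding mul_step_def using bel y1 y2 z1 z2 VA_VD by blast
  qed
qed

lemma tables_step_level:
  assumes "t \<in> Vec n A" "tables_level A le n add mul t j"
  shows "tables_level A le n (add_step D le n add) (mul_step D le n add mul) t (Suc j)"
  unfolding tables_level_def
proof (intro conjI allI impI)
  show "table_level A le n (+) (add_step D le n add) t (Suc j)"
    using add_step_level assms unfolding tables_level_def by blast
  fix k assume k: "\<nu> t \<le> 2 ^ k"
  show "table_level A le n (*) (mul_step D le n add mul) t (Suc j - (k + 1))"
  proof (cases "j \<ge> k + 1")
    case True
    have "table_level A le n (+) add t (Suc k)"
      using assms(2) True unfolding tables_level_def by (auto intro: table_level_mono)
    then have "table_level A le n (*) (mul_step D le n add mul) t (Suc (j - (k + 1)))"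
      using assms k unfolding tables_level_def by (intro mul_step_level) auto
    moreover have "Suc (j - (k + 1)) = Suc j - (k + 1)" using True by simp
    ultimately show ?thesis by simp
  next
    case False
    then show ?thesis by (simp add: table_level_def)
  qed
qed

text \<open>Level \<open>2 * k + 2\<close> stands for \<open>k + 1\<close> steps of addition and
  \<open>k + 1\<close> more of multiplication; the latter then covers second operands up to
  \<open>2 ^ k\<close>, that is, all residues.\<close>

lemma complete_iff_level:
  assumes "t \<in> Vec n A" "1 \<le> \<nu> t" "\<nu> t \<le> 2 ^ k" "tables_level A le n add mul t (2 * k + 2)"
  shows "complete D le n add mul t"
proof -
  have mod_le: "a mod Suc (\<nu> t) \<le> \<nu> t" for a
    by (simp add: less_Suc_eq_le[symmetric] del: less_Suc_eq_le)
  have m: "2 * k + 2 - (k + 1) = k + 1" by simp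
  have mulc: "mul t x y z" if "x \<in> Vec n A" "y \<in> Vec n A" "z \<in> Vec n A" "\<nu> x \<le> \<nu> t" "\<nu> y \<le> \<nu> t"
      "\<nu> z = (\<nu> x * \<nu> y) mod Suc (\<nu> t)" for x y z
  proof (rule table_levelD[of A le n "(*)" mul t "k + 1"])
    show "table_level A le n (*) mul t (k + 1)"
      using assms(3,4) m unfolding tables_level_def by metis
  qed (use that assms(3) in auto)
  have le: "\<nu> t \<le> 2 ^ (2 * k + 2 - 1)"
    using assms(3) power_increasing[of k "2 * k + 2 - 1" "2::nat"] by linarith
  have addc: "add t x y z" if "x \<in> Vec n A" "y \<in> Vec n A" "z \<in> Vec n A" "\<nu> x \<le> \<nu> t" "\<nu> y \<le> \<nu> t"
      "\<nu> z = (\<nu> x + \<nu> y) mod Suc (\<nu> t)" for x y z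
  proof (rule table_levelD[of A le n "(+)" add t "2 * k + 2"])
    show "table_level A le n (+) add t (2 * k + 2)"
      using assms(4) unfolding tables_level_def by blast
  qed (use that le in auto)
  have "\<exists>w\<in>Vec n A. \<nu> w = 1" by (rule num_exists[OF assms(2,1)])
  then obtain w where "w \<in> Vec n A" "\<nu> w = 1" by blast
  then have "one D le n w" "below le n t w"
    using assms by (auto simp: one_iff below_iff length_Vec)
  moreover have "(\<exists>z\<in>Vec n D. add t x y z) \<and> (\<exists>z\<in>Vec n D. mul t x y z)"
    if "x \<in> Vec n D" "y \<in> Vec n D" "below le n t x" "below le n t y" for x y
  proof -
    have xy: "x \<in> Vec n A" "y \<in> Vec n A" "\<nu> x \<le> \<nu> t" "\<nu> y \<le> \<nu> t"
      using that assms by (auto simp: below_iff length_Vec)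
    obtain z1 z2 where "z1 \<in> Vec n A" "\<nu> z1 = (\<nu> x + \<nu> y) mod Suc (\<nu> t)"
      "z2 \<in> Vec n A" "\<nu> z2 = (\<nu> x * \<nu> y) mod Suc (\<nu> t)"
      using num_exists[OF mod_le assms(1), of "\<nu> x + \<nu> y"]
        num_exists[OF mod_le assms(1), of "\<nu> x * \<nu> y"] by blast
    then show ?thesis using addc mulc xy VA_VD by blast
  qed
  ultimately show ?thesis
    unfolding complete_def using \<open>w \<in> Vec n A\<close> VA_VD by blast
qed

end

subsection \<open>The matrix of a graph modulo an integer\<close>

definition Mx :: "int \<Rightarrow> ('a \<times> 'a) set \<Rightarrow> 'a \<Rightarrow> 'a \<Rightarrow> int" where
  "Mx \<theta> G i j = (if i = j then \<theta> else 0) - (if (i, j) \<in> G then 1 else 0)"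

text \<open>The right-inverse law is what the rank-one update preserves by direct
  computation.\<close>

definition inv_mod :: "int \<Rightarrow> int \<Rightarrow> ('a \<times> 'a) set \<Rightarrow> 'a set \<Rightarrow> ('a \<Rightarrow> 'a \<Rightarrow> int) \<Rightarrow> bool" where
  "inv_mod m \<theta> G V N \<longleftrightarrow>
     (\<forall>i\<in>V. \<forall>k\<in>V. m dvd (\<Sum>j\<in>V. Mx \<theta> G i j * N j k) - (if i = k then 1 else 0))"

text \<open>Invertibility modulo a prime, phrased as a trivial kernel: a missing pivot will exhibit
  a column of \<open>N\<close> as a forbidden kernel vector.\<close>

definition nonsingular :: "int \<Rightarrow> int \<Rightarrow> ('a \<times> 'a) set \<Rightarrow> 'a set \<Rightarrow> bool" where
  "nonsingular p \<theta> G V \<longleftrightarrow>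
     (\<forall>w. (\<forall>i\<in>V. p dvd (\<Sum>j\<in>V. Mx \<theta> G i j * w j)) \<longrightarrow> (\<forall>i\<in>V. p dvd w i))"

lemma Mx_sum:
  assumes "finite V" "i \<in> V"
  shows "(\<Sum>j\<in>V. Mx \<theta> G i j * w j) = \<theta> * w i - (\<Sum>j\<in>{j \<in> V. (i, j) \<in> G}. w j)"
proof -
  have "(\<Sum>j\<in>V. Mx \<theta> G i j * w j)
      = (\<Sum>j\<in>V. if i = j then \<theta> * w j else 0) - (\<Sum>j\<in>V. if (i, j) \<in> G then w j else 0)"
    unfolding Mx_def sum_subtractf[symmetric] by (rule sum.cong) (auto simp: algebra_simps)
  also have "(\<Sum>j\<in>V. if i = j then \<theta> * w j else 0) = \<theta> * w i" using assms by simp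
  also have "(\<Sum>j\<in>V. if (i, j) \<in> G then w j else 0) = (\<Sum>j\<in>{j \<in> V. (i, j) \<in> G}. w j)"
    using assms(1) by (simp add: sum.inter_filter)
  finally show ?thesis .
qed

lemma inv_mod_cong:
  assumes "inv_mod m \<theta> G V N" "\<And>i k. i \<in> V \<Longrightarrow> k \<in> V \<Longrightarrow> m dvd N' i k - N i k"
  shows "inv_mod m \<theta> G V N'"
  unfolding inv_mod_def
proof (intro ballI)
  fix i k assume ik: "i \<in> V" "k \<in> V"
  have eq: "(\<Sum>j\<in>V. Mx \<theta> G i j * N' j k) - (if i = k then 1 else 0)
    = ((\<Sum>j\<in>V. Mx \<theta> G i j * N j k) - (if i = k then 1 else 0)) + (\<Sum>j\<in>V. Mx \<theta> G i j * (N' j k - N j k))"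
    by (simp add: algebra_simps sum_subtractf)
  have "m dvd (\<Sum>j\<in>V. Mx \<theta> G i j * (N' j k - N j k))"
    using assms(2) ik by (intro dvd_sum dvd_mult) auto
  moreover have "m dvd (\<Sum>j\<in>V. Mx \<theta> G i j * N j k) - (if i = k then 1 else 0)"
    using assms(1) ik unfolding inv_mod_def by blast
  ultimately show "m dvd (\<Sum>j\<in>V. Mx \<theta> G i j * N' j k) - (if i = k then 1 else 0)"
    unfolding eq by (intro dvd_add)
qed

lemma rank_one_sum:
  assumes "finite V" "v \<in> V"
    and M': "\<And>i j. i \<in> V \<Longrightarrow> j \<in> V \<Longrightarrow> Mx \<theta> G' i j = Mx \<theta> G i j + (if i = u \<and> j = v then \<sigma> else 0)"
    and "i \<in> V"
  shows "(\<Sum>j\<in>V. Mx \<theta> G' i j * w j) = (\<Sum>j\<in>V. Mx \<theta> G i j * w j) + (if i = u then \<sigma> * w v else 0)"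
proof -
  have "(\<Sum>j\<in>V. Mx \<theta> G' i j * w j)
      = (\<Sum>j\<in>V. Mx \<theta> G i j * w j + (if j = v then (if i = u then \<sigma> * w v else 0) else 0))"
    using assms(4) by (intro sum.cong) (auto simp: M' algebra_simps)
  then show ?thesis using assms(1,2) by (simp add: sum.distrib)
qed

text \<open>With \<open>\<eta> = N v u\<close>, the new matrix times the corrected \<open>N\<close>
  is the identity plus \<open>\<rho> + \<sigma> + \<sigma> * \<rho> * \<eta>\<close> times row
  \<open>v\<close> of \<open>N\<close>, placed in row \<open>u\<close>. Requiring this factor to
  vanish replaces the division by \<open>1 + \<sigma> * \<eta>\<close> and makes sense for composite
  \<open>m\<close>.\<close>

lemma sherman_morrison:
  assumes V: "finite V" "u \<in> V" "v \<in> V" and N: "inv_mod m \<theta> G V N"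
    and M': "\<And>i j. i \<in> V \<Longrightarrow> j \<in> V \<Longrightarrow> Mx \<theta> G' i j = Mx \<theta> G i j + (if i = u \<and> j = v then \<sigma> else 0)"
    and \<rho>: "m dvd \<rho> + \<sigma> + \<sigma> * \<rho> * N v u"
  shows "inv_mod m \<theta> G' V (\<lambda>x y. N x y + \<rho> * N x u * N v y)"
  unfolding inv_mod_def
proof (intro ballI)
  fix i k assume ik: "i \<in> V" "k \<in> V"
  define \<delta> where "\<delta> = (\<lambda>k. if i = k then 1 else (0::int))"
  define s where "s = (\<lambda>k. \<Sum>j\<in>V. Mx \<theta> G i j * N j k)"
  have s: "m dvd s k - \<delta> k" if "k \<in> V" for k
    using N ik that unfolding inv_mod_def s_def \<delta>_def by blast
  have eq: "(\<Sum>j\<in>V. Mx \<theta> G i j * (N j k + \<rho> * N j u * N v k)) = s k + \<rho> * N v k * s u"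
    unfolding s_def by (simp add: sum.distrib sum_distrib_left algebra_simps)
  have "(\<Sum>j\<in>V. Mx \<theta> G' i j * (N j k + \<rho> * N j u * N v k)) - \<delta> k
      = s k + \<rho> * N v k * s u + (if i = u then \<sigma> * (N v k + \<rho> * N v u * N v k) else 0) - \<delta> k"
    unfolding eq[symmetric]
    using rank_one_sum[OF V(1,3) M' ik(1), of "\<lambda>j. N j k + \<rho> * N j u * N v k"] by simp
  also have "\<dots> = (s k - \<delta> k) + \<rho> * N v k * (s u - \<delta> u) + \<delta> u * (N v k * (\<rho> + \<sigma> + \<sigma> * \<rho> * N v u))"
    by (auto simp: \<delta>_def algebra_simps)
  also have "m dvd \<dots>"
    by (rule dvd_add[OF dvd_add[OF s[OF ik(2)] dvd_mult[OF s[OF V(2)]]] dvd_mult[OF dvd_mult[OF \<rho>]]])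
  finally show "m dvd (\<Sum>j\<in>V. Mx \<theta> G' i j * (N j k + \<rho> * N j u * N v k)) - (if i = k then 1 else 0)"
    by (simp add: \<delta>_def)
qed

text \<open>If \<open>1 + \<sigma> * N v u\<close> vanishes modulo \<open>p\<close>, column
  \<open>u\<close> of \<open>N\<close> lies in the kernel of the new matrix and hence is zero,
  although the old matrix maps it to a unit vector. Otherwise a Bezout inverse gives the
  pivot.\<close>

lemma pivot_exists:
  assumes p: "prime p" and V: "finite V" "u \<in> V" "v \<in> V" and N: "inv_mod p \<theta> G V N"
    and M': "\<And>i j. i \<in> V \<Longrightarrow> j \<in> V \<Longrightarrow> Mx \<theta> G' i j = Mx \<theta> G i j + (if i = u \<and> j = v then \<sigma> else 0)"
    and \<sigma>: "\<sigma> = 1 \<or> \<sigma> = -1" and ns: "nonsingular p \<theta> G' V"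
  shows "\<exists>\<rho>. p dvd \<rho> + \<sigma> + \<sigma> * \<rho> * N v u"
proof (cases "p dvd 1 + \<sigma> * N v u")
  case True
  have "p dvd (\<Sum>j\<in>V. Mx \<theta> G' i j * N j u)" if i: "i \<in> V" for i
  proof -
    have "(\<Sum>j\<in>V. Mx \<theta> G' i j * N j u) = ((\<Sum>j\<in>V. Mx \<theta> G i j * N j u) - (if i = u then 1 else 0))
        + (if i = u then 1 + \<sigma> * N v u else 0)"
      unfolding rank_one_sum[OF V(1,3) M' i, simplified] by auto
    moreover have "p dvd (\<Sum>j\<in>V. Mx \<theta> G i j * N j u) - (if i = u then 1 else 0)"
      using N i V(2) unfolding inv_mod_def by blast
    ultimately show ?thesis using True by (auto intro!: dvd_add)
  qed
  then have "\<forall>i\<in>V. p dvd N i u"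
    using ns unfolding nonsingular_def by (elim allE[of _ "\<lambda>j. N j u"]) blast
  then have 1: "p dvd (\<Sum>j\<in>V. Mx \<theta> G u j * N j u)" by (intro dvd_sum dvd_mult) auto
  have "p dvd (\<Sum>j\<in>V. Mx \<theta> G u j * N j u) - (if u = u then 1 else 0)"
    using N V(2) unfolding inv_mod_def by blast
  from dvd_diff[OF 1 this] have "p dvd 1" by simp
  then show ?thesis using p by (simp add: not_prime_unit)
next
  case False
  then have "coprime (1 + \<sigma> * N v u) p" using p by (simp add: prime_imp_coprime coprime_commute)
  then obtain a b where ab: "a * (1 + \<sigma> * N v u) + b * p = 1"
    using bezout_int[of "1 + \<sigma> * N v u" p] by auto
  \<comment> \<open>The witness \<open>- \<sigma> * a\<close> is the congruence solved for
    \<open>\<rho>\<close>, with \<open>a\<close> inverse to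
    \<open>1 + \<sigma> * N v u\<close>.\<close>
  have "- \<sigma> * a + \<sigma> + \<sigma> * (- \<sigma> * a) * N v u = \<sigma> * (1 - a * (1 + \<sigma> * N v u))"
    using \<sigma> by (auto simp: algebra_simps)
  also have "1 - a * (1 + \<sigma> * N v u) = b * p" using ab by linarith
  also have "\<sigma> * (b * p) = p * (\<sigma> * b)" by (simp add: ac_simps)
  finally show ?thesis by (metis dvd_triv_left)
qed

text \<open>Over the nodes that cannot reach \<open>t\<close> the matrix has a right inverse modulo \<open>m\<close>. It acts on a
  finite set, hence surjectivity yields injectivity.\<close>

lemma inv_mod_unreachable:
  assumes m: "0 < m" and V: "finite V" "s \<in> V" "t \<in> V" and N: "inv_mod m \<theta> G V N"
    and st: "(s, t) \<notin> G\<^sup>*"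
  shows "m dvd N s t"
proof -
  define W where "W = {i \<in> V. (i, t) \<notin> G\<^sup>*}"
  have W: "finite W" "W \<subseteq> V" "t \<notin> W" "s \<in> W" using V st by (auto simp: W_def)
  \<comment> \<open>An edge into a node that reaches \<open>t\<close> would make its source reach
    \<open>t\<close>, so rows of \<open>W\<close> vanish outside \<open>W\<close>: the matrix is
    block triangular.\<close>
  have restrict: "(\<Sum>j\<in>V. Mx \<theta> G i j * w j) = (\<Sum>j\<in>W. Mx \<theta> G i j * w j)" if "i \<in> W" for i w
  proof (rule sum.mono_neutral_right[OF V(1) W(2)])
    show "\<forall>j\<in>V - W. Mx \<theta> G i j * w j = 0"
      using that by (auto simp: W_def Mx_def intro: converse_rtrancl_into_rtrancl)
  qed
  \<comment> \<open>Residue vectors indexed by \<open>W\<close>, as extensional functions so that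
    there are finitely many.\<close>
  define \<F> where "\<F> = (\<Pi>\<^sub>E i\<in>W. {0..<m})"
  have fin: "finite \<F>" unfolding \<F>_def using W(1) by (intro finite_PiE) auto
  define F where "F = (\<lambda>w. \<lambda>i\<in>W. (\<Sum>j\<in>W. Mx \<theta> G i j * w j) mod m)"
  have "\<F> \<subseteq> F ` \<F>"
  proof
    fix g assume g: "g \<in> \<F>"
    \<comment> \<open>A preimage of \<open>g\<close> is the right inverse applied to it.\<close>
    define w where "w = (\<lambda>j\<in>W. (\<Sum>k\<in>W. N j k * g k) mod m)"
    have "w \<in> \<F>" using m by (auto simp: \<F>_def w_def)
    moreover have "F w = g"
    proof
      fix i
      show "F w i = g i"
      proof (cases "i \<in> W")
        case True
        have "(\<Sum>j\<in>W. Mx \<theta> G i j * w j) mod m = (\<Sum>j\<in>W. Mx \<theta> G i j * (\<Sum>k\<in>W. N j k * g k)) mod m"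
        proof -
          have "(\<Sum>j\<in>W. Mx \<theta> G i j * w j) mod m = (\<Sum>j\<in>W. (Mx \<theta> G i j * w j) mod m) mod m"
            by (simp add: mod_sum_eq)
          also have "\<dots> = (\<Sum>j\<in>W. (Mx \<theta> G i j * (\<Sum>k\<in>W. N j k * g k)) mod m) mod m"
            by (rule arg_cong[of _ _ "\<lambda>x. x mod m"], rule sum.cong) (simp_all add: w_def mod_mult_right_eq)
          finally show ?thesis by (simp add: mod_sum_eq)
        qed
        also have "(\<Sum>j\<in>W. Mx \<theta> G i j * (\<Sum>k\<in>W. N j k * g k)) = (\<Sum>k\<in>W. (\<Sum>j\<in>W. Mx \<theta> G i j * N j k) * g k)"
          unfolding sum_distrib_left sum_distrib_right by (subst sum.swap) (simp add: mult.assoc)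
        also have "\<dots> = (\<Sum>k\<in>W. ((\<Sum>j\<in>W. Mx \<theta> G i j * N j k) - (if i = k then 1 else 0)) * g k)
            + (\<Sum>k\<in>W. (if i = k then 1 else 0) * g k)"
          unfolding sum.distrib[symmetric] by (intro sum.cong) (auto simp: algebra_simps)
        also have "(\<Sum>k\<in>W. (if i = k then 1 else 0) * g k) = (\<Sum>k\<in>W. if i = k then g k else 0)"
          by (intro sum.cong) auto
        also have "\<dots> = g i" using W(1) True by simp
        also have "(\<Sum>k\<in>W. ((\<Sum>j\<in>W. Mx \<theta> G i j * N j k) - (if i = k then 1 else 0)) * g k) + g i
          = g i + m * ((\<Sum>k\<in>W. ((\<Sum>j\<in>W. Mx \<theta> G i j * N j k) - (if i = k then 1 else 0)) * g k) div m)"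
        proof -
          have "m dvd (\<Sum>k\<in>W. ((\<Sum>j\<in>W. Mx \<theta> G i j * N j k) - (if i = k then 1 else 0)) * g k)"
          proof (intro dvd_sum dvd_mult2)
            fix k assume "k \<in> W"
            then have "i \<in> V" "k \<in> V" using True W(2) by auto
            then have "m dvd (\<Sum>j\<in>V. Mx \<theta> G i j * N j k) - (if i = k then 1 else 0)"
              using N unfolding inv_mod_def by blast
            then show "m dvd (\<Sum>j\<in>W. Mx \<theta> G i j * N j k) - (if i = k then 1 else 0)"
              unfolding restrict[OF True] .
          qed
          then show ?thesis by simp
        qed
        finally have "F w i = g i mod m" using True by (simp add: F_def)
        then show ?thesis using g True by (auto simp: \<F>_def PiE_iff)
      qed (use g in \<open>auto simp: F_def \<F>_def PiE_iff extensional_def\<close>)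
    qed
    ultimately show "g \<in> F ` \<F>" by blast
  qed
  moreover have "F ` \<F> \<subseteq> \<F>" using m by (auto simp: \<F>_def F_def)
  ultimately have "F ` \<F> = \<F>" by (intro subset_antisym)
  then have "inj_on F \<F>" by (intro eq_card_imp_inj_on[OF fin]) simp
  \<comment> \<open>The column of \<open>t\<close> is mapped to the unit vector of \<open>t\<close>,
    which is zero on \<open>W\<close> because \<open>t \<notin> W\<close>; injectivity makes the
    column itself vanish there.\<close>
  moreover define c where "c = (\<lambda>j\<in>W. N j t mod m)"
  moreover define z where "z = (\<lambda>j\<in>W. 0 :: int)"
  have "c \<in> \<F>" "z \<in> \<F>" using m by (auto simp: c_def z_def \<F>_def)
  moreover have "F c = F z"
  proof
    fix i
    show "F c i = F z i"
    proof (cases "i \<in> W")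
      case True
      have "(\<Sum>j\<in>W. Mx \<theta> G i j * c j) mod m = (\<Sum>j\<in>W. (Mx \<theta> G i j * c j) mod m) mod m"
        by (simp add: mod_sum_eq)
      also have "\<dots> = (\<Sum>j\<in>W. (Mx \<theta> G i j * N j t) mod m) mod m"
        by (rule arg_cong[of _ _ "\<lambda>x. x mod m"], rule sum.cong) (simp_all add: c_def mod_mult_right_eq)
      also have "\<dots> = (\<Sum>j\<in>V. Mx \<theta> G i j * N j t) mod m" by (simp add: mod_sum_eq restrict True)
      also have "\<dots> = 0"
      proof -
        have i: "i \<in> V" "i \<noteq> t" using True W(2,3) by blast+
        then have "m dvd (\<Sum>j\<in>V. Mx \<theta> G i j * N j t) - (if i = t then 1 else 0)"
          using N V(3) unfolding inv_mod_def by blast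
        then show ?thesis using i by simp
      qed
      finally show ?thesis using True by (simp add: F_def z_def)
    qed (simp add: F_def)
  qed
  ultimately have "c = z" by (meson inj_onD)
  then have "c s = z s" by simp
  then show ?thesis using W(4) by (simp add: c_def z_def dvd_eq_mod_eq_0)
qed

lemma finite_max_point:
  fixes f :: "'a \<Rightarrow> int"
  assumes "finite W" "W \<noteq> {}"
  shows "\<exists>i\<in>W. \<forall>j\<in>W. f j \<le> f i"
proof -
  have "Max (f ` W) \<in> f ` W" using assms by (intro Max_in) auto
  then obtain i where "i \<in> W" "f i = Max (f ` W)" by auto
  then show ?thesis using assms by (intro bexI[of _ i]) auto
qed

text \<open>The matrix is strictly diagonally dominant over the integers. Hence the entries of the column
  of \<open>t\<close> in its adjugate have the sign of the determinant, and do not vanish at the nodes that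
  reach \<open>t\<close>.\<close>

lemma dominant_adjugate:
  fixes W :: "'a set"
  assumes W: "finite W" and G: "G \<subseteq> W \<times> W" and \<theta>: "\<theta> = int (card W) + 1"
  shows "\<exists>d Y. d \<noteq> 0 \<and> \<bar>d\<bar> \<le> 2 ^ (2 * card W * (card W + 2)) \<and>
    (\<forall>i\<in>W. \<forall>k\<in>W. (\<Sum>j\<in>W. Y i j * Mx \<theta> G j k) = (if i = k then d else 0)) \<and>
    (\<forall>i\<in>W. \<forall>k\<in>W. (i, k) \<in> G\<^sup>* \<longrightarrow> Y i k \<noteq> 0) \<and>
    (\<forall>i\<in>W. \<forall>k\<in>W. \<bar>Y i k\<bar> \<le> \<bar>d\<bar>)"
proof -
  let ?n = "card W"
  have bnd: "\<bar>Mx \<theta> G i j\<bar> \<le> int ?n + 2" for i j using \<theta> by (auto simp: Mx_def)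
  obtain d Y where dY: "\<bar>d\<bar> \<le> fact ?n * (int ?n + 2) ^ ?n"
    "\<forall>i\<in>W. \<forall>k\<in>W. (\<Sum>j\<in>W. Y i j * Mx \<theta> G j k) = (if i = k then d else 0)"
    "\<forall>i\<in>W. \<forall>k\<in>W. (\<Sum>j\<in>W. Mx \<theta> G i j * Y j k) = (if i = k then d else 0)"
    "d = 0 \<longrightarrow> (\<exists>w. (\<exists>i\<in>W. w i \<noteq> 0) \<and> (\<forall>i\<in>W. (\<Sum>j\<in>W. Mx \<theta> G i j * w j) = 0))"
    using integer_adjugate[of W "Mx \<theta> G" "int ?n + 2", OF W bnd] by blast
  define out where "out = (\<lambda>i. {j \<in> W. (i, j) \<in> G})"
  have out: "finite (out i)" "card (out i) \<le> ?n" for i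
    using W by (auto simp: out_def intro: card_mono)
  have row: "(\<Sum>j\<in>W. Mx \<theta> G i j * w j) = \<theta> * w i - sum w (out i)" if "i \<in> W" for i w
    using Mx_sum[OF W that] by (simp add: out_def)
  have "d \<noteq> 0"
  proof
    assume "d = 0"
    then obtain w i0 where w: "i0 \<in> W" "w i0 \<noteq> 0" "\<forall>i\<in>W. (\<Sum>j\<in>W. Mx \<theta> G i j * w j) = 0"
      using dY(4) by blast
    \<comment> \<open>At an entry of maximal absolute value the row equation expresses
      \<open>\<theta> * w i\<close> as a sum of at most \<open>card W\<close> entries, none of them
      larger.\<close>
    obtain i where i: "i \<in> W" "\<And>j. j \<in> W \<Longrightarrow> \<bar>w j\<bar> \<le> \<bar>w i\<bar>"
      using finite_max_point[OF W, of "\<lambda>i. \<bar>w i\<bar>"] w(1) by blast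
    have "\<theta> * \<bar>w i\<bar> = \<bar>\<theta> * w i\<bar>" using \<theta> by (simp add: abs_mult)
    also have "\<theta> * w i = sum w (out i)" using w(3) i(1) row[OF i(1), of w] by simp
    also have "\<bar>sum w (out i)\<bar> \<le> (\<Sum>j\<in>out i. \<bar>w j\<bar>)" by (rule sum_abs)
    also have "\<dots> \<le> int (card (out i)) * \<bar>w i\<bar>"
      using sum_bounded_above[of "out i" "\<lambda>j. \<bar>w j\<bar>" "\<bar>w i\<bar>"] i(2) by (auto simp: out_def)
    also have "\<dots> \<le> int ?n * \<bar>w i\<bar>" using out(2)[of i] by (intro mult_right_mono) auto
    finally have "\<bar>w i\<bar> \<le> 0" using \<theta> by (simp add: algebra_simps)
    then show False using i(2)[OF w(1)] w(2) by simp
  qed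
  moreover have "\<bar>d\<bar> \<le> 2 ^ (2 * ?n * (?n + 2))"
  proof -
    have "fact ?n \<le> (int ?n + 2) ^ ?n"
    proof -
      have "fact ?n \<le> ?n ^ ?n" using fact_le_power[where 'a = nat, of ?n] by simp
      also have "\<dots> \<le> (?n + 2) ^ ?n" by (rule power_mono) auto
      finally have "int (fact ?n) \<le> int ((?n + 2) ^ ?n)" by (simp only: of_nat_le_iff)
      then show ?thesis by (simp add: add.commute)
    qed
    then have "fact ?n * (int ?n + 2) ^ ?n \<le> (int ?n + 2) ^ ?n * (int ?n + 2) ^ ?n"
      by (intro mult_right_mono) auto
    also have "\<dots> = (int ?n + 2) ^ (2 * ?n)" by (simp add: mult_2 power_add)
    also have "\<dots> \<le> (2 ^ (?n + 2)) ^ (2 * ?n)"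
    proof (rule power_mono)
      have "?n + 2 \<le> 2 ^ (?n + 2)" by (metis less_exp less_imp_le)
      then have "int (?n + 2) \<le> int (2 ^ (?n + 2))" by (simp only: of_nat_le_iff)
      then show "int ?n + 2 \<le> 2 ^ (?n + 2)" by simp
    qed simp
    also have "\<dots> = 2 ^ (2 * ?n * (?n + 2))" by (simp only: power_mult[symmetric] mult.commute)
    finally show ?thesis using dY(1) by linarith
  qed
  moreover have pos: "0 \<le> sgn d * Y i t \<and> sgn d * Y i t \<le> \<bar>d\<bar> \<and> ((i, t) \<in> G\<^sup>* \<longrightarrow> 0 < sgn d * Y i t)"
    if it: "i \<in> W" "t \<in> W" for i t
  proof -
    define f where "f = (\<lambda>i. sgn d * Y i t)"
    \<comment> \<open>A discrete Poisson equation whose only source is \<open>t\<close>. A minimum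
      and a maximum principle give the sign of \<open>f\<close> and the bound by
      \<open>\<bar>d\<bar>\<close>, and positivity spreads backwards along the edges.\<close>
    have f: "\<theta> * f i = sum f (out i) + (if i = t then \<bar>d\<bar> else 0)" if "i \<in> W" for i
    proof -
      have "\<theta> * f i - sum f (out i) = sgn d * (\<theta> * Y i t - (\<Sum>j\<in>out i. Y j t))"
        unfolding f_def by (simp only: sum_distrib_left right_diff_distrib mult.left_commute)
      also have "\<dots> = sgn d * (if i = t then d else 0)"
        unfolding row[OF that, of "\<lambda>j. Y j t", symmetric] using dY(3) that it(2) by simp
      finally show ?thesis by (simp add: abs_sgn mult.commute split: if_splits)
    qed
    have nonneg: "0 \<le> f i" if "i \<in> W" for i
    proof -
      obtain i0 where i0: "i0 \<in> W" "\<And>j. j \<in> W \<Longrightarrow> f i0 \<le> f j"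
        using finite_max_point[OF W, of "\<lambda>i. - f i", unfolded neg_le_iff_le] it(1) by blast
      have "f i0 \<ge> 0"
      proof (rule ccontr)
        assume neg: "\<not> f i0 \<ge> 0"
        have "int (card (out i0)) * f i0 \<le> sum f (out i0)"
          using sum_bounded_below[of "out i0" "f i0" f] i0(2) by (auto simp: out_def)
        moreover have "int ?n * f i0 \<le> int (card (out i0)) * f i0"
          using neg out(2)[of i0] by (intro mult_right_mono_neg) auto
        ultimately have "int ?n * f i0 \<le> \<theta> * f i0" using f[OF i0(1)] by auto
        then show False using neg \<theta> by (simp add: algebra_simps)
      qed
      then show ?thesis using i0(2)[OF that] by linarith
    qed
    \<comment> \<open>This lets an adjugate entry be charged with no more bits than the
      determinant.\<close>
    have upper: "f i \<le> \<bar>d\<bar>" if "i \<in> W" for i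
    proof -
      obtain i0 where i0: "i0 \<in> W" "\<And>j. j \<in> W \<Longrightarrow> f j \<le> f i0"
        using finite_max_point[OF W, of f] it(1) by blast
      have "sum f (out i0) \<le> int (card (out i0)) * f i0"
        using sum_bounded_above[of "out i0" f "f i0"] i0(2) by (auto simp: out_def)
      also have "\<dots> \<le> int ?n * f i0" using out(2)[of i0] nonneg[OF i0(1)] by (intro mult_right_mono) auto
      finally have "\<theta> * f i0 \<le> int ?n * f i0 + \<bar>d\<bar>" using f[OF i0(1)] by auto
      then have "f i0 \<le> \<bar>d\<bar>" using \<theta> by (simp add: algebra_simps)
      then show ?thesis using i0(2)[OF that] by linarith
    qed
    have nn: "0 \<le> sum f (out i)" for i by (rule sum_nonneg) (auto simp: out_def nonneg)
    have \<theta>0: "0 < \<theta>" using \<theta> by simp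
    have "0 < f i" if "(i, t) \<in> G\<^sup>*" "i \<in> W"
      using that
    proof (induction rule: converse_rtrancl_induct)
      case base
      then have "0 < \<theta> * f t" using f[OF it(2)] nn[of t] \<open>d \<noteq> 0\<close> by simp
      then show ?case using \<theta>0 by (simp add: zero_less_mult_iff)
    next
      case (step i j)
      then have j: "j \<in> out i" "0 < f j" using G by (auto simp: out_def)
      then have "f j \<le> sum f (out i)"
        by (intro member_le_sum) (auto simp: out_def nonneg W)
      then have "0 < \<theta> * f i" using f[OF step.prems] j by auto
      then show ?case using \<theta>0 by (simp add: zero_less_mult_iff)
    qed
    then show ?thesis using nonneg[OF it(1)] upper[OF it(1)] it unfolding f_def by blast
  qed
  moreover have "\<bar>Y i k\<bar> \<le> \<bar>d\<bar>" if "i \<in> W" "k \<in> W" for i k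
  proof -
    have "\<bar>Y i k\<bar> = \<bar>sgn d * Y i k\<bar>" using \<open>d \<noteq> 0\<close> by (simp add: abs_mult abs_sgn_eq)
    then show ?thesis using pos[OF that] by linarith
  qed
  moreover have "Y i k \<noteq> 0" if "i \<in> W" "k \<in> W" "(i, k) \<in> G\<^sup>*" for i k
    using pos[OF that(1,2)] that(3) by auto
  ultimately show ?thesis using dY(2) by blast
qed

text \<open>\<open>W\<close> will be the active nodes and \<open>V\<close> all nodes, so
  \<open>\<theta>\<close> is large only in comparison with \<open>W\<close>. Rows outside
  \<open>W\<close> consist of \<open>\<theta>\<close> on the diagonal; on \<open>W\<close> the
  adjugate turns the image of \<open>w\<close> into \<open>d * w\<close>.\<close>

lemma dominant_nonsingular:
  assumes W: "finite W" "G \<subseteq> W \<times> W" and V: "finite V" "W \<subseteq> V"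
    and Y: "\<And>i k. i \<in> W \<Longrightarrow> k \<in> W \<Longrightarrow> (\<Sum>j\<in>W. Y i j * Mx \<theta> G j k) = (if i = k then d else 0)"
    and p: "prime p" "\<not> p dvd d" "\<not> p dvd \<theta>"
  shows "nonsingular p \<theta> G V"
  unfolding nonsingular_def
proof (intro allI impI ballI)
  fix w i assume w: "\<forall>i\<in>V. p dvd (\<Sum>j\<in>V. Mx \<theta> G i j * w j)" and i: "i \<in> V"
  show "p dvd w i"
  proof (cases "i \<in> W")
    case False
    then have "{j \<in> V. (i, j) \<in> G} = {}" using W(2) by auto
    then have "(\<Sum>j\<in>V. Mx \<theta> G i j * w j) = \<theta> * w i"
      using Mx_sum[OF V(1) i, of \<theta> G w] by (simp only:) simp
    then have "p dvd \<theta> * w i" using w i by metis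
    then show ?thesis using p by (simp add: prime_dvd_mult_iff)
  next
    case True
    have restrict: "(\<Sum>j\<in>V. Mx \<theta> G k j * w j) = (\<Sum>j\<in>W. Mx \<theta> G k j * w j)" if "k \<in> W" for k
      using that W(2) by (intro sum.mono_neutral_right[OF V]) (auto simp: Mx_def)
    have "p dvd (\<Sum>k\<in>W. Y i k * (\<Sum>j\<in>W. Mx \<theta> G k j * w j))"
    proof (rule dvd_sum, rule dvd_mult)
      fix k assume "k \<in> W"
      then show "p dvd (\<Sum>j\<in>W. Mx \<theta> G k j * w j)"
        using w V(2) unfolding restrict[OF \<open>k \<in> W\<close>, symmetric] by blast
    qed
    also have "(\<Sum>k\<in>W. Y i k * (\<Sum>j\<in>W. Mx \<theta> G k j * w j)) = (\<Sum>j\<in>W. (\<Sum>k\<in>W. Y i k * Mx \<theta> G k j) * w j)"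
      unfolding sum_distrib_left sum_distrib_right by (subst sum.swap) (simp add: mult.assoc)
    also have "\<dots> = (\<Sum>j\<in>W. if i = j then d * w j else 0)" by (intro sum.cong) (auto simp: Y True)
    also have "\<dots> = d * w i" using W(1) True by simp
    finally show ?thesis using p by (simp add: prime_dvd_mult_iff)
  qed
qed

text \<open>Multiplying the column of \<open>t\<close> in \<open>N\<close> from the left by the
  matrix and then by the adjugate shows that \<open>d * N s t\<close> and \<open>Y s t\<close> are
  congruent modulo \<open>p\<close>.\<close>

lemma dominant_inv_mod_nonzero:
  assumes W: "finite W" "G \<subseteq> W \<times> W" and V: "finite V" "W \<subseteq> V" and st: "s \<in> W" "t \<in> W"
    and Y: "\<And>i k. i \<in> W \<Longrightarrow> k \<in> W \<Longrightarrow> (\<Sum>j\<in>W. Y i j * Mx \<theta> G j k) = (if i = k then d else 0)"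
    and p: "\<not> p dvd Y s t" and N: "inv_mod p \<theta> G V N"
  shows "\<not> p dvd N s t"
proof
  assume pN: "p dvd N s t"
  have restrict: "(\<Sum>j\<in>V. Mx \<theta> G k j * w j) = (\<Sum>j\<in>W. Mx \<theta> G k j * w j)" if "k \<in> W" for k w
    using that W(2) by (intro sum.mono_neutral_right[OF V]) (auto simp: Mx_def)
  let ?r = "\<lambda>k. (\<Sum>j\<in>W. Mx \<theta> G k j * N j t) - (if k = t then 1 else 0)"
  have r: "p dvd ?r k" if "k \<in> W" for k
  proof -
    have "p dvd (\<Sum>j\<in>V. Mx \<theta> G k j * N j t) - (if k = t then 1 else 0)"
      using N that st(2) V(2) unfolding inv_mod_def by blast
    then show ?thesis using restrict[OF that] by simp
  qed
  have "(\<Sum>k\<in>W. Y s k * (\<Sum>j\<in>W. Mx \<theta> G k j * N j t)) = (\<Sum>j\<in>W. (\<Sum>k\<in>W. Y s k * Mx \<theta> G k j) * N j t)"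
    unfolding sum_distrib_left sum_distrib_right by (subst sum.swap) (simp add: mult.assoc)
  also have "\<dots> = (\<Sum>j\<in>W. if s = j then d * N j t else 0)" by (intro sum.cong) (auto simp: Y st)
  also have "\<dots> = d * N s t" using W(1) st by simp
  finally have 1: "(\<Sum>k\<in>W. Y s k * (\<Sum>j\<in>W. Mx \<theta> G k j * N j t)) = d * N s t" .
  have "(\<Sum>k\<in>W. Y s k * ?r k) = d * N s t - (\<Sum>k\<in>W. if k = t then Y s k else 0)"
    unfolding 1[symmetric] sum_subtractf[symmetric] by (intro sum.cong) (auto simp: algebra_simps)
  also have "(\<Sum>k\<in>W. if k = t then Y s k else 0) = Y s t" using W(1) st by simp
  finally have "Y s t = d * N s t - (\<Sum>k\<in>W. Y s k * ?r k)" by simp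
  moreover have "p dvd (\<Sum>k\<in>W. Y s k * ?r k)" using r by (intro dvd_sum dvd_mult) auto
  moreover have "p dvd d * N s t" using pN by (rule dvd_mult)
  ultimately have "p dvd Y s t" by (simp only: dvd_diff)
  then show False using p by simp
qed

subsection \<open>The update formulas\<close>

type_synonym graph = "nat list \<Rightarrow> nat list \<Rightarrow> bool"

type_synonym threads = "nat list \<Rightarrow> nat list \<Rightarrow> nat list \<Rightarrow> nat list \<Rightarrow> nat list \<Rightarrow> bool"

text \<open>\<open>G\<close> is the graph that the inverses belong to and \<open>E\<close> the graph
  to be caught up with; a pair of nodes is a 4-tuple of elements.\<close>

definition differ :: "(nat \<Rightarrow> nat \<Rightarrow> bool) \<Rightarrow> graph \<Rightarrow> graph \<Rightarrow> graph" where
  "differ le E G u v \<longleftrightarrow> active 4 le (u @ v) \<and> \<not> (E u v \<longleftrightarrow> G u v)"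

text \<open>Taking the least differing pair makes the choice definable, so that several flips per
  change are iterations of one formula.\<close>

definition first_diff :: "nat set \<Rightarrow> (nat \<Rightarrow> nat \<Rightarrow> bool) \<Rightarrow> graph \<Rightarrow> graph \<Rightarrow> graph" where
  "first_diff D le E G u v \<longleftrightarrow> differ le E G u v \<and>
     \<not> (\<exists>x\<in>Vec 2 D. \<exists>y\<in>Vec 2 D. differ le E G x y \<and> tuple_less 4 le (x @ y) (u @ v))"

definition flip_graph :: "nat set \<Rightarrow> (nat \<Rightarrow> nat \<Rightarrow> bool) \<Rightarrow> graph \<Rightarrow> graph \<Rightarrow> graph" where
  "flip_graph D le E G u v \<longleftrightarrow> \<not> (G u v \<longleftrightarrow> first_diff D le E G u v)"

text \<open>With \<open>\<sigma> = -1\<close> if an edge is added and \<open>\<sigma> = 1\<close> if it is removed, \<open>\<rho>\<close> solves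
  \<open>\<rho> + \<sigma> + \<sigma> \<rho> \<eta> = 0\<close>.\<close>

definition pivot ::
  "nat set \<Rightarrow> (nat \<Rightarrow> nat \<Rightarrow> bool) \<Rightarrow> nat \<Rightarrow> table \<Rightarrow> table \<Rightarrow> bool \<Rightarrow> nat list \<Rightarrow> nat list \<Rightarrow> nat list \<Rightarrow> bool" where
  "pivot D le c add mul b t \<eta> \<rho> \<longleftrightarrow> (\<exists>w\<in>Vec c D. \<exists>e\<in>Vec c D. mul t \<rho> \<eta> w \<and> one D le c e \<and>
     (b \<and> add t w e \<rho> \<or>
      \<not> b \<and> (\<exists>w'\<in>Vec c D. \<exists>z\<in>Vec c D. add t \<rho> w w' \<and> zero D le c z \<and> add t w' e z)))"

text \<open>Without a pivot no tuple qualifies and the thread becomes empty. Emptiness is the mark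
  of a dead thread and is inherited by all later updates.\<close>

definition rank_one ::
  "nat set \<Rightarrow> (nat \<Rightarrow> nat \<Rightarrow> bool) \<Rightarrow> nat \<Rightarrow> table \<Rightarrow> table \<Rightarrow> threads \<Rightarrow> bool \<Rightarrow> nat list \<Rightarrow> nat list \<Rightarrow> threads" where
  "rank_one D le c add mul N b u v t \<theta> x y z \<longleftrightarrow>
     (\<exists>\<eta>\<in>Vec c D. \<exists>\<rho>\<in>Vec c D. N t \<theta> v u \<eta> \<and> pivot D le c add mul b t \<eta> \<rho> \<and>
       (\<exists>\<alpha>\<in>Vec c D. \<exists>\<beta>\<in>Vec c D. \<exists>\<gamma>\<in>Vec c D. N t \<theta> x y \<alpha> \<and> N t \<theta> x u \<beta> \<and> N t \<theta> v y \<gamma> \<and>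
         (\<exists>w\<in>Vec c D. \<exists>w'\<in>Vec c D. mul t \<rho> \<beta> w \<and> mul t w \<gamma> w' \<and> add t \<alpha> w' z)))"

text \<open>Two orders occur: \<open>le'\<close> includes the elements activated by the current
  change and selects the pair to flip, while \<open>le\<close> belongs to the tables
  \<open>add\<close> and \<open>mul\<close>, which are those of the state before the change.\<close>

definition flip_threads ::
  "nat set \<Rightarrow> (nat \<Rightarrow> nat \<Rightarrow> bool) \<Rightarrow> (nat \<Rightarrow> nat \<Rightarrow> bool) \<Rightarrow> nat \<Rightarrow> table \<Rightarrow> table \<Rightarrow> graph \<Rightarrow> graph \<Rightarrow> threads \<Rightarrow> threads" where
  "flip_threads D le' le c add mul E G N t \<theta> x y z \<longleftrightarrow>
     (\<exists>u\<in>Vec 2 D. \<exists>v\<in>Vec 2 D. first_diff D le' E G u v \<and> rank_one D le c add mul N (E u v) u v t \<theta> x y z) \<or>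
     (\<not> (\<exists>u\<in>Vec 2 D. \<exists>v\<in>Vec 2 D. first_diff D le' E G u v) \<and> N t \<theta> x y z)"

text \<open>The matrix of the empty graph is \<open>\<theta>\<close> times the identity, and its
  inverse is \<open>\<iota>\<close> times the identity, where \<open>\<iota>\<close> inverts
  \<open>\<theta>\<close>. Only moduli with finished tables receive a thread.\<close>

definition fresh ::
  "nat set \<Rightarrow> (nat \<Rightarrow> nat \<Rightarrow> bool) \<Rightarrow> nat \<Rightarrow> table \<Rightarrow> table \<Rightarrow> threads" where
  "fresh D le c add mul t \<theta> x y z \<longleftrightarrow> active c le t \<and> active c le \<theta> \<and> complete D le c add mul t \<and>
     (\<exists>\<iota>\<in>Vec c D. \<exists>e\<in>Vec c D. one D le c e \<and> mul t \<theta> \<iota> e \<and> (x = y \<and> z = \<iota> \<or> x \<noteq> y \<and> zero D le c z))"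

fun chase ::
  "nat set \<Rightarrow> (nat \<Rightarrow> nat \<Rightarrow> bool) \<Rightarrow> (nat \<Rightarrow> nat \<Rightarrow> bool) \<Rightarrow> nat \<Rightarrow> table \<Rightarrow> table \<Rightarrow> graph \<Rightarrow> nat \<Rightarrow>
    graph \<times> threads \<Rightarrow> graph \<times> threads" where
  "chase D le' le c add mul E 0 GN = GN"
| "chase D le' le c add mul E (Suc k) GN = (let (G, N) = chase D le' le c add mul E k GN in
     (flip_graph D le' E G, flip_threads D le' le c add mul E G N))"

definition caught_up :: "nat set \<Rightarrow> (nat \<Rightarrow> nat \<Rightarrow> bool) \<Rightarrow> graph \<Rightarrow> graph \<Rightarrow> bool" where
  "caught_up D le E G \<longleftrightarrow> \<not> (\<exists>x\<in>Vec 2 D. \<exists>y\<in>Vec 2 D. differ le E G x y)"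

text \<open>Reflexivity is split off because a nontrivial path has active end points, to which the
  counting of primes applies.\<close>

definition connected_by ::
  "nat set \<Rightarrow> (nat \<Rightarrow> nat \<Rightarrow> bool) \<Rightarrow> nat \<Rightarrow> threads \<Rightarrow> nat list \<Rightarrow> nat list \<Rightarrow> bool" where
  "connected_by D le c N x y \<longleftrightarrow> x = y \<or>
     (\<exists>t\<in>Vec c D. \<exists>\<theta>\<in>Vec c D. \<exists>z\<in>Vec c D. N t \<theta> x y z \<and> \<not> zero D le c z)"

text \<open>\<open>le a a\<close> tells whether \<open>a\<close> is active already; otherwise
  \<open>a\<close> is appended as the new maximum.\<close>

definition activate :: "(nat \<Rightarrow> nat \<Rightarrow> bool) \<Rightarrow> nat \<Rightarrow> nat \<Rightarrow> nat \<Rightarrow> bool" where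
  "activate le a x y \<longleftrightarrow> le x y \<or> (\<not> le a a \<and> y = a \<and> (le x x \<or> x = a))"

subsection \<open>Definability of the update formulas\<close>

lemma wf_fo_mono: "wf_fo sig C X \<phi> \<Longrightarrow> X \<subseteq> Y \<Longrightarrow> wf_fo sig C Y \<phi>"
proof (induction \<phi> arbitrary: X Y)
  case (Exists x \<phi>)
  then show ?case by (metis insert_mono wf_fo.simps(5))
next
  case (Rel s ts)
  have "wf_term C X t \<Longrightarrow> wf_term C Y t" for t using Rel.prems by (cases t) auto
  then show ?case using Rel by auto
next
  case (Eq t u)
  have "wf_term C X t \<Longrightarrow> wf_term C Y t" for t using Eq.prems by (cases t) auto
  then show ?case using Eq by auto
qed auto

lemma definable_take:
  assumes "definable sig C k P"
  shows "definable sig C (k + m) (\<lambda>M e. P M (take k e))"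
proof -
  obtain \<phi> where \<phi>: "wf_fo sig C {..<k} \<phi>"
     "\<And>D \<kappa> S \<sigma>. holds D \<kappa> S \<sigma> \<phi> \<longleftrightarrow> P (D, \<kappa>, S) (map \<sigma> [0..<k])"
    using assms unfolding definable_def by blast
  have "wf_fo sig C {..<k + m} \<phi>" using \<phi>(1) by (rule wf_fo_mono) auto
  moreover have "take k (map \<sigma> [0..<k + m]) = map \<sigma> [0..<k]" for \<sigma> :: "nat \<Rightarrow> nat"
    by (simp add: take_map)
  ultimately show ?thesis unfolding definable_def using \<phi>(2) by (intro exI[of _ \<phi>]) simp
qed

text \<open>Definability of a relation that depends on the model is stated for all argument terms at
  once. Formulas with such relations as parameters can then be composed by substitution.\<close>

definition definable_order where
  "definable_order sig C le \<longleftrightarrow> (\<forall>k x y. elem_term C k x \<longrightarrow> elem_term C k y \<longrightarrow>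
     definable sig C k (\<lambda>M e. le M (x M e) (y M e)))"

definition definable_table where
  "definable_table sig C c tab \<longleftrightarrow> (\<forall>k t x y z. vec_term C k c t \<longrightarrow> vec_term C k c x \<longrightarrow>
     vec_term C k c y \<longrightarrow> vec_term C k c z \<longrightarrow>
     definable sig C k (\<lambda>M e. tab M (t M e) (x M e) (y M e) (z M e)))"

definition definable_graph where
  "definable_graph sig C E \<longleftrightarrow> (\<forall>k x y. vec_term C k 2 x \<longrightarrow> vec_term C k 2 y \<longrightarrow>
     definable sig C k (\<lambda>M e. E M (x M e) (y M e)))"

definition definable_threads where
  "definable_threads sig C c N \<longleftrightarrow> (\<forall>k t \<theta> x y z. vec_term C k c t \<longrightarrow> vec_term C k c \<theta> \<longrightarrow>
     vec_term C k 2 x \<longrightarrow> vec_term C k 2 y \<longrightarrow> vec_term C k c z \<longrightarrow>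
     definable sig C k (\<lambda>M e. N M (t M e) (\<theta> M e) (x M e) (y M e) (z M e)))"

lemma definable_orderD: "definable_order sig C le \<Longrightarrow> elem_term C k x \<Longrightarrow> elem_term C k y \<Longrightarrow>
     definable sig C k (\<lambda>M e. le M (x M e) (y M e))"
  by (auto simp: definable_order_def)

lemma definable_tableD: "definable_table sig C c tab \<Longrightarrow> vec_term C k c t \<Longrightarrow> vec_term C k c x \<Longrightarrow>
     vec_term C k c y \<Longrightarrow> vec_term C k c z \<Longrightarrow>
     definable sig C k (\<lambda>M e. tab M (t M e) (x M e) (y M e) (z M e))"
  by (auto simp: definable_table_def)

lemma definable_graphD: "definable_graph sig C E \<Longrightarrow> vec_term C k 2 x \<Longrightarrow> vec_term C k 2 y \<Longrightarrow>
     definable sig C k (\<lambda>M e. E M (x M e) (y M e))"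
  by (auto simp: definable_graph_def)

lemma definable_threadsD: "definable_threads sig C c N \<Longrightarrow> vec_term C k c t \<Longrightarrow> vec_term C k c \<theta> \<Longrightarrow>
     vec_term C k 2 x \<Longrightarrow> vec_term C k 2 y \<Longrightarrow> vec_term C k c z \<Longrightarrow>
     definable sig C k (\<lambda>M e. N M (t M e) (\<theta> M e) (x M e) (y M e) (z M e))"
  by (auto simp: definable_threads_def)

lemma vec_term_append4: "vec_term C k 2 x \<Longrightarrow> vec_term C k 2 y \<Longrightarrow> vec_term C k 4 (\<lambda>M e. x M e @ y M e)"
  using vec_term_append[of C k 2 x 2 y] by simp

context
  fixes sig :: "'s \<Rightarrow> nat option" and C :: "nat set" and le :: "'s model \<Rightarrow> nat \<Rightarrow> nat \<Rightarrow> bool"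
  assumes le: "definable_order sig C le"
begin

lemma definable_active:
  "vec_term C k n x \<Longrightarrow> definable sig C k (\<lambda>M e. active n (le M) (x M e))"
  unfolding active_def
  by (intro definable_All_less definable_orderD[OF le] elem_term_nth)

lemma definable_tuple_less:
  "vec_term C k n x \<Longrightarrow> vec_term C k n y \<Longrightarrow> definable sig C k (\<lambda>M e. tuple_less n (le M) (x M e) (y M e))"
  unfolding tuple_less_def max_le_def lex_less_def
  by (intro definable_intros definable_All_less definable_Ex_less definable_orderD[OF le]
      definable_elem_eq elem_term_nth[of C k n]) auto

lemma definable_zero:
  "vec_term C k n x \<Longrightarrow> definable sig C k (\<lambda>M e. zero (fst M) (le M) n (x M e))"
  unfolding zero_def
  by (intro definable_intros definable_active definable_tuple_less vec_term_intros)

lemma definable_next_num: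
  "vec_term C k n x \<Longrightarrow> vec_term C k n y \<Longrightarrow> definable sig C k (\<lambda>M e. next_num (fst M) (le M) n (x M e) (y M e))"
  unfolding next_num_def
  by (intro definable_intros definable_active definable_tuple_less vec_term_intros)

lemma definable_one:
  "vec_term C k n x \<Longrightarrow> definable sig C k (\<lambda>M e. one (fst M) (le M) n (x M e))"
  unfolding one_def
  by (intro definable_intros definable_zero definable_next_num vec_term_intros)

lemma definable_below:
  "vec_term C k n x \<Longrightarrow> vec_term C k n y \<Longrightarrow> definable sig C k (\<lambda>M e. below (le M) n (x M e) (y M e))"
  unfolding below_def
  by (intro definable_intros definable_active definable_tuple_less)

lemma definable_differ:
  assumes "definable_graph sig C E" "definable_graph sig C G"
  shows "definable_graph sig C (\<lambda>M. differ (le M) (E M) (G M))"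
  unfolding definable_graph_def differ_def
  by (intro allI impI definable_intros definable_active vec_term_append4 definable_graphD[OF assms(1)]
      definable_graphD[OF assms(2)])

lemma definable_first_diff:
  assumes "definable_graph sig C E" "definable_graph sig C G"
  shows "definable_graph sig C (\<lambda>M. first_diff (fst M) (le M) (E M) (G M))"
  unfolding definable_graph_def first_diff_def
  by (intro allI impI definable_intros definable_graphD[OF definable_differ[OF assms]]
      definable_tuple_less vec_term_append4 vec_term_take vec_term_drop)

lemma definable_flip_graph:
  assumes "definable_graph sig C E" "definable_graph sig C G"
  shows "definable_graph sig C (\<lambda>M. flip_graph (fst M) (le M) (E M) (G M))"
  unfolding definable_graph_def flip_graph_def
  by (intro allI impI definable_intros definable_graphD[OF definable_first_diff[OF assms]]
      definable_graphD[OF assms(2)])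

lemma definable_caught_up:
  assumes "definable_graph sig C E" "definable_graph sig C G"
  shows "definable sig C k (\<lambda>M e. caught_up (fst M) (le M) (E M) (G M))"
  unfolding caught_up_def
  by (intro definable_intros definable_graphD[OF definable_differ[OF assms]] vec_term_take vec_term_drop)

lemma definable_connected_by:
  assumes "definable_threads sig C c N"
  shows "definable_graph sig C (\<lambda>M. connected_by (fst M) (le M) c (N M))"
  unfolding definable_graph_def connected_by_def
  by (intro allI impI definable_intros definable_vec_eq[of C _ 2] definable_threadsD[OF assms] definable_zero
      vec_term_take vec_term_drop)

context
  fixes add mul :: "'s model \<Rightarrow> table" and c :: nat
  assumes add: "definable_table sig C c add" and mul: "definable_table sig C c mul"
begin

lemma definable_add_step:
  "definable_table sig C c (\<lambda>M. add_step (fst M) (le M) c (add M))"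
  unfolding definable_table_def add_step_def
  by (intro allI impI definable_intros definable_below definable_zero definable_one definable_next_num
      definable_tableD[OF add] definable_vec_eq[of C _ c] vec_term_take vec_term_drop)

lemma definable_mul_step:
  "definable_table sig C c (\<lambda>M. mul_step (fst M) (le M) c (add M) (mul M))"
  unfolding definable_table_def mul_step_def
  by (intro allI impI definable_intros definable_below definable_zero definable_one
      definable_tableD[OF add] definable_tableD[OF mul] definable_vec_eq[of C _ c] vec_term_take vec_term_drop)

lemma definable_complete:
  "vec_term C k c t \<Longrightarrow> definable sig C k (\<lambda>M e. complete (fst M) (le M) c (add M) (mul M) (t M e))"
  unfolding complete_def
  by (intro definable_intros definable_below definable_one
      definable_tableD[OF add] definable_tableD[OF mul] vec_term_take vec_term_drop)

lemma definable_pivot: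
  "definable sig C k b \<Longrightarrow> vec_term C k c t \<Longrightarrow> vec_term C k c x \<Longrightarrow> vec_term C k c y \<Longrightarrow>
   definable sig C k (\<lambda>M e. pivot (fst M) (le M) c (add M) (mul M) (b M e) (t M e) (x M e) (y M e))"
  unfolding pivot_def
  by (intro definable_intros definable_zero definable_one definable_take
      definable_tableD[OF add] definable_tableD[OF mul] vec_term_take vec_term_drop)

lemma definable_fresh:
  "definable_threads sig C c (\<lambda>M. fresh (fst M) (le M) c (add M) (mul M))"
  unfolding definable_threads_def fresh_def
  by (intro allI impI definable_intros definable_complete definable_zero definable_one definable_active
      definable_tableD[OF mul] vec_term_take vec_term_drop)
    (assumption | (rule definable_vec_eq[of C _ 2]; (intro vec_term_take vec_term_drop; assumption)) |
      (rule definable_vec_eq[of C _ c]; (intro vec_term_take vec_term_drop; assumption)))+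

lemma definable_rank_one:
  assumes N: "definable_threads sig C c N" and b: "definable sig C k b"
    and "vec_term C k 2 u" "vec_term C k 2 v" "vec_term C k c t" "vec_term C k c \<theta>"
      "vec_term C k 2 x" "vec_term C k 2 y" "vec_term C k c z"
  shows "definable sig C k (\<lambda>M e. rank_one (fst M) (le M) c (add M) (mul M) (N M) (b M e) (u M e) (v M e)
    (t M e) (\<theta> M e) (x M e) (y M e) (z M e))"
  unfolding rank_one_def
  by (intro definable_intros definable_pivot definable_take b definable_threadsD[OF N]
      definable_tableD[OF add] definable_tableD[OF mul] vec_term_take vec_term_drop assms(3-))

end

end

lemma definable_flip_threads:
  assumes "definable_order sig C le'" "definable_order sig C le" "definable_table sig C c add"
    "definable_table sig C c mul" "definable_graph sig C E" "definable_graph sig C G" "definable_threads sig C c N"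
  shows "definable_threads sig C c (\<lambda>M. flip_threads (fst M) (le' M) (le M) c (add M) (mul M) (E M) (G M) (N M))"
  unfolding definable_threads_def flip_threads_def
  by (intro allI impI definable_intros definable_graphD[OF definable_first_diff[OF assms(1,5,6)]]
      definable_rank_one[OF assms(2,3,4,7)] definable_graphD[OF assms(5)] definable_threadsD[OF assms(7)]
      vec_term_take vec_term_drop)

text \<open>The number \<open>j\<close> of iterations is fixed in advance, so the iteration unfolds
  into a single formula.\<close>

lemma definable_chase:
  assumes "definable_order sig C le'" "definable_order sig C le" "definable_table sig C c add"
    "definable_table sig C c mul" "definable_graph sig C E" "definable_graph sig C G" "definable_threads sig C c N"
  shows "definable_graph sig C (\<lambda>M. fst (chase (fst M) (le' M) (le M) c (add M) (mul M) (E M) j (G M, N M))) \<and>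
    definable_threads sig C c (\<lambda>M. snd (chase (fst M) (le' M) (le M) c (add M) (mul M) (E M) j (G M, N M)))"
proof (induction j)
  case 0
  then show ?case using assms by simp
next
  case (Suc j)
  then show ?case
    using definable_flip_graph[OF assms(1,5), of "\<lambda>M. fst (chase (fst M) (le' M) (le M) c (add M) (mul M) (E M) j (G M, N M))"]
      definable_flip_threads[OF assms(1-5), of "\<lambda>M. fst (chase (fst M) (le' M) (le M) c (add M) (mul M) (E M) j (G M, N M))"
        "\<lambda>M. snd (chase (fst M) (le' M) (le M) c (add M) (mul M) (E M) j (G M, N M))"]
    by (simp add: Let_def case_prod_unfold)
qed

subsection \<open>Threads\<close>

definition grel :: "nat set \<Rightarrow> graph \<Rightarrow> (nat list \<times> nat list) set" where
  "grel D G = {(x, y). x \<in> Vec 2 D \<and> y \<in> Vec 2 D \<and> G x y}"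

definition thread_dead :: "nat set \<Rightarrow> nat \<Rightarrow> (nat list \<Rightarrow> nat list \<Rightarrow> nat list \<Rightarrow> bool) \<Rightarrow> bool" where
  "thread_dead D n N \<longleftrightarrow> (\<forall>x\<in>Vec 2 D. \<forall>y\<in>Vec 2 D. \<forall>z\<in>Vec n D. \<not> N x y z)"

definition represents ::
  "nat set \<Rightarrow> (nat \<Rightarrow> nat \<Rightarrow> bool) \<Rightarrow> nat set \<Rightarrow> nat \<Rightarrow> nat list \<Rightarrow>
    (nat list \<Rightarrow> nat list \<Rightarrow> nat list \<Rightarrow> bool) \<Rightarrow> (nat list \<Rightarrow> nat list \<Rightarrow> int) \<Rightarrow> bool" where
  "represents A le D n t N f \<longleftrightarrow> (\<forall>x\<in>Vec 2 D. \<forall>y\<in>Vec 2 D. 0 \<le> f x y \<and> f x y \<le> int (num A le n t) \<and>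
     (\<forall>z\<in>Vec n D. N x y z \<longleftrightarrow> z \<in> Vec n A \<and> int (num A le n z) = f x y))"

definition thread_inv ::
  "nat set \<Rightarrow> (nat \<Rightarrow> nat \<Rightarrow> bool) \<Rightarrow> nat set \<Rightarrow> nat \<Rightarrow> nat list \<Rightarrow> nat list \<Rightarrow> (nat list \<times> nat list) set \<Rightarrow>
    (nat list \<Rightarrow> nat list \<Rightarrow> nat list \<Rightarrow> bool) \<Rightarrow> bool" where
  "thread_inv A le D n t \<theta> G N \<longleftrightarrow> (\<exists>f. represents A le D n t N f \<and>
     inv_mod (int (num A le n t) + 1) (int (num A le n \<theta>)) G (Vec 2 D) f)"

text \<open>A thread that has not died is exact, whatever its modulus; soundness of the answer rests
  on this. Survival is a separate promise, made by \<open>alive\<close>.\<close>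

definition threads_ok ::
  "nat set \<Rightarrow> (nat \<Rightarrow> nat \<Rightarrow> bool) \<Rightarrow> nat set \<Rightarrow> nat \<Rightarrow> table \<Rightarrow> table \<Rightarrow> (nat list \<times> nat list) set \<Rightarrow>
    threads \<Rightarrow> bool" where
  "threads_ok A le D n add mul G N \<longleftrightarrow> (\<forall>t\<in>Vec n D. \<forall>\<theta>\<in>Vec n D. thread_dead D n (N t \<theta>) \<or>
     t \<in> Vec n A \<and> \<theta> \<in> Vec n A \<and> complete D le n add mul t \<and> thread_inv A le D n t \<theta> G (N t \<theta>))"

text \<open>The threads with modulus in \<open>P\<close> whose matrix has been invertible for all graphs in
  \<open>\<Gamma>\<close> are alive.\<close>

definition alive ::
  "nat set \<Rightarrow> (nat \<Rightarrow> nat \<Rightarrow> bool) \<Rightarrow> nat set \<Rightarrow> nat \<Rightarrow> (nat \<Rightarrow> bool) \<Rightarrow> (nat list \<times> nat list) set set \<Rightarrow>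
    threads \<Rightarrow> bool" where
  "alive A le D n P \<Gamma> N \<longleftrightarrow> (\<forall>t\<in>Vec n A. \<forall>\<theta>\<in>Vec n A. P (num A le n t) \<longrightarrow>
     prime (num A le n t + 1) \<longrightarrow> num A le n \<theta> \<le> num A le n t \<longrightarrow> 0 < num A le n \<theta> \<longrightarrow>
     (\<forall>G\<in>\<Gamma>. nonsingular (int (num A le n t) + 1) (int (num A le n \<theta>)) G (Vec 2 D)) \<longrightarrow>
     \<not> thread_dead D n (N t \<theta>))"

locale arithmetic = number_line A le D n for A le D n +
  fixes add mul :: table
  assumes finD: "finite D"
    and add_sound: "table_sound A le n (+) add" and mul_sound: "table_sound A le n (*) mul"
begin

abbreviation "V \<equiv> Vec 2 D"

lemma VecA: "x \<in> Vec n A \<Longrightarrow> x \<in> Vec n D" by (rule VA_VD)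

lemma mod_le: "a mod (int (\<nu> t) + 1) \<le> int (\<nu> t)" "0 \<le> a mod (int (\<nu> t) + 1)"
  using pos_mod_bound[of "int (\<nu> t) + 1" a] by auto

lemma rep_exists:
  assumes "t \<in> Vec n A"
  shows "\<exists>z\<in>Vec n A. int (\<nu> z) = a mod (int (\<nu> t) + 1) \<and> \<nu> z \<le> \<nu> t"
proof -
  have "nat (a mod (int (\<nu> t) + 1)) \<le> \<nu> t" using mod_le[of a t] by linarith
  then obtain z where "z \<in> Vec n A" "\<nu> z = nat (a mod (int (\<nu> t) + 1))"
    using num_exists[OF _ assms] by blast
  then show ?thesis using mod_le[of a t] by (intro bexI[of _ z]) auto
qed

lemma rep_unique: "y \<in> Vec n A \<Longrightarrow> int (\<nu> y) = a \<Longrightarrow> x \<in> Vec n A \<and> int (\<nu> x) = a \<longleftrightarrow> x = y"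
  using num_eq_iff[of x n y] by auto

lemma complete_one: "complete D le n add mul t \<Longrightarrow> t \<in> Vec n A \<Longrightarrow> 1 \<le> \<nu> t"
  unfolding complete_def by (auto simp: one_iff below_iff length_Vec)

text \<open>Soundness determines the result of each operation uniquely, because numbers determine
  tuples; totality supplies some result, which must be this one.\<close>

lemma table_exact:
  assumes tab: "table_sound A le n f tab" and t: "t \<in> Vec n A"
    and ex: "\<And>x y. x \<in> Vec n D \<Longrightarrow> y \<in> Vec n D \<Longrightarrow> below le n t x \<Longrightarrow> below le n t y \<Longrightarrow> \<exists>z\<in>Vec n D. tab t x y z"
    and xyz: "x \<in> Vec n D" "y \<in> Vec n D" "z \<in> Vec n D"
  shows "tab t x y z \<longleftrightarrow> x \<in> Vec n A \<and> y \<in> Vec n A \<and> z \<in> Vec n A \<and> \<nu> x \<le> \<nu> t \<and> \<nu> y \<le> \<nu> t \<and>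
    \<nu> z = f (\<nu> x) (\<nu> y) mod Suc (\<nu> t)"
proof
  assume "tab t x y z"
  then show "x \<in> Vec n A \<and> y \<in> Vec n A \<and> z \<in> Vec n A \<and> \<nu> x \<le> \<nu> t \<and> \<nu> y \<le> \<nu> t \<and>
    \<nu> z = f (\<nu> x) (\<nu> y) mod Suc (\<nu> t)" using tab unfolding table_sound_def by blast
next
  assume *: "x \<in> Vec n A \<and> y \<in> Vec n A \<and> z \<in> Vec n A \<and> \<nu> x \<le> \<nu> t \<and> \<nu> y \<le> \<nu> t \<and>
    \<nu> z = f (\<nu> x) (\<nu> y) mod Suc (\<nu> t)"
  then have "below le n t x" "below le n t y" using t by (auto simp: below_iff length_Vec)
  then obtain z' where z': "z' \<in> Vec n D" "tab t x y z'" using ex xyz by blast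
  then have "z' \<in> Vec n A" "\<nu> z' = \<nu> z" using tab * unfolding table_sound_def by auto
  then have "z' = z" using num_eq_iff * by blast
  then show "tab t x y z" using z' by simp
qed

lemma zmod_nat_eq: "int (\<nu> z) = int a mod (int (\<nu> t) + 1) \<longleftrightarrow> \<nu> z = a mod Suc (\<nu> t)"
proof -
  have "int a mod (int (\<nu> t) + 1) = int (a mod Suc (\<nu> t))" by (simp add: zmod_int add.commute)
  then show ?thesis by (simp only: of_nat_eq_iff)
qed

lemma add_iff:
  assumes "complete D le n add mul t" "t \<in> Vec n A" "x \<in> Vec n D" "y \<in> Vec n D" "z \<in> Vec n D"
  shows "add t x y z \<longleftrightarrow> x \<in> Vec n A \<and> y \<in> Vec n A \<and> z \<in> Vec n A \<and> \<nu> x \<le> \<nu> t \<and> \<nu> y \<le> \<nu> t \<and>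
    int (\<nu> z) = (int (\<nu> x) + int (\<nu> y)) mod (int (\<nu> t) + 1)"
proof -
  have "add t x y z \<longleftrightarrow> x \<in> Vec n A \<and> y \<in> Vec n A \<and> z \<in> Vec n A \<and> \<nu> x \<le> \<nu> t \<and> \<nu> y \<le> \<nu> t \<and>
    \<nu> z = (\<nu> x + \<nu> y) mod Suc (\<nu> t)"
    using assms(1) by (intro table_exact[OF add_sound assms(2) _ assms(3-5)]) (auto simp: complete_def)
  then show ?thesis using zmod_nat_eq[of z "\<nu> x + \<nu> y" t] by (simp only: of_nat_add)
qed

lemma mul_iff:
  assumes "complete D le n add mul t" "t \<in> Vec n A" "x \<in> Vec n D" "y \<in> Vec n D" "z \<in> Vec n D"
  shows "mul t x y z \<longleftrightarrow> x \<in> Vec n A \<and> y \<in> Vec n A \<and> z \<in> Vec n A \<and> \<nu> x \<le> \<nu> t \<and> \<nu> y \<le> \<nu> t \<and>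
    int (\<nu> z) = (int (\<nu> x) * int (\<nu> y)) mod (int (\<nu> t) + 1)"
proof -
  have "mul t x y z \<longleftrightarrow> x \<in> Vec n A \<and> y \<in> Vec n A \<and> z \<in> Vec n A \<and> \<nu> x \<le> \<nu> t \<and> \<nu> y \<le> \<nu> t \<and>
    \<nu> z = (\<nu> x * \<nu> y) mod Suc (\<nu> t)"
    using assms(1) by (intro table_exact[OF mul_sound assms(2) _ assms(3-5)]) (auto simp: complete_def)
  then show ?thesis using zmod_nat_eq[of z "\<nu> x * \<nu> y" t] by (simp only: of_nat_mult)
qed

lemma pivot_iff:
  assumes co: "complete D le n add mul t" and t: "t \<in> Vec n A" and \<eta>: "\<eta> \<in> Vec n A" "\<nu> \<eta> \<le> \<nu> t"
    and \<rho>: "\<rho> \<in> Vec n D" and \<sigma>: "\<sigma> = (if b then -1 else 1)"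
  shows "pivot D le n add mul b t \<eta> \<rho> \<longleftrightarrow> \<rho> \<in> Vec n A \<and> \<nu> \<rho> \<le> \<nu> t \<and>
    int (\<nu> t) + 1 dvd int (\<nu> \<rho>) + \<sigma> + \<sigma> * int (\<nu> \<rho>) * int (\<nu> \<eta>)" (is "?L \<longleftrightarrow> ?R")
proof -
  let ?m = "int (\<nu> t) + 1"
  note iffs = add_iff[OF co t] mul_iff[OF co t]
  have one_ex: "\<exists>e\<in>Vec n A. \<nu> e = 1" by (rule num_exists[OF complete_one[OF co t] t])
  have small: "int (\<nu> x) mod ?m = int (\<nu> x)" if "\<nu> x \<le> \<nu> t" for x
    using that by (intro mod_pos_pos_trivial) auto
  have oneD: "e \<in> Vec n A" "\<nu> e = 1" "\<nu> e \<le> \<nu> t" if "one D le n e" "e \<in> Vec n D" for e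
    using that complete_one[OF co t] by (auto simp: one_iff length_Vec)
  show ?thesis
  proof
    assume ?L
    then obtain w e where we: "w \<in> Vec n D" "e \<in> Vec n D" "mul t \<rho> \<eta> w" "one D le n e"
      and b: "b \<and> add t w e \<rho> \<or> \<not> b \<and> (\<exists>w'\<in>Vec n D. \<exists>z\<in>Vec n D. add t \<rho> w w' \<and> zero D le n z \<and> add t w' e z)"
      unfolding pivot_def by blast
    have w: "\<rho> \<in> Vec n A" "\<nu> \<rho> \<le> \<nu> t" "int (\<nu> w) = int (\<nu> \<rho>) * int (\<nu> \<eta>) mod ?m"
      using we(3) iffs(2)[OF \<rho> VecA[OF \<eta>(1)] we(1)] by auto
    show ?R
    proof (cases b)
      case True
      then have "int (\<nu> \<rho>) = (int (\<nu> w) + 1) mod ?m"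
        using b iffs(1)[OF we(1,2) \<rho>] oneD[OF we(4,2)] by auto
      also have "\<dots> = (int (\<nu> \<rho>) * int (\<nu> \<eta>) + 1) mod ?m" by (simp add: w(3) mod_simps)
      finally have "int (\<nu> \<rho>) mod ?m = (int (\<nu> \<rho>) * int (\<nu> \<eta>) + 1) mod ?m"
        unfolding small[OF w(2)] .
      then have "?m dvd int (\<nu> \<rho>) - (int (\<nu> \<rho>) * int (\<nu> \<eta>) + 1)" by (simp only: mod_eq_dvd_iff)
      then show ?thesis using w \<sigma> True by (simp add: algebra_simps)
    next
      case False
      then obtain w' z where w': "w' \<in> Vec n D" "z \<in> Vec n D" "add t \<rho> w w'" "zero D le n z" "add t w' e z"
        using b by blast
      have "int (\<nu> w') = (int (\<nu> \<rho>) + int (\<nu> w)) mod ?m" using w'(3) iffs(1)[OF \<rho> we(1) w'(1)] by auto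
      moreover have "0 = (int (\<nu> w') + 1) mod ?m"
        using w'(4,5) iffs(1)[OF w'(1) we(2) w'(2)] oneD[OF we(4,2)] w'(2) by (auto simp: zero_iff length_Vec)
      ultimately have "(int (\<nu> \<rho>) + int (\<nu> \<rho>) * int (\<nu> \<eta>) + 1) mod ?m = 0"
        by (simp add: w(3) mod_simps)
      then have "?m dvd int (\<nu> \<rho>) + int (\<nu> \<rho>) * int (\<nu> \<eta>) + 1" by (simp only: dvd_eq_mod_eq_0)
      then show ?thesis using w \<sigma> False by (simp add: algebra_simps)
    qed
  next
    assume R: ?R
    obtain e where e: "e \<in> Vec n A" "\<nu> e = 1" using one_ex by blast
    have e1: "\<nu> e \<le> \<nu> t" "one D le n e" using e complete_one[OF co t] by (auto simp: one_iff length_Vec)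
    obtain w where w: "w \<in> Vec n A" "int (\<nu> w) = int (\<nu> \<rho>) * int (\<nu> \<eta>) mod ?m" "\<nu> w \<le> \<nu> t"
      using rep_exists[OF t] by blast
    have mw: "mul t \<rho> \<eta> w" using iffs(2)[OF \<rho> VecA[OF \<eta>(1)] VecA[OF w(1)]] w R \<eta> by blast
    show ?L
    proof (cases b)
      case True
      then have "?m dvd int (\<nu> \<rho>) - (int (\<nu> \<rho>) * int (\<nu> \<eta>) + 1)" using R \<sigma> by (simp add: algebra_simps)
      then have "int (\<nu> \<rho>) mod ?m = (int (\<nu> \<rho>) * int (\<nu> \<eta>) + 1) mod ?m" by (simp only: mod_eq_dvd_iff)
      then have "int (\<nu> \<rho>) = (int (\<nu> w) + int (\<nu> e)) mod ?m"
        using R small by (simp add: w(2) e(2) mod_simps)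
      then have "add t w e \<rho>" using iffs(1)[OF VecA[OF w(1)] VecA[OF e(1)] \<rho>] w e e1 R by blast
      then show ?thesis unfolding pivot_def using True mw e1 VecA[OF w(1)] VecA[OF e(1)] by blast
    next
      case False
      obtain w' where w': "w' \<in> Vec n A" "int (\<nu> w') = (int (\<nu> \<rho>) + int (\<nu> w)) mod ?m" "\<nu> w' \<le> \<nu> t"
        using rep_exists[OF t] by blast
      obtain z where z: "z \<in> Vec n A" "\<nu> z = 0" using num_exists[OF _ t, of 0] by blast
      have "?m dvd int (\<nu> \<rho>) + int (\<nu> \<rho>) * int (\<nu> \<eta>) + 1" using R \<sigma> False by (simp add: algebra_simps)
      then have "(int (\<nu> \<rho>) + int (\<nu> \<rho>) * int (\<nu> \<eta>) + 1) mod ?m = 0" by (simp only: dvd_eq_mod_eq_0)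
      then have "(int (\<nu> w') + int (\<nu> e)) mod ?m = 0" by (simp add: w'(2) w(2) e(2) mod_simps)
      then have "int (\<nu> z) = (int (\<nu> w') + int (\<nu> e)) mod ?m" using z(2) by simp
      then have "add t w' e z"
        using iffs(1)[OF VecA[OF w'(1)] VecA[OF e(1)] VecA[OF z(1)]] w' e e1 z by blast
      moreover have "add t \<rho> w w'"
        using iffs(1)[OF \<rho> VecA[OF w(1)] VecA[OF w'(1)]] w w' R by blast
      moreover have "zero D le n z" using z by (simp add: zero_iff length_Vec)
      ultimately show ?thesis unfolding pivot_def
        using False mw e1 VecA[OF w(1)] VecA[OF e(1)] VecA[OF w'(1)] VecA[OF z(1)] by blast
    qed
  qed
qed

text \<open>All intermediate values are unique residues, so the existential formula computes the
  Sherman-Morrison correction. The first claim covers every modulus; primality enters through the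
  existence of a pivot.\<close>

lemma rank_one_thread:
  assumes co: "complete D le n add mul t" and t: "t \<in> Vec n A" and \<theta>: "\<theta> \<in> Vec n A"
    and inv: "thread_inv A le D n t \<theta> G (N t \<theta>)" and uv: "u \<in> V" "v \<in> V" and \<sigma>: "\<sigma> = (if b then -1 else 1)"
    and M': "\<And>i j. i \<in> V \<Longrightarrow> j \<in> V \<Longrightarrow>
      Mx (int (\<nu> \<theta>)) G' i j = Mx (int (\<nu> \<theta>)) G i j + (if i = u \<and> j = v then \<sigma> else 0)"
  shows "thread_dead D n (rank_one D le n add mul N b u v t \<theta>) \<or>
      thread_inv A le D n t \<theta> G' (rank_one D le n add mul N b u v t \<theta>)"
    and "prime (\<nu> t + 1) \<Longrightarrow> nonsingular (int (\<nu> t) + 1) (int (\<nu> \<theta>)) G' V \<Longrightarrow>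
      \<not> thread_dead D n (rank_one D le n add mul N b u v t \<theta>)"
proof -
  let ?m = "int (\<nu> t) + 1" and ?R = "rank_one D le n add mul N b u v t \<theta>"
  obtain f where f: "represents A le D n t (N t \<theta>) f" "inv_mod ?m (int (\<nu> \<theta>)) G V f"
    using inv unfolding thread_inv_def by blast
  have fV: "0 \<le> f x y" "f x y \<le> int (\<nu> t)" if "x \<in> V" "y \<in> V" for x y
    using f(1) that unfolding represents_def by blast+
  have N: "N t \<theta> x y z \<longleftrightarrow> z \<in> Vec n A \<and> int (\<nu> z) = f x y" if "x \<in> V" "y \<in> V" "z \<in> Vec n D" for x y z
    using f(1) that unfolding represents_def by blast
  have vec: "\<exists>z\<in>Vec n A. int (\<nu> z) = f x y \<and> \<nu> z \<le> \<nu> t" if "x \<in> V" "y \<in> V" for x y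
  proof -
    have "f x y mod ?m = f x y" using fV[OF that] by (intro mod_pos_pos_trivial) auto
    then show ?thesis using rep_exists[OF t, of "f x y"] by simp
  qed
  obtain \<eta> where \<eta>: "\<eta> \<in> Vec n A" "int (\<nu> \<eta>) = f v u" "\<nu> \<eta> \<le> \<nu> t" using vec[OF uv(2,1)] by blast
  have \<eta>N: "N t \<theta> v u \<eta>' \<longleftrightarrow> \<eta>' = \<eta>" if "\<eta>' \<in> Vec n D" for \<eta>'
    unfolding N[OF uv(2,1) that] by (rule rep_unique[OF \<eta>(1,2)])
  note piv = pivot_iff[OF co t \<eta>(1,3) _ \<sigma>, unfolded \<eta>(2)]
  have char: "?R x y z \<longleftrightarrow> (\<exists>\<rho>\<in>Vec n D. pivot D le n add mul b t \<eta> \<rho> \<and> z \<in> Vec n A \<and>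
      int (\<nu> z) = (f x y + int (\<nu> \<rho>) * f x u * f v y) mod ?m)"
    if xyz: "x \<in> V" "y \<in> V" "z \<in> Vec n D" for x y z
  proof -
    obtain \<alpha> where \<alpha>: "\<alpha> \<in> Vec n A" "int (\<nu> \<alpha>) = f x y" "\<nu> \<alpha> \<le> \<nu> t" using vec[OF xyz(1,2)] by blast
    obtain \<beta> where \<beta>: "\<beta> \<in> Vec n A" "int (\<nu> \<beta>) = f x u" "\<nu> \<beta> \<le> \<nu> t" using vec[OF xyz(1) uv(1)] by blast
    obtain \<gamma> where \<gamma>: "\<gamma> \<in> Vec n A" "int (\<nu> \<gamma>) = f v y" "\<nu> \<gamma> \<le> \<nu> t" using vec[OF uv(2) xyz(2)] by blast
    have Ns: "N t \<theta> x y \<alpha>' \<longleftrightarrow> \<alpha>' = \<alpha>" "N t \<theta> x u \<alpha>' \<longleftrightarrow> \<alpha>' = \<beta>" "N t \<theta> v y \<alpha>' \<longleftrightarrow> \<alpha>' = \<gamma>"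
      if "\<alpha>' \<in> Vec n D" for \<alpha>'
      unfolding N[OF xyz(1,2) that] N[OF xyz(1) uv(1) that] N[OF uv(2) xyz(2) that]
      by (rule rep_unique[OF \<alpha>(1,2)] rep_unique[OF \<beta>(1,2)] rep_unique[OF \<gamma>(1,2)])+
    have "(\<exists>w\<in>Vec n D. \<exists>w'\<in>Vec n D. mul t \<rho> \<beta> w \<and> mul t w \<gamma> w' \<and> add t \<alpha> w' z) \<longleftrightarrow>
        z \<in> Vec n A \<and> int (\<nu> z) = (f x y + int (\<nu> \<rho>) * f x u * f v y) mod ?m"
      if \<rho>: "\<rho> \<in> Vec n D" "pivot D le n add mul b t \<eta> \<rho>" for \<rho>
    proof -
      have \<rho>A: "\<rho> \<in> Vec n A" "\<nu> \<rho> \<le> \<nu> t" using piv[OF \<rho>(1)] \<rho>(2) by auto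
      obtain w where w: "w \<in> Vec n A" "int (\<nu> w) = int (\<nu> \<rho>) * int (\<nu> \<beta>) mod ?m" "\<nu> w \<le> \<nu> t"
        using rep_exists[OF t] by blast
      obtain w' where w': "w' \<in> Vec n A" "int (\<nu> w') = int (\<nu> w) * int (\<nu> \<gamma>) mod ?m" "\<nu> w' \<le> \<nu> t"
        using rep_exists[OF t] by blast
      have m1: "mul t \<rho> \<beta> w1 \<longleftrightarrow> w1 = w" if "w1 \<in> Vec n D" for w1
        unfolding mul_iff[OF co t \<rho>(1) VecA[OF \<beta>(1)] that] using \<rho>A \<beta>(1,3) rep_unique[OF w(1,2), of w1] by blast
      have m2: "mul t w \<gamma> w1 \<longleftrightarrow> w1 = w'" if "w1 \<in> Vec n D" for w1
        unfolding mul_iff[OF co t VecA[OF w(1)] VecA[OF \<gamma>(1)] that] using w(1,3) \<gamma>(1,3) rep_unique[OF w'(1,2), of w1] by blast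
      have m3: "add t \<alpha> w' z \<longleftrightarrow> z \<in> Vec n A \<and> int (\<nu> z) = (int (\<nu> \<alpha>) + int (\<nu> w')) mod ?m"
        unfolding add_iff[OF co t VecA[OF \<alpha>(1)] VecA[OF w'(1)] xyz(3)] using \<alpha> w' by blast
      have "(int (\<nu> \<alpha>) + int (\<nu> w')) mod ?m = (f x y + int (\<nu> \<rho>) * f x u * f v y) mod ?m"
        unfolding w'(2) w(2) \<alpha>(2) \<beta>(2) \<gamma>(2) by (simp add: mod_simps)
      moreover have "(\<exists>w\<in>Vec n D. \<exists>w'\<in>Vec n D. mul t \<rho> \<beta> w \<and> mul t w \<gamma> w' \<and> add t \<alpha> w' z) \<longleftrightarrow> add t \<alpha> w' z"
        using m1 m2 VecA[OF w(1)] VecA[OF w'(1)] by blast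
      ultimately show ?thesis using m3 by simp
    qed
    note step = this
    show ?thesis unfolding rank_one_def
    proof (intro iffI; elim bexE conjE)
      fix \<eta>' \<rho> \<alpha>' \<beta>' \<gamma>' w w'
      assume *: "\<eta>' \<in> Vec n D" "\<rho> \<in> Vec n D" "\<alpha>' \<in> Vec n D" "\<beta>' \<in> Vec n D" "\<gamma>' \<in> Vec n D"
        "N t \<theta> v u \<eta>'" "pivot D le n add mul b t \<eta>' \<rho>" "N t \<theta> x y \<alpha>'" "N t \<theta> x u \<beta>'" "N t \<theta> v y \<gamma>'"
        "w \<in> Vec n D" "w' \<in> Vec n D" "mul t \<rho> \<beta>' w" "mul t w \<gamma>' w'" "add t \<alpha>' w' z"
      then have "\<eta>' = \<eta>" "\<alpha>' = \<alpha>" "\<beta>' = \<beta>" "\<gamma>' = \<gamma>" using \<eta>N Ns by blast+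
      then show "\<exists>\<rho>\<in>Vec n D. pivot D le n add mul b t \<eta> \<rho> \<and> z \<in> Vec n A \<and>
          int (\<nu> z) = (f x y + int (\<nu> \<rho>) * f x u * f v y) mod ?m"
        using * step[of \<rho>] by blast
    next
      fix \<rho> assume \<rho>: "\<rho> \<in> Vec n D" "pivot D le n add mul b t \<eta> \<rho>" "z \<in> Vec n A"
        "int (\<nu> z) = (f x y + int (\<nu> \<rho>) * f x u * f v y) mod ?m"
      have W: "\<exists>w\<in>Vec n D. \<exists>w'\<in>Vec n D. mul t \<rho> \<beta> w \<and> mul t w \<gamma> w' \<and> add t \<alpha> w' z"
        by (rule iffD2[OF step[OF \<rho>(1,2)] conjI[OF \<rho>(3,4)]])
      have N4: "N t \<theta> v u \<eta>" "N t \<theta> x y \<alpha>" "N t \<theta> x u \<beta>" "N t \<theta> v y \<gamma>"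
        using \<eta>N[OF VecA[OF \<eta>(1)]] Ns(1)[OF VecA[OF \<alpha>(1)]] Ns(2)[OF VecA[OF \<beta>(1)]]
          Ns(3)[OF VecA[OF \<gamma>(1)]] by simp_all
      have X: "\<exists>\<alpha>\<in>Vec n D. \<exists>\<beta>\<in>Vec n D. \<exists>\<gamma>\<in>Vec n D. N t \<theta> x y \<alpha> \<and> N t \<theta> x u \<beta> \<and> N t \<theta> v y \<gamma> \<and>
         (\<exists>w\<in>Vec n D. \<exists>w'\<in>Vec n D. mul t \<rho> \<beta> w \<and> mul t w \<gamma> w' \<and> add t \<alpha> w' z)"
        by (rule bexI[OF _ VecA[OF \<alpha>(1)]], rule bexI[OF _ VecA[OF \<beta>(1)]], rule bexI[OF _ VecA[OF \<gamma>(1)]])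
          (intro conjI N4(2-) W)
      show "\<exists>\<eta>\<in>Vec n D. \<exists>\<rho>\<in>Vec n D. N t \<theta> v u \<eta> \<and> pivot D le n add mul b t \<eta> \<rho> \<and>
       (\<exists>\<alpha>\<in>Vec n D. \<exists>\<beta>\<in>Vec n D. \<exists>\<gamma>\<in>Vec n D. N t \<theta> x y \<alpha> \<and> N t \<theta> x u \<beta> \<and> N t \<theta> v y \<gamma> \<and>
         (\<exists>w\<in>Vec n D. \<exists>w'\<in>Vec n D. mul t \<rho> \<beta> w \<and> mul t w \<gamma> w' \<and> add t \<alpha> w' z))"
        by (rule bexI[OF _ VecA[OF \<eta>(1)]], rule bexI[OF _ \<rho>(1)], intro conjI N4(1) \<rho>(2) X)
    qed
  qed
  \<comment> \<open>Pivots are unique even for a composite modulus: cross-multiplying the two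
    congruences eliminates the quadratic terms and leaves
    \<open>\<sigma> * (\<rho> - \<rho>')\<close>, where
    \<open>\<sigma> * \<sigma> = 1\<close>.\<close>
  have uniq: "\<rho> = \<rho>'" if \<rho>: "\<rho> \<in> Vec n D" "pivot D le n add mul b t \<eta> \<rho>"
    and \<rho>': "\<rho>' \<in> Vec n D" "pivot D le n add mul b t \<eta> \<rho>'" for \<rho> \<rho>'
  proof -
    have 1: "\<rho> \<in> Vec n A" "\<nu> \<rho> \<le> \<nu> t" "?m dvd int (\<nu> \<rho>) + \<sigma> + \<sigma> * int (\<nu> \<rho>) * f v u"
      using piv[OF \<rho>(1)] \<rho>(2) by auto
    have 2: "\<rho>' \<in> Vec n A" "\<nu> \<rho>' \<le> \<nu> t" "?m dvd int (\<nu> \<rho>') + \<sigma> + \<sigma> * int (\<nu> \<rho>') * f v u"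
      using piv[OF \<rho>'(1)] \<rho>'(2) by auto
    have "?m dvd \<sigma> * (int (\<nu> \<rho>) * (int (\<nu> \<rho>') + \<sigma> + \<sigma> * int (\<nu> \<rho>') * f v u) -
        int (\<nu> \<rho>') * (int (\<nu> \<rho>) + \<sigma> + \<sigma> * int (\<nu> \<rho>) * f v u))"
      by (intro dvd_mult dvd_diff 1(3) 2(3))
    also have "\<sigma> * (int (\<nu> \<rho>) * (int (\<nu> \<rho>') + \<sigma> + \<sigma> * int (\<nu> \<rho>') * f v u) -
        int (\<nu> \<rho>') * (int (\<nu> \<rho>) + \<sigma> + \<sigma> * int (\<nu> \<rho>) * f v u)) = int (\<nu> \<rho>) - int (\<nu> \<rho>')"
      using \<sigma> by (auto simp: algebra_simps split: if_splits)
    finally have "int (\<nu> \<rho>) mod ?m = int (\<nu> \<rho>') mod ?m" by (simp only: mod_eq_dvd_iff)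
    then have "int (\<nu> \<rho>) = int (\<nu> \<rho>')" using 1(2) 2(2) by (simp add: mod_pos_pos_trivial)
    then show ?thesis using num_eq_iff[OF 1(1) 2(1)] by simp
  qed
  have alive: "thread_inv A le D n t \<theta> G' ?R \<and> \<not> thread_dead D n ?R"
    if \<rho>: "\<rho> \<in> Vec n D" "pivot D le n add mul b t \<eta> \<rho>" for \<rho>
  proof
    define g where "g = (\<lambda>x y. (f x y + int (\<nu> \<rho>) * f x u * f v y) mod ?m)"
    have rep: "?R x y z \<longleftrightarrow> z \<in> Vec n A \<and> int (\<nu> z) = g x y" if "x \<in> V" "y \<in> V" "z \<in> Vec n D" for x y z
      unfolding char[OF that] g_def using uniq[OF _ _ \<rho>] \<rho> by blast
    have "represents A le D n t ?R g"
      unfolding represents_def using rep by (auto simp: g_def mod_le)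
    moreover have "inv_mod ?m (int (\<nu> \<theta>)) G' V g"
    proof (rule inv_mod_cong)
      show "inv_mod ?m (int (\<nu> \<theta>)) G' V (\<lambda>x y. f x y + int (\<nu> \<rho>) * f x u * f v y)"
        using piv[OF \<rho>(1)] \<rho>(2)
        by (intro sherman_morrison[OF finite_Vec[OF finD] uv f(2) M']) auto
      show "?m dvd g i k - (f i k + int (\<nu> \<rho>) * f i u * f v k)" for i k
        unfolding g_def mod_eq_dvd_iff[symmetric] by simp
    qed
    ultimately show "thread_inv A le D n t \<theta> G' ?R" unfolding thread_inv_def by blast
    obtain z where "z \<in> Vec n A" "int (\<nu> z) = g u u" using rep_exists[OF t] unfolding g_def by blast
    then have "?R u u z" using rep uv VecA by blast
    then show "\<not> thread_dead D n ?R" unfolding thread_dead_def using uv VecA[OF \<open>z \<in> Vec n A\<close>] by blast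
  qed
  have dead: "thread_dead D n ?R" if "\<not> (\<exists>\<rho>\<in>Vec n D. pivot D le n add mul b t \<eta> \<rho>)"
    unfolding thread_dead_def using char that by blast
  show "thread_dead D n ?R \<or> thread_inv A le D n t \<theta> G' ?R" using alive dead by blast
  assume p: "prime (\<nu> t + 1)" and ns: "nonsingular ?m (int (\<nu> \<theta>)) G' V"
  have "prime (int (\<nu> t + 1))" using p by (simp only: prime_nat_int_transfer)
  then have pm: "prime ?m" by (simp only: of_nat_add of_nat_1)
  have \<sigma>': "\<sigma> = 1 \<or> \<sigma> = -1" using \<sigma> by auto
  obtain r where r: "?m dvd r + \<sigma> + \<sigma> * r * f v u"
    using pivot_exists[OF pm finite_Vec[OF finD] uv f(2) M' \<sigma>' ns] by blast
  obtain \<rho> where \<rho>: "\<rho> \<in> Vec n A" "int (\<nu> \<rho>) = r mod ?m" "\<nu> \<rho> \<le> \<nu> t" using rep_exists[OF t] by blast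
  \<comment> \<open>The solution \<open>r\<close> is reduced to a residue denoted by a tuple; the
    congruence is linear in it and survives the reduction.\<close>
  have rr: "?m dvd r mod ?m - r" unfolding mod_eq_dvd_iff[symmetric] by simp
  have "?m dvd (r + \<sigma> + \<sigma> * r * f v u) + (r mod ?m - r) * (1 + \<sigma> * f v u)"
    by (rule dvd_add[OF r dvd_mult2[OF rr]])
  then have "?m dvd int (\<nu> \<rho>) + \<sigma> + \<sigma> * int (\<nu> \<rho>) * f v u" unfolding \<rho>(2) by (simp add: algebra_simps)
  then have "pivot D le n add mul b t \<eta> \<rho>" using piv[OF VecA[OF \<rho>(1)]] \<rho> by blast
  then show "\<not> thread_dead D n ?R" using alive VecA[OF \<rho>(1)] by blast
qed

lemma fresh_thread:
  assumes t: "t \<in> Vec n D" and \<theta>: "\<theta> \<in> Vec n D"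
  shows "thread_dead D n (fresh D le n add mul t \<theta>) \<or> t \<in> Vec n A \<and> \<theta> \<in> Vec n A \<and>
      complete D le n add mul t \<and> thread_inv A le D n t \<theta> {} (fresh D le n add mul t \<theta>)"
    and "t \<in> Vec n A \<Longrightarrow> \<theta> \<in> Vec n A \<Longrightarrow> complete D le n add mul t \<Longrightarrow> \<nu> \<theta> \<le> \<nu> t \<Longrightarrow> 0 < \<nu> \<theta> \<Longrightarrow> prime (\<nu> t + 1) \<Longrightarrow>
      V \<noteq> {} \<Longrightarrow> \<not> thread_dead D n (fresh D le n add mul t \<theta>)"
proof -
  let ?m = "int (\<nu> t) + 1"
  show "thread_dead D n (fresh D le n add mul t \<theta>) \<or> t \<in> Vec n A \<and> \<theta> \<in> Vec n A \<and>
      complete D le n add mul t \<and> thread_inv A le D n t \<theta> {} (fresh D le n add mul t \<theta>)"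
  proof (cases "thread_dead D n (fresh D le n add mul t \<theta>)")
    case False
    then obtain \<iota> e where *: "active n le t" "active n le \<theta>" and co: "complete D le n add mul t"
      and \<iota>: "\<iota> \<in> Vec n D" and e: "e \<in> Vec n D" "one D le n e" "mul t \<theta> \<iota> e"
      unfolding thread_dead_def fresh_def by blast
    have tA: "t \<in> Vec n A" "\<theta> \<in> Vec n A" using * t \<theta> by (auto simp: active_iff length_Vec)
    have prod: "mul t \<theta> x e \<longleftrightarrow> x \<in> Vec n A \<and> \<nu> x \<le> \<nu> t \<and> \<nu> \<theta> \<le> \<nu> t \<and> 1 = int (\<nu> \<theta>) * int (\<nu> x) mod ?m"
      if "x \<in> Vec n D" "e \<in> Vec n D" "one D le n e" for x e
      using mul_iff[OF co tA(1) \<theta> that(1,2)] that tA by (auto simp: one_iff length_Vec)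
    have \<iota>1: "\<iota> \<in> Vec n A" "\<nu> \<iota> \<le> \<nu> t" "1 = int (\<nu> \<theta>) * int (\<nu> \<iota>) mod ?m"
      using prod[OF \<iota> e(1,2)] e(3) by auto
    have m1: "1 mod ?m = 1" using complete_one[OF co tA(1)] by (intro mod_pos_pos_trivial) auto
    \<comment> \<open>Inverses are unique modulo any number: \<open>\<iota> = \<iota> * (\<theta> *
      \<iota>') = (\<iota> * \<theta>) * \<iota>' = \<iota>'\<close>.\<close>
    have uniq: "\<iota>' = \<iota>" if "\<iota>' \<in> Vec n D" "e' \<in> Vec n D" "one D le n e'" "mul t \<theta> \<iota>' e'" for \<iota>' e'
    proof -
      have \<iota>2: "\<iota>' \<in> Vec n A" "\<nu> \<iota>' \<le> \<nu> t" "1 = int (\<nu> \<theta>) * int (\<nu> \<iota>') mod ?m"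
        using prod[OF that(1-3)] that(4) by auto
      have "int (\<nu> \<iota>) mod ?m = int (\<nu> \<iota>) * (int (\<nu> \<theta>) * int (\<nu> \<iota>')) mod ?m"
        unfolding mod_mult_right_eq[of "int (\<nu> \<iota>)" "int (\<nu> \<theta>) * int (\<nu> \<iota>')", symmetric] \<iota>2(3)[symmetric]
        by simp
      also have "\<dots> = int (\<nu> \<iota>') * (int (\<nu> \<theta>) * int (\<nu> \<iota>)) mod ?m" by (simp add: ac_simps)
      also have "\<dots> = int (\<nu> \<iota>') mod ?m" 
        unfolding mod_mult_right_eq[of "int (\<nu> \<iota>')" "int (\<nu> \<theta>) * int (\<nu> \<iota>)", symmetric] \<iota>1(3)[symmetric]
        by simp
      finally have "int (\<nu> \<iota>) = int (\<nu> \<iota>')" using \<iota>1(2) \<iota>2(2) by (simp add: mod_pos_pos_trivial)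
      then show ?thesis using num_eq_iff[OF \<iota>2(1) \<iota>1(1)] by simp
    qed
    define f where "f = (\<lambda>x y :: nat list. if x = y then int (\<nu> \<iota>) else 0)"
    have "fresh D le n add mul t \<theta> x y z \<longleftrightarrow> z \<in> Vec n A \<and> int (\<nu> z) = f x y" if "z \<in> Vec n D" for x y z
    proof -
      have "fresh D le n add mul t \<theta> x y z \<longleftrightarrow> (x = y \<and> z = \<iota> \<or> x \<noteq> y \<and> zero D le n z)"
        unfolding fresh_def using * co \<iota> e uniq by blast
      also have "\<dots> \<longleftrightarrow> z \<in> Vec n A \<and> int (\<nu> z) = f x y"
        using that \<iota>1(1) num_eq_iff[of z n \<iota>] by (auto simp: f_def zero_iff length_Vec)
      finally show ?thesis .
    qed
    then have "represents A le D n t (fresh D le n add mul t \<theta>) f"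
      unfolding represents_def using \<iota>1(2) by (auto simp: f_def)
    moreover have "inv_mod ?m (int (\<nu> \<theta>)) {} V f"
      unfolding inv_mod_def
    proof (intro ballI)
      fix i k assume "i \<in> V" "k \<in> V"
      then have "(\<Sum>j\<in>V. Mx (int (\<nu> \<theta>)) {} i j * f j k) = int (\<nu> \<theta>) * f i k"
        using Mx_sum[OF finite_Vec[OF finD], of i 2 "int (\<nu> \<theta>)" "{}" "\<lambda>j. f j k"] by simp
      moreover have "?m dvd int (\<nu> \<theta>) * int (\<nu> \<iota>) - 1"
        unfolding mod_eq_dvd_iff[symmetric] using \<iota>1(3) m1 by simp
      ultimately show "?m dvd (\<Sum>j\<in>V. Mx (int (\<nu> \<theta>)) {} i j * f j k) - (if i = k then 1 else 0)"
        by (auto simp: f_def)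
    qed
    ultimately show ?thesis unfolding thread_inv_def using tA co by blast
  qed auto
  assume a: "t \<in> Vec n A" "\<theta> \<in> Vec n A" "complete D le n add mul t" "\<nu> \<theta> \<le> \<nu> t" "0 < \<nu> \<theta>" "prime (\<nu> t + 1)" "V \<noteq> {}"
  have "coprime (\<nu> \<theta>) (\<nu> t + 1)"
    using a(4-6) prime_imp_coprime[of "\<nu> t + 1" "\<nu> \<theta>"] nat_dvd_not_less[of "\<nu> \<theta>" "\<nu> t + 1"]
    by (auto simp: coprime_commute)
  then have "coprime (int (\<nu> \<theta>)) (int (\<nu> t + 1))" by (simp only: coprime_int_iff)
  then have "coprime (int (\<nu> \<theta>)) ?m" by (simp only: of_nat_add of_nat_1)
  then obtain r s where rs: "r * int (\<nu> \<theta>) + s * ?m = 1" using bezout_int[of "int (\<nu> \<theta>)" ?m] by auto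
  obtain \<iota> where \<iota>: "\<iota> \<in> Vec n A" "int (\<nu> \<iota>) = r mod ?m" "\<nu> \<iota> \<le> \<nu> t" using rep_exists[OF a(1)] by blast
  obtain e where e: "e \<in> Vec n A" "\<nu> e = 1" using num_exists[OF complete_one[OF a(3,1)] a(1)] by blast
  have "int (\<nu> e) = (int (\<nu> \<theta>) * int (\<nu> \<iota>)) mod ?m"
  proof -
    have "(int (\<nu> \<theta>) * int (\<nu> \<iota>)) mod ?m = (r * int (\<nu> \<theta>)) mod ?m" unfolding \<iota>(2) by (simp add: mod_simps mult.commute)
    also have "r * int (\<nu> \<theta>) = 1 + (- s) * ?m" using rs by (simp add: algebra_simps)
    also have "\<dots> mod ?m = 1 mod ?m" by (rule mod_mult_self1)
    also have "\<dots> = 1" using complete_one[OF a(3,1)] by (intro mod_pos_pos_trivial) auto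
    finally show ?thesis using e by simp
  qed
  then have "mul t \<theta> \<iota> e" using mul_iff[OF a(3,1) \<theta> VecA[OF \<iota>(1)] VecA[OF e(1)]] a \<iota> e by blast
  moreover have "one D le n e" using e by (simp add: one_iff length_Vec)
  moreover have "active n le t" "active n le \<theta>" using a by (auto simp: active_iff length_Vec)
  ultimately have "fresh D le n add mul t \<theta> x x \<iota>" for x
    unfolding fresh_def using a(3) VecA[OF \<iota>(1)] VecA[OF e(1)] by blast
  then show "\<not> thread_dead D n (fresh D le n add mul t \<theta>)"
    unfolding thread_dead_def using a(7) VecA[OF \<iota>(1)] by blast
qed

end

subsection \<open>Chasing a graph\<close>

definition diffs :: "nat set \<Rightarrow> (nat \<Rightarrow> nat \<Rightarrow> bool) \<Rightarrow> graph \<Rightarrow> graph \<Rightarrow> (nat list \<times> nat list) set" where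
  "diffs D le E G = {(x, y). x \<in> Vec 2 D \<and> y \<in> Vec 2 D \<and> differ le E G x y}"

definition supported :: "nat set \<Rightarrow> graph \<Rightarrow> bool" where
  "supported A G \<longleftrightarrow> (\<forall>x y. G x y \<longrightarrow> x \<in> Vec 2 A \<and> y \<in> Vec 2 A)"

lemma grel_supported: "supported A G \<Longrightarrow> A \<subseteq> D \<Longrightarrow> grel D G \<subseteq> Vec 2 A \<times> Vec 2 A"
  by (auto simp: supported_def grel_def)

lemma append_Vec: "x \<in> Vec 2 A \<Longrightarrow> y \<in> Vec 2 A \<Longrightarrow> x @ y \<in> Vec 4 A"
  by (auto simp: Vec_def)

lemma append_VecD: "x @ y \<in> Vec 4 A \<Longrightarrow> length x = 2 \<Longrightarrow> length y = 2 \<Longrightarrow> x \<in> Vec 2 A \<and> y \<in> Vec 2 A"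
  by (auto simp: Vec_def)

locale chasing = arithmetic A le D n add mul + new: activation A' le'
  for A le D n add mul A' le' +
  assumes A'D: "A' \<subseteq> D"
begin

lemma differ_iff:
  assumes "x \<in> V" "y \<in> V"
  shows "differ le' E G x y \<longleftrightarrow> x \<in> Vec 2 A' \<and> y \<in> Vec 2 A' \<and> \<not> (E x y \<longleftrightarrow> G x y)"
proof -
  have "length (x @ y) = 4" using assms by (auto simp: Vec_def)
  then show ?thesis unfolding differ_def using new.active_iff[of "x @ y" 4] append_Vec[of x A' y]
      append_VecD[of x y A'] assms by (auto simp: length_Vec)
qed

lemma finite_diffs: "finite (diffs D le' E G)"
  by (rule finite_subset[of _ "V \<times> V"]) (auto simp: diffs_def finite_Vec[OF finD])

lemma first_diff_exists:
  assumes "diffs D le' E G \<noteq> {}"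
  shows "\<exists>u\<in>V. \<exists>v\<in>V. first_diff D le' E G u v"
proof -
  let ?f = "\<lambda>(x, y). int (num A' le' 4 (x @ y))"
  have "\<exists>i\<in>diffs D le' E G. \<forall>j\<in>diffs D le' E G. - ?f j \<le> - ?f i"
    by (rule finite_max_point[OF finite_diffs assms])
  then obtain u v where uv: "(u, v) \<in> diffs D le' E G" "\<forall>j\<in>diffs D le' E G. ?f (u, v) \<le> ?f j"
    by auto
  have "first_diff D le' E G u v"
    unfolding first_diff_def
  proof (intro conjI notI)
    show "differ le' E G u v" using uv(1) by (simp add: diffs_def)
    assume "\<exists>x\<in>V. \<exists>y\<in>V. differ le' E G x y \<and> tuple_less 4 le' (x @ y) (u @ v)"
    then obtain x y where xy: "x \<in> V" "y \<in> V" "differ le' E G x y" "tuple_less 4 le' (x @ y) (u @ v)" by blast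
    have "x @ y \<in> Vec 4 A'" "u @ v \<in> Vec 4 A'"
      using differ_iff xy uv(1) by (auto simp: diffs_def append_Vec)
    then have "num A' le' 4 (x @ y) < num A' le' 4 (u @ v)" using new.num_less_iff xy(4) by blast
    moreover have "num A' le' 4 (u @ v) \<le> num A' le' 4 (x @ y)"
      using uv(2) xy by (auto simp: diffs_def dest!: bspec[of _ _ "(x, y)"])
    ultimately show False by simp
  qed
  then show ?thesis using uv(1) by (auto simp: diffs_def)
qed

lemma first_diff_unique:
  assumes "first_diff D le' E G u v" "first_diff D le' E G x y" "u \<in> V" "v \<in> V" "x \<in> V" "y \<in> V"
  shows "x = u \<and> y = v"
proof (rule ccontr)
  assume ne: "\<not> (x = u \<and> y = v)"
  have d: "differ le' E G u v" "differ le' E G x y" using assms unfolding first_diff_def by auto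
  have "x @ y \<in> Vec 4 A'" "u @ v \<in> Vec 4 A'"
    using differ_iff assms(3-) d by (auto simp: append_Vec)
  moreover have "x @ y \<noteq> u @ v" using ne assms(3-) by (auto simp: length_Vec)
  ultimately have "tuple_less 4 le' (x @ y) (u @ v) \<or> tuple_less 4 le' (u @ v) (x @ y)"
    by (intro new.tuple_less_total)
  then show False using assms d unfolding first_diff_def by blast
qed

lemma flip_graph_iff:
  assumes "first_diff D le' E G u v" "u \<in> V" "v \<in> V" "x \<in> V" "y \<in> V"
  shows "flip_graph D le' E G x y \<longleftrightarrow> (if x = u \<and> y = v then E u v else G x y)"
proof -
  have "\<not> (E u v \<longleftrightarrow> G u v)" using assms(1) by (simp add: first_diff_def differ_def)
  moreover have "first_diff D le' E G x y \<longleftrightarrow> x = u \<and> y = v"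
    using first_diff_unique assms by blast
  ultimately show ?thesis unfolding flip_graph_def by auto
qed

lemma diffs_flip_graph:
  assumes "first_diff D le' E G u v" "u \<in> V" "v \<in> V"
  shows "diffs D le' E (flip_graph D le' E G) = diffs D le' E G - {(u, v)}"
proof -
  have "(x, y) \<in> diffs D le' E (flip_graph D le' E G) \<longleftrightarrow> (x, y) \<in> diffs D le' E G - {(u, v)}" for x y
  proof (cases "x \<in> V \<and> y \<in> V")
    case True
    then show ?thesis using flip_graph_iff[OF assms] by (auto simp: diffs_def differ_iff)
  qed (auto simp: diffs_def)
  then show ?thesis by auto
qed

lemma no_first_diff:
  assumes "\<not> (\<exists>u\<in>V. \<exists>v\<in>V. first_diff D le' E G u v)"
  shows "diffs D le' E G = {}" "grel D (flip_graph D le' E G) = grel D G"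
    "\<And>t \<theta>. flip_threads D le' le n add mul E G N t \<theta> = N t \<theta>"
    "diffs D le' E (flip_graph D le' E G) = {}"
proof -
  show d: "diffs D le' E G = {}" using first_diff_exists assms by blast
  have eq: "flip_graph D le' E G x y = G x y" if "x \<in> V" "y \<in> V" for x y
    unfolding flip_graph_def using assms that by blast
  then show "grel D (flip_graph D le' E G) = grel D G" by (auto simp: grel_def)
  show "diffs D le' E (flip_graph D le' E G) = {}"
    using d eq by (auto simp: diffs_def differ_def)
  show "flip_threads D le' le n add mul E G N t \<theta> = N t \<theta>" for t \<theta>
    using assms by (auto simp: flip_threads_def fun_eq_iff)
qed

lemma flip_threads_eq:
  assumes "first_diff D le' E G u v" "u \<in> V" "v \<in> V"
  shows "flip_threads D le' le n add mul E G N t \<theta> = rank_one D le n add mul N (E u v) u v t \<theta>"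
proof -
  have 1: "(\<exists>u'\<in>V. \<exists>v'\<in>V. first_diff D le' E G u' v' \<and> Q u' v') \<longleftrightarrow> Q u v" for Q
    using first_diff_unique[OF assms(1)] assms by blast
  have 2: "\<exists>u'\<in>V. \<exists>v'\<in>V. first_diff D le' E G u' v'" using assms by blast
  show ?thesis
  proof (intro ext)
    fix x y z
    show "flip_threads D le' le n add mul E G N t \<theta> x y z = rank_one D le n add mul N (E u v) u v t \<theta> x y z"
      using 2 1[of "\<lambda>u v. rank_one D le n add mul N (E u v) u v t \<theta> x y z"]
      unfolding flip_threads_def by simp
  qed
qed

lemma flip_Mx:
  assumes "first_diff D le' E G u v" "u \<in> V" "v \<in> V" "i \<in> V" "j \<in> V"
  shows "Mx \<theta> (grel D (flip_graph D le' E G)) i j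
    = Mx \<theta> (grel D G) i j + (if i = u \<and> j = v then (if E u v then -1 else 1) else 0)"
proof -
  have "\<not> (E u v \<longleftrightarrow> G u v)" using assms(1) by (simp add: first_diff_def differ_def)
  then show ?thesis using flip_graph_iff[OF assms(1-5)] assms(4,5) by (auto simp: Mx_def grel_def)
qed

lemma threads_ok_flip:
  assumes "threads_ok A le D n add mul (grel D G) N"
  shows "threads_ok A le D n add mul (grel D (flip_graph D le' E G)) (flip_threads D le' le n add mul E G N)"
proof (cases "\<exists>u\<in>V. \<exists>v\<in>V. first_diff D le' E G u v")
  case False
  then show ?thesis using assms no_first_diff[OF False] by (simp add: threads_ok_def)
next
  case True
  then obtain u v where uv: "u \<in> V" "v \<in> V" "first_diff D le' E G u v" by blast
  let ?R = "rank_one D le n add mul N (E u v) u v"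
  show ?thesis unfolding threads_ok_def flip_threads_eq[OF uv(3,1,2)]
  proof (intro ballI)
    fix t \<theta> assume t: "t \<in> Vec n D" "\<theta> \<in> Vec n D"
    show "thread_dead D n (?R t \<theta>) \<or> t \<in> Vec n A \<and> \<theta> \<in> Vec n A \<and> complete D le n add mul t \<and>
         thread_inv A le D n t \<theta> (grel D (flip_graph D le' E G)) (?R t \<theta>)"
    proof (cases "thread_dead D n (N t \<theta>)")
      case True
      then have "thread_dead D n (?R t \<theta>)" unfolding thread_dead_def rank_one_def using uv by blast
      then show ?thesis by blast
    next
      case False
      then have *: "t \<in> Vec n A" "\<theta> \<in> Vec n A" "complete D le n add mul t"
        "thread_inv A le D n t \<theta> (grel D G) (N t \<theta>)"
        using assms t unfolding threads_ok_def by blast+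
      show ?thesis
        using rank_one_thread(1)[where b = "E u v" and N = N and t = t and \<theta> = \<theta> and u = u and v = v and G = "grel D G" and
            G' = "grel D (flip_graph D le' E G)" and \<sigma> = "if E u v then -1 else 1",
          OF *(3,1,2,4) uv(1,2) refl flip_Mx[OF uv(3,1,2)]] * by blast
    qed
  qed
qed

lemma alive_flip:
  assumes ok: "threads_ok A le D n add mul (grel D G) N" and al: "alive A le D n P \<Gamma> N"
  shows "alive A le D n P (insert (grel D (flip_graph D le' E G)) \<Gamma>) (flip_threads D le' le n add mul E G N)"
proof (cases "\<exists>u\<in>V. \<exists>v\<in>V. first_diff D le' E G u v")
  case False
  then show ?thesis using al no_first_diff[OF False] by (auto simp: alive_def)
next
  case True
  then obtain u v where uv: "u \<in> V" "v \<in> V" "first_diff D le' E G u v" by blast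
  let ?R = "rank_one D le n add mul N (E u v) u v"
  show ?thesis unfolding alive_def flip_threads_eq[OF uv(3,1,2)]
  proof (intro ballI impI)
    fix t \<theta> assume *: "t \<in> Vec n A" "\<theta> \<in> Vec n A" "P (\<nu> t)" "prime (\<nu> t + 1)" "\<nu> \<theta> \<le> \<nu> t" "0 < \<nu> \<theta>"
      and ns: "\<forall>G\<in>insert (grel D (flip_graph D le' E G)) \<Gamma>. nonsingular (int (\<nu> t) + 1) (int (\<nu> \<theta>)) G V"
    then have nd: "\<not> thread_dead D n (N t \<theta>)" using al unfolding alive_def by blast
    then have **: "complete D le n add mul t" "thread_inv A le D n t \<theta> (grel D G) (N t \<theta>)"
      using ok *(1,2) VecA unfolding threads_ok_def by blast+
    show "\<not> thread_dead D n (?R t \<theta>)"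
      using rank_one_thread(2)[where b = "E u v" and N = N and t = t and \<theta> = \<theta> and u = u and v = v and G = "grel D G" and
            G' = "grel D (flip_graph D le' E G)" and \<sigma> = "if E u v then -1 else 1",
          OF **(1) *(1,2) **(2) uv(1,2) refl flip_Mx[OF uv(3,1,2)] *(4)] ns by blast
  qed
qed

text \<open>\<open>\<Gamma>'\<close> collects every graph passed on the way, since a thread survives
  only if its matrix stays invertible for all of them. Each flip removes one difference, and
  truncated subtraction accounts for flips that find none.\<close>

lemma chase_inv:
  assumes ok: "threads_ok A le D n add mul (grel D G) N" and al: "alive A le D n P \<Gamma> N"
    and \<Gamma>: "finite \<Gamma>" "\<And>H. H \<in> \<Gamma> \<Longrightarrow> H \<subseteq> Vec 2 A' \<times> Vec 2 A'"
    and G: "grel D G \<subseteq> Vec 2 A' \<times> Vec 2 A'"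
  shows "\<exists>\<Gamma>'. case chase D le' le n add mul E k (G, N) of (G', N') \<Rightarrow>
    threads_ok A le D n add mul (grel D G') N' \<and> alive A le D n P \<Gamma>' N' \<and>
    finite \<Gamma>' \<and> card \<Gamma>' \<le> card \<Gamma> + k \<and> (\<forall>H\<in>\<Gamma>'. H \<subseteq> Vec 2 A' \<times> Vec 2 A') \<and>
    grel D G' \<subseteq> Vec 2 A' \<times> Vec 2 A' \<and> card (diffs D le' E G') = card (diffs D le' E G) - k"
proof (induction k)
  case 0
  then show ?case using assms by (intro exI[of _ \<Gamma>]) auto
next
  case (Suc k)
  obtain G' N' where GN: "chase D le' le n add mul E k (G, N) = (G', N')" by fastforce
  with Suc.IH obtain \<Gamma>' where IH: "threads_ok A le D n add mul (grel D G') N'" "alive A le D n P \<Gamma>' N'"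
    "finite \<Gamma>'" "card \<Gamma>' \<le> card \<Gamma> + k" "\<forall>H\<in>\<Gamma>'. H \<subseteq> Vec 2 A' \<times> Vec 2 A'"
    "grel D G' \<subseteq> Vec 2 A' \<times> Vec 2 A'" "card (diffs D le' E G') = card (diffs D le' E G) - k" by auto
  let ?G = "flip_graph D le' E G'" and ?N = "flip_threads D le' le n add mul E G' N'"
  have sub: "grel D ?G \<subseteq> Vec 2 A' \<times> Vec 2 A'"
    using IH(6) differ_iff unfolding grel_def flip_graph_def first_diff_def by blast
  have "card (diffs D le' E ?G) = card (diffs D le' E G) - Suc k"
  proof (cases "\<exists>u\<in>V. \<exists>v\<in>V. first_diff D le' E G' u v")
    case False
    then show ?thesis using no_first_diff[OF False] IH(7) by simp
  next
    case True
    then obtain u v where uv: "u \<in> V" "v \<in> V" "first_diff D le' E G' u v" by blast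
    then have "(u, v) \<in> diffs D le' E G'" by (auto simp: diffs_def first_diff_def)
    then show ?thesis using diffs_flip_graph[OF uv(3,1,2)] IH(7) finite_diffs by simp
  qed
  moreover have "card (insert (grel D ?G) \<Gamma>') \<le> card \<Gamma> + Suc k"
    using card_insert_le_m1[of "card \<Gamma> + Suc k" \<Gamma>' "grel D ?G"] IH(4) by simp
  ultimately show ?case
    using threads_ok_flip[OF IH(1)] alive_flip[OF IH(1,2)] sub IH(3,5)
    by (intro exI[of _ "insert (grel D ?G) \<Gamma>'"]) (simp add: GN)
qed

lemma no_diffs_grel:
  assumes "diffs D le' E G = {}" "grel D E \<subseteq> Vec 2 A' \<times> Vec 2 A'" "grel D G \<subseteq> Vec 2 A' \<times> Vec 2 A'"
  shows "grel D G = grel D E"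
proof -
  have "E x y \<longleftrightarrow> G x y" if "x \<in> Vec 2 A'" "y \<in> Vec 2 A'" for x y
    using assms(1) that differ_iff[of x y E G] Vec_mono[OF A'D, of 2] by (auto simp: diffs_def)
  then show ?thesis using assms(2,3) Vec_mono[OF A'D, of 2] unfolding grel_def by blast
qed

lemma caught_up_iff: "caught_up D le' E G \<longleftrightarrow> diffs D le' E G = {}"
  by (auto simp: caught_up_def diffs_def)

end

subsection \<open>Activating further elements\<close>

locale arithmetic_ext = arithmetic A le D n add mul + ext: activation_ext A le A' le'
  for A le D n add mul A' le' +
  assumes A'D: "A' \<subseteq> D"
begin

sublocale new: number_line A' le' D n
  by unfold_locales (rule A'D)

sublocale chasing A le D n add mul A' le'
  by unfold_locales (rule A'D)

abbreviation "\<nu>' \<equiv> num A' le' n"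

lemma Vec_sub: "x \<in> Vec n A \<Longrightarrow> x \<in> Vec n A'" using Vec_mono[OF ext.sub] by blast

text \<open>A tuple that precedes an old one has no newer entries. Hence calculations modulo an old
  modulus stay among old tuples, and old threads remain exact.\<close>

lemma num_le_imp_old:
  assumes "z \<in> Vec n A'" "t \<in> Vec n A" "\<nu>' z \<le> \<nu>' t"
  shows "z \<in> Vec n A"
proof (cases "z = t")
  case False
  then have "\<nu>' z < \<nu>' t" using ext.new.num_eq_iff[OF assms(1) Vec_sub[OF assms(2)]] assms(3) by simp
  then have "tuple_less n le' z t" using ext.new.num_less_iff[OF assms(1) Vec_sub[OF assms(2)]] by simp
  then show ?thesis
  proof (rule ext.new.tuple_less_downward[OF _ _ assms(2), rotated])
    show "x \<in> A" if "le' x y" "y \<in> A" for x y using that ext.ext le_in by blast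
  qed (use assms in \<open>simp add: length_Vec\<close>)
qed (use assms in simp)

lemma small_imp_old:
  assumes "z \<in> Vec n A'" "\<nu>' z < card A ^ n"
  shows "z \<in> Vec n A"
proof (rule ext.new.num_less_imp_Vec[OF assms(2,1) ext.sub])
  show "x \<in> A" if "le' x y" "y \<in> A" for x y using that ext.ext le_in by blast
qed

lemma table_sound_ext:
  assumes "table_sound A le n f tab"
  shows "table_sound A' le' n f tab"
  unfolding table_sound_def
proof (intro allI impI)
  fix t x y z assume "tab t x y z"
  then have "t \<in> Vec n A \<and> x \<in> Vec n A \<and> y \<in> Vec n A \<and> z \<in> Vec n A \<and> \<nu> x \<le> \<nu> t \<and> \<nu> y \<le> \<nu> t \<and>
     \<nu> z \<le> \<nu> t \<and> \<nu> z = f (\<nu> x) (\<nu> y) mod Suc (\<nu> t)"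
    using assms unfolding table_sound_def by blast
  then show "t \<in> Vec n A' \<and> x \<in> Vec n A' \<and> y \<in> Vec n A' \<and> z \<in> Vec n A' \<and> \<nu>' x \<le> \<nu>' t \<and> \<nu>' y \<le> \<nu>' t \<and>
     \<nu>' z \<le> \<nu>' t \<and> \<nu>' z = f (\<nu>' x) (\<nu>' y) mod Suc (\<nu>' t)"
    using Vec_sub by (simp add: ext.num_ext)
qed

lemma table_level_ext:
  assumes "t \<in> Vec n A" "table_level A le n f tab t j"
  shows "table_level A' le' n f tab t j"
  unfolding table_level_def
proof (intro impI ballI)
  fix x y z assume j: "0 < j" and *: "x \<in> Vec n A'" "y \<in> Vec n A'" "z \<in> Vec n A'"
    "\<nu>' x \<le> \<nu>' t \<and> \<nu>' y \<le> \<nu>' t \<and> \<nu>' y \<le> 2 ^ (j - 1) \<and> \<nu>' z = f (\<nu>' x) (\<nu>' y) mod Suc (\<nu>' t)"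
  then have "\<nu>' z \<le> \<nu>' t" by (simp add: less_Suc_eq_le[symmetric] del: less_Suc_eq_le)
  then have old: "x \<in> Vec n A" "y \<in> Vec n A" "z \<in> Vec n A"
    using num_le_imp_old[OF _ assms(1)] * by blast+
  show "tab t x y z"
    by (rule table_levelD[OF assms(2) j old]) (use * ext.num_ext old assms(1) in auto)
qed

lemma tables_level_ext:
  "t \<in> Vec n A \<Longrightarrow> tables_level A le n tab1 tab2 t j \<Longrightarrow> tables_level A' le' n tab1 tab2 t j"
  unfolding tables_level_def by (simp add: table_level_ext ext.num_ext)

lemma thread_inv_ext:
  assumes "t \<in> Vec n A" "\<theta> \<in> Vec n A" "thread_inv A le D n t \<theta> G N"
  shows "thread_inv A' le' D n t \<theta> G N"
proof -
  obtain f where f: "represents A le D n t N f" "inv_mod (int (\<nu> t) + 1) (int (\<nu> \<theta>)) G V f"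
    using assms unfolding thread_inv_def by blast
  have "z \<in> Vec n A \<and> int (\<nu> z) = f x y \<longleftrightarrow> z \<in> Vec n A' \<and> int (\<nu>' z) = f x y"
    if "f x y \<le> int (\<nu> t)" for x y z
  proof
    assume "z \<in> Vec n A' \<and> int (\<nu>' z) = f x y"
    moreover from this have "z \<in> Vec n A"
      using num_le_imp_old[OF _ assms(1), of z] that ext.num_ext[OF assms(1)] by simp
    ultimately show "z \<in> Vec n A \<and> int (\<nu> z) = f x y" by (simp add: ext.num_ext)
  qed (use Vec_sub ext.num_ext in auto)
  then have "represents A' le' D n t N f"
    using f(1) ext.num_ext[OF assms(1)] unfolding represents_def by auto
  then show ?thesis using f(2) ext.num_ext assms unfolding thread_inv_def by auto
qed

lemma complete_ext:
  assumes t: "t \<in> Vec n A" and co: "complete D le n add mul t"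
    and sub: "\<And>x y z. add t x y z \<Longrightarrow> add' t x y z" "\<And>x y z. mul t x y z \<Longrightarrow> mul' t x y z"
  shows "complete D le' n add' mul' t"
  unfolding complete_def
proof (intro conjI ballI impI)
  obtain w where "w \<in> Vec n A" "\<nu> w = 1" "\<nu> w \<le> \<nu> t"
    using co t unfolding complete_def by (auto simp: one_iff below_iff length_Vec)
  then show "\<exists>w\<in>Vec n D. one D le' n w \<and> below le' n t w"
    using t Vec_sub VecA ext.num_ext by (intro bexI[of _ w]) (auto simp: new.one_iff new.below_iff length_Vec)
  fix x y assume xy: "x \<in> Vec n D" "y \<in> Vec n D" "below le' n t x \<and> below le' n t y"
  then have "x \<in> Vec n A" "y \<in> Vec n A"
    using num_le_imp_old[OF _ t] t by (auto simp: new.below_iff length_Vec)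
  then have "below le n t x" "below le n t y"
    using xy t ext.num_ext by (auto simp: below_iff new.below_iff length_Vec)
  then show "\<exists>z\<in>Vec n D. add' t x y z" "\<exists>z\<in>Vec n D. mul' t x y z"
    using co xy sub unfolding complete_def by blast+
qed

lemma threads_ok_ext:
  assumes "threads_ok A le D n add mul G N"
    and sub: "\<And>t x y z. add t x y z \<Longrightarrow> add' t x y z" "\<And>t x y z. mul t x y z \<Longrightarrow> mul' t x y z"
  shows "threads_ok A' le' D n add' mul' G N"
  unfolding threads_ok_def
proof (intro ballI)
  fix t \<theta> assume t: "t \<in> Vec n D" "\<theta> \<in> Vec n D"
  show "thread_dead D n (N t \<theta>) \<or>
     t \<in> Vec n A' \<and> \<theta> \<in> Vec n A' \<and> complete D le' n add' mul' t \<and> thread_inv A' le' D n t \<theta> G (N t \<theta>)"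
  proof (cases "thread_dead D n (N t \<theta>)")
    case False
    then have *: "t \<in> Vec n A" "\<theta> \<in> Vec n A" "complete D le n add mul t" "thread_inv A le D n t \<theta> G (N t \<theta>)"
      using assms(1) t unfolding threads_ok_def by blast+
    then show ?thesis using Vec_sub complete_ext[where add' = add' and mul' = mul', OF *(1,3) sub] thread_inv_ext[OF *(1,2,4)] by blast
  qed simp
qed

text \<open>The hypothesis on \<open>P\<close> confines the promise to moduli that were already
  denotable. Activation creates further moduli, for which a running family has started no
  threads.\<close>

lemma alive_ext:
  assumes "alive A le D n P \<Gamma> N" and P: "\<And>a. P a \<Longrightarrow> a < card A ^ n"
  shows "alive A' le' D n P \<Gamma> N"
  unfolding alive_def
proof (intro ballI impI)
  fix t \<theta> assume *: "t \<in> Vec n A'" "\<theta> \<in> Vec n A'" "P (\<nu>' t)" "prime (\<nu>' t + 1)" "\<nu>' \<theta> \<le> \<nu>' t" "0 < \<nu>' \<theta>"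
    "\<forall>G\<in>\<Gamma>. nonsingular (int (\<nu>' t) + 1) (int (\<nu>' \<theta>)) G V"
  have t: "t \<in> Vec n A" using small_imp_old P * by blast
  have \<theta>: "\<theta> \<in> Vec n A" using num_le_imp_old[OF *(2) t *(5)] .
  show "\<not> thread_dead D n (N t \<theta>)"
    using assms(1) * t \<theta> unfolding alive_def by (simp add: ext.num_ext)
qed

end

subsection \<open>The invariant of the dynamic program\<close>

text \<open>\<open>m\<close>, the modulus minus one, is denotable with the first \<open>b\<close>
  active elements. The \<open>2 * (2 * k + 2)\<close> further activations, at most two per change,
  leave time for the \<open>2 * k + 2\<close> table steps asked for in
  \<open>complete_iff_level\<close>. The last \<open>2\<close> absorbs a delay of one change: a
  fresh family is dated by the order after the change but uses the tables from before it.\<close>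

definition usable :: "nat \<Rightarrow> nat \<Rightarrow> nat \<Rightarrow> bool" where
  "usable n a m \<longleftrightarrow> (\<exists>b k. b + 2 * (2 * k + 2) + 2 \<le> a \<and> b ^ n \<le> 2 ^ k \<and> m < b ^ n)"

text \<open>Time is read off the order: a change activates at most two elements, so
  \<open>2 * j\<close> activations beyond the first \<open>b\<close> elements witness at least
  \<open>j\<close> table steps with \<open>t\<close> already denotable.\<close>

definition levels :: "nat set \<Rightarrow> (nat \<Rightarrow> nat \<Rightarrow> bool) \<Rightarrow> nat \<Rightarrow> table \<Rightarrow> table \<Rightarrow> bool" where
  "levels A le n add mul \<longleftrightarrow> (\<forall>b j. b + 2 * j \<le> card A \<longrightarrow>
     (\<forall>t\<in>Vec n A. num A le n t < b ^ n \<longrightarrow> tables_level A le n add mul t j))"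

text \<open>Updates are predicates on all lists, whereas a stored relation consists of tuples over
  \<open>D\<close> of the right lengths. The guards describe what is actually stored.\<close>

definition guard_table :: "nat set \<Rightarrow> nat \<Rightarrow> table \<Rightarrow> table" where
  "guard_table D n tab t x y z \<longleftrightarrow>
     t \<in> Vec n D \<and> x \<in> Vec n D \<and> y \<in> Vec n D \<and> z \<in> Vec n D \<and> tab t x y z"

definition guard_graph :: "nat set \<Rightarrow> graph \<Rightarrow> graph" where
  "guard_graph D G x y \<longleftrightarrow> x \<in> Vec 2 D \<and> y \<in> Vec 2 D \<and> G x y"

definition guard_threads :: "nat set \<Rightarrow> nat \<Rightarrow> threads \<Rightarrow> threads" where
  "guard_threads D n N t \<theta> x y z \<longleftrightarrow>
     t \<in> Vec n D \<and> \<theta> \<in> Vec n D \<and> x \<in> Vec 2 D \<and> y \<in> Vec 2 D \<and> z \<in> Vec n D \<and> N t \<theta> x y z"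

text \<open>\<open>aS\<close> and \<open>aC\<close> are the numbers of active elements when the computation of \<open>NS\<close> and of
  \<open>NC\<close> started, \<open>\<Gamma>S\<close> and \<open>\<Gamma>C\<close> the graphs passed since then, and \<open>kC\<close> is the number of changes
  since the start for \<open>NC\<close>. The numbers of active elements and of graphs are thus bounded by
  polynomials in \<open>aS\<close>.\<close>

definition generations ::
  "nat set \<Rightarrow> nat \<Rightarrow> nat \<Rightarrow> nat set \<Rightarrow> (nat \<Rightarrow> nat \<Rightarrow> bool) \<Rightarrow> graph \<Rightarrow> threads \<Rightarrow> graph \<Rightarrow> threads \<Rightarrow> bool" where
  "generations D n L A le E NS GC NC \<longleftrightarrow> (\<exists>aS aC kC \<Gamma>S \<Gamma>C. finite \<Gamma>S \<and> finite \<Gamma>C \<and>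
     (\<forall>H\<in>\<Gamma>S \<union> \<Gamma>C. H \<subseteq> Vec 2 A \<times> Vec 2 A) \<and>
     alive A le D n (usable n aS) \<Gamma>S NS \<and> alive A le D n (usable n aC) \<Gamma>C NC \<and>
     card \<Gamma>S \<le> (L + 1) * (aS ^ 4 + 1 + kC) \<and> card \<Gamma>C \<le> (L + 1) * kC \<and>
     card (diffs D le E GC) + kC \<le> aC ^ 4 \<and> aC \<le> aS + 2 * (aS ^ 4 + 1) \<and>
     card A \<le> aC + 2 * kC \<and> aC \<le> card A \<and> aS \<le> card A)"

lemma generationsI:
  assumes "finite \<Gamma>S" "finite \<Gamma>C" "\<And>H. H \<in> \<Gamma>S \<Longrightarrow> H \<subseteq> Vec 2 A \<times> Vec 2 A" "\<And>H. H \<in> \<Gamma>C \<Longrightarrow> H \<subseteq> Vec 2 A \<times> Vec 2 A"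
    "alive A le D n (usable n aS) \<Gamma>S NS" "alive A le D n (usable n aC) \<Gamma>C NC"
    "card \<Gamma>S \<le> (L + 1) * (aS ^ 4 + 1 + kC)" "card \<Gamma>C \<le> (L + 1) * kC"
    "card (diffs D le E GC) + kC \<le> aC ^ 4" "aC \<le> aS + 2 * (aS ^ 4 + 1)"
    "card A \<le> aC + 2 * kC" "aC \<le> card A" "aS \<le> card A"
  shows "generations D n L A le E NS GC NC"
  unfolding generations_def
  by (rule exI[of _ aS], rule exI[of _ aC], rule exI[of _ kC], rule exI[of _ \<Gamma>S], rule exI[of _ \<Gamma>C])
    (use assms in blast)

definition engine_inv ::
  "nat set \<Rightarrow> nat \<Rightarrow> nat \<Rightarrow> nat set \<Rightarrow> (nat \<Rightarrow> nat \<Rightarrow> bool) \<Rightarrow> table \<Rightarrow> table \<Rightarrow> graph \<Rightarrow> threads \<Rightarrow> graph \<Rightarrow> threads \<Rightarrow> bool" where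
  "engine_inv D n L A le add mul E NS GC NC \<longleftrightarrow>
     arithmetic A le D n add mul \<and> levels A le n add mul \<and> supported A E \<and> supported A GC \<and>
     threads_ok A le D n add mul (grel D E) NS \<and> threads_ok A le D n add mul (grel D GC) NC \<and>
     generations D n L A le E NS GC NC"

lemma thread_dead_guard:
  "t \<in> Vec n D \<Longrightarrow> \<theta> \<in> Vec n D \<Longrightarrow> thread_dead D n (guard_threads D n N t \<theta>) \<longleftrightarrow> thread_dead D n (N t \<theta>)"
  by (auto simp: thread_dead_def guard_threads_def)

lemma thread_inv_guard:
  "t \<in> Vec n D \<Longrightarrow> \<theta> \<in> Vec n D \<Longrightarrow>
    thread_inv A le D n t' \<theta>' G (guard_threads D n N t \<theta>) \<longleftrightarrow> thread_inv A le D n t' \<theta>' G (N t \<theta>)"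
  by (auto simp: thread_inv_def represents_def guard_threads_def)

lemma threads_ok_guard: "threads_ok A le D n add mul G (guard_threads D n N) \<longleftrightarrow> threads_ok A le D n add mul G N"
  by (simp add: threads_ok_def thread_dead_guard thread_inv_guard)

lemma alive_guard:
  assumes "A \<subseteq> D"
  shows "alive A le D n P \<Gamma> (guard_threads D n N) \<longleftrightarrow> alive A le D n P \<Gamma> N"
proof -
  have "thread_dead D n (guard_threads D n N t \<theta>) \<longleftrightarrow> thread_dead D n (N t \<theta>)"
    if "t \<in> Vec n A" "\<theta> \<in> Vec n A" for t \<theta>
    using that thread_dead_guard Vec_mono[OF assms] by blast
  then show ?thesis by (simp add: alive_def)
qed

lemma grel_guard: "grel D (guard_graph D G) = grel D G"
  by (auto simp: grel_def guard_graph_def)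

lemma diffs_guard: "diffs D le E (guard_graph D G) = diffs D le E G"
  by (auto simp: diffs_def guard_graph_def differ_def)

lemma supported_guard: "grel D G \<subseteq> Vec 2 A \<times> Vec 2 A \<Longrightarrow> supported A (guard_graph D G)"
  by (auto simp: supported_def guard_graph_def grel_def)

lemma usable_le: "usable n a m \<Longrightarrow> a \<le> c + 2 \<Longrightarrow> m < c ^ n"
  unfolding usable_def
  by (elim exE conjE) (rule less_le_trans, assumption, rule power_mono, auto)

locale engine_step = arithmetic_ext A le D n add mul A' le' for A le D n add mul A' le' +
  fixes E E' :: graph and NS :: threads and GC :: graph and NC :: threads and L :: nat
  assumes lev: "levels A le n add mul" and suppE: "supported A E" and suppG: "supported A GC"
    and okS: "threads_ok A le D n add mul (grel D E) NS"
    and okC: "threads_ok A le D n add mul (grel D GC) NC"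
    and gen: "generations D n L A le E NS GC NC"
    and card': "card A' \<le> card A + 2" and suppE': "supported A' E'"
    and L: "card (diffs D le' E' E) \<le> L" and ne: "D \<noteq> {}"
begin

abbreviation "add' \<equiv> guard_table D n (add_step D le n add)"
abbreviation "mul' \<equiv> guard_table D n (mul_step D le n add mul)"

lemma add'_sub: "add t x y z \<Longrightarrow> add' t x y z"
proof -
  assume a: "add t x y z"
  then have *: "t \<in> Vec n A" "x \<in> Vec n A" "y \<in> Vec n A" "z \<in> Vec n A" "\<nu> x \<le> \<nu> t" "\<nu> y \<le> \<nu> t" "\<nu> z \<le> \<nu> t"
    using add_sound unfolding table_sound_def by blast+
  then have "below le n t x" "below le n t y" "below le n t z" by (auto simp: below_iff length_Vec)
  then show ?thesis using a * VecA by (auto simp: guard_table_def add_step_def)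
qed

lemma mul'_sub: "mul t x y z \<Longrightarrow> mul' t x y z"
proof -
  assume a: "mul t x y z"
  then have *: "t \<in> Vec n A" "x \<in> Vec n A" "y \<in> Vec n A" "z \<in> Vec n A" "\<nu> x \<le> \<nu> t" "\<nu> y \<le> \<nu> t" "\<nu> z \<le> \<nu> t"
    using mul_sound unfolding table_sound_def by blast+
  then have "below le n t x" "below le n t y" "below le n t z" by (auto simp: below_iff length_Vec)
  then show ?thesis using a * VecA by (auto simp: guard_table_def mul_step_def)
qed

lemma arithmetic': "arithmetic A' le' D n add' mul'"
proof unfold_locales
  show "finite D" by (rule finD)
  have "table_sound A le n (+) add'"
    using add_step_sound[OF add_sound] by (simp add: guard_table_def[abs_def])
  then show "table_sound A' le' n (+) add'" by (rule table_sound_ext)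
  have "table_sound A le n (*) mul'"
    using mul_step_sound[OF add_sound mul_sound] by (simp add: guard_table_def[abs_def])
  then show "table_sound A' le' n (*) mul'" by (rule table_sound_ext)
qed

lemma tables_level_guard:
  assumes "tables_level A le n a m t j" "t \<in> Vec n A"
  shows "tables_level A le n (guard_table D n a) (guard_table D n m) t j"
proof -
  have "table_level A le n f (guard_table D n tab) t j" if "table_level A le n f tab t j" for f tab j
    using that assms(2) VecA unfolding table_level_def guard_table_def by blast
  then show ?thesis using assms(1) unfolding tables_level_def by blast
qed

lemma levels': "levels A' le' n add' mul'"
  unfolding levels_def
proof (intro allI impI ballI)
  fix b j t assume bj: "b + 2 * j \<le> card A'" and t: "t \<in> Vec n A'" and b: "\<nu>' t < b ^ n"
  show "tables_level A' le' n add' mul' t j"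
  proof (cases j)
    case 0
    then show ?thesis by (simp add: tables_level_def table_level_def)
  next
    case (Suc i)
    \<comment> \<open>A positive level forces \<open>b \<le> card A\<close>, so the modulus was
      denotable before the change and its tables advance from level \<open>i\<close>.\<close>
    then have bi: "b + 2 * i \<le> card A" using bj card' by simp
    then have "b ^ n \<le> card A ^ n" by (intro power_mono) auto
    then have tA: "t \<in> Vec n A" using small_imp_old[OF t] b by linarith
    then have "tables_level A le n add mul t i"
      using lev bi b ext.num_ext[OF tA] unfolding levels_def by simp
    then have "tables_level A le n add' mul' t (Suc i)"
      by (intro tables_level_guard tables_step_level tA)
    then show ?thesis using tables_level_ext[OF tA] Suc by blast
  qed
qed

text \<open>Of the \<open>L + 1\<close> flips, \<open>L\<close> pay for the differences made by the
  current change. So the family in use is always brought up to date, and the one in preparation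
  gains at least one pair.\<close>

abbreviation "S1 \<equiv> chase D le' le n add mul E' (L + 1) (E, NS)"
abbreviation "C1 \<equiv> chase D le' le n add mul E' (L + 1) (GC, NC)"
abbreviation "caught \<equiv> caught_up D le' E' (fst C1)"
abbreviation "NS' \<equiv> guard_threads D n (if caught then snd C1 else snd S1)"
abbreviation "GC' \<equiv> guard_graph D (if caught then (\<lambda>_ _. False) else fst C1)"
abbreviation "NC' \<equiv> guard_threads D n (if caught then fresh D le n add mul else snd C1)"

lemma sub4: "supported A G \<Longrightarrow> grel D G \<subseteq> Vec 2 A' \<times> Vec 2 A'"
  using grel_supported[of A G D] AD Vec_mono[OF ext.sub, of 2] by blast

text \<open>Both graphs live on old nodes, so pairs with newly active elements add no
  difference.\<close>

lemma diffs_ext: "diffs D le' E GC = diffs D le E GC"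
proof -
  have iff: "differ le E GC x y \<longleftrightarrow> x \<in> Vec 2 A \<and> y \<in> Vec 2 A \<and> \<not> (E x y \<longleftrightarrow> GC x y)"
    if "x \<in> V" "y \<in> V" for x y
  proof -
    have "length (x @ y) = 4" using that by (auto simp: Vec_def)
    then show ?thesis unfolding differ_def using active_iff[of "x @ y" 4] append_Vec[of x A y]
        append_VecD[of x y A] that by (auto simp: length_Vec)
  qed
  have "differ le' E GC x y \<longleftrightarrow> differ le E GC x y" if "x \<in> V" "y \<in> V" for x y
  proof -
    have "x \<in> Vec 2 A \<and> y \<in> Vec 2 A" if "\<not> (E x y \<longleftrightarrow> GC x y)"
      using that suppE suppG unfolding supported_def by blast
    moreover have "z \<in> Vec 2 A'" if "z \<in> Vec 2 A" for z using that Vec_mono[OF ext.sub, of 2] by blast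
    ultimately show ?thesis unfolding iff[OF that] differ_iff[OF that] by blast
  qed
  then show ?thesis by (auto simp: diffs_def)
qed

lemma diffs_trans: "card (diffs D le' E' GC) \<le> card (diffs D le E GC) + L"
proof -
  have "diffs D le' E' GC \<subseteq> diffs D le' E' E \<union> diffs D le' E GC"
    by (auto simp: diffs_def differ_def)
  then have "card (diffs D le' E' GC) \<le> card (diffs D le' E' E \<union> diffs D le' E GC)"
    by (intro card_mono) (auto simp: finite_diffs)
  also have "\<dots> \<le> card (diffs D le' E' E) + card (diffs D le' E GC)" by (rule card_Un_le)
  finally show ?thesis using L unfolding diffs_ext by linarith
qed

text \<open>This is the initial budget \<open>aC ^ 4\<close> of a family that starts from the empty
  graph.\<close>

lemma card_diffs_empty: "card (diffs D le' E' (\<lambda>_ _. False)) \<le> card A' ^ 4"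
proof -
  have "diffs D le' E' (\<lambda>_ _. False) \<subseteq> Vec 2 A' \<times> Vec 2 A'"
    using differ_iff unfolding diffs_def by blast
  then have "card (diffs D le' E' (\<lambda>_ _. False)) \<le> card (Vec 2 A' \<times> Vec 2 A')"
    by (intro card_mono finite_cartesian_product finite_Vec ext.new.fin)
  also have "\<dots> = card A' ^ 4" by (simp add: card_cartesian_product card_Vec ext.new.fin flip: power_add)
  finally show ?thesis .
qed

lemma fresh_ok: "threads_ok A le D n add mul {} (fresh D le n add mul)"
  unfolding threads_ok_def using fresh_thread(1) by blast

lemma fresh_alive: "alive A le D n (usable n (card A')) {} (fresh D le n add mul)"
  unfolding alive_def
proof (intro ballI impI)
  fix t \<theta> assume *: "t \<in> Vec n A" "\<theta> \<in> Vec n A" "usable n (card A') (\<nu> t)" "prime (\<nu> t + 1)" "\<nu> \<theta> \<le> \<nu> t" "0 < \<nu> \<theta>"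
  obtain b k where b: "b + 2 * (2 * k + 2) + 2 \<le> card A'" "b ^ n \<le> 2 ^ k" "\<nu> t < b ^ n"
    using *(3) unfolding usable_def by blast
  have "tables_level A le n add mul t (2 * k + 2)"
    using lev b card' *(1) unfolding levels_def by (elim allE[of _ b] allE[of _ "2 * k + 2"]) auto
  moreover have "1 \<le> \<nu> t" "\<nu> t \<le> 2 ^ k" using *(5,6) b by auto
  ultimately have "complete D le n add mul t" by (intro complete_iff_level *(1))
  moreover obtain d where "d \<in> D" using ne by blast
  then have "[d, d] \<in> V" by (simp add: Vec_def)
  then have "V \<noteq> {}" by blast
  ultimately show "\<not> thread_dead D n (fresh D le n add mul t \<theta>)"
    using fresh_thread(2) * VecA by blast
qed

text \<open>The graphs passed by a family increase by at most \<open>L + 1\<close> per change, and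
  the differences of the family in preparation decrease strictly until it has caught up. This bounds
  its preparation time by \<open>aC ^ 4\<close>, and with it the age of the family that it
  replaces.\<close>

lemma engine_step: "engine_inv D n L A' le' add' mul' E' NS' GC' NC'"
proof -
  obtain aS aC kC \<Gamma>S \<Gamma>C where g: "finite \<Gamma>S" "finite \<Gamma>C" "\<forall>H\<in>\<Gamma>S \<union> \<Gamma>C. H \<subseteq> Vec 2 A \<times> Vec 2 A"
     "alive A le D n (usable n aS) \<Gamma>S NS" "alive A le D n (usable n aC) \<Gamma>C NC"
     "card \<Gamma>S \<le> (L + 1) * (aS ^ 4 + 1 + kC)" "card \<Gamma>C \<le> (L + 1) * kC"
     "card (diffs D le E GC) + kC \<le> aC ^ 4" "aC \<le> aS + 2 * (aS ^ 4 + 1)"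
     "card A \<le> aC + 2 * kC" "aC \<le> card A" "aS \<le> card A"
    using gen unfolding generations_def by blast
  have W: "\<And>H. H \<in> \<Gamma>S \<Longrightarrow> H \<subseteq> Vec 2 A' \<times> Vec 2 A'" "\<And>H. H \<in> \<Gamma>C \<Longrightarrow> H \<subseteq> Vec 2 A' \<times> Vec 2 A'"
    using g(3) Vec_mono[OF ext.sub, of 2] by blast+
  obtain GS1 NS1 where S1: "S1 = (GS1, NS1)" by (cases S1)
  obtain GC1 NC1 where C1: "C1 = (GC1, NC1)" by (cases C1)
  obtain \<Gamma>S' where s: "threads_ok A le D n add mul (grel D GS1) NS1" "alive A le D n (usable n aS) \<Gamma>S' NS1"
    "finite \<Gamma>S'" "card \<Gamma>S' \<le> card \<Gamma>S + (L + 1)" "\<forall>H\<in>\<Gamma>S'. H \<subseteq> Vec 2 A' \<times> Vec 2 A'"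
    "grel D GS1 \<subseteq> Vec 2 A' \<times> Vec 2 A'" "card (diffs D le' E' GS1) = card (diffs D le' E' E) - (L + 1)"
    using chase_inv[where E = E' and k = "L + 1", OF okS g(4,1) W(1) sub4[OF suppE]] unfolding S1 by auto
  obtain \<Gamma>C' where c: "threads_ok A le D n add mul (grel D GC1) NC1" "alive A le D n (usable n aC) \<Gamma>C' NC1"
    "finite \<Gamma>C'" "card \<Gamma>C' \<le> card \<Gamma>C + (L + 1)" "\<forall>H\<in>\<Gamma>C'. H \<subseteq> Vec 2 A' \<times> Vec 2 A'"
    "grel D GC1 \<subseteq> Vec 2 A' \<times> Vec 2 A'" "card (diffs D le' E' GC1) = card (diffs D le' E' GC) - (L + 1)"
    using chase_inv[where E = E' and k = "L + 1", OF okC g(5,2) W(2) sub4[OF suppG]] unfolding C1 by auto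
  have "card (diffs D le' E' GS1) = 0" using s(7) L by simp
  then have "diffs D le' E' GS1 = {}" using finite_diffs by simp
  then have GS1: "grel D GS1 = grel D E'"
    by (rule no_diffs_grel[OF _ grel_supported[OF suppE' A'D] s(6)])
  have cardA: "card A \<le> card A'" by (intro card_mono ext.new.fin ext.sub)
  note ok_ext = threads_ok_ext[where add' = add' and mul' = mul', OF _ add'_sub mul'_sub]
  have use: "a \<le> card A + 2 \<Longrightarrow> usable n a m \<Longrightarrow> m < card A ^ n" for a m by (rule usable_le)
  have le_S: "aS \<le> card A + 2" and le_C: "aC \<le> card A + 2" using g(11,12) by linarith+
  have al_S: "alive A' le' D n (usable n aS) \<Gamma>S' NS1" by (rule alive_ext[OF s(2) use[OF le_S]])
  have al_C: "alive A' le' D n (usable n aC) \<Gamma>C' NC1" by (rule alive_ext[OF c(2) use[OF le_C]])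
  have al_fresh: "alive A' le' D n (usable n (card A')) {} (fresh D le n add mul)"
    by (rule alive_ext[OF fresh_alive use[OF card']])
  have c4: "card \<Gamma>C' \<le> (L + 1) * (kC + 1)" using c(4) g(7) by simp
  show ?thesis
  proof (cases "caught")
    case True
    then have "diffs D le' E' GC1 = {}" unfolding caught_up_iff C1 by simp
    then have GC1: "grel D GC1 = grel D E'"
      by (rule no_diffs_grel[OF _ grel_supported[OF suppE' A'D] c(6)])
    have eq: "NS' = guard_threads D n NC1" "GC' = guard_graph D (\<lambda>_ _. False)"
      "NC' = guard_threads D n (fresh D le n add mul)" using True C1 by simp_all
    have e: "grel D (\<lambda>_ _. False) = {}" by (auto simp: grel_def)
    have k1: "kC \<le> aC ^ 4" using g(8) by simp
    have "card \<Gamma>C' \<le> (L + 1) * (aC ^ 4 + 1)"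
      using c4 mult_le_mono2[of "kC + 1" "aC ^ 4 + 1" "L + 1"] k1 by linarith
    moreover have "card A' \<le> aC + 2 * (aC ^ 4 + 1)" 
    proof -
      \<comment> \<open>The powers are abstracted to variables, which leaves a linear
        inequality.\<close>
      have "x \<le> y + 2 * (z + 1)" if "x \<le> w + 2" "w \<le> y + 2 * k" "k \<le> z" for x y z w k :: nat
        using that by simp
      from this[OF card' g(10) k1] show ?thesis .
    qed
    \<comment> \<open>The family in preparation becomes the one in use and brings along its starting
      size and its graphs; the new one starts with \<open>card A'\<close> elements, no graphs and
      age 0.\<close>
    ultimately have "generations D n L A' le' E' NS' GC' NC'"
      unfolding eq using c(3,5) al_fresh al_C g(11) cardA card_diffs_empty
      by (intro generationsI[where aS = aC and aC = "card A'" and kC = 0 and \<Gamma>S = \<Gamma>C' and \<Gamma>C = "{}"])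
        (simp_all add: alive_guard[OF A'D] diffs_guard)
    moreover have "supported A' (guard_graph D (\<lambda>_ _. False))" by (rule supported_guard) (simp add: e)
    ultimately show ?thesis
      unfolding engine_inv_def eq threads_ok_guard grel_guard e
      using arithmetic' levels' suppE' ok_ext[OF c(1)] ok_ext[OF fresh_ok] unfolding GC1 eq by blast
  next
    case False
    then have "card (diffs D le' E' GC1) \<noteq> 0" unfolding caught_up_iff C1 using finite_diffs by simp
    \<comment> \<open>Differences remain, so the truncated subtraction of \<open>L + 1\<close> was
      exact, and it outweighs the at most \<open>L\<close> new differences.\<close>
    then have "card (diffs D le' E' GC1) + (kC + 1) \<le> aC ^ 4" using c(7) diffs_trans g(8) by linarith
    moreover have eq: "NS' = guard_threads D n NS1" "GC' = guard_graph D GC1" "NC' = guard_threads D n NC1"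
      using False C1 S1 by simp_all
    moreover have "card \<Gamma>S' \<le> (L + 1) * (aS ^ 4 + 1 + (kC + 1))" using s(4) g(6) by (simp add: algebra_simps)
    ultimately have "generations D n L A' le' E' NS' GC' NC'"
      using c(3,5) s(3,5) al_S al_C card' g(9-12) cardA c4 unfolding eq
      by (intro generationsI[where aS = aS and aC = aC and kC = "kC + 1" and \<Gamma>S = \<Gamma>S' and \<Gamma>C = \<Gamma>C'])
        (simp_all add: alive_guard[OF A'D] diffs_guard)
    moreover have "supported A' (guard_graph D GC1)" by (rule supported_guard[OF c(6)])
    ultimately show ?thesis
      unfolding engine_inv_def eq threads_ok_guard grel_guard
      using arithmetic' levels' suppE' ok_ext[OF s(1)] ok_ext[OF c(1)] unfolding GS1 eq by blast
  qed
qed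

end

text \<open>\<open>usable n 0\<close> holds for no number, so empty relations fulfil the promises of
  two families started with no elements.\<close>

lemma engine_inv_initial:
  assumes "finite D"
  shows "engine_inv D n L {} (\<lambda>_ _. False) (\<lambda>_ _ _ _. False) (\<lambda>_ _ _ _. False) (\<lambda>_ _. False)
    (\<lambda>_ _ _ _ _. False) (\<lambda>_ _. False) (\<lambda>_ _ _ _ _. False)"
proof -
  have "activation {} (\<lambda>_ _. False)" by unfold_locales (auto simp: linorder_on_def)
  then have "arithmetic {} (\<lambda>_ _. False) D n (\<lambda>_ _ _ _. False) (\<lambda>_ _ _ _. False)"
    using assms by (auto simp: arithmetic_def number_line_def number_line_axioms_def arithmetic_axioms_def table_sound_def)
  moreover have "levels {} (\<lambda>_ _. False) n (\<lambda>_ _ _ _. False) (\<lambda>_ _ _ _. False)"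
    by (auto simp: levels_def tables_level_def table_level_def)
  moreover have "alive {} (\<lambda>_ _. False) D n (usable n 0) {} N" for N
    by (auto simp: alive_def usable_def)
  moreover have "diffs D (\<lambda>_ _. False) (\<lambda>_ _. False) (\<lambda>_ _. False) = {}"
    by (auto simp: diffs_def differ_def)
  ultimately show ?thesis
    unfolding engine_inv_def
    by (intro conjI generationsI[where aS = 0 and aC = 0 and kC = 0 and \<Gamma>S = "{}" and \<Gamma>C = "{}"])
      (auto simp: supported_def threads_ok_def thread_dead_def)
qed

subsection \<open>There are enough primes\<close>

text \<open>For \<open>a < 2 ^ (k + 2)\<close> the count of primes to avoid is estimated by
  \<open>a ^ 109\<close>, and the Chebyshev bound costs a factor \<open>400 * k \<le> 2 ^ k\<close>.
  Moduli up to \<open>2 ^ (400 * k)\<close> suffice because \<open>110 * k + 218 < 400 * k\<close>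
  for \<open>k \<ge> 15\<close>; the round value 400 is generous.\<close>

abbreviation num_len :: nat where "num_len \<equiv> 400"

text \<open>\<open>1600 * k + 6\<close> is the room \<open>2 * (2 * (k * num_len) + 2) + 2\<close>
  that \<open>usable\<close> reserves for building the tables, and 15 is the exponent guaranteed by
  the threshold \<open>2 ^ 16\<close>.\<close>

lemma linear_le_power2:
  assumes "15 \<le> (k::nat)"
  shows "1600 * k + 6 \<le> 2 ^ k"
  using assms
proof (induction k rule: nat_induct_at_least)
  case base
  then show ?case by simp
next
  case (Suc k)
  then show ?case by simp
qed

text \<open>Everything is estimated by powers of \<open>a\<close>: \<open>c\<close> by
  \<open>a ^ 5\<close>, the age \<open>kC\<close> by \<open>a ^ 20\<close>, the active elements
  \<open>m\<close> by \<open>a ^ 21\<close>, the graphs plus one by \<open>a ^ 22\<close>, the bits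
  of a determinant of size \<open>m ^ 2\<close> by \<open>a ^ 86\<close>. The summand
  \<open>L + 4\<close> of the threshold makes the factor \<open>L + 2\<close> cost only one
  power.\<close>

lemma enough_primes_arith:
  fixes a c kC m g L :: nat
  assumes big: "2 ^ 16 + L + 4 \<le> a" and c: "c \<le> a + 2 * (a ^ 4 + 1)" and k: "kC \<le> c ^ 4"
    and m: "m \<le> c + 2 * kC" and g: "g \<le> (L + 1) * (a ^ 4 + 1 + kC)"
  shows "\<exists>k. 2 ^ k + 2 * (2 * (k * num_len) + 2) + 2 \<le> a \<and>
    k * num_len * ((m ^ 2 + 1) + (g + 1) * (2 * m ^ 2 * (m ^ 2 + 2))) + 1 < 2 ^ (k * num_len)"
proof -
  have a4: "4 \<le> a" using big by simp
  have pow: "a ^ i \<le> a ^ j" if "i \<le> j" for i j using that a4 by (intro power_increasing) auto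
  have pow4: "4 * a ^ i \<le> a ^ Suc i" for i using a4 by simp
  have "a + 2 * (a ^ 4 + 1) \<le> a ^ 5" using pow4[of 4] pow4[of 0] pow[of 1 4] pow[of 0 4] a4 by simp
  then have c5: "c \<le> a ^ 5" using c by linarith
  have "c ^ 4 \<le> (a ^ 5) ^ 4" by (rule power_mono[OF c5]) simp
  then have kC: "kC \<le> a ^ 20" using k by (simp flip: power_mult)
  have m21: "m \<le> a ^ 21" using m c5 kC pow[of 5 20] pow4[of 20] by simp
  have "m ^ 2 \<le> (a ^ 21) ^ 2" by (rule power_mono[OF m21]) simp
  then have m42: "m ^ 2 \<le> a ^ 42" by (simp flip: power_mult)
  have "a ^ 4 + 1 + kC \<le> a ^ 21" using kC pow[of 4 20] pow[of 0 20] pow4[of 20] by simp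
  then have "(L + 1) * (a ^ 4 + 1 + kC) \<le> (L + 1) * a ^ 21" by (rule mult_le_mono2)
  then have "g + 1 \<le> (L + 1) * a ^ 21 + a ^ 21" using g pow[of 0 21] by simp
  also have "\<dots> = (L + 2) * a ^ 21" by (simp add: algebra_simps)
  also have "\<dots> \<le> a * a ^ 21" using big by (intro mult_right_mono) auto
  also have "a * a ^ 21 = a ^ 22" by (simp flip: power_Suc)
  finally have g22: "g + 1 \<le> a ^ 22" .
  have "2 * m ^ 2 \<le> a ^ 43" using m42 pow4[of 42] by simp
  moreover have "m ^ 2 + 2 \<le> a ^ 43" using m42 pow4[of 42] pow[of 0 42] by simp
  ultimately have "2 * m ^ 2 * (m ^ 2 + 2) \<le> a ^ 43 * a ^ 43" by (rule mult_le_mono)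
  then have "(g + 1) * (2 * m ^ 2 * (m ^ 2 + 2)) \<le> a ^ 22 * (a ^ 43 * a ^ 43)"
    by (rule mult_le_mono[OF g22])
  also have "\<dots> = a ^ 108" by (simp flip: power_add)
  finally have T: "(m ^ 2 + 1) + (g + 1) * (2 * m ^ 2 * (m ^ 2 + 2)) \<le> a ^ 109" (is "?T \<le> _")
    using m42 pow[of 42 108] pow[of 0 108] pow4[of 108] by simp
  obtain l where l: "2 ^ l \<le> a" "a < 2 ^ (l + 1)" using ex_power_ivl1[of 2 a] a4 by auto
  have "16 < l + 1"
  proof (rule ccontr)
    assume "\<not> 16 < l + 1"
    then have "(2::nat) ^ (l + 1) \<le> 2 ^ 16" by (intro power_increasing) auto
    then show False using l(2) big by simp
  qed
  \<comment> \<open>Half of \<open>2 ^ l \<le> a\<close> goes to the base \<open>2 ^ k\<close> of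
    the moduli, the other half to the room for the tables.\<close>
  then obtain k where k: "l = Suc k" "15 \<le> k" by (cases l) auto
  have lin: "1600 * k + 6 \<le> 2 ^ k" by (rule linear_le_power2[OF k(2)])
  have "a ^ 109 \<le> (2 ^ (k + 2)) ^ 109" using l(2) k(1) by (intro power_mono) auto
  then have T2: "?T \<le> 2 ^ ((k + 2) * 109)" using T by (simp only: power_mult)
  have "k * num_len \<le> 2 ^ k" using lin by simp
  then have "k * num_len * ?T \<le> 2 ^ k * 2 ^ ((k + 2) * 109)" by (rule mult_le_mono[OF _ T2])
  also have "\<dots> = 2 ^ (k + (k + 2) * 109)" by (rule power_add[symmetric])
  also have "\<dots> \<le> 2 ^ (k * num_len - 1)" using k(2) by (intro power_increasing) auto
  finally have 1: "k * num_len * ?T \<le> 2 ^ (k * num_len - 1)" .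
  obtain e where e: "k * num_len = Suc (Suc e)"
    using k(2) by (intro that[of "k * num_len - 2"]) auto
  have "(1::nat) < 2 ^ Suc e" by (rule one_less_power) auto
  then have "(2::nat) ^ (k * num_len - 1) + 1 < 2 ^ (k * num_len)" unfolding e by simp
  then have "k * num_len * ?T + 1 < 2 ^ (k * num_len)" using 1 by linarith
  moreover have "2 ^ k + 2 * (2 * (k * num_len) + 2) + 2 \<le> a" using l(1) k(1) lin by simp
  ultimately show ?thesis by blast
qed

text \<open>At least \<open>(N - 1) / K\<close> primes are at most \<open>N\<close>. At most
  \<open>\<theta>\<close> of them are too small and at most \<open>e\<close> divide any given
  \<open>d i\<close>, which leaves one over.\<close>

lemma exists_good_prime:
  assumes N: "N \<le> 2 ^ K" "1 \<le> N" and fin: "finite I" and d: "\<And>i. i \<in> I \<Longrightarrow> d i \<noteq> 0 \<and> \<bar>d i :: int\<bar> \<le> 2 ^ e"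
    and cnt: "K * (\<theta> + card I * e) + 1 < N"
  shows "\<exists>p. prime p \<and> p \<le> N \<and> \<theta> < p \<and> (\<forall>i\<in>I. \<not> int p dvd d i)"
proof (rule ccontr)
  assume no: "\<not> ?thesis"
  define Bad where "Bad = (\<lambda>i. {p::nat. prime p \<and> int p dvd d i})"
  have Bad: "finite (Bad i)" "card (Bad i) \<le> e" if "i \<in> I" for i
    unfolding Bad_def
    by (rule card_prime_divisors_le[OF conjunct1[OF d[OF that]] conjunct2[OF d[OF that]]])+
  have "{p. prime p \<and> p \<le> N} \<subseteq> {1..\<theta>} \<union> (\<Union>i\<in>I. Bad i)"
  proof
    fix p assume p: "p \<in> {p. prime p \<and> p \<le> N}"
    have "p \<le> \<theta> \<or> (\<exists>i\<in>I. int p dvd d i)"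
    proof (cases "p \<le> \<theta>")
      case False
      then have "\<theta> < p" by simp
      then show ?thesis using no p by blast
    qed simp
    then show "p \<in> {1..\<theta>} \<union> (\<Union>i\<in>I. Bad i)" using p prime_ge_1_nat[of p] by (auto simp: Bad_def)
  qed
  then have "card {p. prime p \<and> p \<le> N} \<le> card ({1..\<theta>} \<union> (\<Union>i\<in>I. Bad i))"
    using fin Bad by (intro card_mono) auto
  also have "\<dots> \<le> card {1..\<theta>} + card (\<Union>i\<in>I. Bad i)" by (rule card_Un_le)
  also have "\<dots> \<le> \<theta> + (\<Sum>i\<in>I. card (Bad i))" using card_UN_le[OF fin, of Bad] by simp
  also have "\<dots> \<le> \<theta> + card I * e" using sum_bounded_above[of I "\<lambda>i. card (Bad i)" e] Bad by simp
  finally have "K * card {p. prime p \<and> p \<le> N} \<le> K * (\<theta> + card I * e)" by (rule mult_le_mono2)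
  then show False using card_primes_ge[OF N] cnt by linarith
qed

subsection \<open>Reading off reachability\<close>

text \<open>The entry of a live thread is a residue, and for an unreachable pair it is divisible by
  the modulus; hence it is zero. As this covers every thread, the program may trust whichever shows
  a nonzero entry.\<close>

lemma engine_sound:
  assumes inv: "engine_inv D n L A le add mul E NS GC NC" and xy: "x \<in> Vec 2 D" "y \<in> Vec 2 D"
    and con: "connected_by D le n NS x y"
  shows "(x, y) \<in> (grel D E)\<^sup>*"
proof (rule ccontr)
  assume un: "(x, y) \<notin> (grel D E)\<^sup>*"
  interpret arithmetic A le D n add mul using inv by (simp add: engine_inv_def)
  obtain t \<theta> z where *: "t \<in> Vec n D" "\<theta> \<in> Vec n D" "z \<in> Vec n D" "NS t \<theta> x y z" "\<not> zero D le n z"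
    using con un unfolding connected_by_def by auto
  then have "\<not> thread_dead D n (NS t \<theta>)" using xy unfolding thread_dead_def by blast
  then have "thread_inv A le D n t \<theta> (grel D E) (NS t \<theta>)"
    using inv * unfolding engine_inv_def threads_ok_def by blast
  then obtain f where f: "represents A le D n t (NS t \<theta>) f"
    "inv_mod (int (\<nu> t) + 1) (int (\<nu> \<theta>)) (grel D E) V f" unfolding thread_inv_def by blast
  have "int (\<nu> t) + 1 dvd f x y"
    by (rule inv_mod_unreachable[OF _ finite_Vec[OF finD] xy f(2) un]) simp
  moreover have "0 \<le> f x y" "f x y \<le> int (\<nu> t)" and z: "z \<in> Vec n A" "int (\<nu> z) = f x y"
    using f(1) xy * unfolding represents_def by blast+
  ultimately have "f x y = 0" using zdvd_imp_le[of "int (\<nu> t) + 1" "f x y"] by linarith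
  then show False using z *(5) by (simp add: zero_iff length_Vec)
qed

text \<open>The prime must keep the adjugate entry of the current graph nonzero and every graph
  passed by the family nonsingular. These are few nonzero integers with few bits, and the family
  started with enough elements to offer a prime that divides none of them.\<close>

lemma engine_complete:
  assumes inv: "engine_inv D num_len L A le add mul E NS GC NC"
    and big: "card A \<ge> c + 2 * c ^ 4" "c = a0 + 2 * (a0 ^ 4 + 1)" "a0 = 2 ^ 16 + L + 4"
    and reach: "(x, y) \<in> (grel D E)\<^sup>*"
  shows "connected_by D le num_len NS x y"
proof (cases "x = y")
  case False
  let ?n = num_len
  interpret arithmetic A le D ?n add mul using inv by (simp add: engine_inv_def)
  have sE: "supported A E" using inv by (simp add: engine_inv_def)
  obtain aS aC kC \<Gamma>S \<Gamma>C where g: "finite \<Gamma>S" "\<forall>H\<in>\<Gamma>S \<union> \<Gamma>C. H \<subseteq> Vec 2 A \<times> Vec 2 A"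
     "alive A le D ?n (usable ?n aS) \<Gamma>S NS"
     "card \<Gamma>S \<le> (L + 1) * (aS ^ 4 + 1 + kC)"
     "card (diffs D le E GC) + kC \<le> aC ^ 4" "aC \<le> aS + 2 * (aS ^ 4 + 1)"
     "card A \<le> aC + 2 * kC" "aS \<le> card A"
    using inv unfolding engine_inv_def generations_def by blast
  have kC: "kC \<le> aC ^ 4" using g(5) by simp
  \<comment> \<open>A family started with fewer than \<open>a0\<close> elements is replaced before
    \<open>card A\<close> reaches \<open>c + 2 * c ^ 4\<close>: the bounds on \<open>aC\<close> and
    \<open>kC\<close> are monotone in \<open>aS\<close>.\<close>
  have aS: "2 ^ 16 + L + 4 \<le> aS"
  proof (rule ccontr)
    assume "\<not> ?thesis"
    then have lt: "aS + 1 \<le> a0" using big(3) by simp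
    then have "aS ^ 4 \<le> a0 ^ 4" by (intro power_mono) auto
    have "u + 1 \<le> z" if "x \<le> y" "u \<le> v + 2 * (x + 1)" "z = w + 2 * (y + 1)" "v + 1 \<le> w" for x y z u v w :: nat
      using that by simp
    from this[OF \<open>aS ^ 4 \<le> a0 ^ 4\<close> g(6) big(2) lt] have "aC + 1 \<le> c" .
    moreover from this have "aC ^ 4 \<le> c ^ 4" by (intro power_mono) auto
    ultimately have *: "aC + 1 \<le> c" "aC ^ 4 \<le> c ^ 4" by blast+
    have False if "x + 1 \<le> z" "y \<le> t" "m \<le> x + 2 * k" "k \<le> y" "z + 2 * t \<le> m" for x y z t k m :: nat
      using that by simp
    from this[OF * g(7) kC big(1)] show False .
  qed
  \<comment> \<open>There are \<open>card A ^ 2\<close> active nodes, so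
    \<open>card A ^ 2 + 1\<close> exceeds all degrees, in the current graph as in every graph
    passed.\<close>
  let ?W = "Vec 2 A" and ?\<theta> = "card A ^ 2 + 1" and ?e = "2 * card A ^ 2 * (card A ^ 2 + 2)"
  have W: "finite ?W" "card ?W = card A ^ 2" "?W \<subseteq> V"
    using fin AD by (auto simp: finite_Vec card_Vec intro: Vec_mono[THEN subsetD])
  obtain k where k: "2 ^ k + 2 * (2 * (k * ?n) + 2) + 2 \<le> aS"
    "k * ?n * (?\<theta> + (card \<Gamma>S + 1) * ?e) + 1 < 2 ^ (k * ?n)"
    using enough_primes_arith[OF aS g(6) kC g(7,4)] by blast
  have gE: "grel D E \<subseteq> ?W \<times> ?W" by (rule grel_supported[OF sE AD])
  obtain z where "(x, z) \<in> grel D E" using reach False by (blast elim: converse_rtranclE)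
  moreover obtain z' where "(z', y) \<in> grel D E" using reach False by (blast elim: rtranclE)
  ultimately have xy: "x \<in> ?W" "y \<in> ?W" using gE by blast+
  have \<theta>: "int ?\<theta> = int (card ?W) + 1" using W(2) by simp
  define PP where "PP = (\<lambda>H d Y. d \<noteq> 0 \<and> \<bar>d :: int\<bar> \<le> 2 ^ ?e \<and>
    (\<forall>i\<in>?W. \<forall>k\<in>?W. (\<Sum>j\<in>?W. Y i j * Mx (int ?\<theta>) H j k) = (if i = k then d else 0)) \<and>
    (\<forall>i\<in>?W. \<forall>k\<in>?W. (i, k) \<in> H\<^sup>* \<longrightarrow> Y i k \<noteq> 0) \<and>
    (\<forall>i\<in>?W. \<forall>k\<in>?W. \<bar>Y i k\<bar> \<le> \<bar>d\<bar>))"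
  have "\<exists>d Y. PP H d Y" if "H \<subseteq> ?W \<times> ?W" for H
    using dominant_adjugate[OF W(1) that \<theta>] unfolding W(2) PP_def .
  moreover have "\<forall>H\<in>insert (grel D E) \<Gamma>S. H \<subseteq> ?W \<times> ?W" using g(2) gE by blast
  ultimately have "\<forall>H\<in>insert (grel D E) \<Gamma>S. \<exists>d Y. PP H d Y" by blast
  then obtain d Y where PP: "\<forall>H\<in>insert (grel D E) \<Gamma>S. PP H (d H) (Y H)" by metis
  have d: "d H \<noteq> 0 \<and> \<bar>d H\<bar> \<le> 2 ^ ?e" if "H \<in> insert (grel D E) \<Gamma>S" for H
    using PP that unfolding PP_def by blast
  have Y: "(\<forall>i\<in>?W. \<forall>k\<in>?W. (\<Sum>j\<in>?W. Y H i j * Mx (int ?\<theta>) H j k) = (if i = k then d H else 0)) \<and>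
      (\<forall>i\<in>?W. \<forall>k\<in>?W. (i, k) \<in> H\<^sup>* \<longrightarrow> Y H i k \<noteq> 0) \<and> (\<forall>i\<in>?W. \<forall>k\<in>?W. \<bar>Y H i k\<bar> \<le> \<bar>d H\<bar>)"
    if "H \<in> insert (grel D E) \<Gamma>S" for H
    using PP that unfolding PP_def by blast
  \<comment> \<open>\<open>Some H\<close> stands for the determinant of a passed graph,
    \<open>None\<close> for the adjugate entry whose residue decides reachability.\<close>
  define dd where "dd = (\<lambda>i. case i of Some H \<Rightarrow> d H | None \<Rightarrow> Y (grel D E) x y)"
  have YE: "Y (grel D E) x y \<noteq> 0" "\<bar>Y (grel D E) x y\<bar> \<le> \<bar>d (grel D E)\<bar>"
    using Y[of "grel D E"] xy reach by blast+
  have dd: "dd i \<noteq> 0 \<and> \<bar>dd i\<bar> \<le> 2 ^ ?e" if "i \<in> insert None (Some ` \<Gamma>S)" for i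
  proof (cases i)
    case None
    then show ?thesis using YE d[of "grel D E"] by (auto simp: dd_def)
  next
    case (Some H)
    then show ?thesis using that d[of H] by (auto simp: dd_def)
  qed
  have cI: "card (insert None (Some ` \<Gamma>S)) = card \<Gamma>S + 1" using g(1) by (simp add: card_image)
  have "\<exists>p. prime p \<and> p \<le> 2 ^ (k * ?n) \<and> ?\<theta> < p \<and> (\<forall>i\<in>insert None (Some ` \<Gamma>S). \<not> int p dvd dd i)"
    by (rule exists_good_prime[of _ "k * ?n" _ dd ?e]) (use k(2) cI g(1) dd in auto)
  then obtain p where p: "prime p" "p \<le> 2 ^ (k * ?n)" "?\<theta> < p" "\<not> int p dvd Y (grel D E) x y"
    "\<And>H. H \<in> \<Gamma>S \<Longrightarrow> \<not> int p dvd d H"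
    by (auto simp: dd_def)
  \<comment> \<open>The tuple for a modulus denotes the modulus minus one.\<close>
  have p1: "p - 1 < (2 ^ k) ^ ?n" using p(1,2) prime_gt_0_nat[OF p(1)] by (simp add: power_mult)
  have use: "usable ?n aS (p - 1)"
    unfolding usable_def using k(1) p1
    by (intro exI[of _ "2 ^ k"] exI[of _ "k * ?n"]) (simp add: power_mult)
  have lessA: "p - 1 < card A ^ ?n" by (rule usable_le[OF use]) (use g(8) in simp)
  have "\<nu> ` Vec ?n A = {..<card A ^ ?n}" by (rule num_image) (auto dest: le_in)
  then have "i \<in> \<nu> ` Vec ?n A" if "i < card A ^ ?n" for i using that by simp
  then have ex: "\<exists>t\<in>Vec ?n A. \<nu> t = i" if "i < card A ^ ?n" for i using that by blast
  obtain t where t: "t \<in> Vec ?n A" "\<nu> t = p - 1" using ex[OF lessA] by blast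
  have "?\<theta> < card A ^ ?n" using lessA p(3) by linarith
  then obtain th where th: "th \<in> Vec ?n A" "\<nu> th = ?\<theta>" using ex by blast
  have tp: "\<nu> t + 1 = p" "int (\<nu> t) + 1 = int p" using t(2) prime_gt_0_nat[OF p(1)] by auto
  have ip: "prime (int p)" using p(1) by (simp only: prime_nat_int_transfer)
  have \<theta>p: "\<not> int p dvd int ?\<theta>" using p(3) nat_dvd_not_less[of ?\<theta> p] by (simp only: of_nat_dvd_iff) simp
  have ns: "nonsingular (int p) (int ?\<theta>) H V" if "H \<in> \<Gamma>S" for H
  proof (rule dominant_nonsingular[OF W(1) _ finite_Vec[OF finD] W(3) _ ip _ \<theta>p])
    show "H \<subseteq> ?W \<times> ?W" using g(2) that by blast
    show "\<not> int p dvd d H" by (rule p(5)[OF that])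
    show "(\<Sum>j\<in>?W. Y H i j * Mx (int ?\<theta>) H j k) = (if i = k then d H else 0)" if "i \<in> ?W" "k \<in> ?W" for i k
      using Y[of H] \<open>H \<in> \<Gamma>S\<close> that by blast
  qed
  have "\<forall>H\<in>\<Gamma>S. nonsingular (int (\<nu> t) + 1) (int (\<nu> th)) H V" unfolding tp(2) th(2) using ns by blast
  moreover have "prime (\<nu> t + 1)" unfolding tp(1) by (rule p(1))
  moreover have "\<nu> th \<le> \<nu> t" unfolding th(2) t(2) using p(3) by linarith
  moreover have "0 < \<nu> th" unfolding th(2) by simp
  moreover have "usable ?n aS (\<nu> t)" unfolding t(2) by (rule use)
  ultimately have "\<not> thread_dead D ?n (NS t th)" using g(3) t(1) th(1) unfolding alive_def by blast
  then have "thread_inv A le D ?n t th (grel D E) (NS t th)"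
    using inv VecA[OF t(1)] VecA[OF th(1)] unfolding engine_inv_def threads_ok_def by blast
  then obtain f where f: "represents A le D ?n t (NS t th) f" "inv_mod (int p) (int ?\<theta>) (grel D E) V f"
    unfolding thread_inv_def tp(2) th(2) by blast
  have nz: "\<not> int p dvd f x y"
    using Y[of "grel D E"]
    by (intro dominant_inv_mod_nonzero[where Y = "Y (grel D E)" and d = "d (grel D E)", OF W(1) gE finite_Vec[OF finD] W(3) xy _ p(4) f(2)]) blast
  have xyV: "x \<in> V" "y \<in> V" using xy W(3) by auto
  have fr: "0 \<le> f x y" "f x y \<le> int (\<nu> t)" using f(1) xyV unfolding represents_def by blast+
  then have "f x y mod (int (\<nu> t) + 1) = f x y" by (intro mod_pos_pos_trivial) auto
  then obtain z where z: "z \<in> Vec ?n A" "int (\<nu> z) = f x y" using rep_exists[OF t(1), of "f x y"] by auto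
  then have "NS t th x y z" using f(1) xyV VecA[OF z(1)] unfolding represents_def by blast
  moreover have "\<not> zero D le ?n z"
  proof
    assume "zero D le ?n z"
    then have "\<nu> z = 0" using z(1) by (simp add: zero_iff length_Vec)
    then have "f x y = 0" using z(2) by simp
    then show False using nz by simp
  qed
  ultimately show ?thesis unfolding connected_by_def using VecA t(1) th(1) z(1) by blast
qed (simp add: connected_by_def)

subsection \<open>Programs from definable updates\<close>

text \<open>The changed tuple is passed to the updates as the interpretation of two fresh constant symbols,
  which are then turned into the variables \<open>0\<close> and \<open>1\<close>.\<close>

fun shift_term :: "nat \<Rightarrow> nat \<Rightarrow> fo_term \<Rightarrow> fo_term" where
  "shift_term c0 c1 (Var x) = Var (x + 2)"
| "shift_term c0 c1 (Const c) = (if c = c0 then Var 0 else if c = c1 then Var 1 else Const c)"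

fun shift_fo :: "nat \<Rightarrow> nat \<Rightarrow> 's fo \<Rightarrow> 's fo" where
  "shift_fo c0 c1 (Rel s ts) = Rel s (map (shift_term c0 c1) ts)"
| "shift_fo c0 c1 (Eq t u) = Eq (shift_term c0 c1 t) (shift_term c0 c1 u)"
| "shift_fo c0 c1 (Neg \<phi>) = Neg (shift_fo c0 c1 \<phi>)"
| "shift_fo c0 c1 (Conj \<phi> \<psi>) = Conj (shift_fo c0 c1 \<phi>) (shift_fo c0 c1 \<psi>)"
| "shift_fo c0 c1 (Exists x \<phi>) = Exists (x + 2) (shift_fo c0 c1 \<phi>)"

lemma term_val_shift:
  assumes "c0 \<noteq> c1"
  shows "term_val \<kappa> \<sigma> (shift_term c0 c1 t) = term_val (\<kappa>(c0 := \<sigma> 0, c1 := \<sigma> 1)) (\<lambda>x. \<sigma> (x + 2)) t"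
  using assms by (cases t) auto

lemma holds_shift:
  assumes "c0 \<noteq> c1"
  shows "holds D \<kappa> S \<sigma> (shift_fo c0 c1 \<phi>) \<longleftrightarrow> holds D (\<kappa>(c0 := \<sigma> 0, c1 := \<sigma> 1)) S (\<lambda>x. \<sigma> (x + 2)) \<phi>"
proof (induction \<phi> arbitrary: \<sigma>)
  case (Rel s ts)
  have "map (term_val \<kappa> \<sigma> \<circ> shift_term c0 c1) ts = map (term_val (\<kappa>(c0 := \<sigma> 0, c1 := \<sigma> 1)) (\<lambda>x. \<sigma> (x + 2))) ts"
    by (rule map_cong) (simp_all only: o_def term_val_shift[OF assms])
  then show ?case by (simp only: shift_fo.simps holds.simps map_map)
next
  case (Eq t u)
  show ?case by (simp only: shift_fo.simps holds.simps term_val_shift[OF assms])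
next
  case (Exists x \<phi>)
  have eq: "(\<lambda>y. (\<sigma>(x + 2 := d)) (y + 2)) = (\<lambda>y. \<sigma> (y + 2))(x := d)" "(\<sigma>(x + 2 := d)) 0 = \<sigma> 0"
    "(\<sigma>(x + 2 := d)) 1 = \<sigma> 1" for d by auto
  have "holds D \<kappa> S (\<sigma>(x + 2 := d)) (shift_fo c0 c1 \<phi>) \<longleftrightarrow>
      holds D (\<kappa>(c0 := \<sigma> 0, c1 := \<sigma> 1)) S ((\<lambda>y. \<sigma> (y + 2))(x := d)) \<phi>" for d
    using Exists.IH[of "\<sigma>(x + 2 := d)"] by (simp only: eq)
  then show ?case by (simp only: shift_fo.simps holds.simps)
qed auto

lemma wf_shift:
  "wf_fo sig (insert c0 (insert c1 C)) X \<phi> \<Longrightarrow> wf_fo sig C (insert 0 (insert 1 ((\<lambda>x. x + 2) ` X))) (shift_fo c0 c1 \<phi>)"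
proof (induction \<phi> arbitrary: X)
  case (Rel s ts)
  have "wf_term C (insert 0 (insert 1 ((\<lambda>x. x + 2) ` X))) (shift_term c0 c1 t)"
    if "wf_term (insert c0 (insert c1 C)) X t" for t using that by (cases t) auto
  then show ?case using Rel by auto
next
  case (Eq t u)
  have "wf_term C (insert 0 (insert 1 ((\<lambda>x. x + 2) ` X))) (shift_term c0 c1 t)"
    if "wf_term (insert c0 (insert c1 C)) X t" for t using that by (cases t) auto
  then show ?case using Eq by auto
next
  case (Exists x \<phi>)
  then have "wf_fo sig C (insert 0 (insert 1 ((\<lambda>x. x + 2) ` insert x X))) (shift_fo c0 c1 \<phi>)"
    using Exists.IH[of "insert x X"] by (simp only: wf_fo.simps)
  then show ?case by (simp add: insert_commute)
qed auto

lemma update_formula: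
  assumes P: "definable sig (insert c0 (insert c1 C)) k P" and c: "c0 \<noteq> c1"
  shows "\<exists>\<phi>. wf_fo sig C {..<2 + k} \<phi> \<and> (\<forall>D \<kappa> S a b. length a = 2 \<longrightarrow> length b = k \<longrightarrow>
    (holds D \<kappa> S (\<lambda>x. (a @ b) ! x) \<phi> \<longleftrightarrow> P (D, \<kappa>(c0 := a ! 0, c1 := a ! 1), S) b))"
proof -
  obtain \<phi> where \<phi>: "wf_fo sig (insert c0 (insert c1 C)) {..<k} \<phi>"
     "\<And>D \<kappa> S \<sigma>. holds D \<kappa> S \<sigma> \<phi> \<longleftrightarrow> P (D, \<kappa>, S) (map \<sigma> [0..<k])"
    using P unfolding definable_def by blast
  have "insert 0 (insert 1 ((\<lambda>x. x + 2) ` {..<k})) \<subseteq> {..<2 + k}" by auto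
  then have "wf_fo sig C {..<2 + k} (shift_fo c0 c1 \<phi>)" using wf_shift[OF \<phi>(1)] wf_fo_mono by blast
  moreover have "holds D \<kappa> S (\<lambda>x. (a @ b) ! x) (shift_fo c0 c1 \<phi>) \<longleftrightarrow> P (D, \<kappa>(c0 := a ! 0, c1 := a ! 1), S) b"
    if "length a = 2" "length b = k" for D \<kappa> S a b
  proof -
    have "map (\<lambda>x. (a @ b) ! (x + 2)) [0..<k] = b"
      using that by (intro nth_equalityI) (auto simp: nth_append)
    moreover have "(a @ b) ! 0 = a ! 0" "(a @ b) ! 1 = a ! 1" using that by (auto simp: nth_append)
    ultimately show ?thesis unfolding holds_shift[OF c] \<phi>(2) by simp
  qed
  ultimately show ?thesis by blast
qed

lemma op_arity_const: "op_arity (\<lambda>_. 2) \<delta> = 2"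
  by (cases \<delta>) auto

lemma program_exists:
  fixes P :: "'r change_op \<Rightarrow> nat \<Rightarrow> ('r + nat) model \<Rightarrow> nat list \<Rightarrow> bool"
  assumes P: "\<And>\<delta> i. i < length as \<Longrightarrow>
      definable (signature (\<lambda>_. 2) as) (insert c0 (insert c1 C)) (as ! i) (P \<delta> i)"
    and c: "c0 \<noteq> c1" and ans: "ans < length as" "as ! ans = m"
  shows "\<exists>prog. wf_program (\<lambda>_. 2) C \<Delta> m prog \<and> answer prog = ans \<and>
    (\<forall>D \<kappa> \<delta> a I A. length a = 2 \<longrightarrow> step prog D \<kappa> (\<delta>, a) (I, A) = (apply_change (\<delta>, a) I,
       \<lambda>i. if i < length as then {b. length b = as ! i \<and> set b \<subseteq> D \<and>
          P \<delta> i (D, \<kappa>(c0 := a ! 0, c1 := a ! 1), case_sum I A) b} else {}))"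
proof -
  have "\<forall>\<delta> i. \<exists>\<phi>. i < length as \<longrightarrow> wf_fo (signature (\<lambda>_. 2) as) C {..<2 + as ! i} \<phi> \<and>
    (\<forall>D \<kappa> S a b. length a = 2 \<longrightarrow> length b = as ! i \<longrightarrow>
      (holds D \<kappa> S (\<lambda>x. (a @ b) ! x) \<phi> \<longleftrightarrow> P \<delta> i (D, \<kappa>(c0 := a ! 0, c1 := a ! 1), S) b))"
    using update_formula[OF P c] by blast
  then obtain \<phi> where wf: "\<And>\<delta> i. i < length as \<Longrightarrow> wf_fo (signature (\<lambda>_. 2) as) C {..<2 + as ! i} (\<phi> \<delta> i)"
    and \<phi>: "\<And>\<delta> i D \<kappa> S a b. i < length as \<Longrightarrow> length a = 2 \<Longrightarrow> length b = as ! i \<Longrightarrow>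
      (holds D \<kappa> S (\<lambda>x. (a @ b) ! x) (\<phi> \<delta> i) \<longleftrightarrow> P \<delta> i (D, \<kappa>(c0 := a ! 0, c1 := a ! 1), S) b)"
    by metis
  define prog where "prog = \<lparr>aux_arities = as, update = \<phi>, answer = ans\<rparr>"
  have "wf_program (\<lambda>_. 2) C \<Delta> m prog"
    using wf ans by (simp add: wf_program_def prog_def op_arity_const)
  moreover have "step prog D \<kappa> (\<delta>, a) (I, A) = (apply_change (\<delta>, a) I,
       \<lambda>i. if i < length as then {b. length b = as ! i \<and> set b \<subseteq> D \<and>
          P \<delta> i (D, \<kappa>(c0 := a ! 0, c1 := a ! 1), case_sum I A) b} else {})" if "length a = 2" for D \<kappa> \<delta> a I A
    using that by (auto simp: prog_def \<phi> fun_eq_iff)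
  ultimately show ?thesis by (intro exI[of _ prog]) (simp add: prog_def)
qed

subsection \<open>Coloured graphs\<close>

text \<open>A node of a coloured graph is a pair of an element and a colour below \<open>q\<close>. A tuple \<open>(u, v)\<close> of
  \<open>r\<close> yields an edge from \<open>(u, i)\<close> to \<open>(v, j)\<close> for \<open>(r, i, j) \<in> F\<close>, and from \<open>(v, i)\<close> to \<open>(u, j)\<close>
  for \<open>(r, i, j) \<in> B\<close>.\<close>

definition col_edge :: "('r \<times> nat \<times> nat) set \<Rightarrow> ('r \<times> nat \<times> nat) set \<Rightarrow> 'r input \<Rightarrow> nat \<Rightarrow> nat \<Rightarrow> nat \<Rightarrow> nat \<Rightarrow> bool" where
  "col_edge F B I i j u v \<longleftrightarrow>
     (\<exists>r\<in>UNIV. (r, i, j) \<in> F \<and> [u, v] \<in> I r) \<or> (\<exists>r\<in>UNIV. (r, i, j) \<in> B \<and> [v, u] \<in> I r)"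

definition col_graph :: "nat set \<Rightarrow> nat \<Rightarrow> ('r \<times> nat \<times> nat) set \<Rightarrow> ('r \<times> nat \<times> nat) set \<Rightarrow> 'r input \<Rightarrow>
    ((nat \<times> nat) \<times> nat \<times> nat) set" where
  "col_graph D q F B I = {((u, i), (v, j)). u \<in> D \<and> v \<in> D \<and> i < q \<and> j < q \<and> col_edge F B I i j u v}"

text \<open>The colour \<open>i\<close> is encoded by the active element number \<open>i\<close>.\<close>

fun nth_active :: "nat set \<Rightarrow> (nat \<Rightarrow> nat \<Rightarrow> bool) \<Rightarrow> nat \<Rightarrow> nat \<Rightarrow> bool" where
  "nth_active D le 0 w \<longleftrightarrow> zero D le 1 [w]"
| "nth_active D le (Suc i) w \<longleftrightarrow> (\<exists>x\<in>D. nth_active D le i x \<and> next_num D le 1 [x] [w])"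

text \<open>A coloured node is the pair of its element and the element naming its colour. The graph
  stays empty until more than \<open>q\<close> elements are active, as colours may lack a name
  before. When it is switched on, the active domain is still so small that only boundedly many pairs
  change.\<close>

definition node_graph ::
  "nat set \<Rightarrow> nat \<Rightarrow> ('r \<times> nat \<times> nat) set \<Rightarrow> ('r \<times> nat \<times> nat) set \<Rightarrow> (nat \<Rightarrow> nat \<Rightarrow> bool) \<Rightarrow> 'r input \<Rightarrow> graph" where
  "node_graph D q F B le I x y \<longleftrightarrow> length x = 2 \<and> length y = 2 \<and> (\<exists>a\<in>D. nth_active D le q a) \<and>
     (\<exists>i<q. \<exists>j<q. nth_active D le i (x ! 1) \<and> nth_active D le j (y ! 1) \<and> col_edge F B I i j (x ! 0) (y ! 0))"

fun walk :: "nat set \<Rightarrow> nat \<Rightarrow> ('r \<times> nat \<times> nat) set \<Rightarrow> ('r \<times> nat \<times> nat) set \<Rightarrow> 'r input \<Rightarrow>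
    nat \<Rightarrow> nat \<Rightarrow> nat \<Rightarrow> nat \<Rightarrow> nat \<Rightarrow> bool" where
  "walk D q F B I 0 i j u v \<longleftrightarrow> i = j \<and> u = v"
| "walk D q F B I (Suc k) i j u v \<longleftrightarrow> walk D q F B I k i j u v \<or>
     (\<exists>l<q. \<exists>w\<in>D. walk D q F B I k i l u w \<and> col_edge F B I l j w v)"

text \<open>The algebraic answer is guaranteed once more than \<open>n0\<close> elements are active.
  Up to then the coloured graph has at most \<open>(n0 * q) ^ 2\<close> edges, which bounds the
  walks to be tried by a fixed formula.\<close>

definition reach_answer ::
  "nat set \<Rightarrow> nat \<Rightarrow> ('r \<times> nat \<times> nat) set \<Rightarrow> ('r \<times> nat \<times> nat) set \<Rightarrow> nat \<Rightarrow> nat \<Rightarrow>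
    (nat \<Rightarrow> nat \<Rightarrow> bool) \<Rightarrow> 'r input \<Rightarrow> threads \<Rightarrow> nat \<Rightarrow> nat \<Rightarrow> nat \<Rightarrow> nat \<Rightarrow> bool" where
  "reach_answer D q F B n0 n le I N i j u v \<longleftrightarrow>
     (if \<exists>a\<in>D. nth_active D le n0 a
      then i = j \<and> u = v \<or> (\<exists>w\<in>D. \<exists>w'\<in>D. nth_active D le i w \<and> nth_active D le j w' \<and>
        connected_by D le n N [u, w] [v, w'])
      else walk D q F B I ((n0 * q) ^ 2) i j u v)"

definition definable_input where
  "definable_input sig C I \<longleftrightarrow> (\<forall>k t r. vec_term C k 2 t \<longrightarrow> definable sig C k (\<lambda>M e. t M e \<in> I M r))"

lemma definable_inputD: "definable_input sig C I \<Longrightarrow> vec_term C k 2 t \<Longrightarrow> definable sig C k (\<lambda>M e. t M e \<in> I M r)"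
  by (auto simp: definable_input_def)

lemma vec_term_pair: "elem_term C k x \<Longrightarrow> elem_term C k y \<Longrightarrow> vec_term C k 2 (\<lambda>M e. [x M e, y M e])"
  using vec_term_Cons[OF _ vec_term_Cons[OF _ vec_term_Nil], of C k x y] by (simp add: numeral_2_eq_2)

lemma elem_term_take: "elem_term C k x \<Longrightarrow> elem_term C (k + m) (\<lambda>M e. x M (take k e))"
  by (rule vec_term_take)

lemma definable_nth_active:
  assumes "definable_order sig C le" "elem_term C k x"
  shows "definable sig C k (\<lambda>M e. nth_active (fst M) (le M) i (x M e))"
  using assms(2)
proof (induction i arbitrary: k x)
  case 0
  then show ?case using definable_zero[OF assms(1), of k 1 "\<lambda>M e. [x M e]"] by simp
next
  case (Suc i)
  have "definable sig C k (\<lambda>M e. \<exists>y\<in>fst M. nth_active (fst M) (le M) i y \<and> next_num (fst M) (le M) 1 [y] [x M e])"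
    by (intro definable_Ex_elem definable_Conj Suc.IH elem_term_last
        definable_next_num[OF assms(1)] elem_term_take Suc.prems)
  then show ?case by simp
qed

lemma definable_col_edge:
  fixes I :: "'s model \<Rightarrow> 'r::finite input"
  assumes "definable_input sig C I" "elem_term C k u" "elem_term C k v"
  shows "definable sig C k (\<lambda>M e. col_edge F B (I M) i j (u M e) (v M e))"
  unfolding col_edge_def
  by (intro definable_Disj definable_Ex_finite definable_Conj definable_bool
      definable_inputD[OF assms(1)] vec_term_pair assms(2,3) finite_UNIV)

lemma definable_node_graph:
  fixes I :: "'s model \<Rightarrow> 'r::finite input"
  assumes "definable_order sig C le" "definable_input sig C I"
  shows "definable_graph sig C (\<lambda>M. node_graph (fst M) q F B (le M) (I M))"
  unfolding definable_graph_def
proof (intro allI impI)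
  fix k and x y :: "'s model \<Rightarrow> nat list \<Rightarrow> nat list" assume xy: "vec_term C k 2 x" "vec_term C k 2 y"
  have el: "elem_term C k (\<lambda>M e. x M e ! 0)" "elem_term C k (\<lambda>M e. x M e ! 1)"
    "elem_term C k (\<lambda>M e. y M e ! 0)" "elem_term C k (\<lambda>M e. y M e ! 1)"
    by (rule elem_term_nth[OF xy(1)] elem_term_nth[OF xy(2)], simp)+
  have "definable sig C k (\<lambda>M e. (\<exists>a\<in>fst M. nth_active (fst M) (le M) q a) \<and>
     (\<exists>i<q. \<exists>j<q. nth_active (fst M) (le M) i (x M e ! 1) \<and> nth_active (fst M) (le M) j (y M e ! 1) \<and>
        col_edge F B (I M) i j (x M e ! 0) (y M e ! 0)))"
    by (intro definable_Conj definable_Ex_elem definable_Ex_less definable_nth_active[OF assms(1)]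
        definable_col_edge[OF assms(2)] el elem_term_last)
  then show "definable sig C k (\<lambda>M e. node_graph (fst M) q F B (le M) (I M) (x M e) (y M e))"
    by (rule definable_cong) (simp add: node_graph_def length_vec_term[OF xy(1)] length_vec_term[OF xy(2)])
qed

lemma definable_walk:
  fixes I :: "'s model \<Rightarrow> 'r::finite input"
  assumes "definable_input sig C I" "elem_term C k u" "elem_term C k v"
  shows "definable sig C k (\<lambda>M e. walk (fst M) q F B (I M) m i j (u M e) (v M e))"
  using assms(2,3)
proof (induction m arbitrary: k j u v)
  case 0
  have "definable sig C k (\<lambda>M e. i = j \<and> u M e = v M e)"
    by (intro definable_Conj definable_bool definable_elem_eq 0)
  then show ?case by simp
next
  case (Suc m)
  have "definable sig C k (\<lambda>M e. walk (fst M) q F B (I M) m i j (u M e) (v M e) \<or>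
     (\<exists>l<q. \<exists>w\<in>fst M. walk (fst M) q F B (I M) m i l (u M e) w \<and> col_edge F B (I M) l j w (v M e)))"
    by (intro definable_Disj definable_Ex_less definable_Ex_elem definable_Conj Suc.IH
        definable_col_edge[OF assms(1)] elem_term_take elem_term_last Suc.prems)
  then show ?case by simp
qed

lemma definable_reach_answer:
  fixes I :: "'s model \<Rightarrow> 'r::finite input"
  assumes "definable_order sig C le" "definable_input sig C I" "definable_threads sig C n N"
  shows "definable_order sig C (\<lambda>M. reach_answer (fst M) q F B n0 n (le M) (I M) (N M) i j)"
  unfolding definable_order_def reach_answer_def
  by (intro allI impI definable_If definable_Disj definable_Conj definable_bool definable_Ex_elem definable_elem_eq
      definable_nth_active[OF assms(1)] definable_graphD[OF definable_connected_by[OF assms(1,3)]]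
      definable_walk[OF assms(2)] vec_term_pair elem_term_take elem_term_last)

text \<open>Update formulas see only the old state, so the new input is expressed through the old
  one and the changed tuple.\<close>

lemma definable_apply_change:
  fixes I :: "'s model \<Rightarrow> 'r input" and a :: "'s model \<Rightarrow> nat list"
  assumes I: "definable_input sig C I" and a: "\<And>k. vec_term C k 2 (\<lambda>M e. a M)"
  shows "definable_input sig C (\<lambda>M. apply_change (\<delta>, a M) (I M))"
  unfolding definable_input_def
proof (intro allI impI)
  fix k r and t :: "'s model \<Rightarrow> nat list \<Rightarrow> nat list" assume t: "vec_term C k 2 t"
  note intros = definable_Disj definable_Conj definable_Neg definable_If definable_bool definable_inputD[OF I]
    definable_vec_eq[of C _ 2] t a
  show "definable sig C k (\<lambda>M e. t M e \<in> apply_change (\<delta>, a M) (I M) r)"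
  proof (cases \<delta>)
    case (Ins r')
    have "definable sig C k (\<lambda>M e. t M e \<in> I M r \<or> (r = r' \<and> t M e = a M))" by (intro intros)
    then show ?thesis by (rule definable_cong) (auto simp: Ins)
  next
    case (Del r')
    have "definable sig C k (\<lambda>M e. t M e \<in> I M r \<and> \<not> (r = r' \<and> t M e = a M))" by (intro intros)
    then show ?thesis by (rule definable_cong) (auto simp: Del)
  next
    case (Relabel r1 r2)
    have "definable sig C k (\<lambda>M e. if a M \<in> I M r1 then r = r2 \<and> t M e = a M \<or> (t M e \<in> I M r \<and> \<not> (r = r1 \<and> t M e = a M))
        else t M e \<in> I M r)" by (intro intros)
    then show ?thesis by (rule definable_cong) (auto simp: Relabel Let_def)
  qed
qed

section \<open>Activation of elements and the effect of a change on the node graph\<close>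

lemma apply_change_mem: "w \<noteq> a \<Longrightarrow> w \<in> apply_change (\<delta>, a) I r \<longleftrightarrow> w \<in> I r"
  by (cases \<delta>) (auto simp: Let_def)

lemma activation_activate:
  assumes "activation A le"
  shows "activation (insert a A) (activate le a)" "y \<in> A \<Longrightarrow> activate le a x y \<longleftrightarrow> le x y"
proof -
  interpret activation A le by (rule assms)
  have aa: "le a a \<longleftrightarrow> a \<in> A" using le_in le_refl by blast
  have xx: "le x x \<longleftrightarrow> x \<in> A" for x using le_in le_refl by blast
  show "activation (insert a A) (activate le a)"
  proof
    show "finite (insert a A)" using fin by simp
    show "linorder_on (insert a A) (activate le a)"
      unfolding linorder_on_def activate_def aa xx
    proof (intro conjI allI impI ballI)
      fix x y z
      assume "le x y \<or> a \<notin> A \<and> y = a \<and> (x \<in> A \<or> x = a)" "le y z \<or> a \<notin> A \<and> z = a \<and> (y \<in> A \<or> y = a)"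
      then show "le x z \<or> a \<notin> A \<and> z = a \<and> (x \<in> A \<or> x = a)" using le_trans le_in by blast
    next
      fix x y
      assume "le x y \<or> a \<notin> A \<and> y = a \<and> (x \<in> A \<or> x = a)" "le y x \<or> a \<notin> A \<and> x = a \<and> (y \<in> A \<or> y = a)"
      then show "x = y" using le_antisym le_in by blast
    qed (use le_in le_refl le_total in blast)+
  qed
  show "y \<in> A \<Longrightarrow> activate le a x y \<longleftrightarrow> le x y" unfolding activate_def aa by blast
qed

lemma nth_active_iff:
  assumes "number_line A le D"
  shows "nth_active D le i w \<longleftrightarrow> w \<in> A \<and> num A le 1 [w] = i"
proof -
  interpret number_line A le D 1 by (rule assms)
  have v: "[x] \<in> Vec 1 A \<longleftrightarrow> x \<in> A" for x by (simp add: Vec_def)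
  show ?thesis
  proof (induction i arbitrary: w)
    case 0
    then show ?case using zero_iff[of "[w]"] v by simp
  next
    case (Suc i)
    have nx: "next_num D le 1 [x] [w] \<longleftrightarrow> x \<in> A \<and> w \<in> A \<and> num A le 1 [w] = Suc (num A le 1 [x])" for x
      using next_num_iff[of "[x]" "[w]"] v by simp
    have "\<exists>x\<in>A. num A le 1 [x] = i" if wA: "w \<in> A" and wi: "num A le 1 [w] = Suc i"
    proof -
      have wV: "[w] \<in> Vec 1 A" using wA v by simp
      have le: "i \<le> num A le 1 [w]" using wi by simp
      then obtain z where z: "z \<in> Vec 1 A" "num A le 1 z = i" using num_exists[OF le wV] by blast
      obtain x where "z = [x]" using z(1) by (auto simp: Vec_def length_Suc_conv)
      then show ?thesis using z v by auto
    qed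
    moreover have "nth_active D le (Suc i) w \<longleftrightarrow> (\<exists>x\<in>D. (x \<in> A \<and> num A le 1 [x] = i) \<and> next_num D le 1 [x] [w])"
      by (simp only: nth_active.simps Suc.IH)
    ultimately show ?case unfolding nx using AD by auto
  qed
qed

lemma nth_active_exists:
  assumes "number_line A le D"
  shows "(\<exists>w\<in>D. nth_active D le i w) \<longleftrightarrow> i < card A"
proof -
  interpret number_line A le D 1 by (rule assms)
  have im: "num A le 1 ` Vec 1 A = {..<card A ^ 1}" by (rule num_image) (auto dest: le_in)
  have V1: "Vec 1 A = (\<lambda>x. [x]) ` A" by (auto simp: Vec_def length_Suc_conv)
  have "(\<exists>w\<in>D. nth_active D le i w) \<longleftrightarrow> i \<in> num A le 1 ` Vec 1 A"
    unfolding nth_active_iff[OF assms] V1 using AD by auto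
  then show ?thesis unfolding im by simp
qed

lemma nth_active_unique:
  assumes "number_line A le D" "nth_active D le i w" "nth_active D le i w'"
  shows "w = w'"
proof -
  interpret number_line A le D 1 by (rule assms)
  have "[w] \<in> Vec 1 A" "[w'] \<in> Vec 1 A" "num A le 1 [w] = num A le 1 [w']"
    using assms(2,3) nth_active_iff[OF assms(1)] by (auto simp: Vec_def)
  then show ?thesis using num_eq_iff by blast
qed

definition input_ok :: "nat set \<Rightarrow> 'r input \<Rightarrow> bool" where
  "input_ok A I \<longleftrightarrow> (\<forall>r. \<forall>w\<in>I r. \<exists>u\<in>A. \<exists>v\<in>A. w = [u, v])"

lemma col_edge_in: "input_ok A I \<Longrightarrow> col_edge F B I i j u v \<Longrightarrow> u \<in> A \<and> v \<in> A"
  unfolding col_edge_def input_ok_def by fastforce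

lemma node_graph_supported:
  assumes "number_line A le D" "input_ok A I"
  shows "supported A (node_graph D q F B le I)"
  unfolding supported_def
proof (intro allI impI)
  fix x y assume *: "node_graph D q F B le I x y"
  then obtain i j where "length x = 2" "length y = 2" "nth_active D le i (x ! 1)" "nth_active D le j (y ! 1)"
    "col_edge F B I i j (x ! 0) (y ! 0)" unfolding node_graph_def by blast
  moreover from this have "x ! 0 \<in> A" "y ! 0 \<in> A" using col_edge_in[OF assms(2)] by blast+
  ultimately show "x \<in> Vec 2 A \<and> y \<in> Vec 2 A"
    using nth_active_iff[OF assms(1)] by (auto intro!: VecI simp: less_2_cases_iff)
qed

text \<open>Once the colours are named, a pair can change only if its elements are those of the
  changed tuple and its colour names are among the first \<open>q\<close> active elements. Before
  that the old graph is empty and there are at most \<open>q + 2\<close> active elements altogether.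
  Either way all entries come from a set \<open>Z\<close> of at most \<open>q + 2\<close>
  elements.\<close>

lemma node_graph_change:
  fixes a :: "nat list"
  assumes old: "number_line A le D" and ext: "activation_ext A le A' le'" and A'D: "A' \<subseteq> D" and finD: "finite D"
    and ok: "input_ok A I" and ok': "input_ok A' I'" and card: "card A' \<le> card A + 2"
    and chg: "\<And>r w. w \<noteq> [a0, a1] \<Longrightarrow> w \<in> I' r \<longleftrightarrow> w \<in> I r"
  shows "card (diffs D le' (node_graph D q F B le' I') (node_graph D q F B le I)) \<le> (q + 2) ^ 4"
proof -
  interpret e: activation_ext A le A' le' by (rule ext)
  have new: "number_line A' le' D"
    using e.new.activation_axioms A'D by (simp add: number_line_def number_line_axioms_def)
  interpret new: number_line A' le' D 1 by (rule new)
  define Z where "Z = (if q < card A then {a0, a1} \<union> {w \<in> A'. num A' le' 1 [w] < q} else A')"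
  have Z: "finite Z" "card Z \<le> q + 2"
  proof -
    have "inj_on (\<lambda>w. num A' le' 1 [w]) {w \<in> A'. num A' le' 1 [w] < q}"
    proof (rule inj_onI)
      fix x y assume "x \<in> {w \<in> A'. num A' le' 1 [w] < q}" "y \<in> {w \<in> A'. num A' le' 1 [w] < q}"
        "num A' le' 1 [x] = num A' le' 1 [y]"
      moreover from this have "[x] \<in> Vec 1 A'" "[y] \<in> Vec 1 A'" by (auto simp: Vec_def)
      ultimately show "x = y" using e.new.num_eq_iff by blast
    qed
    then have "card {w \<in> A'. num A' le' 1 [w] < q} \<le> card {..<q}"
      by (rule card_inj_on_le) auto
    moreover have "card ({a0, a1} \<union> {w \<in> A'. num A' le' 1 [w] < q}) \<le>
        card {a0, a1} + card {w \<in> A'. num A' le' 1 [w] < q}" by (rule card_Un_le)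
    moreover have "card {a0, a1} \<le> 2" by (simp add: card_insert_if)
    ultimately show "card Z \<le> q + 2" using card by (auto simp: Z_def)
    show "finite Z" using e.new.fin by (auto simp: Z_def)
  qed
  have "diffs D le' (node_graph D q F B le' I') (node_graph D q F B le I) \<subseteq> Vec 2 Z \<times> Vec 2 Z"
  proof
    fix p assume "p \<in> diffs D le' (node_graph D q F B le' I') (node_graph D q F B le I)"
    then obtain x y where p: "p = (x, y)" "x \<in> Vec 2 D" "y \<in> Vec 2 D"
      "\<not> (node_graph D q F B le' I' x y \<longleftrightarrow> node_graph D q F B le I x y)"
      by (auto simp: diffs_def differ_def)
    have "x \<in> Vec 2 Z \<and> y \<in> Vec 2 Z"
    proof (cases "q < card A")
      case False
      then have "\<not> node_graph D q F B le I x y"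
        unfolding node_graph_def nth_active_exists[OF old] by simp
      then show ?thesis using p(4) node_graph_supported[OF new ok'] False by (simp add: supported_def Z_def)
    next
      case True
      have cA: "card A \<le> card A'" by (intro card_mono e.new.fin e.sub)
      \<comment> \<open>The first \<open>card A\<close> active elements keep their numbers, and the
        numbers up to \<open>q\<close> are among these.\<close>
      have same: "nth_active D le' i w \<longleftrightarrow> nth_active D le i w" if "i \<le> q" for i w
      proof
        assume l: "nth_active D le' i w"
        then have w: "[w] \<in> Vec 1 A'" "num A' le' 1 [w] = i"
          using nth_active_iff[OF new] by (auto simp: Vec_def)
        have "[w] \<in> Vec 1 A"
        proof (rule e.new.num_less_imp_Vec[OF _ w(1) e.sub])
          show "num A' le' 1 [w] < card A ^ 1" using w(2) that True by simp
          show "x \<in> A" if "le' x y" "y \<in> A" for x y using that e.ext e.old.le_in by blast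
        qed
        then show "nth_active D le i w"
          using w(2) e.num_ext unfolding nth_active_iff[OF old] by (auto simp: Vec_def)
      next
        assume "nth_active D le i w"
        then have "w \<in> A" "num A le 1 [w] = i" unfolding nth_active_iff[OF old] by auto
        moreover from this have "[w] \<in> Vec 1 A" by (simp add: Vec_def)
        ultimately show "nth_active D le' i w" using e.num_ext e.sub unfolding nth_active_iff[OF new] by auto
      qed
      have l: "length x = 2" "length y = 2" using p by (auto simp: length_Vec)
      have q1: "\<exists>w\<in>D. nth_active D le q w" "\<exists>w\<in>D. nth_active D le' q w"
        using nth_active_exists[OF old] nth_active_exists[OF new] True cA by simp_all
      have iff: "node_graph D q F B le'' I'' x y \<longleftrightarrow> (\<exists>i<q. \<exists>j<q. nth_active D le' i (x ! 1) \<and>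
          nth_active D le' j (y ! 1) \<and> col_edge F B I'' i j (x ! 0) (y ! 0))"
        if "le'' = le' \<or> le'' = le" for le'' and I'' :: "'a input"
        using that q1 l same unfolding node_graph_def by (metis less_imp_le)
      have "node_graph D q F B le' I' x y \<longleftrightarrow> (\<exists>i<q. \<exists>j<q. nth_active D le' i (x ! 1) \<and>
          nth_active D le' j (y ! 1) \<and> col_edge F B I' i j (x ! 0) (y ! 0))"
        "node_graph D q F B le I x y \<longleftrightarrow> (\<exists>i<q. \<exists>j<q. nth_active D le' i (x ! 1) \<and>
          nth_active D le' j (y ! 1) \<and> col_edge F B I i j (x ! 0) (y ! 0))"
        by (rule iff, simp)+
      then obtain i j where ij: "i < q" "j < q" "nth_active D le' i (x ! 1)" "nth_active D le' j (y ! 1)"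
        "\<not> (col_edge F B I' i j (x ! 0) (y ! 0) \<longleftrightarrow> col_edge F B I i j (x ! 0) (y ! 0))"
        using p(4) by blast
      have "[x ! 0, y ! 0] = [a0, a1] \<or> [y ! 0, x ! 0] = [a0, a1]"
        using ij(5) chg unfolding col_edge_def by blast
      then have "x ! 0 \<in> Z" "y ! 0 \<in> Z" using True by (auto simp: Z_def)
      moreover have "x ! 1 \<in> Z" "y ! 1 \<in> Z"
        using ij(1-4) nth_active_iff[OF new] True by (auto simp: Z_def)
      ultimately show ?thesis using l by (auto intro!: VecI simp: less_2_cases_iff)
    qed
    then show "p \<in> Vec 2 Z \<times> Vec 2 Z" using p(1) by simp
  qed
  then have "card (diffs D le' (node_graph D q F B le' I') (node_graph D q F B le I)) \<le> card (Vec 2 Z \<times> Vec 2 Z)"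
    by (intro card_mono finite_cartesian_product finite_Vec Z(1))
  also have "\<dots> = card Z ^ 4" by (simp add: card_cartesian_product card_Vec Z(1) flip: power_add)
  also have "\<dots> \<le> (q + 2) ^ 4" by (rule power_mono[OF Z(2)]) simp
  finally show ?thesis .
qed

section \<open>Correctness of the answer on small and on large active domains\<close>

lemma walk_iff:
  assumes "i < q" "u \<in> D"
  shows "j < q \<Longrightarrow> v \<in> D \<Longrightarrow> walk D q F B I k i j u v \<longleftrightarrow> (\<exists>m\<le>k. ((u, i), (v, j)) \<in> col_graph D q F B I ^^ m)"
proof (induction k arbitrary: j v)
  case 0
  then show ?case by auto
next
  case (Suc k)
  let ?R = "col_graph D q F B I"
  have "(\<exists>l<q. \<exists>w\<in>D. walk D q F B I k i l u w \<and> col_edge F B I l j w v) \<longleftrightarrow>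
      (\<exists>l w. (\<exists>m\<le>k. ((u, i), (w, l)) \<in> ?R ^^ m) \<and> ((w, l), (v, j)) \<in> ?R)"
  proof -
    have step: "((w, l), (v, j)) \<in> ?R \<longleftrightarrow> w \<in> D \<and> l < q \<and> col_edge F B I l j w v" for w l
      using Suc.prems by (auto simp: col_graph_def)
    show ?thesis unfolding step using Suc.IH by blast
  qed
  also have "\<dots> \<longleftrightarrow> (\<exists>m\<le>k. ((u, i), (v, j)) \<in> ?R ^^ Suc m)"
    by (auto simp: relcomp_unfold)
  also have "\<dots> \<longleftrightarrow> (\<exists>m. m \<le> Suc k \<and> m \<noteq> 0 \<and> ((u, i), (v, j)) \<in> ?R ^^ m)"
    by (metis Suc_le_mono not0_implies_Suc nat.distinct(1))
  finally show ?case unfolding walk.simps Suc.IH[OF Suc.prems] by (metis le_SucI le_0_eq le_Suc_eq nat.distinct(1) zero_le)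
qed

text \<open>Reachability in a finite relation takes at most as many steps as the relation has pairs,
  and here all pairs join active elements.\<close>

lemma reach_answer_small:
  assumes nl: "number_line A le D" and ok: "input_ok A I" and small: "card A \<le> n0"
    and ij: "i < q" "j < q" "u \<in> D" "v \<in> D"
  shows "reach_answer D q F B n0 n le I N i j u v \<longleftrightarrow> ((u, i), (v, j)) \<in> (col_graph D q F B I)\<^sup>*"
proof -
  interpret number_line A le D 1 by (rule nl)
  let ?R = "col_graph D q F B I" and ?X = "A \<times> {..<q}"
  have fX: "finite (?X \<times> ?X)" using fin by simp
  have sub: "?R \<subseteq> ?X \<times> ?X" using col_edge_in[OF ok] unfolding col_graph_def by fastforce
  have finR: "finite ?R" by (rule finite_subset[OF sub fX])
  have "card ?R \<le> card (?X \<times> ?X)" by (rule card_mono[OF fX sub])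
  also have "card (?X \<times> ?X) = (card A * q) ^ 2" by (simp add: card_cartesian_product power2_eq_square)
  also have "\<dots> \<le> (n0 * q) ^ 2" using small by (intro power_mono mult_le_mono1) auto
  finally have le: "card ?R \<le> (n0 * q) ^ 2" .
  have "((u, i), (v, j)) \<in> ?R\<^sup>* \<longleftrightarrow> (\<exists>m\<le>(n0 * q) ^ 2. ((u, i), (v, j)) \<in> ?R ^^ m)"
  proof
    assume "((u, i), (v, j)) \<in> ?R\<^sup>*"
    then obtain m where "m \<le> card ?R" "((u, i), (v, j)) \<in> ?R ^^ m"
      unfolding rtrancl_finite_eq_relpow[OF finR] by blast
    then show "\<exists>m\<le>(n0 * q) ^ 2. ((u, i), (v, j)) \<in> ?R ^^ m" using order.trans[OF _ le] by blast
  qed (blast intro: relpow_imp_rtrancl)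
  moreover have "\<not> (\<exists>a\<in>D. nth_active D le n0 a)" using nth_active_exists[OF nl] small by simp
  ultimately show ?thesis unfolding reach_answer_def using walk_iff[OF ij(1,3,2,4)] by simp
qed

text \<open>Replacing a colour by the active element of that number translates edges into edges in
  both directions; more than \<open>q\<close> active elements guarantee that every intermediate
  colour has a name.\<close>

lemma reach_node_graph:
  assumes nl: "number_line A le D" and big: "q < card A" and ij: "i < q" "j < q" "u \<in> D" "v \<in> D"
    and w: "nth_active D le i w" "nth_active D le j w'"
  shows "([u, w], [v, w']) \<in> (grel D (node_graph D q F B le I))\<^sup>* \<longleftrightarrow> ((u, i), (v, j)) \<in> (col_graph D q F B I)\<^sup>*"
proof
  let ?R = "col_graph D q F B I" and ?G = "grel D (node_graph D q F B le I)"
  interpret number_line A le D 1 by (rule nl)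
  have q: "\<exists>a\<in>D. nth_active D le q a" using nth_active_exists[OF nl] big by simp
  have inD: "nth_active D le k x \<Longrightarrow> x \<in> D" for k x using nth_active_iff[OF nl] AD by blast
  have ex: "\<exists>x. nth_active D le k x" if "k < q" for k
    using nth_active_exists[OF nl, of k] big that by auto
  have step: "([u, w], [v, w']) \<in> ?G" if "((u, i), (v, j)) \<in> ?R" "nth_active D le i w" "nth_active D le j w'" for u i v j w w'
    using that q inD unfolding grel_def node_graph_def col_graph_def by (auto simp: Vec_def)
  show "((u, i), (v, j)) \<in> ?R\<^sup>*" if "([u, w], [v, w']) \<in> ?G\<^sup>*"
  proof -
    have "\<exists>v' j'. j' < q \<and> nth_active D le j' (y ! 1) \<and> y = [v', y ! 1] \<and> ((u, i), (v', j')) \<in> ?R\<^sup>*"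
      if "([u, w], y) \<in> ?G\<^sup>*" for y
      using that
    proof (induction rule: rtrancl_induct)
      case base
      then show ?case using w(1) ij(1) by auto
    next
      case (step y z)
      then obtain v' j' where IH: "j' < q" "nth_active D le j' (y ! 1)" "y = [v', y ! 1]" "((u, i), (v', j')) \<in> ?R\<^sup>*"
        by blast
      obtain k l where kl: "k < q" "l < q" "nth_active D le k (y ! 1)" "nth_active D le l (z ! 1)"
        "col_edge F B I k l (y ! 0) (z ! 0)" "y \<in> Vec 2 D" "z \<in> Vec 2 D"
        using step(2) unfolding grel_def node_graph_def by blast
      have "k = j'" using kl(3) IH(2) nth_active_iff[OF nl] by simp
      moreover have y0: "y ! 0 = v'" by (subst IH(3)) simp
      moreover have "y ! 0 \<in> D" "z ! 0 \<in> D" using kl(6,7) by (simp_all add: Vec_nth)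
      ultimately have "((v', j'), (z ! 0, l)) \<in> ?R" using kl by (auto simp: col_graph_def)
      then have "((u, i), (z ! 0, l)) \<in> ?R\<^sup>*" using IH(4) by (rule rtrancl_into_rtrancl[rotated])
      moreover have "z = [z ! 0, z ! 1]" using kl(7)
        by (intro nth_equalityI) (auto simp: length_Vec less_2_cases_iff)
      ultimately show ?case using kl(2,4) by blast
    qed
    from this[OF that] obtain v' j' where "j' < q" "nth_active D le j' w'" "v' = v" "((u, i), (v', j')) \<in> ?R\<^sup>*"
      by auto
    then show ?thesis using w(2) nth_active_iff[OF nl] by simp
  qed
  show "([u, w], [v, w']) \<in> ?G\<^sup>*" if "((u, i), (v, j)) \<in> ?R\<^sup>*"
  proof -
    have "\<forall>x. j < q \<longrightarrow> nth_active D le j x \<longrightarrow> ([u, w], [v, x]) \<in> ?G\<^sup>*"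
      using that
    proof (induction rule: rtrancl_induct2)
      case refl
      then show ?case using nth_active_unique[OF nl w(1)] by auto
    next
      case (step a k b l)
      then have k: "k < q" by (auto simp: col_graph_def)
      then obtain x where x: "nth_active D le k x" using ex by blast
      have "([u, w], [a, x]) \<in> ?G\<^sup>*" using step k x by blast
      moreover have "([a, x], [b, y]) \<in> ?G" if "nth_active D le l y" for y
        using \<open>\<And>u i v j w w'. ((u, i), (v, j)) \<in> ?R \<Longrightarrow> nth_active D le i w \<Longrightarrow> nth_active D le j w' \<Longrightarrow> ([u, w], [v, w']) \<in> ?G\<close>
          step(2) x that by blast
      ultimately show ?case by (meson rtrancl_into_rtrancl)
    qed
    then show ?thesis using ij(2) w(2) by blast
  qed
qed

lemma reach_answer_big:
  assumes inv: "engine_inv D num_len L A le add mul (node_graph D q F B le I) NS GC NC"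
    and n0: "n0 = c + 2 * c ^ 4" "c = a0 + 2 * (a0 ^ 4 + 1)" "a0 = 2 ^ 16 + L + 4" and q: "q \<le> n0" and big: "n0 < card A"
    and ij: "i < q" "j < q" "u \<in> D" "v \<in> D"
  shows "reach_answer D q F B n0 num_len le I NS i j u v \<longleftrightarrow> ((u, i), (v, j)) \<in> (col_graph D q F B I)\<^sup>*"
proof -
  interpret arithmetic A le D num_len add mul using inv by (simp add: engine_inv_def)
  have nl: "number_line A le D" by unfold_locales (rule AD)
  have qA: "q < card A" using q big by simp
  obtain w w' where w: "w \<in> D" "w' \<in> D" "nth_active D le i w" "nth_active D le j w'"
    using nth_active_exists[OF nl] ij qA by (metis order.strict_trans)
  have V: "[u, w] \<in> Vec 2 D" "[v, w'] \<in> Vec 2 D" using ij w by (auto simp: Vec_def)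
  have con: "connected_by D le num_len NS [u, w] [v, w'] \<longleftrightarrow> ([u, w], [v, w']) \<in> (grel D (node_graph D q F B le I))\<^sup>*"
    using engine_sound[OF inv V] engine_complete[OF inv _ n0(2,3)] big n0(1) by auto
  have "(\<exists>x\<in>D. \<exists>y\<in>D. nth_active D le i x \<and> nth_active D le j y \<and> connected_by D le num_len NS [u, x] [v, y])
      \<longleftrightarrow> connected_by D le num_len NS [u, w] [v, w']"
    using w nth_active_unique[OF nl] by blast
  moreover have "\<exists>a\<in>D. nth_active D le n0 a" using nth_active_exists[OF nl] big by simp
  ultimately show ?thesis
    unfolding reach_answer_def con reach_node_graph[OF nl qA ij w(3,4)] by auto
qed

subsection \<open>The dynamic program\<close>

definition acc_order :: "nat list set \<Rightarrow> nat \<Rightarrow> nat \<Rightarrow> bool" where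
  "acc_order R x y \<longleftrightarrow> [x, y] \<in> R"

text \<open>The length conditions make the splitting of a stored tuple into its components
  unique.\<close>

definition acc_table :: "nat \<Rightarrow> nat list set \<Rightarrow> table" where
  "acc_table n R t x y z \<longleftrightarrow> length t = n \<and> length x = n \<and> length y = n \<and> length z = n \<and> t @ x @ y @ z \<in> R"

definition acc_graph :: "nat list set \<Rightarrow> graph" where
  "acc_graph R x y \<longleftrightarrow> length x = 2 \<and> length y = 2 \<and> x @ y \<in> R"

definition acc_threads :: "nat \<Rightarrow> nat list set \<Rightarrow> threads" where
  "acc_threads n R t \<theta> x y z \<longleftrightarrow> length t = n \<and> length \<theta> = n \<and> length x = 2 \<and> length y = 2 \<and> length z = n \<and>
     t @ \<theta> @ x @ y @ z \<in> R"

definition aux :: "('r + nat) model \<Rightarrow> nat \<Rightarrow> nat list set" where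
  "aux M i = snd (snd M) (Inr i)"

definition inp :: "('r + nat) model \<Rightarrow> 'r input" where
  "inp M r = snd (snd M) (Inl r)"

lemma definable_acc_order: "(sig :: 'r + nat \<Rightarrow> nat option) (Inr i) = Some 2 \<Longrightarrow> definable_order sig C (\<lambda>M. acc_order (aux M i))"
  unfolding definable_order_def acc_order_def aux_def by (intro allI impI definable_Rel[where n=2] vec_term_pair)

lemma definable_acc_table:
  fixes sig :: "'r + nat \<Rightarrow> nat option"
  assumes "sig (Inr i) = Some (n + (n + (n + n)))"
  shows "definable_table sig C n (\<lambda>M. acc_table n (aux M i))"
  unfolding definable_table_def
proof (intro allI impI)
  fix k and t x y z :: "('r + nat) model \<Rightarrow> nat list \<Rightarrow> nat list" assume *: "vec_term C k n t" "vec_term C k n x" "vec_term C k n y" "vec_term C k n z"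
  have "definable sig C k (\<lambda>M e. t M e @ x M e @ y M e @ z M e \<in> snd (snd M) (Inr i))"
    by (intro definable_Rel[where sig=sig and s="Inr i", OF _ assms] vec_term_append *)
  then show "definable sig C k (\<lambda>M e. acc_table n (aux M i) (t M e) (x M e) (y M e) (z M e))"
    by (rule definable_cong) (simp add: acc_table_def aux_def *[THEN length_vec_term])
qed

lemma definable_acc_graph:
  fixes sig :: "'r + nat \<Rightarrow> nat option"
  assumes "sig (Inr i) = Some 4"
  shows "definable_graph sig C (\<lambda>M. acc_graph (aux M i))"
  unfolding definable_graph_def
proof (intro allI impI)
  fix k and x y :: "('r + nat) model \<Rightarrow> nat list \<Rightarrow> nat list" assume *: "vec_term C k 2 x" "vec_term C k 2 y"
  have "definable sig C k (\<lambda>M e. x M e @ y M e \<in> snd (snd M) (Inr i))"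
    by (intro definable_Rel[where sig=sig and s="Inr i", OF _ assms] vec_term_append4 *)
  then show "definable sig C k (\<lambda>M e. acc_graph (aux M i) (x M e) (y M e))"
    by (rule definable_cong) (simp add: acc_graph_def aux_def *[THEN length_vec_term])
qed

lemma definable_acc_threads:
  fixes sig :: "'r + nat \<Rightarrow> nat option"
  assumes "sig (Inr i) = Some (n + (n + (2 + (2 + n))))"
  shows "definable_threads sig C n (\<lambda>M. acc_threads n (aux M i))"
  unfolding definable_threads_def
proof (intro allI impI)
  fix k and t \<theta> x y z :: "('r + nat) model \<Rightarrow> nat list \<Rightarrow> nat list" assume *: "vec_term C k n t" "vec_term C k n \<theta>" "vec_term C k 2 x" "vec_term C k 2 y" "vec_term C k n z"
  have "definable sig C k (\<lambda>M e. t M e @ \<theta> M e @ x M e @ y M e @ z M e \<in> snd (snd M) (Inr i))"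
    by (intro definable_Rel[where sig=sig and s="Inr i", OF _ assms] vec_term_append *)
  then show "definable sig C k (\<lambda>M e. acc_threads n (aux M i) (t M e) (\<theta> M e) (x M e) (y M e) (z M e))"
    by (rule definable_cong) (simp add: acc_threads_def aux_def *[THEN length_vec_term])
qed

definition seg :: "nat \<Rightarrow> nat \<Rightarrow> nat list \<Rightarrow> nat list" where
  "seg m l b = take l (drop m b)"

lemma vec_term_seg: "m + l \<le> k \<Longrightarrow> vec_term C k l (\<lambda>M e. seg m l e)"
  unfolding seg_def
  by (rule vec_term_take'[OF vec_term_drop'[OF vec_term_env, of m "k - m"]]) auto

text \<open>\<open>Q\<close> expresses a Boolean query through the reachability relations
  \<open>r i j\<close> between colours. By \<open>Q_cong\<close> it looks only at colours below
  \<open>q\<close>, elements of \<open>D\<close> and constants in \<open>C\<close>, hence not at the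
  auxiliary constants \<open>c0\<close> and \<open>c1\<close> that carry the changed tuple.\<close>

locale engine_program =
  fixes n q n0 L c0 c1 :: nat and F B :: "('r::finite \<times> nat \<times> nat) set" and C :: "nat set"
    and Q :: "nat set \<Rightarrow> (nat \<Rightarrow> nat) \<Rightarrow> (nat \<Rightarrow> nat \<Rightarrow> nat \<Rightarrow> nat \<Rightarrow> bool) \<Rightarrow> bool"
  assumes n: "n = num_len" and L: "L = (q + 2) ^ 4"
    and n0: "n0 = (let a = 2 ^ 16 + L + 4; c = a + 2 * (a ^ 4 + 1) in c + 2 * c ^ 4)"
    and c: "c0 \<noteq> c1" "c0 \<notin> C" "c1 \<notin> C"
    and Q_definable: "\<And>(sig :: 'r + nat \<Rightarrow> nat option) R.
      (\<And>i j. definable_order sig (insert c0 (insert c1 C)) (R i j)) \<Longrightarrow>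
      definable sig (insert c0 (insert c1 C)) 0 (\<lambda>M e. Q (fst M) (fst (snd M)) (\<lambda>i j. R i j M))"
    and Q_cong: "\<And>D \<kappa> \<kappa>' r r'. (\<And>i j u v. i < q \<Longrightarrow> j < q \<Longrightarrow> u \<in> D \<Longrightarrow> v \<in> D \<Longrightarrow> r i j u v = r' i j u v) \<Longrightarrow>
      (\<And>c. c \<in> C \<Longrightarrow> \<kappa> c = \<kappa>' c \<and> \<kappa> c \<in> D) \<Longrightarrow> Q D \<kappa> r = Q D \<kappa>' r'"
begin

text \<open>In turn: the order of activation, the two tables, the inverses in use, the graph and the
  inverses in preparation, the answer. The graph of the inverses in use is definable from the input
  and the order, hence not stored.\<close>

definition tuple_sizes :: "nat list" where
  "tuple_sizes = [2, n + (n + (n + n)), n + (n + (n + n)), n + (n + (2 + (2 + n))), 4, n + (n + (2 + (2 + n))), 0]"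

abbreviation "sg \<equiv> signature (\<lambda>_ :: 'r. 2) tuple_sizes"
abbreviation "CC \<equiv> insert c0 (insert c1 C)"

definition chg :: "('r + nat) model \<Rightarrow> nat list" where
  "chg M = [fst (snd M) c0, fst (snd M) c1]"

definition "le_old M = acc_order (aux M 0)"
definition "le_new M = activate (activate (le_old M) (fst (snd M) c0)) (fst (snd M) c1)"
definition "add_old M = acc_table n (aux M 1)"
definition "mul_old M = acc_table n (aux M 2)"
definition "inp_new \<delta> M = apply_change (\<delta>, chg M) (inp M)"
definition "E_old M = node_graph (fst M) q F B (le_old M) (inp M)"
definition "E_new \<delta> M = node_graph (fst M) q F B (le_new M) (inp_new \<delta> M)"
definition "chS \<delta> M = chase (fst M) (le_new M) (le_old M) n (add_old M) (mul_old M) (E_new \<delta> M) (L + 1)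
  (E_old M, acc_threads n (aux M 3))"
definition "chC \<delta> M = chase (fst M) (le_new M) (le_old M) n (add_old M) (mul_old M) (E_new \<delta> M) (L + 1)
  (acc_graph (aux M 4), acc_threads n (aux M 5))"
definition "ready \<delta> M = caught_up (fst M) (le_new M) (E_new \<delta> M) (fst (chC \<delta> M))"
definition "NS_new \<delta> M t \<theta> x y z = (if ready \<delta> M then snd (chC \<delta> M) t \<theta> x y z else snd (chS \<delta> M) t \<theta> x y z)"
definition "GC_new \<delta> M x y = (if ready \<delta> M then False else fst (chC \<delta> M) x y)"
definition "NC_new \<delta> M t \<theta> x y z = (if ready \<delta> M then fresh (fst M) (le_old M) n (add_old M) (mul_old M) t \<theta> x y z
  else snd (chC \<delta> M) t \<theta> x y z)"
text \<open>The answer is due in the same step, so it is computed from the new inverses by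
  substituting their update formulas.\<close>

definition "reach_new \<delta> i j M = reach_answer (fst M) q F B n0 n (le_new M) (inp_new \<delta> M) (NS_new \<delta> M) i j"

definition upd :: "'r change_op \<Rightarrow> nat \<Rightarrow> ('r + nat) model \<Rightarrow> nat list \<Rightarrow> bool" where
  "upd \<delta> i M b =
    (if i = 0 then le_new M (b ! 0) (b ! 1)
     else if i = 1 then add_step (fst M) (le_old M) n (add_old M) (seg 0 n b) (seg n n b) (seg (n + n) n b) (seg (n + n + n) n b)
     else if i = 2 then mul_step (fst M) (le_old M) n (add_old M) (mul_old M) (seg 0 n b) (seg n n b) (seg (n + n) n b) (seg (n + n + n) n b)
     else if i = 3 then NS_new \<delta> M (seg 0 n b) (seg n n b) (seg (n + n) 2 b) (seg (n + n + 2) 2 b) (seg (n + n + 4) n b)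
     else if i = 4 then GC_new \<delta> M (seg 0 2 b) (seg 2 2 b)
     else if i = 5 then NC_new \<delta> M (seg 0 n b) (seg n n b) (seg (n + n) 2 b) (seg (n + n + 2) 2 b) (seg (n + n + 4) n b)
     else Q (fst M) (fst (snd M)) (\<lambda>i j. reach_new \<delta> i j M))"

lemma sg_simps: "sg (Inr 0) = Some 2" "sg (Inr 1) = Some (n + (n + (n + n)))" "sg (Inr 2) = Some (n + (n + (n + n)))"
  "sg (Inr 3) = Some (n + (n + (2 + (2 + n))))" "sg (Inr 4) = Some 4" "sg (Inr 5) = Some (n + (n + (2 + (2 + n))))"
  "sg (Inl r) = Some 2"
  by (simp_all add: signature_def tuple_sizes_def eval_nat_numeral)

lemma definable_le_old: "definable_order sg CC le_old"
  unfolding le_old_def[abs_def] by (rule definable_acc_order[where sig=sg and i=0, OF sg_simps(1)])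

lemma elem_term_c: "elem_term CC k (\<lambda>M e. fst (snd M) c0)" "elem_term CC k (\<lambda>M e. fst (snd M) c1)"
  by (rule elem_term_const; simp)+

lemma definable_activate':
  assumes "definable_order sg CC le" "\<And>k. elem_term CC k (\<lambda>M e. a M)"
  shows "definable_order sg CC (\<lambda>M. activate (le M) (a M))"
  unfolding definable_order_def activate_def
  by (intro allI impI definable_intros definable_orderD[OF assms(1)] definable_elem_eq assms(2))

lemma definable_le_new: "definable_order sg CC le_new"
  unfolding le_new_def[abs_def] by (intro definable_activate' definable_le_old elem_term_c)

lemma definable_tables_old: "definable_table sg CC n add_old" "definable_table sg CC n mul_old"
  unfolding add_old_def[abs_def] mul_old_def[abs_def] by (intro definable_acc_table sg_simps)+

lemma definable_inp: "definable_input sg CC inp"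
  unfolding definable_input_def inp_def by (intro allI impI definable_Rel[where n=2] sg_simps)

lemma definable_inp_new: "definable_input sg CC (inp_new \<delta>)"
  unfolding inp_new_def[abs_def] chg_def
  by (intro definable_apply_change definable_inp vec_term_pair elem_term_c)

lemma definable_E: "definable_graph sg CC E_old" "definable_graph sg CC (E_new \<delta>)"
  unfolding E_old_def[abs_def] E_new_def[abs_def]
  by (intro definable_node_graph definable_le_old definable_le_new definable_inp definable_inp_new)+

lemma definable_ch: "definable_threads sg CC n (\<lambda>M. snd (chS \<delta> M))"
  "definable_graph sg CC (\<lambda>M. fst (chC \<delta> M))" "definable_threads sg CC n (\<lambda>M. snd (chC \<delta> M))"
  unfolding chS_def chC_def
  using definable_chase[OF definable_le_new definable_le_old definable_tables_old definable_E(2,1)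
      definable_acc_threads[where sig=sg and i=3, OF sg_simps(4)], of \<delta> "L + 1"]
    definable_chase[OF definable_le_new definable_le_old definable_tables_old definable_E(2)
      definable_acc_graph[where sig=sg and i=4, OF sg_simps(5)] definable_acc_threads[where sig=sg and i=5, OF sg_simps(6)], of \<delta> "L + 1"]
  by blast+

lemma definable_ready: "definable sg CC k (\<lambda>M e. ready \<delta> M)"
  unfolding ready_def by (rule definable_caught_up[OF definable_le_new definable_E(2) definable_ch(2)])

lemma definable_NS_new: "definable_threads sg CC n (NS_new \<delta>)"
  unfolding definable_threads_def NS_new_def
  by (intro allI impI definable_If definable_ready definable_threadsD[OF definable_ch(1)] definable_threadsD[OF definable_ch(3)])

lemma definable_GC_new: "definable_graph sg CC (GC_new \<delta>)"
  unfolding definable_graph_def GC_new_def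
  by (intro allI impI definable_If definable_ready definable_False definable_graphD[OF definable_ch(2)])

lemma definable_NC_new: "definable_threads sg CC n (NC_new \<delta>)"
  unfolding definable_threads_def NC_new_def
  by (intro allI impI definable_If definable_ready definable_threadsD[OF definable_ch(3)]
      definable_threadsD[OF definable_fresh[OF definable_le_old definable_tables_old]])

lemma definable_upd:
  assumes "i < length tuple_sizes"
  shows "definable sg CC (tuple_sizes ! i) (upd \<delta> i)"
proof -
  consider "i = 0" | "i = 1" | "i = 2" | "i = 3" | "i = 4" | "i = 5" | "i = 6"
    using assms by (force simp: tuple_sizes_def)
  then show ?thesis
  proof cases
    case 1
    have "definable sg CC 2 (\<lambda>M e. le_new M (e ! 0) (e ! 1))"
      by (intro definable_orderD[OF definable_le_new] elem_term_nth[OF vec_term_env]) auto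
    then show ?thesis using 1 by (simp add: upd_def[abs_def] tuple_sizes_def)
  next
    case 2
    have "definable sg CC (n + (n + (n + n))) (\<lambda>M e. add_step (fst M) (le_old M) n (add_old M)
        (seg 0 n e) (seg n n e) (seg (n + n) n e) (seg (n + n + n) n e))"
      by (intro definable_tableD[OF definable_add_step[OF definable_le_old definable_tables_old]] vec_term_seg) auto
    then show ?thesis using 2 by (simp add: upd_def[abs_def] tuple_sizes_def)
  next
    case 3
    have "definable sg CC (n + (n + (n + n))) (\<lambda>M e. mul_step (fst M) (le_old M) n (add_old M) (mul_old M)
        (seg 0 n e) (seg n n e) (seg (n + n) n e) (seg (n + n + n) n e))"
      by (intro definable_tableD[OF definable_mul_step[OF definable_le_old definable_tables_old]] vec_term_seg) auto
    then show ?thesis using 3 by (simp add: upd_def[abs_def] tuple_sizes_def)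
  next
    case 4
    have "definable sg CC (n + (n + (2 + (2 + n)))) (\<lambda>M e. NS_new \<delta> M (seg 0 n e) (seg n n e)
        (seg (n + n) 2 e) (seg (n + n + 2) 2 e) (seg (n + n + 4) n e))"
      by (intro definable_threadsD[OF definable_NS_new] vec_term_seg) auto
    then show ?thesis using 4 by (simp add: upd_def[abs_def] tuple_sizes_def)
  next
    case 5
    have "definable sg CC 4 (\<lambda>M e. GC_new \<delta> M (seg 0 2 e) (seg 2 2 e))"
      by (intro definable_graphD[OF definable_GC_new] vec_term_seg) auto
    then show ?thesis using 5 by (simp add: upd_def[abs_def] tuple_sizes_def)
  next
    case 6
    have "definable sg CC (n + (n + (2 + (2 + n)))) (\<lambda>M e. NC_new \<delta> M (seg 0 n e) (seg n n e)
        (seg (n + n) 2 e) (seg (n + n + 2) 2 e) (seg (n + n + 4) n e))"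
      by (intro definable_threadsD[OF definable_NC_new] vec_term_seg) auto
    then show ?thesis using 6 by (simp add: upd_def[abs_def] tuple_sizes_def)
  next
    case 7
    have "definable_order sg CC (reach_new \<delta> i j)" for i j
      unfolding reach_new_def[abs_def]
      by (rule definable_reach_answer[OF definable_le_new definable_inp_new definable_NS_new])
    then have "definable sg CC 0 (\<lambda>M e. Q (fst M) (fst (snd M)) (\<lambda>i j. reach_new \<delta> i j M))"
      by (rule Q_definable)
    then show ?thesis using 7 by (simp add: upd_def[abs_def] tuple_sizes_def)
  qed
qed

definition state_inv :: "nat set \<Rightarrow> 'r input \<Rightarrow> (nat \<Rightarrow> nat list set) \<Rightarrow> bool" where
  "state_inv D I R \<longleftrightarrow> (\<exists>A. input_ok A I \<and> engine_inv D n L A (acc_order (R 0)) (acc_table n (R 1)) (acc_table n (R 2))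
     (node_graph D q F B (acc_order (R 0)) I) (acc_threads n (R 3)) (acc_graph (R 4)) (acc_threads n (R 5)))"

definition reach_col :: "nat set \<Rightarrow> 'r input \<Rightarrow> nat \<Rightarrow> nat \<Rightarrow> nat \<Rightarrow> nat \<Rightarrow> bool" where
  "reach_col D I i j u v \<longleftrightarrow> ((u, i), (v, j)) \<in> (col_graph D q F B I)\<^sup>*"

lemma reach_answer_correct:
  assumes inv: "engine_inv D n L A le add mul (node_graph D q F B le I) NS GC NC" and ok: "input_ok A I"
    and ij: "i < q" "j < q" "u \<in> D" "v \<in> D"
  shows "reach_answer D q F B n0 n le I NS i j u v \<longleftrightarrow> reach_col D I i j u v"
proof (cases "card A \<le> n0")
  case True
  interpret arithmetic A le D n add mul using inv by (simp add: engine_inv_def)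
  have "number_line A le D" by unfold_locales (rule AD)
  then show ?thesis unfolding reach_col_def by (rule reach_answer_small[OF _ ok True ij])
next
  case False
  have "q \<le> (q + 2) ^ 4" using self_le_power[of "q + 2" 4] by simp
  then have "q \<le> n0" using L n0 by (simp add: Let_def)
  then show ?thesis unfolding reach_col_def n
    using reach_answer_big[OF inv[unfolded n], of n0 _ _ i j u v] n0 False ij by (simp add: Let_def)
qed

lemma state_step:
  assumes inv: "state_inv D I R" and a: "a0 \<in> D" "a1 \<in> D" and \<kappa>: "\<And>c. c \<in> C \<Longrightarrow> \<kappa> c \<in> D"
    and M: "M = (D, \<kappa>(c0 := a0, c1 := a1), case_sum I R)"
    and R': "R' = (\<lambda>i. if i < length tuple_sizes then {b. length b = tuple_sizes ! i \<and> set b \<subseteq> D \<and> upd \<delta> i M b} else {})"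
    and I': "I' = apply_change (\<delta>, [a0, a1]) I"
  shows "state_inv D I' R' \<and> R' 6 = (if Q D \<kappa> (reach_col D I') then {[]} else {}) \<and> input_ok D I'"
proof -
  obtain A where ok: "input_ok A I" and ei: "engine_inv D n L A (acc_order (R 0)) (acc_table n (R 1)) (acc_table n (R 2))
     (node_graph D q F B (acc_order (R 0)) I) (acc_threads n (R 3)) (acc_graph (R 4)) (acc_threads n (R 5))"
    using inv unfolding state_inv_def by blast
  define le where "le = acc_order (R 0)"
  define le' where "le' = activate (activate le a0) a1"
  define A' where "A' = insert a1 (insert a0 A)"
  interpret arithmetic A le D n "acc_table n (R 1)" "acc_table n (R 2)"
    using ei by (simp add: engine_inv_def le_def)
  have act1: "activation (insert a0 A) (activate le a0)" "\<And>x y. y \<in> A \<Longrightarrow> activate le a0 x y \<longleftrightarrow> le x y"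
    using activation_activate[OF activation_axioms] by blast+
  have act2: "activation A' le'" "\<And>x y. y \<in> A \<Longrightarrow> le' x y \<longleftrightarrow> le x y"
    unfolding A'_def le'_def using activation_activate[OF act1(1)] act1(2) by blast+
  have A'D: "A' \<subseteq> D" using AD a by (auto simp: A'_def)
  have cardA': "card A' \<le> card A + 2"
    unfolding A'_def using card_insert_le_m1[of "Suc (card A)" A a0]
    by (simp add: card_insert_if fin)
  have ae: "activation_ext A le A' le'"
    using activation_axioms act2 by (intro activation_ext.intro activation_ext_axioms.intro) (auto simp: A'_def)
  have nl: "number_line A le D" by unfold_locales (rule AD)
  have nl': "number_line A' le' D"
    using act2(1) A'D by (simp add: number_line_def number_line_axioms_def)
  have chgI: "w \<in> I' r \<longleftrightarrow> w \<in> I r" if "w \<noteq> [a0, a1]" for r w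
    unfolding I' by (rule apply_change_mem[OF that])
  have ok': "input_ok A' I'"
    unfolding input_ok_def
  proof (intro allI ballI)
    fix r w assume w: "w \<in> I' r"
    show "\<exists>u\<in>A'. \<exists>v\<in>A'. w = [u, v]"
    proof (cases "w = [a0, a1]")
      case False
      then have "w \<in> I r" using chgI w by blast
      then show ?thesis using ok unfolding input_ok_def A'_def by blast
    qed (auto simp: A'_def)
  qed
  let ?E = "node_graph D q F B le I" and ?E' = "node_graph D q F B le' I'"
  interpret es: engine_step A le D n "acc_table n (R 1)" "acc_table n (R 2)" A' le' ?E ?E'
     "acc_threads n (R 3)" "acc_graph (R 4)" "acc_threads n (R 5)" L
  proof (intro engine_step.intro arithmetic_ext.intro arithmetic_ext_axioms.intro engine_step_axioms.intro)
    show "arithmetic A le D n (acc_table n (R 1)) (acc_table n (R 2))" by (rule arithmetic_axioms)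
    show "activation_ext A le A' le'" by (rule ae)
    show "A' \<subseteq> D" by (rule A'D)
    show "card A' \<le> card A + 2" by (rule cardA')
    show "card (diffs D le' ?E' ?E) \<le> L"
      unfolding L by (rule node_graph_change[OF nl ae A'D finD ok ok' cardA' chgI])
    show "supported A' ?E'" by (rule node_graph_supported[OF nl' ok'])
  qed (use ei a in \<open>auto simp: engine_inv_def le_def\<close>)
  have fM: "fst M = D" "fst (snd M) c0 = a0" "fst (snd M) c1 = a1" "aux M = R" "inp M = I"
    using c(1) by (auto simp: M aux_def inp_def fun_eq_iff)
  have m: "le_old M = le" "le_new M = le'" "add_old M = acc_table n (R 1)" "mul_old M = acc_table n (R 2)"
    "inp_new \<delta> M = I'" "E_old M = ?E" "E_new \<delta> M = ?E'"
    by (simp_all add: le_old_def le_new_def add_old_def mul_old_def inp_new_def E_old_def E_new_def fM chg_def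
        le_def le'_def I')
  have ch: "chS \<delta> M = es.S1" "chC \<delta> M = es.C1" "ready \<delta> M \<longleftrightarrow> es.caught"
    by (simp_all only: chS_def chC_def ready_def m fM)
  have NSn: "NS_new \<delta> M = (if es.caught then snd es.C1 else snd es.S1)"
    by (simp add: fun_eq_iff NS_new_def ch)
  have GCn: "GC_new \<delta> M = (if es.caught then (\<lambda>_ _. False) else fst es.C1)"
    by (simp add: fun_eq_iff GC_new_def ch)
  have NCn: "NC_new \<delta> M = (if es.caught then fresh D le n (acc_table n (R 1)) (acc_table n (R 2)) else snd es.C1)"
    by (simp add: fun_eq_iff NC_new_def ch m fM)
  have e0: "acc_order (R' 0) = le'"
  proof (intro ext)
    fix x y
    have "le' x y \<Longrightarrow> x \<in> D \<and> y \<in> D" using activation.le_in[OF act2(1)] A'D by blast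
    then show "acc_order (R' 0) x y = le' x y"
      by (auto simp: acc_order_def R' tuple_sizes_def upd_def m)
  qed
  have e1: "acc_table n (R' 1) = es.add'"
    by (intro ext) (auto simp: acc_table_def R' tuple_sizes_def upd_def m fM guard_table_def Vec_def seg_def)
  have e2: "acc_table n (R' 2) = es.mul'"
    by (intro ext) (auto simp: acc_table_def R' tuple_sizes_def upd_def m fM guard_table_def Vec_def seg_def)
  have e3: "acc_threads n (R' 3) = es.NS'"
    by (intro ext) (auto simp: acc_threads_def R' tuple_sizes_def upd_def NSn guard_threads_def Vec_def seg_def)
  have e4: "acc_graph (R' 4) = es.GC'"
    by (intro ext) (auto simp: acc_graph_def R' tuple_sizes_def upd_def GCn guard_graph_def Vec_def seg_def)
  have e5: "acc_threads n (R' 5) = es.NC'"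
    by (intro ext) (auto simp: acc_threads_def R' tuple_sizes_def upd_def NCn guard_threads_def Vec_def seg_def)
  have ei': "engine_inv D n L A' (acc_order (R' 0)) (acc_table n (R' 1)) (acc_table n (R' 2))
     (node_graph D q F B (acc_order (R' 0)) I') (acc_threads n (R' 3)) (acc_graph (R' 4)) (acc_threads n (R' 5))"
    unfolding e0 e1 e2 e3 e4 e5 by (rule es.engine_step)
  have "reach_new \<delta> i j M u v \<longleftrightarrow> reach_col D I' i j u v" if ij: "i < q" "j < q" "u \<in> D" "v \<in> D" for i j u v
  proof -
    \<comment> \<open>The answer is evaluated on unguarded formulas, whereas the invariant speaks
      about stored relations; the two agree on tuples over \<open>D\<close>.\<close>
    have guard: "guard_threads D n N t \<theta> [x, w] [y, w'] z \<longleftrightarrow> N t \<theta> [x, w] [y, w'] z"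
      if "t \<in> Vec n D" "\<theta> \<in> Vec n D" "z \<in> Vec n D" "x \<in> D" "w \<in> D" "y \<in> D" "w' \<in> D" for N t \<theta> x w y w' z
      using that by (simp add: guard_threads_def Vec_def)
    have con: "connected_by D le' n (NS_new \<delta> M) [u, w] [v, w'] \<longleftrightarrow> connected_by D le' n es.NS' [u, w] [v, w']"
      if "w \<in> D" "w' \<in> D" for w w'
      unfolding connected_by_def NSn using guard that ij by (metis (no_types, lifting))
    then have "reach_new \<delta> i j M u v \<longleftrightarrow> reach_answer D q F B n0 n le' I' es.NS' i j u v"
      unfolding reach_new_def reach_answer_def m fM by (simp add: con cong: bex_cong conj_cong)
    also have "\<dots> \<longleftrightarrow> reach_col D I' i j u v"
      by (rule reach_answer_correct[OF es.engine_step ok' ij])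
    finally show ?thesis .
  qed
  then have "Q D (fst (snd M)) (\<lambda>i j. reach_new \<delta> i j M) = Q D \<kappa> (reach_col D I')"
    using c(2,3) \<kappa> by (intro Q_cong) (auto simp: M)
  then have "R' 6 = (if Q D \<kappa> (reach_col D I') then {[]} else {})"
    by (auto simp: R' tuple_sizes_def upd_def fM)
  moreover have "input_ok D I'" using ok' A'D unfolding input_ok_def by blast
  ultimately show ?thesis unfolding state_inv_def using ok' ei' by blast
qed

lemma state_inv_initial:
  assumes "finite D"
  shows "state_inv D (\<lambda>_. {}) (\<lambda>_. {})"
proof -
  have "node_graph D q F B (\<lambda>_ _. False) (\<lambda>_. {}) = (\<lambda>_ _. False)"
    by (auto simp: fun_eq_iff node_graph_def col_edge_def)
  moreover have "acc_order {} = (\<lambda>_ _. False)" "acc_table n {} = (\<lambda>_ _ _ _. False)"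
    "acc_graph {} = (\<lambda>_ _. False)" "acc_threads n {} = (\<lambda>_ _ _ _ _. False)"
    by (auto simp: fun_eq_iff acc_order_def acc_table_def acc_graph_def acc_threads_def)
  ultimately show ?thesis
    unfolding state_inv_def using engine_inv_initial[OF assms, of n L]
    by (intro exI[of _ "{}"]) (simp add: input_ok_def)
qed

theorem query_in_DynFO:
  assumes q0: "\<And>D \<kappa> I. finite D \<Longrightarrow> \<kappa> ` C \<subseteq> D \<Longrightarrow> input_ok D I \<Longrightarrow> q0 D \<kappa> I = Q D \<kappa> (reach_col D I)"
  shows "in_DynFO (\<lambda>_. 2) C \<Delta> 0 (boolean_query q0)"
proof -
  have "6 < length tuple_sizes" "tuple_sizes ! 6 = 0" by (simp_all add: tuple_sizes_def)
  then obtain prog where wf: "wf_program (\<lambda>_. 2) C \<Delta> 0 prog" and ans: "answer prog = 6"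
    and step: "\<And>D \<kappa> \<delta> a I A. length a = 2 \<Longrightarrow> step prog D \<kappa> (\<delta>, a) (I, A) = (apply_change (\<delta>, a) I,
       \<lambda>i. if i < length tuple_sizes then {b. length b = tuple_sizes ! i \<and> set b \<subseteq> D \<and>
          upd \<delta> i (D, \<kappa>(c0 := a ! 0, c1 := a ! 1), case_sum I A) b} else {})"
    using program_exists[where as=tuple_sizes and P=upd and ans=6 and m=0 and \<Delta>=\<Delta>, OF definable_upd c(1)] by blast
  have "maintains (\<lambda>_. 2) C \<Delta> prog (boolean_query q0)"
    unfolding maintains_def
  proof (intro allI impI)
    fix D \<kappa> and cs :: "'r change list"
    assume D: "finite D" "\<kappa> ` C \<subseteq> D" and cs: "cs \<noteq> []" "\<forall>c\<in>set cs. valid_change (\<lambda>_. 2) \<Delta> D c"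
    \<comment> \<open>The invariant holds from the start, the answer only after a change, because
      all auxiliary relations begin empty.\<close>
    have "state_inv D (fst (run prog D \<kappa> cs)) (snd (run prog D \<kappa> cs)) \<and> (cs \<noteq> [] \<longrightarrow>
        snd (run prog D \<kappa> cs) 6 = boolean_query q0 D \<kappa> (fst (run prog D \<kappa> cs)))"
      using cs(2)
    proof (induction cs rule: rev_induct)
      case Nil
      then show ?case using state_inv_initial[OF D(1)] by (simp add: run_def initial_state_def)
    next
      case (snoc ch cs)
      obtain \<delta> a where ch: "ch = (\<delta>, a)" by (cases ch)
      have a: "length a = 2" "set a \<subseteq> D" using snoc.prems by (auto simp: ch valid_change_def op_arity_const)
      then obtain a0 a1 where aa: "a = [a0, a1]" by (auto simp: length_Suc_conv numeral_2_eq_2)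
      obtain I R where st: "run prog D \<kappa> cs = (I, R)" by (cases "run prog D \<kappa> cs")
      define I' where "I' = apply_change (\<delta>, [a0, a1]) I"
      define R' where "R' = (\<lambda>i. if i < length tuple_sizes then {b. length b = tuple_sizes ! i \<and> set b \<subseteq> D \<and>
          upd \<delta> i (D, \<kappa>(c0 := a0, c1 := a1), case_sum I R) b} else {})"
      have step': "step prog D \<kappa> (\<delta>, [a0, a1]) (I, R) = (I', R')"
        using step[of "[a0, a1]" D \<kappa> \<delta> I R] by (simp add: I'_def R'_def del: step.simps cong: if_cong)
      have run: "run prog D \<kappa> (cs @ [ch]) = (I', R')"
        using st step' by (simp add: run_def ch aa del: step.simps)
      have aD: "a0 \<in> D" "a1 \<in> D" using a(2) by (auto simp: aa)
      have \<kappa>D: "\<And>c. c \<in> C \<Longrightarrow> \<kappa> c \<in> D" using D(2) by blast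
      have "state_inv D I R" using snoc st by auto
      then have "state_inv D I' R' \<and> R' 6 = (if Q D \<kappa> (reach_col D I') then {[]} else {}) \<and> input_ok D I'"
        using state_step[OF _ aD \<kappa>D refl R'_def I'_def] by blast
      then show ?case using q0[OF D, of I'] by (simp add: run boolean_query_def)
    qed
    then show "snd (run prog D \<kappa> cs) (answer prog) = boolean_query q0 D \<kappa> (fst (run prog D \<kappa> cs))"
      using cs(1) ans by simp
  qed
  then show ?thesis unfolding in_DynFO_def using wf by blast
qed

end

subsection \<open>Regular path queries\<close>

text \<open>The left quotient; the quotients of a language are the states of its minimal
  deterministic automaton.\<close>

definition quot :: "'l list set \<Rightarrow> 'l list \<Rightarrow> 'l list set" where
  "quot K w = {v. w @ v \<in> K}"

definition conc :: "'l list set \<Rightarrow> 'l list set \<Rightarrow> 'l list set" where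
  "conc K K' = {u @ v | u v. u \<in> K \<and> v \<in> K'}"

lemma quot_Nil: "quot K [] = K"
  by (simp add: quot_def)

lemma quot_quot: "quot (quot K w) v = quot K (w @ v)"
  by (simp add: quot_def)

text \<open>The removed prefix \<open>w\<close> either ends within the first factor or reaches into
  the second one.\<close>

lemma quot_conc: "quot (conc K K') w = conc (quot K w) K' \<union> \<Union>{quot K' y | x y. w = x @ y \<and> x \<in> K}"
proof (intro Set.set_eqI iffI)
  fix v assume "v \<in> quot (conc K K') w"
  then obtain p s where ps: "w @ v = p @ s" "p \<in> K" "s \<in> K'" by (auto simp: quot_def conc_def)
  then consider u where "p = w @ u" "v = u @ s" | y where "w = p @ y" "s = y @ v"
    by (auto simp: append_eq_append_conv2)
  then show "v \<in> conc (quot K w) K' \<union> \<Union>{quot K' y | x y. w = x @ y \<and> x \<in> K}"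
  proof cases
    case 1
    then have "u \<in> quot K w" using ps by (simp add: quot_def)
    then show ?thesis using 1 ps by (auto simp: conc_def)
  next
    case 2
    then have "v \<in> quot K' y" using ps by (simp add: quot_def)
    then show ?thesis using 2 ps by blast
  qed
next
  fix v assume "v \<in> conc (quot K w) K' \<union> \<Union>{quot K' y | x y. w = x @ y \<and> x \<in> K}"
  then show "v \<in> quot (conc K K') w"
  proof
    assume "v \<in> conc (quot K w) K'"
    then obtain u s where "v = u @ s" "w @ u \<in> K" "s \<in> K'" by (auto simp: conc_def quot_def)
    then show ?thesis unfolding quot_def conc_def
      by (intro CollectI exI[of _ "w @ u"] exI[of _ s]) simp
  next
    assume "v \<in> \<Union>{quot K' y | x y. w = x @ y \<and> x \<in> K}"
    then obtain x y where "w = x @ y" "x \<in> K" "y @ v \<in> K'" by (auto simp: quot_def)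
    then show ?thesis unfolding quot_def conc_def
      by (intro CollectI exI[of _ x] exI[of _ "y @ v"]) simp
  qed
qed

lemma kleene_star_append: "u \<in> kleene_star K \<Longrightarrow> v \<in> kleene_star K \<Longrightarrow> u @ v \<in> kleene_star K"
proof (induction rule: kleene_star.induct)
  case (append u w)
  then have "u @ (w @ v) \<in> kleene_star K" using kleene_star.append[OF append.hyps(1)] by blast
  then show ?case by simp
qed simp

text \<open>A nonempty prefix of a product of factors ends within one factor or at its end; the
  complete factors before it form \<open>x\<close>.\<close>

lemma kleene_star_split:
  assumes "z \<in> kleene_star K" "z = w @ v" "w \<noteq> []"
  shows "\<exists>x y. w = x @ y \<and> x \<in> kleene_star K \<and> v \<in> conc (quot K y) (kleene_star K)"
  using assms
proof (induction arbitrary: w rule: kleene_star.induct)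
  case (append u v')
  from append.prems(1) consider r where "u = w @ r" "r @ v' = v" | w' where "w = u @ w'" "v' = w' @ v"
    by (auto simp: append_eq_append_conv2)
  then show ?case
  proof cases
    case 1
    then have "r \<in> quot K w" using append.hyps(1) by (simp add: quot_def)
    then have "v \<in> conc (quot K w) (kleene_star K)" using 1 append.hyps(2) unfolding conc_def by blast
    then show ?thesis by (intro exI[of _ "[]"] exI[of _ w]) (simp add: kleene_star.Nil)
  next
    case 2
    show ?thesis
    proof (cases "w' = []")
      case True
      then have "[] \<in> quot K w" "v = [] @ v'" using 2 append.hyps(1) by (auto simp: quot_def)
      then have "v \<in> conc (quot K w) (kleene_star K)" using append.hyps(2) unfolding conc_def by blast
      then show ?thesis by (intro exI[of _ "[]"] exI[of _ w]) (simp add: kleene_star.Nil)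
    next
      case False
      then obtain x y where xy: "w' = x @ y" "x \<in> kleene_star K" "v \<in> conc (quot K y) (kleene_star K)"
        using append.IH[OF 2(2)] by blast
      have "u @ x \<in> kleene_star K" using append.hyps(1) xy(2) by (rule kleene_star.append)
      then show ?thesis using 2(1) xy by (intro exI[of _ "u @ x"] exI[of _ y]) simp
    qed
  qed
qed simp

lemma quot_star:
  assumes "w \<noteq> []"
  shows "quot (kleene_star K) w = \<Union>{conc (quot K y) (kleene_star K) | x y. w = x @ y \<and> x \<in> kleene_star K}"
proof (intro Set.set_eqI iffI)
  fix v assume "v \<in> quot (kleene_star K) w"
  then have "w @ v \<in> kleene_star K" by (simp add: quot_def)
  from kleene_star_split[OF this refl assms]
  show "v \<in> \<Union>{conc (quot K y) (kleene_star K) | x y. w = x @ y \<and> x \<in> kleene_star K}" by blast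
next
  fix v assume "v \<in> \<Union>{conc (quot K y) (kleene_star K) | x y. w = x @ y \<and> x \<in> kleene_star K}"
  then obtain x y r s where *: "w = x @ y" "x \<in> kleene_star K" "y @ r \<in> K" "s \<in> kleene_star K" "v = r @ s"
    by (auto simp: conc_def quot_def)
  then have "(y @ r) @ s \<in> kleene_star K" by (intro kleene_star.append)
  then have "x @ ((y @ r) @ s) \<in> kleene_star K" by (rule kleene_star_append[OF *(2)])
  then show "v \<in> quot (kleene_star K) w" using * by (simp add: quot_def)
qed

text \<open>A quotient of a composite language is determined by quotients of its parts: for a
  concatenation by one quotient of the first language and a set of quotients of the second, for a
  star and a nonempty word by a set of quotients. Finite sets have finitely many subsets.\<close>

lemma finite_quotients: "finite (range (quot (lang \<alpha>)))"
proof (induction \<alpha>)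
  case Empty
  have "range (quot (lang Empty)) \<subseteq> {{}}" by (auto simp: quot_def)
  then show ?case by (rule finite_subset) simp
next
  case Epsilon
  have "range (quot (lang Epsilon)) \<subseteq> {{}, {[]}}" by (auto simp: quot_def)
  then show ?case by (rule finite_subset) simp
next
  case (Letter a)
  have "quot {[a]} w \<in> {{}, {[]}, {[a]}}" for w
    by (cases w) (auto simp: quot_def)
  then have "range (quot (lang (Letter a))) \<subseteq> {{}, {[]}, {[a]}}" by auto
  then show ?case by (rule finite_subset) simp
next
  case (Union \<alpha> \<beta>)
  have "quot (lang (Union \<alpha> \<beta>)) w = quot (lang \<alpha>) w \<union> quot (lang \<beta>) w" for w by (auto simp: quot_def)
  then have "range (quot (lang (Union \<alpha> \<beta>))) \<subseteq> (\<lambda>(X, Y). X \<union> Y) ` (range (quot (lang \<alpha>)) \<times> range (quot (lang \<beta>)))"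
    by auto
  then show ?case by (rule finite_subset) (use Union in simp)
next
  case (Concat \<alpha> \<beta>)
  let ?f = "\<lambda>(X, \<Y>). conc X (lang \<beta>) \<union> \<Union>\<Y>" and ?S = "range (quot (lang \<alpha>)) \<times> Pow (range (quot (lang \<beta>)))"
  have "quot (lang (Concat \<alpha> \<beta>)) w \<in> ?f ` ?S" for w
  proof (rule image_eqI)
    have "lang (Concat \<alpha> \<beta>) = conc (lang \<alpha>) (lang \<beta>)" by (simp add: conc_def)
    then show "quot (lang (Concat \<alpha> \<beta>)) w = ?f (quot (lang \<alpha>) w, {quot (lang \<beta>) y | x y. w = x @ y \<and> x \<in> lang \<alpha>})"
      by (simp only: quot_conc prod.case)
  qed auto
  then have "range (quot (lang (Concat \<alpha> \<beta>))) \<subseteq> ?f ` ?S" by blast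
  then show ?case by (rule finite_subset) (use Concat in simp)
next
  case (Star \<alpha>)
  let ?f = "\<lambda>\<Y>. \<Union>Y\<in>\<Y>. conc Y (kleene_star (lang \<alpha>))"
  have "quot (lang (Star \<alpha>)) w \<in> insert (kleene_star (lang \<alpha>)) (?f ` Pow (range (quot (lang \<alpha>))))" for w
  proof (cases "w = []")
    case False
    have "quot (lang (Star \<alpha>)) w = ?f {quot (lang \<alpha>) y | x y. w = x @ y \<and> x \<in> kleene_star (lang \<alpha>)}"
      unfolding lang.simps quot_star[OF False] by blast
    then show ?thesis by (intro insertI2 image_eqI) auto
  qed (simp add: quot_Nil)
  then have "range (quot (lang (Star \<alpha>))) \<subseteq> insert (kleene_star (lang \<alpha>)) (?f ` Pow (range (quot (lang \<alpha>))))" by blast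
  then show ?case by (rule finite_subset) (use Star in simp)
qed

text \<open>The coloured graph is the product of the labeled graph with the quotient automaton: a
  walk from \<open>(u, i)\<close> reading \<open>w\<close> ends in the colour of the quotient of
  \<open>lang \<alpha>\<close> by \<open>w\<close>, and \<open>w\<close> is accepted if this
  quotient contains the empty word.\<close>

lemma rpq_reach:
  fixes I :: "'l input"
  assumes f: "bij_betw f {..<q} \<Q>" and closed: "\<And>K a. K \<in> \<Q> \<Longrightarrow> quot K [a] \<in> \<Q>"
    and F: "F = {(a, i, j). i < q \<and> j < q \<and> f j = quot (f i) [a]}"
    and ok: "input_ok D I" and i: "i < q" "f i = lang \<alpha>" and u: "u \<in> D"
  shows "rpq_holds \<alpha> (edges I) u v \<longleftrightarrow> (\<exists>j<q. [] \<in> f j \<and> ((u, i), (v, j)) \<in> (col_graph D q F {} I)\<^sup>*)"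
proof
  let ?R = "col_graph D q F {} I"
  have fQ: "f k \<in> \<Q>" if "k < q" for k using f that by (auto simp: bij_betw_def)
  have surj: "\<exists>k<q. f k = K" if "K \<in> \<Q>" for K using f that by (force simp: bij_betw_def)
  have Redge: "((x, k), (y, l)) \<in> ?R \<longleftrightarrow> x \<in> D \<and> y \<in> D \<and> k < q \<and> l < q \<and> (\<exists>a. f l = quot (f k) [a] \<and> (x, a, y) \<in> edges I)"
    for x k y l by (auto simp: col_graph_def col_edge_def F edges_def)
  show "\<exists>j<q. [] \<in> f j \<and> ((u, i), (v, j)) \<in> ?R\<^sup>*" if rpq: "rpq_holds \<alpha> (edges I) u v"
  proof -
    have path: "\<exists>j<q. f j = quot (f k) w \<and> ((x, k), (y, j)) \<in> ?R\<^sup>*"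
      if "labeled_path (edges I) x w y" "k < q" "x \<in> D" for x w y k
      using that
    proof (induction arbitrary: k rule: labeled_path.induct)
      case (Nil x)
      then show ?case by (auto simp: quot_Nil)
    next
      case (Cons x a x' w y)
      obtain l where l: "l < q" "f l = quot (f k) [a]" using surj[OF closed[OF fQ[OF Cons.prems(1)]]] by blast
      have x': "x' \<in> D" using Cons.hyps(1) ok by (fastforce simp: edges_def input_ok_def)
      have e: "((x, k), (x', l)) \<in> ?R" unfolding Redge using Cons.prems Cons.hyps(1) l x' by blast
      obtain j where j: "j < q" "f j = quot (f l) w" "((x', l), (y, j)) \<in> ?R\<^sup>*" using Cons.IH[OF l(1) x'] by blast
      have "f j = quot (f k) (a # w)" using j(2) l(2) by (simp add: quot_quot)
      moreover have "((x, k), (y, j)) \<in> ?R\<^sup>*" using e j(3) by (rule converse_rtrancl_into_rtrancl)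
      ultimately show ?case using j(1) by blast
    qed
    obtain w where w: "w \<in> lang \<alpha>" "labeled_path (edges I) u w v" using rpq unfolding rpq_holds_def by blast
    obtain j where j: "j < q" "f j = quot (f i) w" "((u, i), (v, j)) \<in> ?R\<^sup>*" using path[OF w(2) i(1) u] by blast
    have "[] \<in> f j" using j(2) i(2) w(1) by (simp add: quot_def)
    then show ?thesis using j by blast
  qed
  show "rpq_holds \<alpha> (edges I) u v" if ex: "\<exists>j<q. [] \<in> f j \<and> ((u, i), (v, j)) \<in> ?R\<^sup>*"
  proof -
    obtain j where j: "[] \<in> f j" "((u, i), (v, j)) \<in> ?R\<^sup>*" using ex by blast
    have "\<exists>w. labeled_path (edges I) u w v \<and> f j = quot (f i) w"
      using j(2)
    proof (induction rule: converse_rtrancl_induct2)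
      case refl
      then show ?case by (intro exI[of _ "[]"]) (simp add: quot_Nil labeled_path.Nil)
    next
      case (step x k y l)
      then obtain a w where "f l = quot (f k) [a]" "(x, a, y) \<in> edges I" "labeled_path (edges I) y w v" "f j = quot (f l) w"
        using Redge by blast
      then show ?case by (intro exI[of _ "a # w"]) (simp add: quot_quot labeled_path.Cons)
    qed
    then obtain w where "labeled_path (edges I) u w v" "f j = quot (f i) w" by blast
    moreover from this have "w \<in> lang \<alpha>" using j(1) i(2) by (simp add: quot_def)
    ultimately show ?thesis unfolding rpq_holds_def by blast
  qed
qed

lemma fresh_constants:
  assumes "finite (C :: nat set)"
  obtains c0 c1 where "c0 \<noteq> c1" "c0 \<notin> C" "c1 \<notin> C"
proof -
  obtain c0 where c0: "c0 \<notin> C" using ex_new_if_finite[OF infinite_UNIV_nat assms] by blast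
  obtain c1 where "c1 \<notin> insert c0 C" using ex_new_if_finite[OF infinite_UNIV_nat, of "insert c0 C"] assms by blast
  then show thesis using that[of c0 c1] c0 by blast
qed

text \<open>All queries share one coloured graph, whose colours are the quotients of all their
  languages; they differ in the initial colour \<open>ini\<close>. A single program thus serves the
  whole conjunction.\<close>

lemma rpq_conjunction_in_DynFO:
  fixes qs :: "('l::finite rexp \<times> nat \<times> nat) list"
  shows "in_DynFO (\<lambda>_. 2) (\<Union>(\<alpha>, s, t)\<in>set qs. {s, t}) \<Delta> 0 (rpq_conjunction qs)"
proof -
  define C where "C = (\<Union>(\<alpha>, s, t)\<in>set qs. {s, t})"
  define \<Q> where "\<Q> = (\<Union>(\<alpha>, s, t)\<in>set qs. range (quot (lang \<alpha>)))"
  have "finite C" unfolding C_def by auto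
  then obtain c0 c1 where c: "c0 \<noteq> c1" "c0 \<notin> C" "c1 \<notin> C" using fresh_constants by blast
  have "finite \<Q>" unfolding \<Q>_def using finite_quotients by auto
  then obtain f where f: "bij_betw f {..<card \<Q>} \<Q>"
    using ex_bij_betw_nat_finite[of \<Q>] by (auto simp: atLeast0LessThan)
  define q where "q = card \<Q>"
  have closed: "quot K [a] \<in> \<Q>" if KQ: "K \<in> \<Q>" for K a
  proof -
    obtain p where p: "p \<in> set qs" "K \<in> (case p of (\<alpha>, s, t) \<Rightarrow> range (quot (lang \<alpha>)))"
      using KQ unfolding \<Q>_def by (rule UN_E)
    obtain \<alpha> s t where pp: "p = (\<alpha>, s, t)" by (cases p)
    show ?thesis unfolding \<Q>_def using p(2) by (intro UN_I[OF p(1)]) (auto simp: pp quot_quot)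
  qed
  have init: "\<exists>i<q. f i = lang \<alpha>" if "(\<alpha>, s, t) \<in> set qs" for \<alpha> s t
  proof -
    have "quot (lang \<alpha>) [] \<in> \<Q>" using that unfolding \<Q>_def by blast
    then have "lang \<alpha> \<in> f ` {..<q}" unfolding bij_betw_imp_surj_on[OF f] q_def quot_Nil .
    then show ?thesis by (elim imageE) auto
  qed
  define ini where "ini = (\<lambda>\<alpha>. SOME i. i < q \<and> f i = lang \<alpha>)"
  have ini: "ini \<alpha> < q" "f (ini \<alpha>) = lang \<alpha>" if "(\<alpha>, s, t) \<in> set qs" for \<alpha> s t
    using someI_ex[OF init[OF that]] unfolding ini_def by auto
  define F where "F = {(a :: 'l, i, j). i < q \<and> j < q \<and> f j = quot (f i) [a]}"
  define Q where "Q = (\<lambda>(D :: nat set) (\<kappa> :: nat \<Rightarrow> nat) (r :: nat \<Rightarrow> nat \<Rightarrow> nat \<Rightarrow> nat \<Rightarrow> bool).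
    \<forall>p\<in>set qs. \<exists>j<q. [] \<in> f j \<and> r (ini (fst p)) j (\<kappa> (fst (snd p))) (\<kappa> (snd (snd p))))"
  define L where "L = (q + 2) ^ 4"
  define n0 where "n0 = (let a = 2 ^ 16 + L + 4; c = a + 2 * (a ^ 4 + 1) in c + 2 * c ^ 4)"
  have inC: "fst (snd p) \<in> C" "snd (snd p) \<in> C" if "p \<in> set qs" for p
    unfolding C_def by (cases p, rule UN_I[OF that], simp)+
  interpret engine_program num_len q n0 L c0 c1 F "{}" C Q
  proof
    fix sig :: "'l + nat \<Rightarrow> nat option" and R :: "nat \<Rightarrow> nat \<Rightarrow> ('l + nat) model \<Rightarrow> nat \<Rightarrow> nat \<Rightarrow> bool"
    assume R: "\<And>i j. definable_order sig (insert c0 (insert c1 C)) (R i j)"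
    show "definable sig (insert c0 (insert c1 C)) 0 (\<lambda>M e. Q (fst M) (fst (snd M)) (\<lambda>i j. R i j M))"
      unfolding Q_def using inC
      by (intro definable_All_finite definable_Ex_less definable_Conj definable_bool
          definable_orderD[OF R] elem_term_const) auto
  next
    fix D and \<kappa> \<kappa>' :: "nat \<Rightarrow> nat" and r r' :: "nat \<Rightarrow> nat \<Rightarrow> nat \<Rightarrow> nat \<Rightarrow> bool"
    assume r: "\<And>i j u v. i < q \<Longrightarrow> j < q \<Longrightarrow> u \<in> D \<Longrightarrow> v \<in> D \<Longrightarrow> r i j u v = r' i j u v"
      and \<kappa>: "\<And>c. c \<in> C \<Longrightarrow> \<kappa> c = \<kappa>' c \<and> \<kappa> c \<in> D"
    have "r (ini (fst p)) j (\<kappa> (fst (snd p))) (\<kappa> (snd (snd p))) = r' (ini (fst p)) j (\<kappa>' (fst (snd p))) (\<kappa>' (snd (snd p)))"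
      if "p \<in> set qs" "j < q" for p j
    proof -
      have "\<kappa>' (fst (snd p)) = \<kappa> (fst (snd p))" "\<kappa>' (snd (snd p)) = \<kappa> (snd (snd p))"
        "\<kappa> (fst (snd p)) \<in> D" "\<kappa> (snd (snd p)) \<in> D"
        by (rule \<kappa>[OF inC(1)[OF that(1)], THEN conjunct1, symmetric] \<kappa>[OF inC(2)[OF that(1)], THEN conjunct1, symmetric]
            \<kappa>[OF inC(1)[OF that(1)], THEN conjunct2] \<kappa>[OF inC(2)[OF that(1)], THEN conjunct2])+
      moreover have "ini (fst p) < q" using ini(1)[of "fst p" "fst (snd p)" "snd (snd p)"] that(1) by simp
      ultimately show ?thesis using r that(2) by simp
    qed
    then show "Q D \<kappa> r = Q D \<kappa>' r'" unfolding Q_def by (simp cong: ball_cong conj_cong)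
  qed (use c in \<open>simp_all add: L_def n0_def\<close>)
  have "in_DynFO (\<lambda>_. 2) C \<Delta> 0
    (boolean_query (\<lambda>D \<kappa> I. \<forall>(\<alpha>, s, t)\<in>set qs. rpq_holds \<alpha> (edges I) (\<kappa> s) (\<kappa> t)))"
  proof (rule query_in_DynFO)
    fix D \<kappa> and I :: "'l input"
    assume D: "finite D" "\<kappa> ` C \<subseteq> D" "input_ok D I"
    have key: "(case p of (\<alpha>, s, t) \<Rightarrow> rpq_holds \<alpha> (edges I) (\<kappa> s) (\<kappa> t)) \<longleftrightarrow>
      (\<exists>j<q. [] \<in> f j \<and> reach_col D I (ini (fst p)) j (\<kappa> (fst (snd p))) (\<kappa> (snd (snd p))))" if "p \<in> set qs" for p
    proof -
      obtain \<alpha> s t where p: "p = (\<alpha>, s, t)" by (cases p)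
      have "s \<in> C" using inC(1)[OF that] p by simp
      then have "\<kappa> s \<in> D" using D(2) by blast
      have pq: "(\<alpha>, s, t) \<in> set qs" using that p by simp
      have "rpq_holds \<alpha> (edges I) (\<kappa> s) (\<kappa> t) \<longleftrightarrow>
          (\<exists>j<q. [] \<in> f j \<and> ((\<kappa> s, ini \<alpha>), (\<kappa> t, j)) \<in> (col_graph D q F {} I)\<^sup>*)"
        by (rule rpq_reach[where f = f and \<Q> = \<Q> and q = q,
              OF f[folded q_def] closed F_def D(3) ini(1)[OF pq] ini(2)[OF pq] \<open>\<kappa> s \<in> D\<close>])
      then show ?thesis by (simp add: reach_col_def p)
    qed
    show "(\<forall>(\<alpha>, s, t)\<in>set qs. rpq_holds \<alpha> (edges I) (\<kappa> s) (\<kappa> t)) = Q D \<kappa> (reach_col D I)"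
      unfolding Q_def by (rule ball_cong[OF refl key])
  qed
  then show ?thesis unfolding rpq_conjunction_def C_def .
qed

subsection \<open>2-SAT\<close>

text \<open>Variables are decided one after the other. One of the two literals of \<open>x\<close>
  does not imply its own negation, and its consequences are added to \<open>T\<close>. By
  contraposition, a conflict with \<open>T\<close> would put the negated literal into the closed set
  \<open>T\<close>, and a conflict among the consequences would make the literal imply its
  negation.\<close>

lemma consistent_extension:
  fixes R :: "(nat \<times> nat) rel" and neg :: "nat \<times> nat \<Rightarrow> nat \<times> nat"
  assumes contra: "\<And>l m. (l, m) \<in> R\<^sup>* \<Longrightarrow> (neg m, neg l) \<in> R\<^sup>*" and neg: "\<And>l. neg (neg l) = l"
    and acyc: "\<And>x. x \<in> S \<Longrightarrow> \<not> (((x, 0), (x, 1)) \<in> R\<^sup>* \<and> ((x, 1), (x, 0)) \<in> R\<^sup>*)"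
    and n01: "\<And>x. neg (x, 0) = (x, 1)" and S: "finite S"
  shows "\<exists>T. (\<forall>l m. l \<in> T \<longrightarrow> (l, m) \<in> R\<^sup>* \<longrightarrow> m \<in> T) \<and> (\<forall>l. \<not> (l \<in> T \<and> neg l \<in> T)) \<and>
    (\<forall>x\<in>S. (x, 0) \<in> T \<or> (x, 1) \<in> T)"
  using S acyc
proof (induction S rule: finite_induct)
  case empty
  then show ?case by (intro exI[of _ "{}"]) simp
next
  case (insert x S)
  then obtain T where T: "\<And>l m. l \<in> T \<Longrightarrow> (l, m) \<in> R\<^sup>* \<Longrightarrow> m \<in> T" "\<And>l. \<not> (l \<in> T \<and> neg l \<in> T)"
    "\<forall>x\<in>S. (x, 0) \<in> T \<or> (x, 1) \<in> T" using insert.IH[OF insert.prems[OF insertI2]] by blast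
  show ?case
  proof (cases "(x, 0) \<in> T \<or> (x, 1) \<in> T")
    case True
    then show ?thesis using T by (intro exI[of _ T]) auto
  next
    case False
    have n10: "neg (x, 1) = (x, 0)" using neg[of "(x, 0)"] n01 by simp
    have "((x, 0), neg (x, 0)) \<notin> R\<^sup>* \<or> ((x, 1), neg (x, 1)) \<notin> R\<^sup>*"
      using insert.prems[OF insertI1] unfolding n01 n10 by blast
    then obtain l where l: "l = (x, 0) \<or> l = (x, 1)" "(l, neg l) \<notin> R\<^sup>*" by blast
    have und: "l \<notin> T" "neg l \<notin> T" using l(1) False n01 n10 by auto
    define T' where "T' = T \<union> {m. (l, m) \<in> R\<^sup>*}"
    have closed: "m' \<in> T'" if "m \<in> T'" "(m, m') \<in> R\<^sup>*" for m m'
      using that T(1) unfolding T'_def by (blast intro: rtrancl_trans)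
    have cons: "\<not> (m \<in> T' \<and> neg m \<in> T')" for m
    proof
      assume "m \<in> T' \<and> neg m \<in> T'"
      then consider "m \<in> T" "neg m \<in> T" | "m \<in> T" "(l, neg m) \<in> R\<^sup>*" | "(l, m) \<in> R\<^sup>*" "neg m \<in> T"
        | "(l, m) \<in> R\<^sup>*" "(l, neg m) \<in> R\<^sup>*" unfolding T'_def by blast
      then show False
      proof cases
        case 1
        then show ?thesis using T(2) by blast
      next
        case 2
        then have "(m, neg l) \<in> R\<^sup>*" using contra[of l "neg m"] neg by simp
        then show ?thesis using T(1) 2(1) und by blast
      next
        case 3
        then have "(neg m, neg l) \<in> R\<^sup>*" using contra by blast
        then show ?thesis using T(1) 3(2) und by blast
      next
        case 4
        then have "(m, neg l) \<in> R\<^sup>*" using contra[of l "neg m"] neg by simp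
        then show ?thesis using 4(1) l(2) by (meson rtrancl_trans)
      qed
    qed
    have "l \<in> T'" by (simp add: T'_def)
    then have "(x, 0) \<in> T' \<or> (x, 1) \<in> T'" using l(1) by blast
    moreover have "T \<subseteq> T'" by (simp add: T'_def)
    ultimately have "\<forall>y\<in>insert x S. (y, 0) \<in> T' \<or> (y, 1) \<in> T'" using T(3) by blast
    then show ?thesis using closed cons by (intro exI[of _ T']) blast
  qed
qed

text \<open>A clause amounts to an implication and its contrapositive. \<open>implF\<close> leads
  from a literal of the first variable to one of the second, \<open>implB\<close> from the second
  back to the first.\<close>

definition implF :: "(clause_rel \<times> nat \<times> nat) set" where
  "implF = {(C_TT, 1, 0), (C_TF, 1, 1), (C_FF, 0, 1)}"

definition implB :: "(clause_rel \<times> nat \<times> nat) set" where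
  "implB = {(C_TT, 1, 0), (C_TF, 0, 0), (C_FF, 0, 1)}"

text \<open>Colour \<open>0\<close> stands for positive and colour \<open>1\<close> for negative literals.\<close>

lemma satisfiable_iff:
  assumes D: "finite D" and ok: "input_ok D I"
  shows "(\<exists>\<beta>. satisfies \<beta> I) \<longleftrightarrow> \<not> (\<exists>x\<in>D. ((x, 0), (x, 1)) \<in> (col_graph D 2 implF implB I)\<^sup>* \<and>
    ((x, 1), (x, 0)) \<in> (col_graph D 2 implF implB I)\<^sup>*)"
proof -
  let ?R = "col_graph D 2 implF implB I"
  have inD: "u \<in> D" "v \<in> D" if "[u, v] \<in> I r" for u v r
    using ok that unfolding input_ok_def by fastforce+
  have edge: "((u, i), (v, j)) \<in> ?R \<longleftrightarrow>
      i = 1 \<and> j = 0 \<and> ([u, v] \<in> I C_TT \<or> [v, u] \<in> I C_TT) \<or> i = 1 \<and> j = 1 \<and> [u, v] \<in> I C_TF \<or>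
      i = 0 \<and> j = 0 \<and> [v, u] \<in> I C_TF \<or> i = 0 \<and> j = 1 \<and> ([u, v] \<in> I C_FF \<or> [v, u] \<in> I C_FF)" for u i v j
    by (auto simp: col_graph_def col_edge_def implF_def implB_def dest: inD)
  show ?thesis
  proof
    assume "\<exists>\<beta>. satisfies \<beta> I"
    then obtain \<beta> where \<beta>: "satisfies \<beta> I" by blast
    define tr where "tr = (\<lambda>(x :: nat, i :: nat). (i = 0) = \<beta> x)"
    have st: "tr l \<Longrightarrow> tr m" if "(l, m) \<in> ?R" for l m
      using that \<beta> edge[of "fst l" "snd l" "fst m" "snd m"]
      unfolding tr_def satisfies_def by (cases l; cases m) auto
    have trs: "tr l \<Longrightarrow> tr m" if "(l, m) \<in> ?R\<^sup>*" for l m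
      using that by (induction rule: rtrancl_induct) (auto intro: st)
    show "\<not> (\<exists>x\<in>D. ((x, 0), (x, 1)) \<in> ?R\<^sup>* \<and> ((x, 1), (x, 0)) \<in> ?R\<^sup>*)"
    proof
      assume "\<exists>x\<in>D. ((x, 0), (x, 1)) \<in> ?R\<^sup>* \<and> ((x, 1), (x, 0)) \<in> ?R\<^sup>*"
      then obtain x where x: "((x, 0), (x, 1)) \<in> ?R\<^sup>*" "((x, 1), (x, 0)) \<in> ?R\<^sup>*" by blast
      have "tr (x, 0) \<longleftrightarrow> tr (x, 1)" using trs[OF x(1)] trs[OF x(2)] by blast
      then show False by (simp add: tr_def)
    qed
  next
    assume no: "\<not> (\<exists>x\<in>D. ((x, 0), (x, 1)) \<in> ?R\<^sup>* \<and> ((x, 1), (x, 0)) \<in> ?R\<^sup>*)"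
    \<comment> \<open>Colours other than 0 and 1 are left fixed, so that \<open>neg\<close> is an
      involution on all pairs.\<close>
    define neg where "neg = (\<lambda>(x :: nat, i :: nat). (x, if i = 0 then 1 else if i = 1 then 0 else i))"
    have negneg: "neg (neg l) = l" for l by (cases l) (simp add: neg_def)
    have contra1: "(neg m, neg l) \<in> ?R" if "(l, m) \<in> ?R" for l m
    proof -
      obtain u i v j where lm: "l = (u, i)" "m = (v, j)" by (cases l, cases m)
      show ?thesis using that unfolding lm neg_def edge prod.case by auto
    qed
    have contra: "(neg m, neg l) \<in> ?R\<^sup>*" if "(l, m) \<in> ?R\<^sup>*" for l m
      using that by (induction rule: rtrancl_induct) (auto intro: contra1 converse_rtrancl_into_rtrancl)
    have acyc: "\<not> (((x, 0), (x, 1)) \<in> ?R\<^sup>* \<and> ((x, 1), (x, 0)) \<in> ?R\<^sup>*)" if "x \<in> D" for x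
      using no that by blast
    have n01: "neg (x, 0) = (x, 1)" for x by (simp add: neg_def)
    have "\<exists>T. (\<forall>l m. l \<in> T \<longrightarrow> (l, m) \<in> ?R\<^sup>* \<longrightarrow> m \<in> T) \<and> (\<forall>l. \<not> (l \<in> T \<and> neg l \<in> T)) \<and>
        (\<forall>x\<in>D. (x, 0) \<in> T \<or> (x, 1) \<in> T)"
      by (rule consistent_extension[where R = ?R and neg = neg and S = D, OF contra negneg acyc n01 D])
    then obtain T where T0: "(\<forall>l m. l \<in> T \<longrightarrow> (l, m) \<in> ?R\<^sup>* \<longrightarrow> m \<in> T) \<and> (\<forall>l. \<not> (l \<in> T \<and> neg l \<in> T)) \<and>
        (\<forall>x\<in>D. (x, 0) \<in> T \<or> (x, 1) \<in> T)" by (elim exE)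
    have T: "\<And>l m. l \<in> T \<Longrightarrow> (l, m) \<in> ?R\<^sup>* \<Longrightarrow> m \<in> T" "\<And>l. \<not> (l \<in> T \<and> neg l \<in> T)"
      "\<And>x. x \<in> D \<Longrightarrow> (x, 0) \<in> T \<or> (x, 1) \<in> T"
      using T0 by blast+
    have cons: "\<not> ((x, 0) \<in> T \<and> (x, 1) \<in> T)" for x using T(2)[of "(x, 0)"] by (simp add: neg_def)
    have T1: "m \<in> T" if "l \<in> T" "(l, m) \<in> ?R" for l m using T(1) that by blast
    have "satisfies (\<lambda>x. (x, 0) \<in> T) I"
      unfolding satisfies_def
    proof (intro conjI allI impI)
      fix x y
      show "(x, 0) \<in> T \<or> (y, 0) \<in> T" if "[x, y] \<in> I C_TT"
        using T(3)[OF inD(1)[OF that]] T1[of "(x, 1)" "(y, 0)"] that unfolding edge by auto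
      show "(x, 0) \<in> T \<or> (y, 0) \<notin> T" if "[x, y] \<in> I C_TF"
        using T(3)[OF inD(1)[OF that]] T1[of "(x, 1)" "(y, 1)"] cons[of y] that unfolding edge by auto
      show "(x, 0) \<notin> T \<or> (y, 0) \<notin> T" if "[x, y] \<in> I C_FF"
        using T1[of "(x, 0)" "(y, 1)"] cons[of y] that unfolding edge by auto
    qed
    then show "\<exists>\<beta>. satisfies \<beta> I" by blast
  qed
qed

lemma two_sat_in_DynFO: "in_DynFO (\<lambda>_. 2) {} \<Delta> 0 two_sat"
proof -
  define Q where "Q = (\<lambda>(D :: nat set) (\<kappa> :: nat \<Rightarrow> nat) (r :: nat \<Rightarrow> nat \<Rightarrow> nat \<Rightarrow> nat \<Rightarrow> bool).
    \<not> (\<exists>x\<in>D. r 0 1 x x \<and> r 1 0 x x))"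
  define L where "L = (2 + 2 :: nat) ^ 4"
  define n0 where "n0 = (let a = 2 ^ 16 + L + 4; c = a + 2 * (a ^ 4 + 1) in c + 2 * c ^ 4)"
  \<comment> \<open>The query has no constant symbols, so 0 and 1 are free to carry the changed
    tuple.\<close>
  interpret engine_program num_len 2 n0 L 0 1 implF implB "{}" Q
  proof
    fix sig :: "clause_rel + nat \<Rightarrow> nat option" and R :: "nat \<Rightarrow> nat \<Rightarrow> (clause_rel + nat) model \<Rightarrow> nat \<Rightarrow> nat \<Rightarrow> bool"
    assume R: "\<And>i j. definable_order sig (insert 0 (insert 1 {})) (R i j)"
    show "definable sig (insert 0 (insert 1 {})) 0 (\<lambda>M e. Q (fst M) (fst (snd M)) (\<lambda>i j. R i j M))"
      unfolding Q_def
      by (intro definable_Neg definable_Ex_elem definable_Conj definable_orderD[OF R] elem_term_last)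
  next
    fix D and \<kappa> \<kappa>' :: "nat \<Rightarrow> nat" and r r' :: "nat \<Rightarrow> nat \<Rightarrow> nat \<Rightarrow> nat \<Rightarrow> bool"
    assume r: "\<And>i j u v. i < 2 \<Longrightarrow> j < 2 \<Longrightarrow> u \<in> D \<Longrightarrow> v \<in> D \<Longrightarrow> r i j u v = r' i j u v"
    show "Q D \<kappa> r = Q D \<kappa>' r'" unfolding Q_def using r[of 0 1] r[of 1 0] by auto
  qed (simp_all add: L_def n0_def)
  show ?thesis unfolding two_sat_def
  proof (rule query_in_DynFO)
    show "(\<exists>\<beta>. satisfies \<beta> I) = Q D \<kappa> (reach_col D I)" if "finite D" "input_ok D I" for D \<kappa> I
      unfolding Q_def reach_col_def by (rule satisfiable_iff[OF that])
  qed
qed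

theorem theorem9:
  shows "(\<forall>(\<alpha> :: 'l::finite rexp) s t.
            in_DynFO (\<lambda>_. 2) {s, t} labeled_graph_changes 0 (rpq \<alpha> s t)) \<and>
         (\<forall>qs :: ('l rexp \<times> nat \<times> nat) list.
            in_DynFO (\<lambda>_. 2) (\<Union>(\<alpha>, s, t)\<in>set qs. {s, t}) labeled_graph_changes 0
              (rpq_conjunction qs)) \<and>
         in_DynFO (\<lambda>_. 2) {} single_tuple_changes 0 two_sat"
proof (intro conjI allI)
  fix \<alpha> :: "'l rexp" and s t
  show "in_DynFO (\<lambda>_. 2) {s, t} labeled_graph_changes 0 (rpq \<alpha> s t)"
    using rpq_conjunction_in_DynFO[of "[(\<alpha>, s, t)]" labeled_graph_changes]
    by (simp add: rpq_conjunction_def rpq_def)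
qed (rule rpq_conjunction_in_DynFO two_sat_in_DynFO)+

end
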